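(* Let $\Omega\subset\mathbb{R}^n$ be a bounded Lipschitz domain, $\gamma\in(0,1)$, and let $\mathcal{F}[u]=\int_\Omega F(x,u,\nabla u)\,dx$, where $F:\Omega\times\mathbb{R}\times\mathbb{R}^n\to\mathbb{R}$ is measurable with respect to the first variable and continuous with respect to the second and the third variable. Suppose that for a weak $N$-function $M:\Omega\times\mathbb{R}^n\to[0,\infty)$ and constants $0<\nu,\beta<1<L$, $$\nu M(x,\beta\xi)\le F(x,z,\xi)\le L\,(M(x,\xi)+1)\qquad\text{for all } x\in\Omega,\ z\in\mathbb{R},\ \xi\in\mathbb{R}^n.$$ Isotropic cases: (i) (variable exponent) If $M(x,\xi)=|\xi|^{p(x)}$, $p\in\mathcal{P}^{\log}(\Omega)$, $1\le p(\cdot)<\infty$, then Lavrentiev's phenomenon for $\mathcal{F}$ does not occur between $V^{1,M}_0(\Omega)=W^{1,p(\cdot)}_0(\Omega)$ and $C_c^\infty(\Omega)$, as well as between $W^{1,p(\cdot)}_0(\Omega)\cap C^{0,\gamma}(\Omega)$ and $C_c^\infty(\Omega)$. (ii) (mild double-phase) If $M(x,\xi)=|\xi|^p+a(x)|\xi|^p\log(e+|\xi|)$, $0\le a\in\mathcal{P}^{\log}(\Omega)$, $1\le p<\infty$, then Lavrentiev's phenomenon for $\mathcal{F}$ does not occur between $V^{1,M}_0(\Omega)$ and $C_c^\infty(\Omega)$, as well as between $V^{1,M}_0(\Omega)\cap C^{0,\gamma}(\Omega)$ and $C_c^\infty(\Omega)$. (iii) (double-phase) If $M(x,\xi)=|\xi|^p+a(x)|\xi|^q$,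 $0\le a\in C^{0,\alpha}(\Omega)$, $1\le p\le q$, then Lavrentiev's phenomenon for $\mathcal{F}$ does not occur between $V^{1,M}_0(\Omega)$ and $C_c^\infty(\Omega)$ whenever $q\le p+\alpha$, and between $V^{1,M}_0(\Omega)\cap C^{0,\gamma}(\Omega)$ and $C_c^\infty(\Omega)$ whenever $q\le p+\alpha/(1-\gamma)$. (iv) (variable exponent double-phase) If $M(x,\xi)=|\xi|^{p(x)}+a(x)|\xi|^{q(x)}$, $0\le a\in C^{0,\alpha}(\Omega)$, $1\le p(x)\le q(x)$, $p,q\in\mathcal{P}^{\log}(\Omega)$, then Lavrentiev's phenomenon for $\mathcal{F}$ does not occur between $V^{1,M}_0(\Omega)$ and $C_c^\infty(\Omega)$ whenever $\sup_{x\in\Omega}(q(x)-p(x))\le\alpha$, and between $V^{1,M}_0(\Omega)\cap C^{0,\gamma}(\Omega)$ and $C_c^\infty(\Omega)$ whenever $\sup_{x\in\Omega}(q(x)-p(x))\le\alpha/(1-\gamma)$. (v) (multi-phase) If $M(x,\xi)=|\xi|^p+\sum_{i=1}^na_i(x)|\xi|^{q_i}$, $0\le a_i\in C^{0,\alpha_i}(\Omega)$, $1\le p\le q_i$, $i=1,\dots,n$, then Lavrentiev's phenomenon for $\mathcal{F}$ does not occur between $V^{1,M}_0(\Omega)$ and $C_c^\infty(\Omega)$ whenever $q_i\le p+\alpha_i$ for all $i$, and between $V^{1,M}_0(\Omega)\cap C^{0,\gamma}(\Omega)$ and $C_c^\infty(\Omega)$ whenever $q_i\le p+\alpha_i/(1-\gamma)$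 for all $i$. (vi) (Orlicz double-phase) If $M(x,\xi)=\phi(|\xi|)+a(x)\psi(|\xi|)$, where $\phi,\psi$ are Young functions with $\phi,\psi\in\Delta_2$ and $\psi(t)/\phi(t)\to\infty$ as $t\to\infty$, and $0\le a\in C(\Omega)$ has a modulus of continuity $\omega_a$, then Lavrentiev's phenomenon for $\mathcal{F}$ does not occur between $V^{1,M}_0(\Omega)$ and $C_c^\infty(\Omega)$ whenever $\omega_a(t)\le\phi(t^{-1})/\psi(t^{-1})$, and between $V^{1,M}_0(\Omega)\cap C^{0,\gamma}(\Omega)$ and $C_c^\infty(\Omega)$ whenever $\omega_a(t)\le\phi(t^{\gamma-1})/\psi(t^{\gamma-1})$. In particular, if $\phi(t)=t^p\log^{-\tau}(e+t)$ and $\psi(t)=t^p\log^{\sigma}(e+t)$ with $1<p<\infty$, $\sigma,\tau\ge0$, then $\omega_a(t)\le\log^{-(\sigma+\tau)}(e+1/t)$ excludes Lavrentiev's phenomenon between $V^{1,M}_0(\Omega)$ and $C_c^\infty(\Omega)$. Anisotropic cases (with $\xi=(\xi_1,\dots,\xi_n)$): (i') If $M(x,\xi)=\sum_{i=1}^n|\xi_i|^{p_i(x)}$, $p_i\in\mathcal{P}^{\log}(\Omega)$, $1\le p_i(\cdot)<\infty$, $i=1,\dots,n$, $\vec p=(p_1,\dots,p_n)$, then Lavrentiev's phenomenon for $\mathcal{F}$ does not occur between $V^{1,M}_0(\Omega)=W^{1,\vec p(\cdot)}_0(\Omega)$ and $C_c^\infty(\Omega)$, as well as between $W^{1,\vec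 p(\cdot)}_0(\Omega)\cap C^{0,\gamma}(\Omega)$ and $C_c^\infty(\Omega)$. (ii') If $M(x,\xi)=\sum_{i=1}^n|\xi_i|^{p_i}+\sum_{i=1}^na_i(x)|\xi_i|^{q_i}$, $0\le a_i\in C^{0,\alpha_i}(\Omega)$, $1\le p_i\le q_i$, $i=1,\dots,n$, then Lavrentiev's phenomenon for $\mathcal{F}$ does not occur between $V^{1,M}_0(\Omega)$ and $C_c^\infty(\Omega)$ if $q_i\le p_i+\alpha_i$ for all $i$, and between $V^{1,M}_0(\Omega)\cap C^{0,\gamma}(\Omega)$ and $C_c^\infty(\Omega)$ if $q_i\le p_i+\alpha_i/(1-\gamma)$ for all $i$. (iii') If $M(x,\xi)=\sum_{i=1}^n|\xi_i|^{p_i}+\sum_{i=1}^na_i(x)|\xi_i|^{p_i}\log(e+|\xi_i|)$, $0\le a_i\in\mathcal{P}^{\log}(\Omega)$, $1\le p_i<\infty$, $i=1,\dots,n$, then Lavrentiev's phenomenon for $\mathcal{F}$ does not occur between $V^{1,M}_0(\Omega)$ and $C_c^\infty(\Omega)$, as well as between $V^{1,M}_0(\Omega)\cap C^{0,\gamma}(\Omega)$ and $C_c^\infty(\Omega)$. (iv') If $M(x,\xi)=\sum_{i=1}^n|\xi_i|^{p_i(x)}+\sum_{i=1}^na_i(x)|\xi_i|^{q_i(x)}$, $0\le a_i\in C^{0,\alpha_i}(\Omega)$, $1\le p_i(\cdot)\le q_i(\cdot)$, $p_i,q_i\in\mathcal{P}^{\log}(\Omega)$, $i=1,\dots,n$,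 then Lavrentiev's phenomenon for $\mathcal{F}$ does not occur between $V^{1,M}_0(\Omega)$ and $C_c^\infty(\Omega)$ whenever $\sup_{x\in\Omega}(q_i(x)-p_i(x))\le\alpha_i$ for all $i$, and between $V^{1,M}_0(\Omega)\cap C^{0,\gamma}(\Omega)$ and $C_c^\infty(\Omega)$ whenever $\sup_{x\in\Omega}(q_i(x)-p_i(x))\le\alpha_i/(1-\gamma)$ for all $i$.
   Context: Weak $N$-functions. A function $M:\Omega\times\mathbb{R}^n\to[0,\infty)$ is a weak $N$-function if: (1) it is Carathéodory (measurable in $x$, continuous in $\xi$); (2) $M(x,0)=0$ and $\xi\mapsto M(x,\xi)$ is convex for a.a. $x\in\Omega$; (3) $M(x,\xi)=M(x,-\xi)$ for a.a. $x$ and all $\xi$; (4) there exist convex functions $m_1,m_2:[0,\infty)\to[0,\infty)$ with $m_1(0)=0$, $m_1(s)>0$ for $s>0$, such that $m_1(|\xi|)\le M(x,\xi)\le m_2(|\xi|)$ for a.a. $x\in\Omega$ and all $\xi$. A function $\phi:[0,\infty)\to[0,\infty)$ satisfies $\Delta_2$ if there are constants $c,C,h>0$ with $\phi(2t)\le c\,\phi(t)+h$ for all $t>C$. A Young function here is a convex function $\phi:[0,\infty)\to[0,\infty)$ with $\phi(0)=0$ and $\phi(t)>0$ for $t>0$. $\mathcal{P}^{\log}(\Omega)$ is the set of log-Hölder continuous functions on $\Omega$: those $p$ for which there is $c>0$ with $|p(x)-p(y)|\le c/\log(1/|x-y|)$ for $x,y$ close enough. For $\gamma\in(0,1]$, $h\in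 C^{0,\gamma}(\Omega)$ means $\sup_{x\ne y\in\Omega}|h(x)-h(y)|/|x-y|^\gamma<\infty$; the exponents $\alpha,\alpha_i$ lie in $(0,1]$. A modulus of continuity $\omega_a$ of $a$ is a nondecreasing function with $|a(x)-a(y)|\le\omega_a(|x-y|)$ for all $x,y\in\Omega$. $L_M(\Omega;\mathbb{R}^n)$ is the smallest linear space containing all measurable $\xi:\Omega\to\mathbb{R}^n$ with $\int_\Omega M(x,\xi(x))\,dx<\infty$. $V^1L_M(\Omega)=\{f\in W^{1,1}(\Omega):\nabla f\in L_M(\Omega;\mathbb{R}^n)\}$ and $V^{1,M}_0(\Omega)=\{f\in W^{1,1}_0(\Omega):\nabla f\in L_M(\Omega;\mathbb{R}^n)\}$. "Lavrentiev's phenomenon for $\mathcal{F}$ does not occur between $V^{1,M}_0(\Omega)$ and $C_c^\infty(\Omega)$" means that for every $u_0\in V^1L_M(\Omega)$, $\inf_{u\in u_0+V^{1,M}_0(\Omega)}\mathcal{F}[u]=\inf_{u\in u_0+C_c^\infty(\Omega)}\mathcal{F}[u]$. "Lavrentiev's phenomenon for $\mathcal{F}$ does not occur between $V^{1,M}_0(\Omega)\cap C^{0,\gamma}(\Omega)$ and $C_c^\infty(\Omega)$" means that for every $u_0\in V^1L_M(\Omega)\cap C^{0,\gamma}(\Omega)$, $\inf_{u\in u_0+(V^{1,M}_0(\Omega)\cap C^{0,\gamma}(\Omega))}\mathcal{F}[u]=\inf_{u\in u_0+C_c^\infty(\Omega)}\mathcal{F}[u]$. *)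

theory Defs
  imports "HOL-Analysis.Analysis"
begin

section \<open>Domains and function classes\<close>

text \<open>
  Real-valued functions on a set \<open>\<Omega>\<close> are represented by total functions on \<open>real ^ 'n\<close>; only their
  restriction to \<open>\<Omega>\<close> matters, and functions are not identified when they agree almost
  everywhere.  Measurability is with respect to Lebesgue measurable sets.
\<close>

text \<open>
  Near each boundary point, \<open>\<Omega>\<close> is the strict epigraph, in the direction of some unit vector \<open>e\<close>, of
  a Lipschitz function \<open>h\<close> on the hyperplane orthogonal to \<open>e\<close>.
\<close>

definition bounded_lipschitz_domain :: "(real ^ 'n) set \<Rightarrow> bool" where
  "bounded_lipschitz_domain \<Omega> \<longleftrightarrow>
     open \<Omega> \<and> connected \<Omega> \<and> \<Omega> \<noteq> {} \<and> bounded \<Omega> \<and>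
     (\<forall>x0\<in>frontier \<Omega>. \<exists>r>0. \<exists>e C. \<exists>h :: real ^ 'n \<Rightarrow> real.
        norm e = 1 \<and> C-lipschitz_on {y. y \<bullet> e = 0} h \<and>
        \<Omega> \<inter> ball x0 r = {x \<in> ball x0 r. h (x - (x \<bullet> e) *\<^sub>R e) < x \<bullet> e})"

definition partial_deriv :: "'n \<Rightarrow> (real ^ 'n \<Rightarrow> real) \<Rightarrow> real ^ 'n \<Rightarrow> real" where
  "partial_deriv i f x = frechet_derivative f (at x) (axis i 1)"

primrec k_times_cont_diff :: "nat \<Rightarrow> (real ^ 'n \<Rightarrow> real) \<Rightarrow> bool" where
  "k_times_cont_diff 0 f \<longleftrightarrow> continuous_on UNIV f"
| "k_times_cont_diff (Suc k) f \<longleftrightarrow>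
     (\<forall>x. f differentiable (at x)) \<and> (\<forall>i. k_times_cont_diff k (partial_deriv i f))"

definition Cc_infty :: "(real ^ 'n) set \<Rightarrow> (real ^ 'n \<Rightarrow> real) set" where
  "Cc_infty \<Omega> = {f. (\<forall>k. k_times_cont_diff k f) \<and>
                    compact (closure {x. f x \<noteq> 0}) \<and> closure {x. f x \<noteq> 0} \<subseteq> \<Omega>}"

definition log_holder :: "(real ^ 'n) set \<Rightarrow> (real ^ 'n \<Rightarrow> real) set" where
  "log_holder \<Omega> = {p. \<exists>c>0. \<exists>\<delta>>0. \<forall>x\<in>\<Omega>. \<forall>y\<in>\<Omega>.
     x \<noteq> y \<and> dist x y < \<delta> \<longrightarrow> \<bar>p x - p y\<bar> \<le> c / ln (1 / dist x y)}"

definition holder_space :: "(real ^ 'n) set \<Rightarrow> real \<Rightarrow> (real ^ 'n \<Rightarrow> real) set" where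
  "holder_space \<Omega> \<gamma> =
     {h. bdd_above {\<bar>h x - h y\<bar> / dist x y powr \<gamma> | x y. x \<in> \<Omega> \<and> y \<in> \<Omega> \<and> x \<noteq> y}}"

definition modulus_of_continuity ::
    "(real ^ 'n) set \<Rightarrow> (real ^ 'n \<Rightarrow> real) \<Rightarrow> (real \<Rightarrow> real) \<Rightarrow> bool" where
  "modulus_of_continuity \<Omega> a \<omega> \<longleftrightarrow>
     mono_on {0..} \<omega> \<and> (\<forall>x\<in>\<Omega>. \<forall>y\<in>\<Omega>. \<bar>a x - a y\<bar> \<le> \<omega> (dist x y))"


section \<open>Young functions and weak N-functions\<close>

definition Delta2 :: "(real \<Rightarrow> real) \<Rightarrow> bool" where
  "Delta2 \<phi> \<longleftrightarrow> (\<exists>c>0. \<exists>C>0. \<exists>h>0. \<forall>t>C. \<phi> (2 * t) \<le> c * \<phi> t + h)"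

definition Young_function :: "(real \<Rightarrow> real) \<Rightarrow> bool" where
  "Young_function \<phi> \<longleftrightarrow> convex_on {0..} \<phi> \<and> \<phi> 0 = 0 \<and> (\<forall>t>0. \<phi> t > 0)"

definition weak_N_function ::
    "(real ^ 'n) set \<Rightarrow> (real ^ 'n \<Rightarrow> real ^ 'n \<Rightarrow> real) \<Rightarrow> bool" where
  "weak_N_function \<Omega> M \<longleftrightarrow>
     (\<forall>x\<in>\<Omega>. \<forall>\<xi>. 0 \<le> M x \<xi>) \<and>
     (\<forall>\<xi>. (\<lambda>x. M x \<xi>) \<in> borel_measurable (lebesgue_on \<Omega>)) \<and>
     (\<forall>x\<in>\<Omega>. continuous_on UNIV (M x)) \<and>
     (AE x in lebesgue_on \<Omega>. M x 0 = 0 \<and> convex_on UNIV (M x)) \<and>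
     (AE x in lebesgue_on \<Omega>. \<forall>\<xi>. M x \<xi> = M x (- \<xi>)) \<and>
     (\<exists>m1 m2 :: real \<Rightarrow> real.
        convex_on {0..} m1 \<and> convex_on {0..} m2 \<and>
        (\<forall>s\<ge>0. 0 \<le> m1 s) \<and> (\<forall>s\<ge>0. 0 \<le> m2 s) \<and>
        m1 0 = 0 \<and> (\<forall>s>0. 0 < m1 s) \<and>
        (AE x in lebesgue_on \<Omega>. \<forall>\<xi>. m1 (norm \<xi>) \<le> M x \<xi> \<and> M x \<xi> \<le> m2 (norm \<xi>)))"


section \<open>Sobolev and Musielak--Orlicz--Sobolev spaces\<close>

definition has_weak_gradient ::
    "(real ^ 'n) set \<Rightarrow> (real ^ 'n \<Rightarrow> real) \<Rightarrow> (real ^ 'n \<Rightarrow> real ^ 'n) \<Rightarrow> bool" where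
  "has_weak_gradient \<Omega> u g \<longleftrightarrow>
     (\<forall>K. compact K \<and> K \<subseteq> \<Omega> \<longrightarrow> integrable (lebesgue_on K) u \<and> integrable (lebesgue_on K) g) \<and>
     (\<forall>\<phi>\<in>Cc_infty \<Omega>. \<forall>i.
        (LINT x|lebesgue_on \<Omega>. u x * partial_deriv i \<phi> x) =
        - (LINT x|lebesgue_on \<Omega>. g x $ i * \<phi> x))"

text \<open>
  The weak gradient is unique up to null sets, and all notions below are insensitive to the
  representative chosen here.
\<close>

definition weak_gradient ::
    "(real ^ 'n) set \<Rightarrow> (real ^ 'n \<Rightarrow> real) \<Rightarrow> real ^ 'n \<Rightarrow> real ^ 'n" where
  "weak_gradient \<Omega> u = (SOME g. has_weak_gradient \<Omega> u g)"

definition W11 :: "(real ^ 'n) set \<Rightarrow> (real ^ 'n \<Rightarrow> real) set" where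
  "W11 \<Omega> = {u. integrable (lebesgue_on \<Omega>) u \<and>
               (\<exists>g. has_weak_gradient \<Omega> u g \<and> integrable (lebesgue_on \<Omega>) g)}"

definition W11_norm :: "(real ^ 'n) set \<Rightarrow> (real ^ 'n \<Rightarrow> real) \<Rightarrow> real" where
  "W11_norm \<Omega> u = (LINT x|lebesgue_on \<Omega>. \<bar>u x\<bar>) + (LINT x|lebesgue_on \<Omega>. norm (weak_gradient \<Omega> u x))"

definition W11_0 :: "(real ^ 'n) set \<Rightarrow> (real ^ 'n \<Rightarrow> real) set" where
  "W11_0 \<Omega> = {u \<in> W11 \<Omega>. \<exists>\<phi> :: nat \<Rightarrow> real ^ 'n \<Rightarrow> real.
     (\<forall>k. \<phi> k \<in> Cc_infty \<Omega>) \<and> (\<lambda>k. W11_norm \<Omega> (\<lambda>x. u x - \<phi> k x)) \<longlonglongrightarrow> 0}"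

definition linear_function_space :: "(real ^ 'n \<Rightarrow> real ^ 'n) set \<Rightarrow> bool" where
  "linear_function_space V \<longleftrightarrow>
     (\<lambda>x. 0) \<in> V \<and> (\<forall>f\<in>V. \<forall>g\<in>V. (\<lambda>x. f x + g x) \<in> V) \<and> (\<forall>c. \<forall>f\<in>V. (\<lambda>x. c *\<^sub>R f x) \<in> V)"

definition L_space ::
    "(real ^ 'n) set \<Rightarrow> (real ^ 'n \<Rightarrow> real ^ 'n \<Rightarrow> real) \<Rightarrow> (real ^ 'n \<Rightarrow> real ^ 'n) set" where
  "L_space \<Omega> M = \<Inter> {V. linear_function_space V \<and>
     {\<xi> \<in> borel_measurable (lebesgue_on \<Omega>). (\<integral>\<^sup>+ x. ennreal (M x (\<xi> x)) \<partial>lebesgue_on \<Omega>) < \<infinity>} \<subseteq> V}"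

definition V1L ::
    "(real ^ 'n) set \<Rightarrow> (real ^ 'n \<Rightarrow> real ^ 'n \<Rightarrow> real) \<Rightarrow> (real ^ 'n \<Rightarrow> real) set" where
  "V1L \<Omega> M = {f \<in> W11 \<Omega>. weak_gradient \<Omega> f \<in> L_space \<Omega> M}"

definition V1_0 ::
    "(real ^ 'n) set \<Rightarrow> (real ^ 'n \<Rightarrow> real ^ 'n \<Rightarrow> real) \<Rightarrow> (real ^ 'n \<Rightarrow> real) set" where
  "V1_0 \<Omega> M = {f \<in> W11_0 \<Omega>. weak_gradient \<Omega> f \<in> L_space \<Omega> M}"

definition Lp_var ::
    "(real ^ 'n) set \<Rightarrow> (real ^ 'n \<Rightarrow> real) \<Rightarrow> (real ^ 'n \<Rightarrow> real) set" where
  "Lp_var \<Omega> p = {f \<in> borel_measurable (lebesgue_on \<Omega>).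
     \<exists>k>0. (\<integral>\<^sup>+ x. ennreal ((\<bar>f x\<bar> / k) powr p x) \<partial>lebesgue_on \<Omega>) < \<infinity>}"

text \<open>
  In the spaces of the next two definitions only the gradient is asked to lie in a variable exponent
  Lebesgue space (given by its Luxemburg description \<open>Lp_var\<close>), as is common for functions with
  zero boundary values.
\<close>

definition W1p_var_0 ::
    "(real ^ 'n) set \<Rightarrow> (real ^ 'n \<Rightarrow> real) \<Rightarrow> (real ^ 'n \<Rightarrow> real) set" where
  "W1p_var_0 \<Omega> p = {f \<in> W11_0 \<Omega>. (\<lambda>x. norm (weak_gradient \<Omega> f x)) \<in> Lp_var \<Omega> p}"

definition W1p_aniso_0 ::
    "(real ^ 'n) set \<Rightarrow> ('n \<Rightarrow> real ^ 'n \<Rightarrow> real) \<Rightarrow> (real ^ 'n \<Rightarrow> real) set" where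
  "W1p_aniso_0 \<Omega> p = {f \<in> W11_0 \<Omega>. \<forall>i. (\<lambda>x. weak_gradient \<Omega> f x $ i) \<in> Lp_var \<Omega> (p i)}"


section \<open>The functional and Lavrentiev's phenomenon\<close>

definition caratheodory_integrand ::
    "(real ^ 'n) set \<Rightarrow> (real ^ 'n \<Rightarrow> real \<Rightarrow> real ^ 'n \<Rightarrow> real) \<Rightarrow> bool" where
  "caratheodory_integrand \<Omega> F \<longleftrightarrow>
     (\<forall>z \<xi>. (\<lambda>x. F x z \<xi>) \<in> borel_measurable (lebesgue_on \<Omega>)) \<and>
     (\<forall>x\<in>\<Omega>. continuous_on UNIV (\<lambda>(z, \<xi>). F x z \<xi>))"

text \<open>
  Meant for nonnegative integrands only, whose integral is a well-defined element of \<open>[0, \<infinity>]\<close>.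
\<close>

definition functional ::
    "(real ^ 'n) set \<Rightarrow> (real ^ 'n \<Rightarrow> real \<Rightarrow> real ^ 'n \<Rightarrow> real) \<Rightarrow> (real ^ 'n \<Rightarrow> real) \<Rightarrow> ennreal" where
  "functional \<Omega> F u = (\<integral>\<^sup>+ x. ennreal (F x (u x) (weak_gradient \<Omega> u x)) \<partial>lebesgue_on \<Omega>)"

definition translate_space ::
    "(real ^ 'n \<Rightarrow> real) \<Rightarrow> (real ^ 'n \<Rightarrow> real) set \<Rightarrow> (real ^ 'n \<Rightarrow> real) set" where
  "translate_space u0 X = {\<lambda>x. u0 x + v x | v. v \<in> X}"

text \<open>\<open>D\<close> is the class of admissible boundary data \<open>u0\<close>.\<close>

definition no_lavrentiev ::
    "(real ^ 'n) set \<Rightarrow> (real ^ 'n \<Rightarrow> real \<Rightarrow> real ^ 'n \<Rightarrow> real) \<Rightarrow>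
     (real ^ 'n \<Rightarrow> real) set \<Rightarrow> (real ^ 'n \<Rightarrow> real) set \<Rightarrow> bool" where
  "no_lavrentiev \<Omega> F D X \<longleftrightarrow>
     (\<forall>u0\<in>D. (INF u\<in>translate_space u0 X. functional \<Omega> F u) =
              (INF u\<in>translate_space u0 (Cc_infty \<Omega>). functional \<Omega> F u))"

definition no_lavrentiev_V ::
    "(real ^ 'n) set \<Rightarrow> (real ^ 'n \<Rightarrow> real ^ 'n \<Rightarrow> real) \<Rightarrow>
     (real ^ 'n \<Rightarrow> real \<Rightarrow> real ^ 'n \<Rightarrow> real) \<Rightarrow> bool" where
  "no_lavrentiev_V \<Omega> M F \<longleftrightarrow> no_lavrentiev \<Omega> F (V1L \<Omega> M) (V1_0 \<Omega> M)"

definition no_lavrentiev_V_holder ::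
    "(real ^ 'n) set \<Rightarrow> (real ^ 'n \<Rightarrow> real ^ 'n \<Rightarrow> real) \<Rightarrow>
     (real ^ 'n \<Rightarrow> real \<Rightarrow> real ^ 'n \<Rightarrow> real) \<Rightarrow> real \<Rightarrow> bool" where
  "no_lavrentiev_V_holder \<Omega> M F \<gamma> \<longleftrightarrow>
     no_lavrentiev \<Omega> F (V1L \<Omega> M \<inter> holder_space \<Omega> \<gamma>) (V1_0 \<Omega> M \<inter> holder_space \<Omega> \<gamma>)"

end

theory Submission
  imports Defs
begin

text \<open>
  Test functions are admissible competitors, so the infimum over \<open>u0 + Cc_infty\<close> is never the smaller
  one. For the other inequality it is enough that every admissible \<open>v\<close> is a limit of test functions
  \<open>\<phi> n\<close> with \<open>F [u0 + \<phi> n] \<longlonglongrightarrow> F [u0 + v]\<close>. Since \<open>F\<close> is continuous in \<open>(u, \<nabla>u)\<close> and dominated by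
  \<open>M + 1\<close>, and \<open>M\<close> is doubling, this holds as soon as \<open>\<phi> n\<close> and \<open>\<nabla>(\<phi> n)\<close> converge almost everywhere and
  \<open>M x (\<nabla>(\<phi> n) x) \<le> H n x\<close> for functions \<open>H n\<close> that converge in \<open>L\<^sup>1\<close>: this is dominated convergence
  with moving bounds (\<open>integral_tendsto_moving_bound\<close>, \<open>functional_tendsto\<close>).

  The \<open>\<phi> n\<close> are mollifications of \<open>v\<close>, and the question is why mollifying at scale \<open>\<delta>\<close> does not destroy
  the integrability of \<open>M x (\<nabla>v x)\<close> although \<open>M\<close> depends on \<open>x\<close>. All the model functions depend on \<open>\<xi>\<close>
  either through \<open>norm \<xi>\<close> or as a sum over the coordinates, so it is enough to look at profiles
  \<open>f x t\<close> of one variable \<open>t \<ge> 0\<close>. Call a profile balanced with parameter \<open>\<theta>\<close> if \<open>f x t \<le> C * (f y t + 1)\<close>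
  whenever \<open>dist x y \<le> \<delta>\<close> and \<open>1 \<le> t \<le> K * \<delta> powr (\<theta> - 1)\<close>. The range of \<open>t\<close> is exactly the range of
  the gradient of a mollified function: it is of size \<open>1 / \<delta>\<close> if \<open>v\<close> is bounded (\<open>\<theta> = 0\<close>) and of size
  \<open>\<delta> powr (\<gamma> - 1)\<close> if \<open>v\<close> is Hoelder continuous with exponent \<open>\<gamma>\<close> (\<open>\<theta> = \<gamma>\<close>), see \<open>conv_gradient_bound\<close>.
  In this range freezing \<open>x\<close> costs only a constant. For \<open>g = \<nabla>v\<close> and a mollifier \<open>k\<close> of radius \<open>\<delta>\<close>, the
  convexity of each single \<open>f y\<close>, together with doubling, then bounds \<open>f x\<close> at the size of \<open>k * g\<close> by a
  multiple of \<open>k * h\<close> with \<open>h y = M y (g y) + norm (g y)\<close> (\<open>averaging_component\<close>). Since \<open>k * h\<close> converges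
  to \<open>h\<close> in \<open>L\<^sup>1\<close>, it serves as the moving bound.

  Two points remain. Mollified functions must have compact support in \<open>\<Omega>\<close>; therefore \<open>v\<close> is first split
  by a partition of unity, and near the boundary the mollifier is supported in a small ball off the
  origin, inside the cone of inward directions that a Lipschitz boundary provides (\<open>inward_mollifier\<close>,
  \<open>approximation\<close>). This needs \<open>v\<close> to extend by zero, which is clear for limits of test functions in
  \<open>W\<^sup>1\<^sup>,\<^sup>1\<close>, and, in the Hoelder case, the extension to be Hoelder continuous, which follows since \<open>v\<close>
  vanishes on the boundary (\<open>holder_boundary_value\<close>). Finally, a general \<open>v\<close> is not bounded; it is replaced
  by \<open>m * arctan (v / m)\<close>, whose gradient is that of \<open>v\<close> times a factor in \<open>[0, 1]\<close>, and \<open>m\<close> is sent to infinity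
  (\<open>no_lavrentiev_V_balanced\<close>).

  What is left for each model is to check balance; this is where the conditions linking exponents and
  weights come from. Log-Hoelder continuity says that \<open>\<bar>p x - p y\<bar> * ln t\<close> stays bounded for
  \<open>dist x y \<le> \<delta>\<close> and \<open>1 \<le> t \<le> K / \<delta>\<close>. For a weight \<open>a\<close> in \<open>C\<^sup>0\<^sup>,\<^sup>\<alpha>\<close> the
  oscillation of \<open>a x * t powr q\<close> is at most a multiple of
  \<open>\<delta> powr \<alpha> * t powr (q - p) * t powr p\<close>, and \<open>\<delta> powr \<alpha> * t powr (q - p)\<close> is bounded for
  \<open>t \<le> K * \<delta> powr (\<theta> - 1)\<close> precisely when \<open>(1 - \<theta>) * (q - p) \<le> \<alpha>\<close>: this is \<open>q \<le> p + \<alpha>\<close> for \<open>\<theta> = 0\<close>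
  and \<open>q \<le> p + \<alpha> / (1 - \<gamma>)\<close> for \<open>\<theta> = \<gamma>\<close>. The Orlicz conditions say the same in terms of \<open>\<phi> / \<psi>\<close>.
\<close>

section \<open>Smooth functions and test functions\<close>

definition smooth :: "(real ^ 'n \<Rightarrow> real) \<Rightarrow> bool" where
  "smooth f \<longleftrightarrow> (\<forall>k. k_times_cont_diff k f)"

lemma partial_deriv_eqI:
  "(f has_derivative f') (at x) \<Longrightarrow> partial_deriv i f x = f' (axis i 1)"
  unfolding partial_deriv_def using frechet_derivative_at by metis

lemma smooth_coinduct:
  assumes "f \<in> S"
    and diff: "\<And>f x. f \<in> S \<Longrightarrow> f differentiable (at x)"
    and closed: "\<And>f i. f \<in> S \<Longrightarrow> partial_deriv i f \<in> S"
  shows "smooth f"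
proof -
  have "\<forall>f\<in>S. k_times_cont_diff k f" for k
  proof (induction k)
    case 0
    then show ?case
      using diff by (auto intro!: differentiable_imp_continuous_on simp: differentiable_on_def)
  next
    case (Suc k)
    then show ?case using diff closed by auto
  qed
  then show ?thesis using assms(1) unfolding smooth_def by auto
qed

lemma smooth_differentiable: "smooth f \<Longrightarrow> f differentiable (at x)"
  unfolding smooth_def by (metis k_times_cont_diff.simps(2))

lemma smooth_partial_deriv: "smooth f \<Longrightarrow> smooth (partial_deriv i f)"
  unfolding smooth_def by (metis k_times_cont_diff.simps(2))

lemma smooth_continuous: "smooth f \<Longrightarrow> continuous_on A f"
  using continuous_on_subset[of UNIV f A] unfolding smooth_def by (metis k_times_cont_diff.simps(1) subset_UNIV)

text \<open>
  The functions \<open>exp (- 1 / s) / s ^ m\<close>, extended by zero to \<open>s \<le> 0\<close>: the derivative of one of them is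
  a linear combination of others, which is why all powers \<open>m\<close> are considered together.
\<close>

definition flat_exp :: "nat \<Rightarrow> real \<Rightarrow> real" where
  "flat_exp m s = (if s \<le> 0 then 0 else exp (- (1 / s)) / s ^ m)"

lemma flat_exp_tendsto_0: "((\<lambda>s. flat_exp m s) \<longlongrightarrow> 0) (at_right 0)"
proof -
  have "((\<lambda>x::real. x ^ m / exp x) \<longlongrightarrow> 0) at_top"
    by (rule tendsto_power_div_exp_0)
  then have *: "((\<lambda>s::real. inverse s ^ m / exp (inverse s)) \<longlongrightarrow> 0) (at_right 0)"
    by (rule filterlim_compose[OF _ filterlim_inverse_at_top_right])
  have ev: "eventually (\<lambda>s. inverse s ^ m / exp (inverse s) = flat_exp m s) (at_right 0)"
    by (auto simp: eventually_at_right_less flat_exp_def exp_minus field_simps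
        intro!: eventually_mono[OF eventually_at_right_less])
  show ?thesis
    by (rule tendsto_cong[THEN iffD1, OF ev *])
qed

lemma flat_exp_has_derivative:
  "(flat_exp m has_real_derivative (flat_exp (m + 2) s - m * flat_exp (m + 1) s)) (at s)"
proof (cases s "0::real" rule: linorder_cases)
  case less
  have "((\<lambda>_. 0) has_real_derivative 0) (at s)" by simp
  moreover have "\<forall>\<^sub>F x in nhds s. flat_exp m x = 0"
    using eventually_nhds_in_open[of "{..<0}" s] less by (auto simp: flat_exp_def elim!: eventually_mono)
  ultimately have "(flat_exp m has_real_derivative 0) (at s)"
    using DERIV_cong_ev[OF refl _ refl, of "flat_exp m" "\<lambda>_. 0" s 0] by auto
  then show ?thesis using less by (simp add: flat_exp_def)
next
  case greater
  have "((\<lambda>s. exp (- (1 / s)) / s ^ m) has_real_derivative (flat_exp (m + 2) s - m * flat_exp (m + 1) s)) (at s)"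
  proof -
    have "((\<lambda>s. exp (- (1 / s)) / s ^ m) has_real_derivative
       (exp (- (1 / s)) * (1 / (s * s)) * s ^ m - exp (- (1 / s)) * (real m * s ^ (m - 1))) / (s ^ m * s ^ m)) (at s)"
      using greater by (auto intro!: derivative_eq_intros)
    moreover have "(exp (- (1 / s)) * (1 / (s * s)) * s ^ m - exp (- (1 / s)) * (real m * s ^ (m - 1))) / (s ^ m * s ^ m)
       = flat_exp (m + 2) s - m * flat_exp (m + 1) s"
    proof (cases m)
      case 0
      then show ?thesis using greater by (simp add: flat_exp_def power2_eq_square)
    next
      case (Suc k)
      then show ?thesis using greater by (simp add: flat_exp_def field_simps)
    qed
    ultimately show ?thesis by simp
  qed
  moreover have "\<forall>\<^sub>F x in nhds s. flat_exp m x = exp (- (1 / x)) / x ^ m"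
    using eventually_nhds_in_open[of "{0<..}" s] greater by (auto simp: flat_exp_def elim!: eventually_mono)
  ultimately show ?thesis
    using DERIV_cong_ev[OF refl _ refl, of "flat_exp m" "\<lambda>s. exp (- (1 / s)) / s ^ m" s] by auto
next
  case equal
  have r: "((\<lambda>h. flat_exp m h / h) \<longlongrightarrow> 0) (at_right 0)"
  proof (rule tendsto_cong[THEN iffD1, OF _ flat_exp_tendsto_0[of "m + 1"]])
    show "\<forall>\<^sub>F x in at_right 0. flat_exp (m + 1) x = flat_exp m x / x"
      by (auto simp: flat_exp_def intro!: eventually_mono[OF eventually_at_right_less])
  qed
  have l: "((\<lambda>h. flat_exp m h / h) \<longlongrightarrow> 0) (at_left 0)"
  proof (rule tendsto_cong[THEN iffD1, OF _ tendsto_const])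
    show "\<forall>\<^sub>F x in at_left 0. 0 = flat_exp m x / x"
      by (auto simp: flat_exp_def eventually_at intro!: exI[of _ 1])
  qed
  have "((\<lambda>h. flat_exp m h / h) \<longlongrightarrow> 0) (at 0)"
    using l r by (simp add: filterlim_split_at)
  then show ?thesis using equal by (simp add: DERIV_def flat_exp_def)
qed

lemma flat_exp_nonneg: "0 \<le> flat_exp m s" and flat_exp_pos: "0 < s \<Longrightarrow> 0 < flat_exp m s"
  and flat_exp_eq_0: "s \<le> 0 \<Longrightarrow> flat_exp m s = 0"
  by (auto simp: flat_exp_def)

text \<open>
  A class of functions whose partial derivatives stay in the class consists of smooth functions
  (\<open>smooth_coinduct\<close>). The constructors are those under which this class is closed by the sum, product
  and chain rules, so one induction gives all closure properties of smooth functions at once.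
\<close>

inductive_set smooth_closure :: "(real ^ 'n \<Rightarrow> real) set" where
  base: "smooth f \<Longrightarrow> f \<in> smooth_closure"
| coord: "(\<lambda>x. x $ j) \<in> smooth_closure"
| const: "(\<lambda>x. c) \<in> smooth_closure"
| add: "f \<in> smooth_closure \<Longrightarrow> g \<in> smooth_closure \<Longrightarrow> (\<lambda>x. f x + g x) \<in> smooth_closure"
| mult: "f \<in> smooth_closure \<Longrightarrow> g \<in> smooth_closure \<Longrightarrow> (\<lambda>x. f x * g x) \<in> smooth_closure"
| inverse: "f \<in> smooth_closure \<Longrightarrow> (\<And>x. f x \<noteq> 0) \<Longrightarrow> (\<lambda>x. inverse (f x)) \<in> smooth_closure"
| flat: "f \<in> smooth_closure \<Longrightarrow> (\<lambda>x. flat_exp m (f x)) \<in> smooth_closure"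
| affine: "f \<in> smooth_closure \<Longrightarrow> (\<lambda>x. f (c *\<^sub>R x + b)) \<in> smooth_closure"

lemma partial_deriv_add:
  assumes "f differentiable (at x)" "g differentiable (at x)"
  shows "partial_deriv i (\<lambda>x. f x + g x) x = partial_deriv i f x + partial_deriv i g x"
  using has_derivative_add[OF assms[unfolded frechet_derivative_works]]
  by (intro partial_deriv_eqI[THEN trans]) (auto simp: partial_deriv_def)

lemma partial_deriv_mult:
  assumes "f differentiable (at x)" "g differentiable (at x)"
  shows "partial_deriv i (\<lambda>x. f x * g x) x = f x * partial_deriv i g x + partial_deriv i f x * g x"
  using has_derivative_mult[OF assms[unfolded frechet_derivative_works]]
  by (intro partial_deriv_eqI[THEN trans]) (auto simp: partial_deriv_def)

lemma partial_deriv_affine: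
  assumes "f differentiable (at (c *\<^sub>R x + b))"
  shows "(\<lambda>x. f (c *\<^sub>R x + b)) differentiable (at x)"
    and "partial_deriv i (\<lambda>x. f (c *\<^sub>R x + b)) x = c * partial_deriv i f (c *\<^sub>R x + b)"
proof -
  have a: "((\<lambda>x. c *\<^sub>R x + b) has_derivative (\<lambda>h. c *\<^sub>R h)) (at x)"
    by (auto intro!: derivative_eq_intros)
  have *: "((\<lambda>x. f (c *\<^sub>R x + b)) has_derivative (\<lambda>h. frechet_derivative f (at (c *\<^sub>R x + b)) (c *\<^sub>R h))) (at x)"
    by (rule has_derivative_compose[OF a assms[unfolded frechet_derivative_works]])
  then show "(\<lambda>x. f (c *\<^sub>R x + b)) differentiable (at x)"
    by (auto simp: differentiable_def)
  have "linear (frechet_derivative f (at (c *\<^sub>R x + b)))"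
    using assms by (simp add: linear_frechet_derivative)
  then show "partial_deriv i (\<lambda>x. f (c *\<^sub>R x + b)) x = c * partial_deriv i f (c *\<^sub>R x + b)"
    using partial_deriv_eqI[OF *, of i] by (simp add: partial_deriv_def linear_scale)
qed

lemma partial_deriv_chain:
  assumes "f differentiable (at x)" "(G has_real_derivative G') (at (f x))"
  shows "(\<lambda>x. G (f x)) differentiable (at x)"
    and "partial_deriv i (\<lambda>x. G (f x)) x = G' * partial_deriv i f x"
proof -
  have *: "((\<lambda>x. G (f x)) has_derivative (\<lambda>h. G' * frechet_derivative f (at x) h)) (at x)"
    using has_derivative_compose[OF assms(1)[unfolded frechet_derivative_works] assms(2)[unfolded has_field_derivative_def]] .
  then show "(\<lambda>x. G (f x)) differentiable (at x)"
    by (auto simp: differentiable_def)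
  show "partial_deriv i (\<lambda>x. G (f x)) x = G' * partial_deriv i f x"
    using partial_deriv_eqI[OF *, of i] by (simp add: partial_deriv_def)
qed

lemma smooth_closure_smooth:
  assumes "f \<in> smooth_closure"
  shows "smooth f"
proof -
  have "(\<forall>x. f differentiable (at x)) \<and> (\<forall>i. partial_deriv i f \<in> smooth_closure)" if "f \<in> smooth_closure" for f :: "real ^ 'n \<Rightarrow> real"
    using that
  proof (induction)
    case (base f)
    then show ?case by (auto intro: smooth_closure.base smooth_differentiable smooth_partial_deriv)
  next
    case (coord j)
    have *: "((\<lambda>x::real^'n. x $ j) has_derivative (\<lambda>h. h $ j)) (at x)" for x
      by (rule bounded_linear_imp_has_derivative[OF bounded_linear_vec_nth])
    have "partial_deriv i (\<lambda>x. x $ j) = (\<lambda>x. axis i 1 $ j)" for i :: 'n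
      by (rule ext) (rule partial_deriv_eqI[OF *])
    then show ?case using * by (auto simp: differentiable_def intro: smooth_closure.const)
  next
    case (const c)
    have *: "((\<lambda>x::real^'n. c) has_derivative (\<lambda>h. 0)) (at x)" for x
      by (auto intro!: derivative_eq_intros)
    have "partial_deriv i (\<lambda>x. c) = (\<lambda>x. 0)" for i :: 'n
      by (rule ext) (rule partial_deriv_eqI[OF *])
    then show ?case using * by (auto simp: differentiable_def intro: smooth_closure.const)
  next
    case (add f g)
    have "partial_deriv i (\<lambda>x. f x + g x) = (\<lambda>x. partial_deriv i f x + partial_deriv i g x)" for i
      using add by (intro ext partial_deriv_add) auto
    then show ?case using add by (auto intro!: smooth_closure.add)
  next
    case (mult f g)
    have "partial_deriv i (\<lambda>x. f x * g x) = (\<lambda>x. f x * partial_deriv i g x + partial_deriv i f x * g x)" for i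
      using mult by (intro ext partial_deriv_mult) auto
    then show ?case using mult by (auto intro!: smooth_closure.add smooth_closure.mult)
  next
    case (inverse f)
    have d: "(inverse has_real_derivative - (inverse (f x) * inverse (f x))) (at (f x))" for x
      using DERIV_inverse[OF inverse.hyps(2)[of x]] by (simp add: numeral_2_eq_2)
    have "partial_deriv i (\<lambda>x. inverse (f x)) = (\<lambda>x. (-1) * (inverse (f x) * inverse (f x)) * partial_deriv i f x)" for i
      using inverse by (intro ext) (simp add: partial_deriv_chain[OF _ d])
    moreover have "(\<lambda>x. (-1) * (inverse (f x) * inverse (f x)) * partial_deriv i f x) \<in> smooth_closure" for i
      using inverse by (intro smooth_closure.mult smooth_closure.inverse smooth_closure.const) auto
    ultimately show ?case using inverse partial_deriv_chain(1)[OF _ d] by simp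
  next
    case (flat f m)
    have d: "partial_deriv i (\<lambda>x. flat_exp m (f x)) =
        (\<lambda>x. (flat_exp (m + 2) (f x) + (- real m) * flat_exp (m + 1) (f x)) * partial_deriv i f x)" for i
      using flat by (intro ext) (simp add: partial_deriv_chain[OF _ flat_exp_has_derivative])
    show ?case
    proof (intro conjI allI)
      show "(\<lambda>x. flat_exp m (f x)) differentiable (at x)" for x
        using flat.IH by (intro partial_deriv_chain(1)[OF _ flat_exp_has_derivative]) auto
      show "partial_deriv i (\<lambda>x. flat_exp m (f x)) \<in> smooth_closure" for i
        unfolding d using flat
        by (intro smooth_closure.mult smooth_closure.add smooth_closure.flat smooth_closure.const) auto
    qed
  next
    case (affine f c b)
    have "partial_deriv i (\<lambda>x. f (c *\<^sub>R x + b)) = (\<lambda>x. c * partial_deriv i f (c *\<^sub>R x + b))" for i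
      using affine by (intro ext partial_deriv_affine) auto
    moreover have "(\<lambda>x. f (c *\<^sub>R x + b)) differentiable (at x)" for x
      using affine.IH by (intro partial_deriv_affine(1)) auto
    ultimately show ?case using affine
      by (auto intro!: smooth_closure.mult smooth_closure.affine[of "partial_deriv _ f"] smooth_closure.const)
  qed
  then show ?thesis
    using assms by (intro smooth_coinduct[of f smooth_closure]) auto
qed

lemma smooth_add: "smooth f \<Longrightarrow> smooth g \<Longrightarrow> smooth (\<lambda>x. f x + g x)"
  and smooth_mult: "smooth f \<Longrightarrow> smooth g \<Longrightarrow> smooth (\<lambda>x. f x * g x)"
  and smooth_inverse: "smooth f \<Longrightarrow> (\<And>x. f x \<noteq> 0) \<Longrightarrow> smooth (\<lambda>x. inverse (f x))"
  and smooth_flat_exp: "smooth f \<Longrightarrow> smooth (\<lambda>x. flat_exp m (f x))"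
  and smooth_affine: "smooth f \<Longrightarrow> smooth (\<lambda>x. f (c *\<^sub>R x + b))"
  and smooth_const: "smooth (\<lambda>x::real^'n. a)"
  and smooth_coord: "smooth (\<lambda>x::real^'n. x $ j)"
proof -
  note base = smooth_closure.base
  show "smooth f \<Longrightarrow> smooth g \<Longrightarrow> smooth (\<lambda>x. f x + g x)"
    by (rule smooth_closure_smooth[OF smooth_closure.add[OF base base]])
  show "smooth f \<Longrightarrow> smooth g \<Longrightarrow> smooth (\<lambda>x. f x * g x)"
    by (rule smooth_closure_smooth[OF smooth_closure.mult[OF base base]])
  show "smooth f \<Longrightarrow> (\<And>x. f x \<noteq> 0) \<Longrightarrow> smooth (\<lambda>x. inverse (f x))"
    by (rule smooth_closure_smooth[OF smooth_closure.inverse[OF base]])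
  show "smooth f \<Longrightarrow> smooth (\<lambda>x. flat_exp m (f x))"
    by (rule smooth_closure_smooth[OF smooth_closure.flat[OF base]])
  show "smooth f \<Longrightarrow> smooth (\<lambda>x. f (c *\<^sub>R x + b))"
    by (rule smooth_closure_smooth[OF smooth_closure.affine[OF base]])
  show "smooth (\<lambda>x::real^'n. a)" "smooth (\<lambda>x::real^'n. x $ j)"
    by (rule smooth_closure_smooth[OF smooth_closure.const], rule smooth_closure_smooth[OF smooth_closure.coord])
qed

lemma smooth_sum: "(\<And>i. i \<in> I \<Longrightarrow> smooth (f i)) \<Longrightarrow> smooth (\<lambda>x. \<Sum>i\<in>I. f i x)"
  by (induction I rule: infinite_finite_induct) (auto intro: smooth_const smooth_add)

lemma smooth_diff: "smooth f \<Longrightarrow> smooth g \<Longrightarrow> smooth (\<lambda>x. f x - g x)"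
  using smooth_add[OF _ smooth_mult[OF smooth_const[of "-1"]], of f g] by simp

definition bump :: "real ^ 'n \<Rightarrow> real \<Rightarrow> real ^ 'n \<Rightarrow> real" where
  "bump d s x = flat_exp 0 (s\<^sup>2 - (norm (x - d))\<^sup>2)"

lemma smooth_bump:
  fixes d :: "real ^ 'n"
  shows "smooth (bump d s)"
proof -
  have "smooth (\<lambda>x::real^'n. x $ j - d $ j)" for j
    by (intro smooth_diff smooth_coord smooth_const)
  then have "smooth (\<lambda>x. flat_exp 0 (s\<^sup>2 - (\<Sum>j\<in>UNIV. (x $ j - d $ j) * (x $ j - d $ j))))"
    by (intro smooth_flat_exp smooth_diff[OF smooth_const] smooth_sum smooth_mult)
  then show ?thesis
    by (simp add: bump_def[abs_def] power2_norm_eq_inner inner_vec_def)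
qed

lemma bump_nonneg: "0 \<le> bump d s x"
  and bump_pos: "norm (x - d) < s \<Longrightarrow> 0 < bump d s x"
  and bump_eq_0: "0 \<le> s \<Longrightarrow> s \<le> norm (x - d) \<Longrightarrow> bump d s x = 0"
  by (auto simp: bump_def intro!: flat_exp_nonneg flat_exp_pos flat_exp_eq_0 power_strict_mono power_mono)

abbreviation test :: "(real ^ 'n \<Rightarrow> real) \<Rightarrow> bool" where
  "test \<psi> \<equiv> \<psi> \<in> Cc_infty UNIV"

lemma Cc_infty_iff:
  "f \<in> Cc_infty \<Omega> \<longleftrightarrow> smooth f \<and> (\<exists>K. compact K \<and> K \<subseteq> \<Omega> \<and> (\<forall>x. x \<notin> K \<longrightarrow> f x = 0))"
proof
  assume "f \<in> Cc_infty \<Omega>"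
  then show "smooth f \<and> (\<exists>K. compact K \<and> K \<subseteq> \<Omega> \<and> (\<forall>x. x \<notin> K \<longrightarrow> f x = 0))"
    unfolding Cc_infty_def smooth_def
    by (auto intro!: exI[of _ "closure {x. f x \<noteq> 0}"]) (metis (mono_tags) closure_subset mem_Collect_eq subsetD)
next
  assume *: "smooth f \<and> (\<exists>K. compact K \<and> K \<subseteq> \<Omega> \<and> (\<forall>x. x \<notin> K \<longrightarrow> f x = 0))"
  then obtain K where K: "compact K" "K \<subseteq> \<Omega>" "\<And>x. x \<notin> K \<Longrightarrow> f x = 0" by auto
  then have "closure {x. f x \<noteq> 0} \<subseteq> K"
    by (intro closure_minimal) (auto intro: compact_imp_closed)
  moreover from this have "compact (closure {x. f x \<noteq> 0})"
    using K(1) by (meson bounded_subset closed_closure compact_eq_bounded_closed)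
  ultimately show "f \<in> Cc_infty \<Omega>"
    using * K(2) by (auto simp: Cc_infty_def smooth_def)
qed

lemma Cc_infty_mono: "A \<subseteq> B \<Longrightarrow> Cc_infty A \<subseteq> Cc_infty B"
  by (auto simp: Cc_infty_def)

lemma Cc_infty_test: "f \<in> Cc_infty A \<Longrightarrow> test f"
  using Cc_infty_mono by blast

lemma test_mult: "smooth f \<Longrightarrow> \<psi> \<in> Cc_infty A \<Longrightarrow> (\<lambda>x. f x * \<psi> x) \<in> Cc_infty A"
  unfolding Cc_infty_iff by (auto intro: smooth_mult)

lemma test_add:
  assumes "\<phi> \<in> Cc_infty A" "\<psi> \<in> Cc_infty A"
  shows "(\<lambda>x. \<phi> x + \<psi> x) \<in> Cc_infty A"
proof -
  obtain K L where "compact K" "K \<subseteq> A" "\<And>x. x \<notin> K \<Longrightarrow> \<phi> x = 0" "compact L" "L \<subseteq> A" "\<And>x. x \<notin> L \<Longrightarrow> \<psi> x = 0"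
    using assms unfolding Cc_infty_iff by metis
  then have "\<exists>K. compact K \<and> K \<subseteq> A \<and> (\<forall>x. x \<notin> K \<longrightarrow> \<phi> x + \<psi> x = 0)"
    by (intro exI[of _ "K \<union> L"]) (simp add: compact_Un)
  moreover have "smooth (\<lambda>x. \<phi> x + \<psi> x)"
    using assms unfolding Cc_infty_iff by (simp add: smooth_add)
  ultimately show ?thesis unfolding Cc_infty_iff by simp
qed

lemma test_zero: "(\<lambda>x. 0) \<in> Cc_infty A"
  unfolding Cc_infty_iff by (auto intro!: smooth_const)

lemma test_sum: "(\<And>i. i \<in> I \<Longrightarrow> f i \<in> Cc_infty A) \<Longrightarrow> (\<lambda>x. \<Sum>i\<in>I. f i x) \<in> Cc_infty A"
  by (induction I rule: infinite_finite_induct) (auto intro: test_add test_zero)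

lemma partial_deriv_eq_0_outside:
  assumes "closed K" "\<And>x. x \<notin> K \<Longrightarrow> f x = 0" "x \<notin> K"
  shows "partial_deriv i f x = 0"
proof -
  have "((\<lambda>_. 0) has_derivative (\<lambda>_. 0)) (at x)" by simp
  then have "(f has_derivative (\<lambda>_. 0)) (at x)"
    by (rule has_derivative_transform_within_open[of _ _ _ _ "- K"]) (use assms in auto)
  then show ?thesis by (rule partial_deriv_eqI)
qed

lemma Cc_infty_partial_deriv: "f \<in> Cc_infty A \<Longrightarrow> partial_deriv i f \<in> Cc_infty A"
  unfolding Cc_infty_iff
  by (metis compact_imp_closed partial_deriv_eq_0_outside smooth_partial_deriv)

lemma test_bump: "0 \<le> s \<Longrightarrow> bump d s \<in> Cc_infty UNIV"
  unfolding Cc_infty_iff using bump_eq_0[of s _ d]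
  by (auto intro!: smooth_bump exI[of _ "cball d s"] simp: dist_norm norm_minus_commute)

lemma test_affine: 
  assumes "test f" "c \<noteq> 0"
  shows "test (\<lambda>x. f (c *\<^sub>R x + b))"
proof -
  obtain K where K: "compact K" "\<And>x. x \<notin> K \<Longrightarrow> f x = 0" "smooth f" using assms(1) unfolding Cc_infty_iff by auto
  have "compact ((\<lambda>y. (1 / c) *\<^sub>R (y - b)) ` K)"
    by (intro compact_continuous_image continuous_intros K)
  moreover have "f (c *\<^sub>R x + b) = 0" if "x \<notin> (\<lambda>y. (1 / c) *\<^sub>R (y - b)) ` K" for x
  proof (rule K(2), rule)
    assume "c *\<^sub>R x + b \<in> K"
    moreover have "x = (1 / c) *\<^sub>R ((c *\<^sub>R x + b) - b)" using assms(2) by simp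
    ultimately show False using that by blast
  qed
  ultimately show ?thesis unfolding Cc_infty_iff using smooth_affine[OF K(3)] by blast
qed

lemma test_continuous: "test f \<Longrightarrow> continuous_on A f"
  by (auto simp: Cc_infty_iff smooth_continuous)

lemma test_bounded: 
  assumes "test f" obtains B where "0 < B" "\<And>x. \<bar>f x\<bar> \<le> B"
proof -
  obtain K where K: "compact K" "\<And>x. x \<notin> K \<Longrightarrow> f x = 0" using assms unfolding Cc_infty_iff by auto
  have "bounded (f ` K)" using compact_continuous_image[OF test_continuous[OF assms] K(1)] compact_imp_bounded by auto
  then obtain B where B: "B > 0" "\<forall>y\<in>f ` K. norm y \<le> B" using bounded_pos by blast
  have "\<bar>f x\<bar> \<le> B" for x using B K(2)[of x] by (cases "x \<in> K") auto
  then show ?thesis using B that by auto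
qed

section \<open>Translations of integrable functions\<close>

lemma lebesgue_affine_density:
  fixes t :: "'a::euclidean_space"
  assumes "c \<noteq> 0"
  shows "lebesgue = density (distr lebesgue lebesgue (\<lambda>x. t + c *\<^sub>R x)) (\<lambda>_. ennreal (\<bar>c\<bar> ^ DIM('a)))"
    and "(\<lambda>x. t + c *\<^sub>R x) \<in> lebesgue \<rightarrow>\<^sub>M lebesgue"
proof -
  have *: "(\<Sum>j\<in>Basis. (c * (x \<bullet> j)) *\<^sub>R j) = c *\<^sub>R x" for x :: 'a
    unfolding scaleR_scaleR[symmetric] scaleR_sum_right[symmetric] euclidean_representation ..
  show "lebesgue = density (distr lebesgue lebesgue (\<lambda>x. t + c *\<^sub>R x)) (\<lambda>_. ennreal (\<bar>c\<bar> ^ DIM('a)))"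
    using lebesgue_affine_euclidean[of "\<lambda>_. c" t] assms unfolding * by (simp add: prod_constant)
  show "(\<lambda>x. t + c *\<^sub>R x) \<in> lebesgue \<rightarrow>\<^sub>M lebesgue"
    using lebesgue_affine_measurable[of "\<lambda>_. c" t] assms unfolding * by simp
qed

lemma
  fixes f :: "'a::euclidean_space \<Rightarrow> 'b::{banach, second_countable_topology}"
  assumes "c \<noteq> 0" "integrable lebesgue f"
  shows integrable_lebesgue_affine: "integrable lebesgue (\<lambda>x. f (t + c *\<^sub>R x))"
    and integral_lebesgue_affine: "(\<integral>x. f x \<partial>lebesgue) = \<bar>c\<bar> ^ DIM('a) *\<^sub>R (\<integral>x. f (t + c *\<^sub>R x) \<partial>lebesgue)"
proof -
  note d = lebesgue_affine_density[OF assms(1), of t]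
  have f[measurable]: "f \<in> borel_measurable lebesgue" using assms(2) by auto
  have [measurable]: "f \<in> borel_measurable (distr lebesgue lebesgue (\<lambda>x. t + c *\<^sub>R x))" by simp
  have "integrable (density (distr lebesgue lebesgue (\<lambda>x. t + c *\<^sub>R x)) (\<lambda>_. ennreal (\<bar>c\<bar> ^ DIM('a)))) f"
    using assms(2) d(1) by simp
  then have "integrable lebesgue (\<lambda>x. \<bar>c\<bar> ^ DIM('a) *\<^sub>R f (t + c *\<^sub>R x))"
    using d(2) assms(1) by (subst (asm) integrable_density) (auto simp: integrable_distr_eq)
  from integrable_scaleR_right[of "1 / \<bar>c\<bar> ^ DIM('a)", OF this] show "integrable lebesgue (\<lambda>x. f (t + c *\<^sub>R x))"
    using assms(1) by simp
  have "(\<integral>x. f x \<partial>lebesgue) = (\<integral>x. f x \<partial>density (distr lebesgue lebesgue (\<lambda>x. t + c *\<^sub>R x)) (\<lambda>_. ennreal (\<bar>c\<bar> ^ DIM('a))))"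
    using d(1) by simp
  also have "\<dots> = \<bar>c\<bar> ^ DIM('a) *\<^sub>R (\<integral>x. f (t + c *\<^sub>R x) \<partial>lebesgue)"
    using d(2) by (subst integral_density) (auto simp: integral_distr)
  finally show "(\<integral>x. f x \<partial>lebesgue) = \<bar>c\<bar> ^ DIM('a) *\<^sub>R (\<integral>x. f (t + c *\<^sub>R x) \<partial>lebesgue)" .
qed

lemma
  fixes f :: "'a::euclidean_space \<Rightarrow> 'b::{banach, second_countable_topology}"
  assumes "integrable lebesgue f"
  shows integrable_lebesgue_diff: "integrable lebesgue (\<lambda>x. f (x - z))"
    and integral_lebesgue_diff: "(\<integral>x. f (x - z) \<partial>lebesgue) = (\<integral>x. f x \<partial>lebesgue)"
  using integrable_lebesgue_affine[OF _ assms, of 1 "-z"] integral_lebesgue_affine[OF _ assms, of 1 "-z"]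
  by (simp_all add: algebra_simps)

lemma
  fixes f :: "'a::euclidean_space \<Rightarrow> 'b::{banach, second_countable_topology}"
  assumes "integrable lebesgue f"
  shows integrable_lebesgue_reflect: "integrable lebesgue (\<lambda>y. f (x - y))"
    and integral_lebesgue_reflect: "(\<integral>y. f (x - y) \<partial>lebesgue) = (\<integral>y. f y \<partial>lebesgue)"
  using integrable_lebesgue_affine[OF _ assms, of "-1" x] integral_lebesgue_affine[OF _ assms, of "-1" x]
  by (simp_all add: algebra_simps)

lemma lmeasurable_compact_open_approx:
  fixes A :: "'a::euclidean_space set"
  assumes "A \<in> sets lebesgue" "emeasure lebesgue A < \<infinity>" "0 < e"
  obtains K U where "compact K" "open U" "K \<subseteq> A" "A \<subseteq> U" "U - K \<in> lmeasurable" "measure lebesgue (U - K) < e"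
proof -
  obtain U where U: "open U" "A \<subseteq> U" "U - A \<in> lmeasurable" "emeasure lebesgue (U - A) < ennreal (e / 3)"
    using sets_lebesgue_outer_open[OF assms(1), of "e / 3"] assms(3) by auto
  obtain T where T: "closed T" "T \<subseteq> A" "A - T \<in> lmeasurable" "emeasure lebesgue (A - T) < ennreal (e / 3)"
    using sets_lebesgue_inner_closed[OF assms(1), of "e / 3"] assms(3) by auto
  have A: "A \<in> lmeasurable" using assms by (simp add: fmeasurable_def)
  have T': "T \<in> lmeasurable" 
    by (rule fmeasurableI2[OF A T(2)]) (simp add: T(1) borel_closed sets_completionI_sets)
  have "(\<lambda>n. measure lebesgue (T - cball 0 (real n))) \<longlonglongrightarrow> measure lebesgue (\<Inter>n. T - cball 0 (real n))"
  proof (rule Lim_measure_decseq)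
    have "T - cball 0 (real n) \<in> lmeasurable" for n using T' by (intro fmeasurable.Diff) auto
    then show "range (\<lambda>n. T - cball 0 (real n)) \<subseteq> sets lebesgue"
      and "emeasure lebesgue (T - cball 0 (real n)) \<noteq> \<infinity>" for n
      by (auto dest: fmeasurableD simp only: fmeasurableD2 infinity_ennreal_def)
  qed (auto simp: decseq_def)
  moreover have "(\<Inter>n. T - cball 0 (real n)) = {}"
    using real_arch_simple by (auto simp: ) blast
  ultimately have "(\<lambda>n. measure lebesgue (T - cball 0 (real n))) \<longlonglongrightarrow> 0"
    by (simp only: measure_empty)
  then have "eventually (\<lambda>n. measure lebesgue (T - cball 0 (real n)) < e / 3) sequentially"
    using assms(3) by (intro order_tendstoD) auto
  then obtain n where n: "measure lebesgue (T - cball 0 (real n)) < e / 3"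
    by (auto simp: eventually_sequentially)
  have "U - (T \<inter> cball 0 (real n)) = (U - A) \<union> (A - T) \<union> (T - cball 0 (real n))"
    using U T by auto
  moreover have "measure lebesgue (U - A) < e / 3" "measure lebesgue (A - T) < e / 3"
    using U T assms(3) by (auto simp: emeasure_eq_measure2 ennreal_less_iff)
  moreover have D: "T - cball 0 (real n) \<in> lmeasurable"
    using T' by (intro fmeasurable.Diff) auto
  moreover have "measure lebesgue ((U - A) \<union> (A - T) \<union> (T - cball 0 (real n))) \<le>
     measure lebesgue (U - A) + measure lebesgue (A - T) + measure lebesgue (T - cball 0 (real n))"
    using U T D measure_Un_le[of "U - A" lebesgue "A - T"]
      measure_Un_le[of "(U - A) \<union> (A - T)" lebesgue "T - cball 0 (real n)"] by (auto simp: fmeasurableD)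
  ultimately have "measure lebesgue (U - (T \<inter> cball 0 (real n))) < e" using n by auto
  moreover have "compact (T \<inter> cball 0 (real n))" using T by (simp add: closed_Int_compact)
  moreover have "U - (T \<inter> cball 0 (real n)) \<in> lmeasurable"
    unfolding \<open>U - (T \<inter> cball 0 (real n)) = _\<close> using U T D by (intro fmeasurable.Un) auto
  ultimately show ?thesis using that U T by blast
qed

definition translation_continuous :: "('a::euclidean_space \<Rightarrow> 'b::{banach, second_countable_topology}) \<Rightarrow> bool" where
  "translation_continuous w \<longleftrightarrow>
     (\<forall>e>0. \<exists>d>0. \<forall>z. norm z < d \<longrightarrow> (\<integral>x. norm (w (x - z) - w x) \<partial>lebesgue) < e)"

lemma translation_continuousD:
  assumes "translation_continuous w" "0 < e"
  obtains d where "0 < d" "\<And>z. norm z < d \<Longrightarrow> (\<integral>x. norm (w (x - z) - w x) \<partial>lebesgue) < e"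
  using assms unfolding translation_continuous_def by blast

text \<open>
  For the indicator of \<open>A\<close> choose \<open>K \<subseteq> A \<subseteq> U\<close> with \<open>K\<close> compact, \<open>U\<close> open and \<open>U - K\<close> of small
  measure: a translation by less than the distance of \<open>K\<close> to the complement of \<open>U\<close> changes the
  indicator only on \<open>U - K\<close> and its translate. Linearity and density in \<open>L\<^sup>1\<close> do the rest.
\<close>

lemma translation_continuous_L1:
  fixes w :: "'a::euclidean_space \<Rightarrow> 'b::{banach, second_countable_topology}"
  assumes "integrable lebesgue w"
  shows "translation_continuous w"
  using assms
proof (induction)
  case (base A c)
  show ?case unfolding translation_continuous_def
  proof (intro allI impI)
    fix e :: real assume e: "0 < e"
    obtain K U where KU: "compact K" "open U" "K \<subseteq> A" "A \<subseteq> U" "U - K \<in> lmeasurable"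
      "measure lebesgue (U - K) < e / (2 * (norm c + 1))"
      using lmeasurable_compact_open_approx[OF base, of "e / (2 * (norm c + 1))"] e
      by (auto simp: add_nonneg_pos)
    obtain d where d: "d > 0" "\<forall>x\<in>K. \<forall>y\<in>-U. d \<le> dist x y"
      using separate_compact_closed[of K "-U"] KU by (auto simp: closed_Compl)
    let ?I = "indicator (U - K) :: 'a \<Rightarrow> real"
    have I: "integrable lebesgue ?I" 
      using KU(5) by (intro integrable_real_indicator) (auto simp: fmeasurable_def)
    have "(\<integral>x. norm (indicator A (x - z) *\<^sub>R c - indicator A x *\<^sub>R c) \<partial>lebesgue) < e" if z: "norm z < d" for z
    proof -
      have KUz: "x - z \<in> U" "x + z \<in> U" if "x \<in> K" for x
        using d(2)[rule_format, OF that, of "x - z"] d(2)[rule_format, OF that, of "x + z"] z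
        by (auto simp: dist_norm)
      have "(\<integral>x. norm (indicator A (x - z) *\<^sub>R c - indicator A x *\<^sub>R c) \<partial>lebesgue)
         \<le> (\<integral>x. norm c * (?I x + ?I (x - z)) \<partial>lebesgue)"
      proof (rule integral_mono')
        show "integrable lebesgue (\<lambda>x. norm c * (?I x + ?I (x - z)))"
          by (intro integrable_mult_right Bochner_Integration.integrable_add I integrable_lebesgue_diff)
        fix x
        have "x - z \<in> K \<Longrightarrow> x \<in> U" using KUz(2)[of "x - z"] by simp
        then have "(x \<in> A) \<noteq> (x - z \<in> A) \<Longrightarrow> x \<in> U - K \<or> x - z \<in> U - K"
          using KU(3,4) KUz(1)[of x] by blast
        moreover have "0 \<le> ?I x" "0 \<le> ?I (x - z)" by simp_all
        ultimately have "(x \<in> A) \<noteq> (x - z \<in> A) \<Longrightarrow> 1 \<le> ?I x + ?I (x - z)"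
          by (smt (verit, best) indicator_simps(1))
        from mult_left_mono[OF this, of "norm c"]
        show "norm (indicator A (x - z) *\<^sub>R c - indicator A x *\<^sub>R c) \<le> norm c * (?I x + ?I (x - z))"
          by (cases "x \<in> A"; cases "x - z \<in> A") simp_all
      qed auto
      also have "\<dots> = norm c * (2 * measure lebesgue (U - K))"
        using I integrable_lebesgue_diff[OF I, of z] integral_lebesgue_diff[OF I, of z] by simp
      also have "\<dots> \<le> norm c * (2 * (e / (2 * (norm c + 1))))"
        using KU(6) by (intro mult_left_mono) auto
      also have "\<dots> < e" 
      proof -
        have "norm c / (norm c + 1) < 1" by (simp add: add_nonneg_pos)
        from mult_strict_right_mono[OF this e] have "norm c / (norm c + 1) * e < e" by simp
        moreover have "a * (2 * (e / (2 * b))) = a / b * e" for a b :: real by simp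
        ultimately show ?thesis by (simp only:)
      qed
      finally show ?thesis .
    qed
    then show "\<exists>d>0. \<forall>z. norm z < d \<longrightarrow> (\<integral>x. norm (indicator A (x - z) *\<^sub>R c - indicator A x *\<^sub>R c) \<partial>lebesgue) < e"
      using d(1) by blast
  qed
next
  case (add f g)
  show ?case unfolding translation_continuous_def
  proof (intro allI impI)
    fix e :: real assume e: "0 < e"
    obtain d1 where d1: "d1 > 0" "\<And>z. norm z < d1 \<Longrightarrow> (\<integral>x. norm (f (x - z) - f x) \<partial>lebesgue) < e / 2"
      using translation_continuousD[OF add.IH(1), of "e / 2"] e by auto
    obtain d2 where d2: "d2 > 0" "\<And>z. norm z < d2 \<Longrightarrow> (\<integral>x. norm (g (x - z) - g x) \<partial>lebesgue) < e / 2"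
      using translation_continuousD[OF add.IH(2), of "e / 2"] e by auto
    have "(\<integral>x. norm ((f (x - z) + g (x - z)) - (f x + g x)) \<partial>lebesgue) < e" if "norm z < min d1 d2" for z
    proof -
      have i: "integrable lebesgue (\<lambda>x. norm (f (x - z) - f x))" "integrable lebesgue (\<lambda>x. norm (g (x - z) - g x))"
        using add by (auto intro!: integrable_norm Bochner_Integration.integrable_diff integrable_lebesgue_diff)
      have "(\<integral>x. norm ((f (x - z) + g (x - z)) - (f x + g x)) \<partial>lebesgue)
         \<le> (\<integral>x. norm (f (x - z) - f x) + norm (g (x - z) - g x) \<partial>lebesgue)"
        using i by (intro integral_mono') (auto simp: add_diff_add norm_triangle_ineq)
      also have "\<dots> = (\<integral>x. norm (f (x - z) - f x) \<partial>lebesgue) + (\<integral>x. norm (g (x - z) - g x) \<partial>lebesgue)"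
        using i by simp
      finally show ?thesis using d1(2)[of z] d2(2)[of z] that by simp
    qed
    then show "\<exists>d>0. \<forall>z. norm z < d \<longrightarrow> (\<integral>x. norm ((f (x - z) + g (x - z)) - (f x + g x)) \<partial>lebesgue) < e"
      using d1(1) d2(1) by (intro exI[of _ "min d1 d2"]) auto
  qed
next
  case (lim f s)
  show ?case unfolding translation_continuous_def
  proof (intro allI impI)
    fix e :: real assume e: "0 < e"
    have "(\<lambda>i. \<integral>x. norm (s i x - f x) \<partial>lebesgue) \<longlonglongrightarrow> integral\<^sup>L lebesgue (\<lambda>x::'a. 0)"
    proof (rule integral_dominated_convergence[where w="\<lambda>x. 3 * norm (f x)"])
      show "AE x in lebesgue. (\<lambda>i. norm (s i x - f x)) \<longlonglongrightarrow> 0"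
        using lim.hyps(2) by (auto intro!: AE_I2 tendsto_norm_zero simp: LIM_zero_iff)
      show "AE x in lebesgue. norm (norm (s i x - f x)) \<le> 3 * norm (f x)" for i
        using lim.hyps(3)[of _ i] norm_triangle_ineq4[of "s i _" "f _"] by (intro AE_I2) (smt (verit) norm_ge_zero real_norm_def UNIV_I space_completion space_lborel)
    qed (use lim in auto)
    then have "eventually (\<lambda>i. (\<integral>x. norm (s i x - f x) \<partial>lebesgue) < e / 3) sequentially"
      using e by (intro order_tendstoD) auto
    then obtain i where i: "(\<integral>x. norm (s i x - f x) \<partial>lebesgue) < e / 3" by (auto simp: eventually_sequentially)
    obtain d where d: "d > 0" "\<And>z. norm z < d \<Longrightarrow> (\<integral>x. norm (s i (x - z) - s i x) \<partial>lebesgue) < e / 3"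
      using translation_continuousD[OF lim.IH(1)[of i], of "e / 3"] e by auto
    have "(\<integral>x. norm (f (x - z) - f x) \<partial>lebesgue) < e" if "norm z < d" for z
    proof -
      have n: "integrable lebesgue (\<lambda>x. norm (s i x - f x))"
        using lim by auto
      note n' = integrable_lebesgue_diff[OF n, of z]
      have m: "integrable lebesgue (\<lambda>x. norm (s i (x - z) - s i x))"
        using lim by (auto intro!: integrable_norm Bochner_Integration.integrable_diff integrable_lebesgue_diff)
      have "(\<integral>x. norm (f (x - z) - f x) \<partial>lebesgue)
         \<le> (\<integral>x. norm (s i (x - z) - f (x - z)) + norm (s i (x - z) - s i x) + norm (s i x - f x) \<partial>lebesgue)"
      proof (rule integral_mono')
        fix x
        have "f (x - z) - f x = - (s i (x - z) - f (x - z)) + (s i (x - z) - s i x) + (s i x - f x)" by simp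
        also have "norm \<dots> \<le> norm (- (s i (x - z) - f (x - z))) + norm (s i (x - z) - s i x) + norm (s i x - f x)"
          by (intro norm_triangle_le add_mono norm_triangle_ineq order_refl)
        finally show "norm (f (x - z) - f x) \<le> norm (s i (x - z) - f (x - z)) + norm (s i (x - z) - s i x) + norm (s i x - f x)"
          by (simp only: norm_minus_cancel)
      qed (use n n' m in auto)
      also have "\<dots> = (\<integral>x. norm (s i (x - z) - f (x - z)) \<partial>lebesgue) + (\<integral>x. norm (s i (x - z) - s i x) \<partial>lebesgue) + (\<integral>x. norm (s i x - f x) \<partial>lebesgue)"
        using n n' m by simp
      also have "(\<integral>x. norm (s i (x - z) - f (x - z)) \<partial>lebesgue) = (\<integral>x. norm (s i x - f x) \<partial>lebesgue)"
        by (rule integral_lebesgue_diff[OF n])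
      finally show ?thesis using i d(2)[OF that] by simp
    qed
    then show "\<exists>d>0. \<forall>z. norm z < d \<longrightarrow> (\<integral>x. norm (f (x - z) - f x) \<partial>lebesgue) < e"
      using d(1) by blast
  qed
qed

section \<open>Convolution with a test function\<close>

lemma test_integrable: "test f \<Longrightarrow> integrable lebesgue f"
proof -
  assume f: "test f"
  then obtain K where K: "compact K" "\<And>x. x \<notin> K \<Longrightarrow> f x = 0" unfolding Cc_infty_iff by auto
  have "integrable lborel (\<lambda>x. indicator K x *\<^sub>R f x)"
    by (rule borel_integrable_compact[OF K(1) test_continuous[OF f]])
  moreover have "(\<lambda>x. indicator K x *\<^sub>R f x) = f"
  proof
    show "indicator K x *\<^sub>R f x = f x" for x using K(2)[of x] by (cases "x \<in> K") auto
  qed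
  ultimately have "integrable lborel f" by simp
  then show ?thesis using integrable_completion[of f lborel] borel_measurable_integrable by blast
qed

lemma test_borel_measurable: "test f \<Longrightarrow> f \<in> borel_measurable borel"
  by (intro borel_measurable_continuous_onI test_continuous)

definition conv :: "('a::euclidean_space \<Rightarrow> real) \<Rightarrow> ('a \<Rightarrow> 'b::{banach, second_countable_topology}) \<Rightarrow> 'a \<Rightarrow> 'b" where
  "conv k w x = (\<integral>y. k (x - y) *\<^sub>R w y \<partial>lebesgue)"

lemma conv_integrable:
  fixes w :: "real ^ 'n \<Rightarrow> 'b::{banach, second_countable_topology}"
  assumes "test k" "integrable lebesgue w"
  shows "integrable lebesgue (\<lambda>y. k (x - y) *\<^sub>R w y)"
proof -
  obtain B where B: "0 < B" "\<And>x. \<bar>k x\<bar> \<le> B" using test_bounded[OF assms(1)] by blast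
  have [measurable]: "(\<lambda>y. k (x - y)) \<in> borel_measurable borel"
    using test_borel_measurable[OF assms(1)] by measurable
  show ?thesis
  proof (rule Bochner_Integration.integrable_bound[of _ "\<lambda>y. B * norm (w y)"])
    show "(\<lambda>y. k (x - y) *\<^sub>R w y) \<in> borel_measurable lebesgue"
      by (intro borel_measurable_scaleR borel_measurable_integrable[OF assms(2)] measurable_completion) simp
  qed (use assms B in \<open>auto intro!: mult_right_mono AE_I2\<close>)
qed

lemma ex_borel_representative:
  fixes w :: "'a::euclidean_space \<Rightarrow> real"
  assumes "w \<in> borel_measurable lebesgue"
  obtains w' where "w' \<in> borel_measurable borel" "AE x in lebesgue. w x = w' x"
proof -
  obtain w' where w': "w' \<in> borel_measurable lborel" "AE x in lborel. w x = w' x"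
    using completion_ex_borel_measurable_real[OF assms] by blast
  show ?thesis using that[of w'] w' AE_completion by auto
qed

text \<open>
  By Tonelli's theorem the \<open>L\<^sup>1\<close> distance of \<open>conv k w\<close> to \<open>w\<close> is at most the \<open>k\<close>-average of the \<open>L\<^sup>1\<close>
  distances of the translates of \<open>w\<close> to \<open>w\<close>. Joint measurability of \<open>(x, z) \<mapsto> w (x - z)\<close> is at hand for
  Borel functions, hence the passage to a Borel representative.
\<close>

lemma conv_diff_L1_le:
  fixes w :: "real ^ 'n \<Rightarrow> real"
  assumes k: "test k" "\<And>z. 0 \<le> k z" "(\<integral>z. k z \<partial>lebesgue) = 1"
    and w: "integrable lebesgue w"
    and e: "\<And>z. k z \<noteq> 0 \<Longrightarrow> (\<integral>x. \<bar>w (x - z) - w x\<bar> \<partial>lebesgue) \<le> e" "0 \<le> e"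
  shows "(\<integral>\<^sup>+x. ennreal \<bar>conv k w x - w x\<bar> \<partial>lebesgue) \<le> ennreal e"
proof -
  obtain u where u[measurable]: "u \<in> borel_measurable borel" and wu: "AE x in lebesgue. w x = u x"
    using ex_borel_representative[of w] w by auto
  have iu: "integrable lebesgue u" 
    by (rule integrable_cong_AE_imp[OF w _ wu], rule measurable_completion) simp
  have [measurable]: "k \<in> borel_measurable borel" by (rule test_borel_measurable[OF k(1)])
  have c: "conv k w x = conv k u x" for x
    unfolding conv_def
    by (rule integral_cong_AE) (use conv_integrable[OF k(1) w] conv_integrable[OF k(1) iu] wu in auto)
  have shift: "(\<integral>x. \<bar>w (x - z) - w x\<bar> \<partial>lebesgue) = (\<integral>x. \<bar>u (x - z) - u x\<bar> \<partial>lebesgue)" for z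
  proof (rule integral_cong_AE)
    show "AE x in lebesgue. \<bar>w (x - z) - w x\<bar> = \<bar>u (x - z) - u x\<bar>"
    proof -
      have "integrable lebesgue (\<lambda>x. \<bar>w x - u x\<bar>)" using w iu by auto
      from integral_lebesgue_diff[OF this, of z] integrable_lebesgue_diff[OF this, of z]
      have "integrable lebesgue (\<lambda>x. \<bar>w (x - z) - u (x - z)\<bar>)"
         "(\<integral>x. \<bar>w (x - z) - u (x - z)\<bar> \<partial>lebesgue) = (\<integral>x. \<bar>w x - u x\<bar> \<partial>lebesgue)" by auto
      moreover have "(\<integral>x. \<bar>w x - u x\<bar> \<partial>lebesgue) = 0"
        using wu by (intro integral_eq_zero_AE) auto
      ultimately have "AE x in lebesgue. \<bar>w (x - z) - u (x - z)\<bar> = 0"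
        using integral_nonneg_eq_0_iff_AE[of lebesgue "\<lambda>x. \<bar>w (x - z) - u (x - z)\<bar>"] by auto
      then show ?thesis using wu by eventually_elim auto
    qed
  qed (use integrable_lebesgue_diff[OF w, of z] integrable_lebesgue_diff[OF iu, of z] w iu in auto)
  have ik: "integrable lebesgue k" by (rule test_integrable[OF k(1)])
  have ik': "(\<integral>\<^sup>+z. ennreal (k z) \<partial>lborel) = 1"
    using ik k by (subst nn_integral_completion[symmetric]) (simp add: nn_integral_eq_integral)
  have le: "ennreal \<bar>conv k u x - u x\<bar> \<le> (\<integral>\<^sup>+z. ennreal (k z * \<bar>u (x - z) - u x\<bar>) \<partial>lborel)" for x
  proof -
    have i: "integrable lebesgue (\<lambda>z. k z * u (x - z))"
      using integrable_lebesgue_reflect[OF conv_integrable[OF k(1) iu], of x x] by simp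
    have "conv k u x - u x = (\<integral>z. k z * u (x - z) \<partial>lebesgue) - u x"
      using integral_lebesgue_reflect[OF conv_integrable[OF k(1) iu], of x x] by (simp add: conv_def)
    also have "\<dots> = (\<integral>z. k z * (u (x - z) - u x) \<partial>lebesgue)"
      using i ik k(3) by (simp add: algebra_simps)
    finally have "ennreal \<bar>conv k u x - u x\<bar> \<le> (\<integral>\<^sup>+z. ennreal (norm (k z * (u (x - z) - u x))) \<partial>lebesgue)"
      using integral_norm_bound_ennreal[of lebesgue "\<lambda>z. k z * (u (x - z) - u x)"] i ik
      by (simp add: right_diff_distrib)
    then show ?thesis using k(2) by (simp add: nn_integral_completion abs_mult)
  qed
  have "AE x in lebesgue. conv k w x - w x = conv k u x - u x" using wu by eventually_elim (simp add: c)
  then have "(\<integral>\<^sup>+x. ennreal \<bar>conv k w x - w x\<bar> \<partial>lebesgue) = (\<integral>\<^sup>+x. ennreal \<bar>conv k u x - u x\<bar> \<partial>lebesgue)"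
    by (intro nn_integral_cong_AE) auto
  also have "\<dots> \<le> (\<integral>\<^sup>+x. (\<integral>\<^sup>+z. ennreal (k z * \<bar>u (x - z) - u x\<bar>) \<partial>lborel) \<partial>lborel)"
    unfolding nn_integral_completion by (intro nn_integral_mono le)
  also have "\<dots> = (\<integral>\<^sup>+z. (\<integral>\<^sup>+x. ennreal (k z * \<bar>u (x - z) - u x\<bar>) \<partial>lborel) \<partial>lborel)"
    by (rule lborel_pair.Fubini') measurable
  also have "\<dots> \<le> (\<integral>\<^sup>+z. ennreal (k z) * ennreal e \<partial>lborel)"
  proof (rule nn_integral_mono)
    fix z
    have "(\<integral>\<^sup>+x. ennreal (k z * \<bar>u (x - z) - u x\<bar>) \<partial>lborel) = ennreal (k z) * (\<integral>\<^sup>+x. ennreal \<bar>u (x - z) - u x\<bar> \<partial>lebesgue)"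
      using k(2) by (simp add: ennreal_mult nn_integral_cmult nn_integral_completion)
    also have "(\<integral>\<^sup>+x. ennreal \<bar>u (x - z) - u x\<bar> \<partial>lebesgue) = ennreal (\<integral>x. \<bar>w (x - z) - w x\<bar> \<partial>lebesgue)"
      unfolding shift using iu integrable_lebesgue_diff[OF iu, of z] by (subst nn_integral_eq_integral) auto
    also have "ennreal (k z) * \<dots> \<le> ennreal (k z) * ennreal e"
      using e by (cases "k z = 0") (auto intro!: mult_left_mono ennreal_leI)
    finally show "(\<integral>\<^sup>+x. ennreal (k z * \<bar>u (x - z) - u x\<bar>) \<partial>lborel) \<le> ennreal (k z) * ennreal e" .
  qed
  also have "\<dots> = ennreal e" using ik' by (simp add: nn_integral_multc)
  finally show ?thesis .
qed

lemma has_derivative_partial_deriv: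
  fixes f :: "real ^ 'n \<Rightarrow> real"
  assumes "f differentiable (at x)"
  shows "(f has_derivative (\<lambda>h. \<Sum>i\<in>UNIV. h $ i * partial_deriv i f x)) (at x)"
proof -
  have l: "linear (frechet_derivative f (at x))" using assms by (rule linear_frechet_derivative)
  have "frechet_derivative f (at x) h = (\<Sum>i\<in>UNIV. h $ i * partial_deriv i f x)" for h
  proof -
    have "h = (\<Sum>i\<in>UNIV. h $ i *\<^sub>R axis i 1)"
      using basis_expansion[of h] by (simp add: scalar_mult_eq_scaleR)
    then have "frechet_derivative f (at x) h = (\<Sum>i\<in>UNIV. frechet_derivative f (at x) (h $ i *\<^sub>R axis i 1))"
      using linear_sum[OF l, of "\<lambda>i. h $ i *\<^sub>R axis i 1" UNIV] by simp
    then show ?thesis by (simp add: linear_scale[OF l] partial_deriv_def)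
  qed
  then have "frechet_derivative f (at x) = (\<lambda>h. \<Sum>i\<in>UNIV. h $ i * partial_deriv i f x)" by (rule ext)
  then show ?thesis using assms[unfolded frechet_derivative_works] by simp
qed

lemma test_lipschitz:
  fixes f :: "real ^ 'n \<Rightarrow> real"
  assumes "test f"
  obtains L where "0 < L" "\<And>x y. \<bar>f x - f y\<bar> \<le> L * norm (x - y)"
proof -
  have "\<exists>B. 0 < B \<and> (\<forall>x. \<bar>partial_deriv i f x\<bar> \<le> B)" for i
    using test_bounded[OF Cc_infty_partial_deriv[OF assms, of i]] by metis
  then obtain B where B: "\<And>i. 0 < B i" "\<And>i x. \<bar>partial_deriv i f x\<bar> \<le> B i" by metis
  have s: "smooth f" using assms by (auto simp: Cc_infty_iff)
  have "norm (f x - f y) \<le> (\<Sum>i\<in>UNIV. B i) * norm (x - y)" for x y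
  proof (rule differentiable_bound[OF convex_UNIV])
    show "(f has_derivative (\<lambda>h. \<Sum>i\<in>UNIV. h $ i * partial_deriv i f x)) (at x within UNIV)" for x
      using has_derivative_partial_deriv[OF smooth_differentiable[OF s]] by simp
    show "onorm (\<lambda>h. \<Sum>i\<in>UNIV. h $ i * partial_deriv i f x) \<le> (\<Sum>i\<in>UNIV. B i)" for x
    proof (rule onorm_le)
      fix h :: "real ^ 'n"
      have "norm (\<Sum>i\<in>UNIV. h $ i * partial_deriv i f x) \<le> (\<Sum>i\<in>UNIV. norm h * B i)"
        using B(2) component_le_norm_cart[of h]
        by (intro sum_norm_le) (auto simp: abs_mult intro!: mult_mono)
      then show "norm (\<Sum>i\<in>UNIV. h $ i * partial_deriv i f x) \<le> (\<Sum>i\<in>UNIV. B i) * norm h"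
        by (simp add: sum_distrib_left mult.commute)
    qed
  qed auto
  moreover have "0 < (\<Sum>i\<in>UNIV. B i)" using B(1) by (intro sum_pos) auto
  ultimately show ?thesis using that by (metis real_norm_def)
qed

text \<open>
  The remainder is quadratic uniformly in \<open>x\<close>; this is what allows differentiation of a convolution
  under the integral sign for merely integrable \<open>w\<close>.
\<close>

lemma test_linearization:
  fixes f :: "real ^ 'n \<Rightarrow> real"
  assumes "test f"
  obtains C where "0 \<le> C" "\<And>x h. \<bar>f (x + h) - f x - (\<Sum>i\<in>UNIV. h $ i * partial_deriv i f x)\<bar> \<le> C * (norm h)\<^sup>2"
proof -
  have "\<exists>L. 0 < L \<and> (\<forall>x y. \<bar>partial_deriv i f x - partial_deriv i f y\<bar> \<le> L * norm (x - y))" for i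
    using test_lipschitz[OF Cc_infty_partial_deriv[OF assms, of i]] by metis
  then obtain L where L: "\<And>i. 0 < L i" "\<And>i x y. \<bar>partial_deriv i f x - partial_deriv i f y\<bar> \<le> L i * norm (x - y)" by metis
  have s: "smooth f" using assms by (auto simp: Cc_infty_iff)
  let ?D = "\<lambda>x h. \<Sum>i\<in>UNIV. h $ i * partial_deriv i f x"
  have "\<bar>f (x + h) - f x - ?D x h\<bar> \<le> (\<Sum>i\<in>UNIV. L i) * (norm h)\<^sup>2" for x h
  proof -
    have "norm (f (x + h) - f x - ?D x ((x + h) - x)) \<le> norm ((x + h) - x) * ((\<Sum>i\<in>UNIV. L i) * norm h)"
    proof (rule differentiable_bound_linearization[where S="cball x (norm h)"])
      show "x + t *\<^sub>R (x + h - x) \<in> cball x (norm h)" if "t \<in> {0..1}" for t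
        using that by (simp add: dist_norm mult_left_le_one_le)
      show "(f has_derivative ?D y) (at y within cball x (norm h))" for y
        using has_derivative_partial_deriv[OF smooth_differentiable[OF s]] has_derivative_at_withinI by blast
      show "onorm (?D y - ?D x) \<le> (\<Sum>i\<in>UNIV. L i) * norm h" if y: "y \<in> cball x (norm h)" for y
      proof (rule onorm_le)
        fix v :: "real ^ 'n"
        have "(?D y - ?D x) v = (\<Sum>i\<in>UNIV. v $ i * (partial_deriv i f y - partial_deriv i f x))"
          by (simp add: sum_subtractf right_diff_distrib)
        also have "norm \<dots> \<le> (\<Sum>i\<in>UNIV. norm v * (L i * norm h))"
        proof (rule sum_norm_le)
          fix i
          have "\<bar>partial_deriv i f y - partial_deriv i f x\<bar> \<le> L i * norm h"
            using L(1)[of i] y by (intro order_trans[OF L(2)] mult_left_mono) (auto simp: dist_norm norm_minus_commute)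
          then show "norm (v $ i * (partial_deriv i f y - partial_deriv i f x)) \<le> norm v * (L i * norm h)"
            using component_le_norm_cart[of v i] by (auto simp: abs_mult intro!: mult_mono)
        qed
        finally show "norm ((?D y - ?D x) v) \<le> (\<Sum>i\<in>UNIV. L i) * norm h * norm v"
          by (simp add: sum_distrib_left sum_distrib_right mult_ac)
      qed
    qed auto
    then show ?thesis by (simp add: power2_eq_square mult_ac)
  qed
  moreover have "0 \<le> (\<Sum>i\<in>UNIV. L i)" using L(1) by (intro sum_nonneg) (auto intro: less_imp_le)
  ultimately show ?thesis using that by blast
qed

lemma
  fixes w :: "real ^ 'n \<Rightarrow> real"
  assumes k: "test k" and w: "integrable lebesgue w"
  shows conv_differentiable: "conv k w differentiable (at x)"
    and partial_deriv_conv: "partial_deriv i (conv k w) x = conv (partial_deriv i k) w x"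
proof -
  obtain C where C: "0 \<le> C" "\<And>x h. \<bar>k (x + h) - k x - (\<Sum>i\<in>UNIV. h $ i * partial_deriv i k x)\<bar> \<le> C * (norm h)\<^sup>2"
    using test_linearization[OF k] by blast
  note i1 = conv_integrable[OF k w, unfolded real_scaleR_def]
  note i2 = conv_integrable[OF Cc_infty_partial_deriv[OF k] w, unfolded real_scaleR_def]
  let ?D = "\<lambda>h. \<Sum>i\<in>UNIV. h $ i * conv (partial_deriv i k) w x"
  have D: "(conv k w has_derivative ?D) (at x)"
  proof (rule has_derivativeI_sandwich[where e=1])
    show "bounded_linear ?D"
      by (intro bounded_linear_sum bounded_linear_compose[OF bounded_linear_mult_left] bounded_linear_vec_nth)
    let ?E = "\<lambda>h y. k (x - y + h) - k (x - y) - (\<Sum>i\<in>UNIV. h $ i * partial_deriv i k (x - y))"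
    show "((\<lambda>y. C * (\<integral>y. \<bar>w y\<bar> \<partial>lebesgue) * norm (y - x)) \<longlongrightarrow> 0) (at x)"
      by (auto intro!: tendsto_eq_intros)
    fix z assume "z \<noteq> x" "dist z x < 1"
    define h where "h = z - x"
    have E: "(\<lambda>y. ?E h y * w y) = (\<lambda>y. k (z - y) * w y - k (x - y) * w y - (\<Sum>i\<in>UNIV. h $ i * (partial_deriv i k (x - y) * w y)))"
      by (auto simp: h_def algebra_simps sum_distrib_left sum_distrib_right fun_eq_iff)
    have int: "integrable lebesgue (\<lambda>y. ?E h y * w y)"
      unfolding E
      by (intro Bochner_Integration.integrable_diff Bochner_Integration.integrable_sum integrable_mult_right i1 i2)
    have "conv k w z - conv k w x - ?D (z - x) = (\<integral>y. ?E h y * w y \<partial>lebesgue)"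
      unfolding E using i1[of z] i1[of x] i2[of _ x]
      by (simp add: conv_def h_def Bochner_Integration.integral_sum Bochner_Integration.integrable_sum)
    also have "norm (\<integral>y. ?E h y * w y \<partial>lebesgue) \<le> (\<integral>y. C * (norm h)\<^sup>2 * \<bar>w y\<bar> \<partial>lebesgue)"
      using C w by (intro order_trans[OF integral_norm_bound integral_mono']) (auto simp: abs_mult intro!: mult_right_mono)
    also have "\<dots> = C * (norm h)\<^sup>2 * (\<integral>y. \<bar>w y\<bar> \<partial>lebesgue)" by simp
    finally show "norm (conv k w z - conv k w x - ?D (z - x)) / norm (z - x) \<le> C * (\<integral>y. \<bar>w y\<bar> \<partial>lebesgue) * norm (z - x)"
      using \<open>z \<noteq> x\<close> by (simp add: h_def divide_le_eq power2_eq_square mult_ac)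
  qed auto
  then show "conv k w differentiable (at x)" by (auto simp: differentiable_def)
  show "partial_deriv i (conv k w) x = conv (partial_deriv i k) w x"
    using partial_deriv_eqI[OF D, of i] by (simp add: axis_def if_distrib if_distribR cong: if_cong)
qed

lemma smooth_conv:
  assumes "test k" "integrable lebesgue w"
  shows "smooth (conv k w)"
proof (rule smooth_coinduct[of _ "{conv k w | k. test k}"])
  show "conv k w \<in> {conv k w | k. test k}" using assms by blast
  show "f differentiable (at x)" if "f \<in> {conv k w | k. test k}" for f x
    using that conv_differentiable assms(2) by auto
  show "partial_deriv i f \<in> {conv k w | k. test k}" if "f \<in> {conv k w | k. test k}" for f i
    using that partial_deriv_conv[OF _ assms(2), of _ i] Cc_infty_partial_deriv[of _ UNIV i] by blast
qed

lemma conv_eq_0: "(\<And>y. w y \<noteq> 0 \<Longrightarrow> k (x - y) = 0) \<Longrightarrow> conv k w x = 0"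
proof -
  assume *: "\<And>y. w y \<noteq> 0 \<Longrightarrow> k (x - y) = 0"
  have "(\<lambda>y. k (x - y) *\<^sub>R w y) = (\<lambda>y. 0)" using * by (auto simp: fun_eq_iff)
  then show ?thesis unfolding conv_def by simp
qed

lemma conv_measurable:
  fixes w :: "real ^ 'n \<Rightarrow> real"
  shows "test k \<Longrightarrow> integrable lebesgue w \<Longrightarrow> conv k w \<in> borel_measurable lebesgue"
  by (intro measurable_completion) (simp add: borel_measurable_continuous_onI smooth_conv smooth_continuous)

section \<open>Mollifiers\<close>

definition mollifier :: "(real ^ 'n \<Rightarrow> real) \<Rightarrow> bool" where
  "mollifier \<rho> \<longleftrightarrow> test \<rho> \<and> (\<forall>z. 0 \<le> \<rho> z) \<and> (\<integral>z. \<rho> z \<partial>lebesgue) = 1 \<and> (\<forall>z. \<rho> z \<noteq> 0 \<longrightarrow> norm z \<le> 1)"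

definition rescale :: "(real ^ 'n \<Rightarrow> real) \<Rightarrow> real \<Rightarrow> real ^ 'n \<Rightarrow> real" where
  "rescale \<rho> \<delta> x = (1 / \<delta>) ^ CARD('n) * \<rho> ((1 / \<delta>) *\<^sub>R x)"

text \<open>
  The support can be placed in any ball of the unit ball; balls away from the origin are used to push
  functions into a domain.
\<close>

lemma mollifier_exists:
  fixes d :: "real ^ 'n"
  assumes "0 < s" "cball d s \<subseteq> cball 0 1"
  obtains \<rho> where "mollifier \<rho>" "\<And>z. \<rho> z \<noteq> 0 \<Longrightarrow> z \<in> cball d s"
proof -
  let ?b = "bump d s" and ?I = "\<integral>z. bump d s z \<partial>lebesgue"
  have t: "test ?b" using assms by (intro test_bump) auto
  have i: "integrable lebesgue ?b" by (rule test_integrable[OF t])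
  have "?I \<noteq> 0"
  proof
    assume "?I = 0"
    then have "AE x in lebesgue. ?b x = 0"
      using integral_nonneg_eq_0_iff_AE[OF i] bump_nonneg by auto
    moreover have "?b x \<noteq> 0" if "x \<in> ball d s" for x
      using bump_pos[of x d s] that by (auto simp: dist_norm norm_minus_commute)
    ultimately have "AE x in lebesgue. x \<notin> ball d s" by (auto elim: eventually_mono)
    then have "negligible (ball d s)" by (auto simp: negligible_iff_null_sets AE_iff_null_sets)
    then show False using assms(1) open_not_negligible[of "ball d s"] by (metis centre_in_ball empty_iff open_ball)
  qed
  moreover have "0 \<le> ?I" by (rule Bochner_Integration.integral_nonneg) (rule bump_nonneg)
  ultimately have I: "0 < ?I" by simp
  have z: "bump d s z \<noteq> 0 \<Longrightarrow> z \<in> cball d s" for z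
    using bump_eq_0[of s z d] assms(1) by (cases "s \<le> norm (z - d)") (auto simp: dist_norm norm_minus_commute)
  show ?thesis
  proof (rule that)
    have "test (\<lambda>x. (1 / ?I) * ?b x)" by (rule test_mult[OF smooth_const t])
    then show "mollifier (\<lambda>x. (1 / ?I) * ?b x)"
      unfolding mollifier_def using I z assms(2) bump_nonneg i
      by (auto simp: subset_iff intro!: divide_nonneg_nonneg)
    show "z \<in> cball d s" if "(1 / ?I) * ?b z \<noteq> 0" for z using z that by simp
  qed
qed

lemma test_rescale: "test \<rho> \<Longrightarrow> 0 < \<delta> \<Longrightarrow> test (rescale \<rho> \<delta>)"
  unfolding rescale_def[abs_def] using test_affine[of \<rho> "1 / \<delta>" 0] by (intro test_mult smooth_const) auto

lemma integral_rescale: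
  fixes \<rho> :: "real ^ 'n \<Rightarrow> real"
  assumes "integrable lebesgue \<rho>" "0 < \<delta>"
  shows "(\<integral>x. rescale \<rho> \<delta> x \<partial>lebesgue) = (\<integral>x. \<rho> x \<partial>lebesgue)"
  using integral_lebesgue_affine[OF _ assms(1), of "1 / \<delta>" 0] assms(2) by (simp add: rescale_def[abs_def])

lemma partial_deriv_rescale:
  assumes "test \<rho>" "0 < \<delta>"
  shows "partial_deriv i (rescale \<rho> \<delta>) x = (1 / \<delta>) * rescale (partial_deriv i \<rho>) \<delta> x"
proof -
  have s: "smooth \<rho>" using assms by (auto simp: Cc_infty_iff)
  have d: "\<rho> differentiable (at ((1 / \<delta>) *\<^sub>R x + 0))" using smooth_differentiable[OF s] .
  note a = partial_deriv_affine[OF d]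
  have "partial_deriv i (\<lambda>x. (1 / \<delta>) ^ CARD('a) * \<rho> ((1 / \<delta>) *\<^sub>R x + 0)) x =
     (1 / \<delta>) ^ CARD('a) * partial_deriv i (\<lambda>x. \<rho> ((1 / \<delta>) *\<^sub>R x + 0)) x + partial_deriv i (\<lambda>x. (1 / \<delta>) ^ CARD('a)) x * \<rho> ((1 / \<delta>) *\<^sub>R x + 0)"
    by (intro partial_deriv_mult a) auto
  moreover have "partial_deriv i (\<lambda>x. (1 / \<delta>) ^ CARD('a)) x = 0"
    by (rule partial_deriv_eqI) (rule has_derivative_const)
  ultimately show ?thesis using a(2)[of i] by (simp add: rescale_def[abs_def])
qed

lemma mollifier_rescale:
  assumes "mollifier \<rho>" "0 < \<delta>"
  shows "test (rescale \<rho> \<delta>)" "0 \<le> rescale \<rho> \<delta> z" "(\<integral>z. rescale \<rho> \<delta> z \<partial>lebesgue) = 1"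
    "rescale \<rho> \<delta> z \<noteq> 0 \<Longrightarrow> norm z \<le> \<delta>"
  using assms test_rescale integral_rescale[OF test_integrable, of \<rho> \<delta>] unfolding mollifier_def
  by (auto simp: rescale_def divide_le_eq)

lemma
  fixes w :: "real ^ 'n \<Rightarrow> real"
  assumes \<rho>: "mollifier \<rho>" and w: "integrable lebesgue w"
  shows integrable_conv_mollifier: "0 < \<delta> \<Longrightarrow> integrable lebesgue (conv (rescale \<rho> \<delta>) w)"
    and conv_tendsto_L1: "(\<And>m. 0 < d m) \<Longrightarrow> d \<longlonglongrightarrow> 0 \<Longrightarrow>
      (\<lambda>m. \<integral>x. \<bar>conv (rescale \<rho> (d m)) w x - w x\<bar> \<partial>lebesgue) \<longlonglongrightarrow> 0"
proof -
  have diff: "integrable lebesgue (\<lambda>x. conv (rescale \<rho> \<delta>) w x - w x)"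
    and le: "\<And>e. 0 \<le> e \<Longrightarrow> (\<And>z. norm z \<le> \<delta> \<Longrightarrow> (\<integral>x. \<bar>w (x - z) - w x\<bar> \<partial>lebesgue) \<le> e) \<Longrightarrow>
       (\<integral>x. \<bar>conv (rescale \<rho> \<delta>) w x - w x\<bar> \<partial>lebesgue) \<le> e" if "0 < \<delta>" for \<delta>
  proof -
    note m = mollifier_rescale[OF \<rho> that]
    have [measurable]: "conv (rescale \<rho> \<delta>) w \<in> borel_measurable lebesgue" "w \<in> borel_measurable lebesgue"
      using conv_measurable[OF m(1) w] w by auto
    note c = conv_diff_L1_le[OF m(1) m(2) m(3) w]
    have "(\<integral>x. \<bar>w (x - z) - w x\<bar> \<partial>lebesgue) \<le> (\<integral>x. \<bar>w (x - z)\<bar> + \<bar>w x\<bar> \<partial>lebesgue)" for z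
      using w integrable_lebesgue_diff[OF w, of z] by (intro integral_mono') auto
    also have "\<dots> z = 2 * (\<integral>x. \<bar>w x\<bar> \<partial>lebesgue)" for z
      using w integrable_lebesgue_diff[OF integrable_abs[OF w], of z] integral_lebesgue_diff[OF integrable_abs[OF w], of z]
      by simp
    finally have "(\<integral>\<^sup>+x. ennreal \<bar>conv (rescale \<rho> \<delta>) w x - w x\<bar> \<partial>lebesgue) \<le> ennreal (2 * (\<integral>x. \<bar>w x\<bar> \<partial>lebesgue))"
      by (intro c) auto
    then have fin: "(\<integral>\<^sup>+x. ennreal \<bar>conv (rescale \<rho> \<delta>) w x - w x\<bar> \<partial>lebesgue) < \<infinity>"
      by (rule le_less_trans) simp
    then show i: "integrable lebesgue (\<lambda>x. conv (rescale \<rho> \<delta>) w x - w x)"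
      by (intro integrableI_bounded) auto
    fix e :: real assume e: "0 \<le> e" "\<And>z. norm z \<le> \<delta> \<Longrightarrow> (\<integral>x. \<bar>w (x - z) - w x\<bar> \<partial>lebesgue) \<le> e"
    have "ennreal (\<integral>x. \<bar>conv (rescale \<rho> \<delta>) w x - w x\<bar> \<partial>lebesgue) \<le> ennreal e"
      using c[of e] e m(4) i by (subst nn_integral_eq_integral[symmetric]) auto
    then show "(\<integral>x. \<bar>conv (rescale \<rho> \<delta>) w x - w x\<bar> \<partial>lebesgue) \<le> e" using e(1) by (simp add: ennreal_le_iff)
  qed
  show "integrable lebesgue (conv (rescale \<rho> \<delta>) w)" if "0 < \<delta>"
    using Bochner_Integration.integrable_add[OF diff[OF that] w] by simp
  assume d: "\<And>m. 0 < d m" "d \<longlonglongrightarrow> 0"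
  show "(\<lambda>m. \<integral>x. \<bar>conv (rescale \<rho> (d m)) w x - w x\<bar> \<partial>lebesgue) \<longlonglongrightarrow> 0"
  proof (rule LIMSEQ_I)
    fix r :: real assume r: "0 < r"
    obtain t where t: "0 < t" "\<And>z. norm z < t \<Longrightarrow> (\<integral>x. norm (w (x - z) - w x) \<partial>lebesgue) < r / 2"
      using translation_continuousD[OF translation_continuous_L1[OF w], of "r / 2"] r by auto
    have "eventually (\<lambda>m. d m < t) sequentially" using d(2) t(1) by (intro order_tendstoD)
    then obtain N where N: "\<And>m. m \<ge> N \<Longrightarrow> d m < t" by (auto simp: eventually_sequentially)
    have "norm ((\<integral>x. \<bar>conv (rescale \<rho> (d m)) w x - w x\<bar> \<partial>lebesgue) - 0) < r" if "m \<ge> N" for m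
    proof -
      have "(\<integral>x. \<bar>conv (rescale \<rho> (d m)) w x - w x\<bar> \<partial>lebesgue) \<le> r / 2"
        using N[OF that] r t(2) by (intro le[OF d(1)]) (auto intro: less_imp_le)
      then show ?thesis using r by simp
    qed
    then show "\<exists>no. \<forall>n\<ge>no. norm ((\<integral>x. \<bar>conv (rescale \<rho> (d n)) w x - w x\<bar> \<partial>lebesgue) - 0) < r" by blast
  qed
qed

section \<open>Weak gradients on the whole space\<close>

text \<open>
  The difference quotients in the direction of an axis have integral zero by translation invariance,
  and they converge boundedly to the partial derivative. No second derivative enters, so the lemma applies
  to functions that are only once differentiable, such as compositions with \<open>C\<^sup>1\<close> functions.
\<close>

lemma integral_partial_deriv_eq_0:
  fixes p :: "real ^ 'n \<Rightarrow> real"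
  assumes diff: "\<And>x. p differentiable (at x)"
    and B: "\<And>x. \<bar>partial_deriv i p x\<bar> \<le> B"
    and meas: "partial_deriv i p \<in> borel_measurable lebesgue"
    and K: "compact K" "\<And>x. x \<notin> K \<Longrightarrow> p x = 0"
    and int: "integrable lebesgue p"
  shows "(\<integral>x. partial_deriv i p x \<partial>lebesgue) = 0"
proof -
  let ?e = "axis i 1 :: real ^ 'n"
  have der: "((\<lambda>s. p (x + s *\<^sub>R ?e)) has_real_derivative partial_deriv i p (x + s *\<^sub>R ?e)) (at s)" for x s
  proof -
    have 1: "((\<lambda>s. x + s *\<^sub>R ?e) has_derivative (\<lambda>h. h *\<^sub>R ?e)) (at s)"
      by (auto intro!: derivative_eq_intros)
    have 2: "((\<lambda>s. p (x + s *\<^sub>R ?e)) has_derivative (\<lambda>h. \<Sum>j\<in>UNIV. (h *\<^sub>R ?e) $ j * partial_deriv j p (x + s *\<^sub>R ?e))) (at s)"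
      by (rule has_derivative_compose[OF 1 has_derivative_partial_deriv[OF diff]])
    have "(\<Sum>j\<in>UNIV. (h *\<^sub>R ?e) $ j * partial_deriv j p (x + s *\<^sub>R ?e)) = partial_deriv i p (x + s *\<^sub>R ?e) * h" for h
      by (simp add: axis_def if_distrib if_distribR cong: if_cong)
    then show ?thesis using 2 unfolding has_field_derivative_def by (simp only:)
  qed
  define t where "t n = 1 / real (Suc n)" for n
  have t: "t n > 0" "t n \<le> 1" "t n \<noteq> 0" for n by (auto simp: t_def)
  have tlim: "filterlim t (at 0) sequentially"
    unfolding filterlim_at using t(3) LIMSEQ_inverse_real_of_nat
    by (auto simp: t_def[abs_def] inverse_eq_divide)
  define q where "q n x = (p (x + t n *\<^sub>R ?e) - p x) / t n" for n x
  \<comment> \<open>the difference quotients of step at most 1 vanish outside the unit neighbourhood of \<open>K\<close>\<close>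
  define K' where "K' = {x - y | x y. x \<in> K \<and> y \<in> cball (0::real^'n) 1}"
  have K': "compact K'" unfolding K'_def by (intro compact_differences K compact_cball)
  have sub: "x \<notin> K' \<Longrightarrow> p (x + t n *\<^sub>R ?e) = 0 \<and> p x = 0" for x n
  proof -
    assume x: "x \<notin> K'"
    have "x + t n *\<^sub>R ?e \<notin> K"
    proof
      assume "x + t n *\<^sub>R ?e \<in> K"
      moreover have "x = (x + t n *\<^sub>R ?e) - t n *\<^sub>R ?e" "t n *\<^sub>R ?e \<in> cball 0 1" using t[of n] by (auto simp: norm_axis_1)
      ultimately show False using x unfolding K'_def by blast
    qed
    moreover have "x \<notin> K"
    proof
      assume "x \<in> K"
      moreover have "x = x - 0" "(0::real^'n) \<in> cball 0 1" by auto
      ultimately show False using x unfolding K'_def by blast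
    qed
    ultimately show ?thesis using K(2) by simp
  qed
  have "(\<lambda>n. \<integral>x. q n x \<partial>lebesgue) \<longlonglongrightarrow> (\<integral>x. partial_deriv i p x \<partial>lebesgue)"
  proof (rule integral_dominated_convergence[where w="\<lambda>x. B * indicator K' x"])
    show "integrable lebesgue (\<lambda>x. B * indicator K' x)"
      using lmeasurable_compact[OF K'] by (intro integrable_mult_right integrable_real_indicator) (auto simp: fmeasurable_def)
    show "q n \<in> borel_measurable lebesgue" for n
      using integrable_lebesgue_affine[OF _ int, of 1 "t n *\<^sub>R ?e"] int
      by (auto simp: q_def[abs_def] add.commute intro!: borel_measurable_divide borel_measurable_diff)
    show "AE x in lebesgue. (\<lambda>n. q n x) \<longlonglongrightarrow> partial_deriv i p x"
    proof (rule AE_I2)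
      fix x
      have "((\<lambda>h. (p (x + (0 + h) *\<^sub>R ?e) - p (x + 0 *\<^sub>R ?e)) / h) \<longlongrightarrow> partial_deriv i p (x + 0 *\<^sub>R ?e)) (at 0)"
        using der[of x 0] unfolding DERIV_def .
      from filterlim_compose[OF this tlim] show "(\<lambda>n. q n x) \<longlonglongrightarrow> partial_deriv i p x"
        by (simp add: q_def)
    qed
    show "AE x in lebesgue. norm (q n x) \<le> B * indicator K' x" for n
    proof (rule AE_I2)
      fix x
      show "norm (q n x) \<le> B * indicator K' x"
      proof (cases "x \<in> K'")
        case False
        then show ?thesis using sub[OF False, of n] by (simp add: q_def)
      next
        case True
        have "norm (p (x + t n *\<^sub>R ?e) - p (x + 0 *\<^sub>R ?e)) \<le> B * norm (t n - 0)"
          by (rule field_differentiable_bound[OF convex_UNIV, of "\<lambda>s. p (x + s *\<^sub>R ?e)"])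
            (use der B in \<open>auto intro: has_field_derivative_at_within\<close>)
        then show ?thesis using True t[of n] by (simp add: q_def divide_le_eq)
      qed
    qed
  qed (rule meas)
  moreover have "(\<integral>x. q n x \<partial>lebesgue) = 0" for n
    using integrable_lebesgue_affine[OF _ int, of 1 "t n *\<^sub>R ?e"] integral_lebesgue_affine[OF _ int, of 1 "t n *\<^sub>R ?e"] int
    by (simp add: q_def add.commute)
  ultimately show ?thesis by (simp add: LIMSEQ_const_iff)
qed

lemma tendsto_integral_L1:
  fixes u :: "nat \<Rightarrow> 'a \<Rightarrow> real"
  assumes "\<And>n. integrable M (u n)" "integrable M f"
    and "\<And>n. (\<integral>x. \<bar>u n x - f x\<bar> \<partial>M) \<le> e n" "e \<longlonglongrightarrow> 0"
  shows "(\<lambda>n. \<integral>x. u n x \<partial>M) \<longlonglongrightarrow> (\<integral>x. f x \<partial>M)"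
proof -
  have "norm ((\<integral>x. u n x \<partial>M) - (\<integral>x. f x \<partial>M)) \<le> e n" for n
    using integral_norm_bound[of M "\<lambda>x. u n x - f x"] assms(1,2) assms(3)[of n] by auto
  then have "(\<lambda>n. (\<integral>x. u n x \<partial>M) - (\<integral>x. f x \<partial>M)) \<longlonglongrightarrow> 0"
    by (intro Lim_null_comparison[OF _ assms(4)]) auto
  then show ?thesis by (simp add: LIM_zero_iff)
qed

text \<open>
  Integrability over the whole space makes weak gradients stable under convolution; functions
  on a domain enter through their extension by zero.
\<close>

definition weak_grad :: "(real ^ 'n \<Rightarrow> real) \<Rightarrow> (real ^ 'n \<Rightarrow> real ^ 'n) \<Rightarrow> bool" where
  "weak_grad v g \<longleftrightarrow> integrable lebesgue v \<and> integrable lebesgue g \<and>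
     (\<forall>\<psi> i. test \<psi> \<longrightarrow> (\<integral>x. v x * partial_deriv i \<psi> x \<partial>lebesgue) = - (\<integral>x. g x $ i * \<psi> x \<partial>lebesgue))"

lemma integrable_component:
  fixes g :: "'a \<Rightarrow> real ^ 'n"
  shows "integrable M g \<Longrightarrow> integrable M (\<lambda>x. g x $ i)"
  by (rule integrable_bounded_linear[OF bounded_linear_vec_nth])

lemma integrable_componentI:
  fixes g :: "'a \<Rightarrow> real ^ 'n"
  assumes "\<And>i. integrable M (\<lambda>x. g x $ i)"
  shows "integrable M g"
proof -
  have "integrable M (\<lambda>x. \<Sum>i\<in>UNIV. g x $ i *\<^sub>R axis i (1::real))"
    using assms by (intro Bochner_Integration.integrable_sum integrable_scaleR_left) auto
  moreover have "(\<Sum>i\<in>UNIV. g x $ i *\<^sub>R axis i (1::real)) = g x" for x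
    using basis_expansion[of "g x"] by (simp add: scalar_mult_eq_scaleR)
  ultimately show ?thesis by simp
qed

lemma integrable_mult_bounded:
  fixes f b :: "'a \<Rightarrow> real"
  assumes "integrable M f" "b \<in> borel_measurable M" "\<And>x. \<bar>b x\<bar> \<le> B"
  shows "integrable M (\<lambda>x. b x * f x)"
proof (rule Bochner_Integration.integrable_bound[of _ "\<lambda>x. B * f x"])
  show "AE x in M. norm (b x * f x) \<le> norm (B * f x)"
    using assms(3) by (auto simp: abs_mult intro!: AE_I2 mult_right_mono order_trans[OF assms(3) abs_ge_self])
qed (use assms in auto)

lemma integrable_mult_test:
  assumes "integrable lebesgue f" "test \<psi>"
  shows "integrable lebesgue (\<lambda>x. f x * \<psi> x)"
proof -
  obtain B where "\<And>x. \<bar>\<psi> x\<bar> \<le> B" using test_bounded[OF assms(2)] by blast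
  then show ?thesis
    using integrable_mult_bounded[OF assms(1), of \<psi> B] test_integrable[OF assms(2)] by (simp add: mult.commute)
qed

lemma weak_gradD:
  assumes "weak_grad v g"
  shows "integrable lebesgue v" "integrable lebesgue g" "integrable lebesgue (\<lambda>x. g x $ i)"
    "test \<psi> \<Longrightarrow> (\<integral>x. v x * partial_deriv i \<psi> x \<partial>lebesgue) = - (\<integral>x. g x $ i * \<psi> x \<partial>lebesgue)"
  using assms by (auto simp: weak_grad_def integrable_component)

text \<open>
  Testing the weak identity with \<open>y \<mapsto> k (x - y)\<close> moves the derivative from the kernel to \<open>v\<close>.
\<close>

lemma weak_grad_conv:
  assumes "weak_grad v g" "test k"
  shows "partial_deriv i (conv k v) x = conv k (\<lambda>y. g y $ i) x"
proof -
  let ?\<psi> = "\<lambda>y. k ((-1) *\<^sub>R y + x)"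
  have t: "test ?\<psi>" by (rule test_affine[OF assms(2)]) simp
  have "k differentiable (at y)" for y using assms(2) by (auto simp: Cc_infty_iff intro: smooth_differentiable)
  then have d: "partial_deriv i ?\<psi> y = - partial_deriv i k (x - y)" for y
    using partial_deriv_affine(2)[of k "-1" y x i] by simp
  have "(\<integral>y. v y * partial_deriv i ?\<psi> y \<partial>lebesgue) = - (\<integral>y. g y $ i * ?\<psi> y \<partial>lebesgue)"
    by (rule weak_gradD(4)[OF assms(1) t])
  then have "(\<integral>y. partial_deriv i k (x - y) * v y \<partial>lebesgue) = (\<integral>y. k (x - y) * (g y $ i) \<partial>lebesgue)"
    unfolding d by (simp add: mult.commute)
  then show ?thesis
    using partial_deriv_conv[OF assms(2) weak_gradD(1)[OF assms(1)], of i x] by (simp add: conv_def)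
qed

definition grad :: "(real ^ 'n \<Rightarrow> real) \<Rightarrow> real ^ 'n \<Rightarrow> real ^ 'n" where
  "grad f x = (\<chi> i. partial_deriv i f x)"

lemma weak_grad_test:
  assumes "test f"
  shows "weak_grad f (grad f)"
  unfolding weak_grad_def
proof (intro conjI allI impI)
  show "integrable lebesgue f" by (rule test_integrable[OF assms])
  show "integrable lebesgue (grad f)"
    by (rule integrable_componentI) (simp add: grad_def test_integrable[OF Cc_infty_partial_deriv[OF assms]])
  fix \<psi> :: "real ^ 'a \<Rightarrow> real" and i assume \<psi>: "test \<psi>"
  have s: "smooth f" "smooth \<psi>" using assms \<psi> by (auto simp: Cc_infty_iff)
  have t: "test (\<lambda>x. f x * \<psi> x)" by (rule test_mult[OF s(1) \<psi>])
  note td = Cc_infty_partial_deriv[OF t, of i]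
  obtain B where B: "\<And>x. \<bar>partial_deriv i (\<lambda>x. f x * \<psi> x) x\<bar> \<le> B" using test_bounded[OF td] by blast
  obtain K where K: "compact K" "\<And>x. x \<notin> K \<Longrightarrow> f x * \<psi> x = 0" using t by (auto simp: Cc_infty_iff)
  have "(\<integral>x. partial_deriv i (\<lambda>x. f x * \<psi> x) x \<partial>lebesgue) = 0"
    by (rule integral_partial_deriv_eq_0[OF _ B _ K test_integrable[OF t]])
      (use t test_integrable[OF td] in \<open>auto simp: Cc_infty_iff smooth_differentiable\<close>)
  moreover have "partial_deriv i (\<lambda>x. f x * \<psi> x) x = f x * partial_deriv i \<psi> x + partial_deriv i f x * \<psi> x" for x
    by (intro partial_deriv_mult smooth_differentiable s)
  moreover have "integrable lebesgue (\<lambda>x. f x * partial_deriv i \<psi> x)" "integrable lebesgue (\<lambda>x. partial_deriv i f x * \<psi> x)"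
    by (intro integrable_mult_test test_integrable Cc_infty_partial_deriv assms \<psi>)+
  ultimately show "(\<integral>x. f x * partial_deriv i \<psi> x \<partial>lebesgue) = - (\<integral>x. grad f x $ i * \<psi> x \<partial>lebesgue)"
    by (simp add: grad_def)
qed

lemma weak_grad_mult:
  assumes vg: "weak_grad v g" and z: "test \<zeta>"
  shows "weak_grad (\<lambda>x. \<zeta> x * v x) (\<lambda>x. \<zeta> x *\<^sub>R g x + v x *\<^sub>R grad \<zeta> x)"
  unfolding weak_grad_def
proof (intro conjI allI impI)
  have s: "smooth \<zeta>" using z by (auto simp: Cc_infty_iff)
  have 1: "integrable lebesgue (\<lambda>x. \<zeta> x * v x)"
    using integrable_mult_test[OF weak_gradD(1)[OF vg] z] by (simp add: mult.commute)
  then show "integrable lebesgue (\<lambda>x. \<zeta> x * v x)" .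
  have 2: "integrable lebesgue (\<lambda>x. \<zeta> x * g x $ i)" for i
    using integrable_mult_test[OF weak_gradD(3)[OF vg] z] by (simp add: mult.commute)
  have 3: "integrable lebesgue (\<lambda>x. v x * partial_deriv i \<zeta> x)" for i
    by (rule integrable_mult_test[OF weak_gradD(1)[OF vg] Cc_infty_partial_deriv[OF z]])
  show "integrable lebesgue (\<lambda>x. \<zeta> x *\<^sub>R g x + v x *\<^sub>R grad \<zeta> x)"
    by (rule integrable_componentI) (use 2 3 in \<open>simp add: grad_def\<close>)
  fix \<psi> :: "real ^ 'a \<Rightarrow> real" and i assume \<psi>: "test \<psi>"
  have s': "smooth \<psi>" using \<psi> by (auto simp: Cc_infty_iff)
  have t: "test (\<lambda>x. \<zeta> x * \<psi> x)" by (rule test_mult[OF s \<psi>])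
  have p: "partial_deriv i (\<lambda>x. \<zeta> x * \<psi> x) x = \<zeta> x * partial_deriv i \<psi> x + partial_deriv i \<zeta> x * \<psi> x" for x
    by (intro partial_deriv_mult smooth_differentiable s s')
  have "(\<integral>x. v x * (\<zeta> x * partial_deriv i \<psi> x + partial_deriv i \<zeta> x * \<psi> x) \<partial>lebesgue) = - (\<integral>x. g x $ i * (\<zeta> x * \<psi> x) \<partial>lebesgue)"
    using weak_gradD(4)[OF vg t, of i] unfolding p .
  moreover have i1: "integrable lebesgue (\<lambda>x. (\<zeta> x * v x) * partial_deriv i \<psi> x)"
    by (rule integrable_mult_test[OF 1 Cc_infty_partial_deriv[OF \<psi>]])
  moreover have i2: "integrable lebesgue (\<lambda>x. (v x * partial_deriv i \<zeta> x) * \<psi> x)"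
    by (rule integrable_mult_test[OF 3 \<psi>])
  moreover have i3: "integrable lebesgue (\<lambda>x. (\<zeta> x * g x $ i) * \<psi> x)"
    by (rule integrable_mult_test[OF 2 \<psi>])
  moreover have "(\<integral>x. v x * (\<zeta> x * partial_deriv i \<psi> x + partial_deriv i \<zeta> x * \<psi> x) \<partial>lebesgue) =
     (\<integral>x. (\<zeta> x * v x) * partial_deriv i \<psi> x + (v x * partial_deriv i \<zeta> x) * \<psi> x \<partial>lebesgue)"
    by (rule Bochner_Integration.integral_cong) (auto simp: algebra_simps)
  moreover have "(\<integral>x. (\<zeta> x *\<^sub>R g x + v x *\<^sub>R grad \<zeta> x) $ i * \<psi> x \<partial>lebesgue) =
     (\<integral>x. (\<zeta> x * g x $ i) * \<psi> x + (v x * partial_deriv i \<zeta> x) * \<psi> x \<partial>lebesgue)"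
    by (rule Bochner_Integration.integral_cong) (auto simp: algebra_simps grad_def)
  moreover have "(\<integral>x. g x $ i * (\<zeta> x * \<psi> x) \<partial>lebesgue) = (\<integral>x. (\<zeta> x * g x $ i) * \<psi> x \<partial>lebesgue)"
    by (rule Bochner_Integration.integral_cong) (auto simp: algebra_simps)
  ultimately show "(\<integral>x. (\<zeta> x * v x) * partial_deriv i \<psi> x \<partial>lebesgue) = - (\<integral>x. (\<zeta> x *\<^sub>R g x + v x *\<^sub>R grad \<zeta> x) $ i * \<psi> x \<partial>lebesgue)"
    by simp
qed

lemma ex_mollifier: "\<exists>\<rho> :: real ^ 'n \<Rightarrow> real. mollifier \<rho>"
  using mollifier_exists[of 1 0] by auto

text \<open>
  The identity holds classically for the mollifications of \<open>v\<close> and passes to the limit: \<open>H\<close> is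
  Lipschitz, so \<open>H (V m)\<close> converges in \<open>L\<^sup>1\<close>, while \<open>H' (V m)\<close> is bounded and converges almost everywhere
  along a subsequence, because \<open>H'\<close> is continuous.
\<close>

lemma weak_grad_chain:
  fixes v :: "real ^ 'n \<Rightarrow> real"
  assumes vg: "weak_grad v g"
    and H: "\<And>s. (H has_real_derivative H' s) (at s)" "continuous_on UNIV H'" "\<And>s. \<bar>H' s\<bar> \<le> C" "H 0 = 0"
  shows "weak_grad (\<lambda>x. H (v x)) (\<lambda>x. H' (v x) *\<^sub>R g x)"
  unfolding weak_grad_def
proof (intro conjI allI impI)
  note iv = weak_gradD(1)[OF vg] and ig = weak_gradD(2,3)[OF vg]
  have lip: "\<bar>H a - H b\<bar> \<le> C * \<bar>a - b\<bar>" for a b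
    using field_differentiable_bound[OF convex_UNIV, of H H' C a b] H by (auto intro: has_field_derivative_at_within)
  have C: "0 \<le> C" using H(3)[of 0] by linarith
  have Hc: "continuous_on UNIV H" using H(1) by (auto intro!: continuous_at_imp_continuous_on DERIV_isCont)
  have [measurable]: "H \<in> borel_measurable borel" "H' \<in> borel_measurable borel"
    using Hc H(2) by (auto intro: borel_measurable_continuous_onI)
  have [measurable]: "v \<in> borel_measurable lebesgue" "g \<in> borel_measurable lebesgue" "(\<lambda>x. g x $ i) \<in> borel_measurable lebesgue" for i
    using iv ig by auto
  show "integrable lebesgue (\<lambda>x. H (v x))"
  proof (rule Bochner_Integration.integrable_bound[of _ "\<lambda>x. C * v x"])
    show "AE x in lebesgue. norm (H (v x)) \<le> norm (C * v x)"
      using lip[of "v _" 0] H(4) C by (auto simp: abs_mult)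
  qed (use iv in auto)
  show "integrable lebesgue (\<lambda>x. H' (v x) *\<^sub>R g x)"
    by (rule integrable_componentI)
      (use integrable_mult_bounded[OF ig(2), of "\<lambda>x. H' (v x)" C] H(3) in simp)
  fix \<psi> :: "real ^ 'n \<Rightarrow> real" and i assume \<psi>: "test \<psi>"
  obtain B where B: "\<And>x. \<bar>\<psi> x\<bar> \<le> B" using test_bounded[OF \<psi>] by blast
  obtain B' where B': "\<And>x. \<bar>partial_deriv i \<psi> x\<bar> \<le> B'" using test_bounded[OF Cc_infty_partial_deriv[OF \<psi>]] by blast
  have B0: "0 \<le> B" "0 \<le> B'" using B[of 0] B'[of 0] by linarith+
  obtain K where K: "compact K" "\<And>x. x \<notin> K \<Longrightarrow> \<psi> x = 0" and s\<psi>: "smooth \<psi>" using \<psi> by (auto simp: Cc_infty_iff)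
  obtain \<rho> :: "real ^ 'n \<Rightarrow> real" where \<rho>: "mollifier \<rho>" using ex_mollifier by blast
  define d where "d m = 1 / real (Suc m)" for m
  have d: "0 < d m" for m by (simp add: d_def)
  have d0: "d \<longlonglongrightarrow> 0" using LIMSEQ_inverse_real_of_nat by (simp add: d_def[abs_def] inverse_eq_divide)
  define V where "V m = conv (rescale \<rho> (d m)) v" for m
  define G where "G m = conv (rescale \<rho> (d m)) (\<lambda>y. g y $ i)" for m
  have t: "test (rescale \<rho> (d m))" for m using mollifier_rescale(1)[OF \<rho> d] .
  have sV: "smooth (V m)" for m unfolding V_def by (rule smooth_conv[OF t iv])
  have sG: "smooth (G m)" for m unfolding G_def by (rule smooth_conv[OF t ig(2)])
  have VG: "partial_deriv i (V m) x = G m x" for m x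
    unfolding V_def G_def by (rule weak_grad_conv[OF vg t])
  have iV: "integrable lebesgue (V m)" and iG: "integrable lebesgue (G m)" for m
    unfolding V_def G_def by (rule integrable_conv_mollifier[OF \<rho> _ d], fact)+
  have [measurable]: "V m \<in> borel_measurable lebesgue" "G m \<in> borel_measurable lebesgue" for m
    using iV iG by auto
  have [measurable]: "\<psi> \<in> borel_measurable lebesgue" "partial_deriv i \<psi> \<in> borel_measurable lebesgue"
    using test_integrable[OF \<psi>] test_integrable[OF Cc_infty_partial_deriv[OF \<psi>]] by auto
  have LV: "(\<lambda>m. \<integral>x. \<bar>V m x - v x\<bar> \<partial>lebesgue) \<longlonglongrightarrow> 0"
    unfolding V_def by (rule conv_tendsto_L1[OF \<rho> iv d d0])
  have LG: "(\<lambda>m. \<integral>x. \<bar>G m x - g x $ i\<bar> \<partial>lebesgue) \<longlonglongrightarrow> 0"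
    unfolding G_def by (rule conv_tendsto_L1[OF \<rho> ig(2) d d0])
  have by_parts: "(\<integral>x. H (V m x) * partial_deriv i \<psi> x \<partial>lebesgue) = - (\<integral>x. H' (V m x) * G m x * \<psi> x \<partial>lebesgue)" for m
  proof -
    let ?p = "\<lambda>x. H (V m x) * \<psi> x"
    have dV: "(\<lambda>x. H (V m x)) differentiable (at x)" for x
      by (rule partial_deriv_chain(1)[OF smooth_differentiable[OF sV] H(1)])
    have pd: "partial_deriv i ?p x = H (V m x) * partial_deriv i \<psi> x + H' (V m x) * G m x * \<psi> x" for x
      using partial_deriv_mult[OF dV smooth_differentiable[OF s\<psi>], of i x]
        partial_deriv_chain(2)[OF smooth_differentiable[OF sV[of m]] H(1), of i x] VG[of m x] by simp
    have pd0: "partial_deriv i ?p x = 0" if "x \<notin> K" for x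
      by (rule partial_deriv_eq_0_outside[OF compact_imp_closed[OF K(1)]]) (use that K(2) in auto)
    have cont: "continuous_on K (\<lambda>x. H (V m x) * partial_deriv i \<psi> x + H' (V m x) * G m x * \<psi> x)"
      by (intro continuous_intros smooth_continuous sG s\<psi> smooth_partial_deriv
          continuous_on_compose2[OF Hc smooth_continuous[OF sV]] continuous_on_compose2[OF H(2) smooth_continuous[OF sV]]) auto
    have "bounded ((\<lambda>x. H (V m x) * partial_deriv i \<psi> x + H' (V m x) * G m x * \<psi> x) ` K)"
      by (rule compact_imp_bounded[OF compact_continuous_image[OF cont K(1)]])
    then obtain b where b: "0 < b" "\<And>x. x \<in> K \<Longrightarrow> \<bar>partial_deriv i ?p x\<bar> \<le> b"
      unfolding pd bounded_pos by auto
    have i1: "integrable lebesgue (\<lambda>x. H (V m x) * partial_deriv i \<psi> x)" and i0: "integrable lebesgue ?p"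
    proof -
      have "integrable lebesgue (\<lambda>x. H (V m x))"
      proof (rule Bochner_Integration.integrable_bound[of _ "\<lambda>x. C * V m x"])
        show "AE x in lebesgue. norm (H (V m x)) \<le> norm (C * V m x)"
          using lip[of "V m _" 0] H(4) C by (auto simp: abs_mult)
      qed (use iV in auto)
      then show "integrable lebesgue (\<lambda>x. H (V m x) * partial_deriv i \<psi> x)" "integrable lebesgue ?p"
        by (auto intro!: integrable_mult_test \<psi> Cc_infty_partial_deriv)
    qed
    have i2: "integrable lebesgue (\<lambda>x. H' (V m x) * G m x * \<psi> x)"
      by (intro integrable_mult_test[OF _ \<psi>] integrable_mult_bounded[OF iG, of _ C]) (use H(3) in auto)
    have "(\<integral>x. partial_deriv i ?p x \<partial>lebesgue) = 0"
    proof (rule integral_partial_deriv_eq_0[of ?p i b K])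
      show "?p differentiable (at x)" for x using dV smooth_differentiable[OF s\<psi>] by (intro differentiable_mult)
      show "\<bar>partial_deriv i ?p x\<bar> \<le> b" for x using b pd0[of x] by (cases "x \<in> K") auto
      show "partial_deriv i ?p \<in> borel_measurable lebesgue"
        using i1 i2 by (simp add: pd[abs_def])
    qed (use K i0 in auto)
    then show ?thesis using i1 i2 by (simp add: pd[abs_def])
  qed
  have "\<exists>r::nat\<Rightarrow>nat. strict_mono r \<and> (AE x in lebesgue. (\<lambda>n. V (r n) x - v x) \<longlonglongrightarrow> 0)"
    by (rule tendsto_L1_AE_subseq) (use LV iV iv in auto)
  then obtain r :: "nat \<Rightarrow> nat" where r: "strict_mono r" "AE x in lebesgue. (\<lambda>n. V (r n) x - v x) \<longlonglongrightarrow> 0" by blast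
  note sub = LIMSEQ_subseq_LIMSEQ[OF _ r(1), unfolded o_def]
  have iH: "integrable lebesgue (\<lambda>x. H (u x) * partial_deriv i \<psi> x)" if u: "integrable lebesgue u" for u
  proof -
    have "integrable lebesgue (\<lambda>x. H (u x))"
    proof (rule Bochner_Integration.integrable_bound[of _ "\<lambda>x. C * u x"])
      show "AE x in lebesgue. norm (H (u x)) \<le> norm (C * u x)"
        using lip[of "u _" 0] H(4) C by (auto simp: abs_mult)
    qed (use u in auto)
    then show ?thesis by (auto intro!: integrable_mult_test \<psi> Cc_infty_partial_deriv)
  qed
  have 1: "(\<lambda>n. \<integral>x. H (V (r n) x) * partial_deriv i \<psi> x \<partial>lebesgue) \<longlonglongrightarrow> (\<integral>x. H (v x) * partial_deriv i \<psi> x \<partial>lebesgue)"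
  proof (rule tendsto_integral_L1[OF iH[OF iV] iH[OF iv]])
    show "(\<lambda>n. C * B' * (\<integral>x. \<bar>V (r n) x - v x\<bar> \<partial>lebesgue)) \<longlonglongrightarrow> 0"
      by (rule tendsto_mult_right_zero[OF sub[OF LV]])
    fix n
    have "(\<integral>x. \<bar>H (V (r n) x) * partial_deriv i \<psi> x - H (v x) * partial_deriv i \<psi> x\<bar> \<partial>lebesgue)
       \<le> (\<integral>x. C * B' * \<bar>V (r n) x - v x\<bar> \<partial>lebesgue)"
    proof (rule integral_mono')
      fix x
      have "\<bar>H (V (r n) x) * partial_deriv i \<psi> x - H (v x) * partial_deriv i \<psi> x\<bar> = \<bar>H (V (r n) x) - H (v x)\<bar> * \<bar>partial_deriv i \<psi> x\<bar>"
        by (simp add: abs_mult[symmetric] left_diff_distrib)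
      also have "\<dots> \<le> (C * \<bar>V (r n) x - v x\<bar>) * B'"
        using C by (intro mult_mono lip B') auto
      finally show "\<bar>H (V (r n) x) * partial_deriv i \<psi> x - H (v x) * partial_deriv i \<psi> x\<bar> \<le> C * B' * \<bar>V (r n) x - v x\<bar>"
        by (simp add: mult_ac)
    qed (use iV iv C B0 in auto)
    then show "(\<integral>x. \<bar>H (V (r n) x) * partial_deriv i \<psi> x - H (v x) * partial_deriv i \<psi> x\<bar> \<partial>lebesgue)
       \<le> C * B' * (\<integral>x. \<bar>V (r n) x - v x\<bar> \<partial>lebesgue)" by simp
  qed
  have iH': "integrable lebesgue (\<lambda>x. H' (u x) * (f x) * \<psi> x)"
    if f: "integrable lebesgue f" and [measurable]: "u \<in> borel_measurable lebesgue" for u f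
    by (intro integrable_mult_test[OF _ \<psi>] integrable_mult_bounded[OF f, of _ C]) (use H(3) in auto)
  \<comment> \<open>\<open>H' (V n) * G n\<close> is split as \<open>H' (V n) * (G n - g) + H' (V n) * g\<close>: the first term tends to zero in \<open>L\<^sup>1\<close>,
    the second one by dominated convergence\<close>
  have 2: "(\<lambda>n. \<integral>x. H' (V (r n) x) * (G (r n) x - g x $ i) * \<psi> x \<partial>lebesgue) \<longlonglongrightarrow> (\<integral>x. 0 * \<psi> x \<partial>lebesgue)"
  proof (rule tendsto_integral_L1[OF iH'])
    show "(\<lambda>n. C * B * (\<integral>x. \<bar>G (r n) x - g x $ i\<bar> \<partial>lebesgue)) \<longlonglongrightarrow> 0"
      by (rule tendsto_mult_right_zero[OF sub[OF LG]])
    fix n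
    have "(\<integral>x. \<bar>H' (V (r n) x) * (G (r n) x - g x $ i) * \<psi> x - 0 * \<psi> x\<bar> \<partial>lebesgue)
       \<le> (\<integral>x. C * B * \<bar>G (r n) x - g x $ i\<bar> \<partial>lebesgue)"
    proof (rule integral_mono')
      fix x
      have "\<bar>H' (V (r n) x) * (G (r n) x - g x $ i) * \<psi> x - 0 * \<psi> x\<bar> = \<bar>H' (V (r n) x)\<bar> * \<bar>\<psi> x\<bar> * \<bar>G (r n) x - g x $ i\<bar>"
        by (simp add: abs_mult)
      also have "\<dots> \<le> (C * B) * \<bar>G (r n) x - g x $ i\<bar>"
        using C B0 by (intro mult_mono H(3) B) auto
      finally show "\<bar>H' (V (r n) x) * (G (r n) x - g x $ i) * \<psi> x - 0 * \<psi> x\<bar> \<le> C * B * \<bar>G (r n) x - g x $ i\<bar>" .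
    qed (use iG ig C B0 in auto)
    then show "(\<integral>x. \<bar>H' (V (r n) x) * (G (r n) x - g x $ i) * \<psi> x - 0 * \<psi> x\<bar> \<partial>lebesgue)
       \<le> C * B * (\<integral>x. \<bar>G (r n) x - g x $ i\<bar> \<partial>lebesgue)" by simp
  qed (use iG ig in auto)
  have 3: "(\<lambda>n. \<integral>x. H' (V (r n) x) * (g x $ i) * \<psi> x \<partial>lebesgue) \<longlonglongrightarrow> (\<integral>x. H' (v x) * (g x $ i) * \<psi> x \<partial>lebesgue)"
  proof (rule integral_dominated_convergence[where w="\<lambda>x. C * B * \<bar>g x $ i\<bar>"])
    show "AE x in lebesgue. (\<lambda>n. H' (V (r n) x) * g x $ i * \<psi> x) \<longlonglongrightarrow> H' (v x) * g x $ i * \<psi> x"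
      using r(2)
    proof eventually_elim
      fix x assume "(\<lambda>n. V (r n) x - v x) \<longlonglongrightarrow> 0"
      then have "(\<lambda>n. V (r n) x) \<longlonglongrightarrow> v x" by (simp add: LIM_zero_iff)
      then have "(\<lambda>n. H' (V (r n) x)) \<longlonglongrightarrow> H' (v x)"
        using H(2) continuous_on_tendsto_compose[of UNIV H'] by auto
      then show "(\<lambda>n. H' (V (r n) x) * g x $ i * \<psi> x) \<longlonglongrightarrow> H' (v x) * g x $ i * \<psi> x"
        by (intro tendsto_mult tendsto_const)
    qed
    show "AE x in lebesgue. norm (H' (V (r n) x) * g x $ i * \<psi> x) \<le> C * B * \<bar>g x $ i\<bar>" for n
    proof (rule AE_I2)
      fix x
      have "norm (H' (V (r n) x) * g x $ i * \<psi> x) = \<bar>H' (V (r n) x)\<bar> * \<bar>\<psi> x\<bar> * \<bar>g x $ i\<bar>"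
        by (simp add: abs_mult)
      also have "\<dots> \<le> (C * B) * \<bar>g x $ i\<bar>"
        using C B0 by (intro mult_mono H(3) B) auto
      finally show "norm (H' (V (r n) x) * g x $ i * \<psi> x) \<le> C * B * \<bar>g x $ i\<bar>" .
    qed
  qed (use ig in auto)
  have "(\<integral>x. H (V (r n) x) * partial_deriv i \<psi> x \<partial>lebesgue) =
    - ((\<integral>x. H' (V (r n) x) * (G (r n) x - g x $ i) * \<psi> x \<partial>lebesgue) + (\<integral>x. H' (V (r n) x) * (g x $ i) * \<psi> x \<partial>lebesgue))" for n
    unfolding by_parts
    using iH'[of "\<lambda>x. G (r n) x - g x $ i" "V (r n)"] iH'[of "\<lambda>x. g x $ i" "V (r n)"] iG ig(2)
    by (subst Bochner_Integration.integral_add[symmetric]) (auto simp: algebra_simps)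
  with 1 have "(\<lambda>n. - ((\<integral>x. H' (V (r n) x) * (G (r n) x - g x $ i) * \<psi> x \<partial>lebesgue) + (\<integral>x. H' (V (r n) x) * (g x $ i) * \<psi> x \<partial>lebesgue)))
     \<longlonglongrightarrow> (\<integral>x. H (v x) * partial_deriv i \<psi> x \<partial>lebesgue)" by simp
  from LIMSEQ_unique[OF this tendsto_minus[OF tendsto_add[OF 2 3]]]
  show "(\<integral>x. H (v x) * partial_deriv i \<psi> x \<partial>lebesgue) = - (\<integral>x. (H' (v x) *\<^sub>R g x) $ i * \<psi> x \<partial>lebesgue)"
    by simp
qed

section \<open>Weak gradients on a domain\<close>

definition zero_ext :: "(real ^ 'n) set \<Rightarrow> (real ^ 'n \<Rightarrow> 'b::real_vector) \<Rightarrow> real ^ 'n \<Rightarrow> 'b" where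
  "zero_ext \<Omega> f x = indicator \<Omega> x *\<^sub>R f x"

lemma zero_ext_simps: "x \<in> \<Omega> \<Longrightarrow> zero_ext \<Omega> f x = f x" "x \<notin> \<Omega> \<Longrightarrow> zero_ext \<Omega> f x = 0"
  by (auto simp: zero_ext_def)

lemma open_sets_lebesgue: "open \<Omega> \<Longrightarrow> \<Omega> \<in> sets lebesgue"
  by (simp add: borel_open sets_completionI_sets)

lemma compact_sets_lebesgue: "compact \<Omega> \<Longrightarrow> \<Omega> \<in> sets lebesgue"
  by (simp add: borel_closed compact_imp_closed sets_completionI_sets)

lemma
  fixes f :: "real ^ 'n \<Rightarrow> 'b::{banach, second_countable_topology}"
  assumes "\<Omega> \<in> sets lebesgue"
  shows integrable_zero_ext: "integrable (lebesgue_on \<Omega>) f \<longleftrightarrow> integrable lebesgue (zero_ext \<Omega> f)"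
    and integral_zero_ext: "integral\<^sup>L (lebesgue_on \<Omega>) f = integral\<^sup>L lebesgue (zero_ext \<Omega> f)"
    and AE_lebesgue_on: "(AE x in lebesgue_on \<Omega>. P x) \<longleftrightarrow> (AE x in lebesgue. x \<in> \<Omega> \<longrightarrow> P x)"
  using assms by (simp_all add: zero_ext_def[abs_def] integrable_restrict_space integral_restrict_space
      borel_measurable_restrict_space_iff AE_restrict_space_iff)

lemma measurable_lebesgue_AE:
  assumes f: "f \<in> borel_measurable lebesgue" and ae: "AE x in lebesgue. f x = g x"
  shows "g \<in> borel_measurable lebesgue"
proof (rule measurableI)
  fix A :: "'b set" assume A: "A \<in> sets borel"
  show "g -` A \<inter> space lebesgue \<in> sets lebesgue"
  proof (rule completion.in_sets_AE)
    show "f -` A \<inter> space lebesgue \<in> sets lebesgue" using measurable_sets[OF f A] .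
    show "AE x in lebesgue. x \<in> f -` A \<inter> space lebesgue \<longleftrightarrow> x \<in> g -` A \<inter> space lebesgue"
      using ae by eventually_elim auto
  qed auto
qed auto

lemma Cc_inftyI:
  assumes "test f" "compact K" "\<And>x. x \<notin> K \<Longrightarrow> f x = 0" "K \<subseteq> \<Omega>"
  shows "f \<in> Cc_infty \<Omega>"
  using assms unfolding Cc_infty_iff by blast

text \<open>
  The mollifications of \<open>u\<close> vanish on the inner ball, since the kernels centred there are test functions
  in the outer ball, and a subsequence of them converges to \<open>u\<close> almost everywhere.
\<close>

lemma AE_zero_locally:
  fixes u :: "real ^ 'n \<Rightarrow> real"
  assumes u: "integrable lebesgue u" and r: "0 < r"
    and z: "\<And>\<phi>. \<phi> \<in> Cc_infty (ball x0 (2 * r)) \<Longrightarrow> (\<integral>y. u y * \<phi> y \<partial>lebesgue) = 0"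
  shows "AE x in lebesgue. x \<in> ball x0 r \<longrightarrow> u x = 0"
proof -
  obtain \<rho> :: "real ^ 'n \<Rightarrow> real" where \<rho>: "mollifier \<rho>" using ex_mollifier by blast
  define d where "d m = r / 2 * (1 / real (Suc m))" for m
  have d: "0 < d m" for m using r by (simp add: d_def)
  have d1: "d m < r" for m
  proof -
    have "d m \<le> r / 2 * 1" unfolding d_def using r by (intro mult_left_mono) auto
    then show ?thesis using r by simp
  qed
  have d0: "d \<longlonglongrightarrow> 0" using tendsto_mult_right_zero[OF LIMSEQ_inverse_real_of_nat, of "r / 2"]
    by (simp add: d_def[abs_def] inverse_eq_divide)
  have conv0: "conv (rescale \<rho> (d m)) u x = 0" if x: "x \<in> ball x0 r" for m x
  proof -
    note m = mollifier_rescale[OF \<rho> d[of m]]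
    let ?\<psi> = "\<lambda>y. rescale \<rho> (d m) ((-1) *\<^sub>R y + x)"
    have "test ?\<psi>" by (rule test_affine[OF m(1)]) simp
    moreover have "?\<psi> y = 0" if "y \<notin> cball x (d m)" for y
      using m(4)[of "x - y"] that by (auto simp: dist_norm norm_minus_commute)
    moreover have "cball x (d m) \<subseteq> ball x0 (2 * r)"
    proof
      fix y assume "y \<in> cball x (d m)"
      then show "y \<in> ball x0 (2 * r)" using x d1[of m] dist_triangle[of x0 y x] by auto
    qed
    ultimately have "?\<psi> \<in> Cc_infty (ball x0 (2 * r))"
      by (rule Cc_inftyI[OF _ compact_cball])
    from z[OF this] show ?thesis by (simp add: conv_def mult.commute)
  qed
  have "\<exists>s::nat\<Rightarrow>nat. strict_mono s \<and> (AE x in lebesgue. (\<lambda>n. conv (rescale \<rho> (d (s n))) u x - u x) \<longlonglongrightarrow> 0)"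
  proof (rule tendsto_L1_AE_subseq)
    show "integrable lebesgue (\<lambda>x. conv (rescale \<rho> (d n)) u x - u x)" for n
      by (intro Bochner_Integration.integrable_diff integrable_conv_mollifier[OF \<rho> u d] u)
    show "(\<lambda>n. \<integral>x. norm (conv (rescale \<rho> (d n)) u x - u x) \<partial>lebesgue) \<longlonglongrightarrow> 0"
      unfolding real_norm_def by (rule conv_tendsto_L1[OF \<rho> u d d0])
  qed
  then obtain s where s: "AE x in lebesgue. (\<lambda>n. conv (rescale \<rho> (d (s n))) u x - u x) \<longlonglongrightarrow> 0" by blast
  then show ?thesis
    by eventually_elim (auto simp: conv0 LIMSEQ_const_iff)
qed

text \<open>
  By Lindelof's theorem \<open>\<Omega>\<close> is a countable union of balls whose doubles are still contained in \<open>\<Omega>\<close>, and on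
  each of them \<open>u\<close> may be cut off to an integrable function.
\<close>

lemma fundamental_lemma:
  fixes u :: "real ^ 'n \<Rightarrow> real"
  assumes \<Omega>: "open \<Omega>"
    and int: "\<And>K. compact K \<Longrightarrow> K \<subseteq> \<Omega> \<Longrightarrow> integrable (lebesgue_on K) u"
    and z: "\<And>\<phi>. \<phi> \<in> Cc_infty \<Omega> \<Longrightarrow> (\<integral>y. u y * \<phi> y \<partial>lebesgue_on \<Omega>) = 0"
  shows "AE x in lebesgue. x \<in> \<Omega> \<longrightarrow> u x = 0"
proof -
  define \<B> where "\<B> = {ball x r | x r. 0 < r \<and> cball x (2 * r) \<subseteq> \<Omega>}"
  obtain \<C> where C: "\<C> \<subseteq> \<B>" "countable \<C>" "\<Union>\<C> = \<Union>\<B>"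
    using Lindelof[of \<B>] unfolding \<B>_def by auto
  have "\<Omega> \<subseteq> \<Union>\<B>"
  proof
    fix x assume "x \<in> \<Omega>"
    then obtain e where "0 < e" "cball x e \<subseteq> \<Omega>" using \<Omega> open_contains_cball by blast
    then have "ball x (e / 2) \<in> \<B>" "x \<in> ball x (e / 2)" unfolding \<B>_def by (auto intro!: exI[of _ x] exI[of _ "e / 2"])
    then show "x \<in> \<Union>\<B>" by blast
  qed
  moreover have "AE x in lebesgue. x \<in> B \<longrightarrow> u x = 0" if BB: "B \<in> \<B>" for B
  proof -
    obtain x0 r where B: "B = ball x0 r" "0 < r" "cball x0 (2 * r) \<subseteq> \<Omega>" using BB unfolding \<B>_def by blast
    let ?K = "cball x0 (2 * r)"
    have "AE x in lebesgue. x \<in> ball x0 r \<longrightarrow> zero_ext ?K u x = 0"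
    proof (rule AE_zero_locally[OF _ B(2)])
      show "integrable lebesgue (zero_ext ?K u)"
        using int[OF compact_cball B(3)] by (simp add: integrable_zero_ext)
      fix \<phi> :: "real ^ 'n \<Rightarrow> real" assume \<phi>: "\<phi> \<in> Cc_infty (ball x0 (2 * r))"
      have "ball x0 (2 * r) \<subseteq> ?K" by auto
      then have \<phi>0: "\<phi> y = 0" if "y \<notin> ?K" for y
        using \<phi> that unfolding Cc_infty_iff by (meson in_mono)
      have "\<phi> \<in> Cc_infty \<Omega>" 
        using Cc_infty_mono[of "ball x0 (2 * r)" \<Omega>] \<phi> B(3) \<open>ball x0 (2 * r) \<subseteq> ?K\<close> by blast
      from z[OF this] have "(\<integral>y. zero_ext \<Omega> (\<lambda>y. u y * \<phi> y) y \<partial>lebesgue) = 0"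
        using \<Omega> by (simp add: integral_zero_ext open_sets_lebesgue)
      moreover have "zero_ext \<Omega> (\<lambda>y. u y * \<phi> y) y = zero_ext ?K u y * \<phi> y" for y
        using \<phi>0[of y] B(3) by (auto simp: zero_ext_def indicator_def)
      ultimately show "(\<integral>y. zero_ext ?K u y * \<phi> y \<partial>lebesgue) = 0" by simp
    qed
    then show ?thesis
    proof eventually_elim
      fix x assume *: "x \<in> ball x0 r \<longrightarrow> zero_ext ?K u x = 0"
      show "x \<in> B \<longrightarrow> u x = 0"
      proof
        assume "x \<in> B"
        then have "x \<in> ball x0 r" "x \<in> ?K" using B by auto
        then show "u x = 0" using * by (simp add: zero_ext_simps)
      qed
    qed
  qed
  then have "AE x in lebesgue. \<forall>B\<in>\<C>. x \<in> B \<longrightarrow> u x = 0"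
    using C by (subst AE_ball_countable) auto
  ultimately show ?thesis using C(3) by (auto elim!: eventually_mono)
qed

lemma integrable_test_on:
  fixes u :: "real ^ 'n \<Rightarrow> real"
  assumes \<Omega>: "open \<Omega>"
    and int: "\<And>K. compact K \<Longrightarrow> K \<subseteq> \<Omega> \<Longrightarrow> integrable (lebesgue_on K) u"
    and \<phi>: "\<phi> \<in> Cc_infty \<Omega>"
  shows "integrable (lebesgue_on \<Omega>) (\<lambda>x. u x * \<phi> x)"
proof -
  obtain K where K: "compact K" "K \<subseteq> \<Omega>" "\<And>x. x \<notin> K \<Longrightarrow> \<phi> x = 0" using \<phi> by (auto simp: Cc_infty_iff)
  have "integrable lebesgue (zero_ext K u)"
    using int[OF K(1,2)] by (simp add: integrable_zero_ext compact_sets_lebesgue K)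
  from integrable_mult_test[OF this Cc_infty_test[OF \<phi>]]
  have "integrable lebesgue (\<lambda>x. zero_ext K u x * \<phi> x)" .
  moreover have "zero_ext K u x * \<phi> x = zero_ext \<Omega> (\<lambda>x. u x * \<phi> x) x" for x
    using K(2,3) by (auto simp: zero_ext_def indicator_def)
  ultimately show ?thesis using \<Omega> by (simp add: integrable_zero_ext open_sets_lebesgue)
qed

lemma has_weak_gradientD:
  assumes "has_weak_gradient \<Omega> u g" "compact K" "K \<subseteq> \<Omega>"
  shows "integrable (lebesgue_on K) u" "integrable (lebesgue_on K) g" "integrable (lebesgue_on K) (\<lambda>x. g x $ i)"
  using assms by (auto simp: has_weak_gradient_def integrable_component)

lemma has_weak_gradient_by_parts:
  assumes "has_weak_gradient \<Omega> u g" "\<phi> \<in> Cc_infty \<Omega>"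
  shows "(\<integral>x. u x * partial_deriv i \<phi> x \<partial>lebesgue_on \<Omega>) = - (\<integral>x. g x $ i * \<phi> x \<partial>lebesgue_on \<Omega>)"
  using assms by (simp add: has_weak_gradient_def)

lemma weak_gradient_unique:
  assumes \<Omega>: "open \<Omega>" and g: "has_weak_gradient \<Omega> u g1" "has_weak_gradient \<Omega> u g2"
  shows "AE x in lebesgue. x \<in> \<Omega> \<longrightarrow> g1 x = g2 x"
proof -
  have "AE x in lebesgue. x \<in> \<Omega> \<longrightarrow> g1 x $ i - g2 x $ i = 0" for i
  proof (rule fundamental_lemma[OF \<Omega>])
    show "integrable (lebesgue_on K) (\<lambda>x. g1 x $ i - g2 x $ i)" if "compact K" "K \<subseteq> \<Omega>" for K
      using has_weak_gradientD(3)[OF g(1) that] has_weak_gradientD(3)[OF g(2) that] by simp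
    fix \<phi> :: "real ^ 'a \<Rightarrow> real" assume \<phi>: "\<phi> \<in> Cc_infty \<Omega>"
    have i: "integrable (lebesgue_on \<Omega>) (\<lambda>x. g1 x $ i * \<phi> x)" "integrable (lebesgue_on \<Omega>) (\<lambda>x. g2 x $ i * \<phi> x)"
      by (intro integrable_test_on[OF \<Omega> _ \<phi>] has_weak_gradientD(3)[OF g(1)] has_weak_gradientD(3)[OF g(2)]; assumption)+
    have "(\<integral>x. g1 x $ i * \<phi> x \<partial>lebesgue_on \<Omega>) = (\<integral>x. g2 x $ i * \<phi> x \<partial>lebesgue_on \<Omega>)"
      using has_weak_gradient_by_parts[OF g(1) \<phi>, of i] has_weak_gradient_by_parts[OF g(2) \<phi>, of i] by simp
    then show "(\<integral>y. (g1 y $ i - g2 y $ i) * \<phi> y \<partial>lebesgue_on \<Omega>) = 0"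
      using i by (simp add: left_diff_distrib)
  qed
  then have "AE x in lebesgue. \<forall>i\<in>UNIV. x \<in> \<Omega> \<longrightarrow> g1 x $ i - g2 x $ i = 0"
    by (intro eventually_ball_finite) auto
  then show ?thesis by eventually_elim (auto simp: vec_eq_iff)
qed

lemma has_weak_gradient_add:
  assumes \<Omega>: "open \<Omega>" and u: "has_weak_gradient \<Omega> u g" and v: "has_weak_gradient \<Omega> v h"
  shows "has_weak_gradient \<Omega> (\<lambda>x. u x + c * v x) (\<lambda>x. g x + c *\<^sub>R h x)"
  unfolding has_weak_gradient_def
proof (intro conjI allI impI ballI)
  fix K :: "(real ^ 'a) set" assume "compact K \<and> K \<subseteq> \<Omega>"
  then show "integrable (lebesgue_on K) (\<lambda>x. u x + c * v x)" "integrable (lebesgue_on K) (\<lambda>x. g x + c *\<^sub>R h x)"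
    using has_weak_gradientD(1,2)[OF u, of K] has_weak_gradientD(1,2)[OF v, of K] by auto
next
  fix \<phi> :: "real ^ 'a \<Rightarrow> real" and i assume \<phi>: "\<phi> \<in> Cc_infty \<Omega>"
  note int = integrable_test_on[OF \<Omega> _ \<phi>] integrable_test_on[OF \<Omega> _ Cc_infty_partial_deriv[OF \<phi>, of i]]
  have i: "integrable (lebesgue_on \<Omega>) (\<lambda>x. u x * partial_deriv i \<phi> x)" "integrable (lebesgue_on \<Omega>) (\<lambda>x. v x * partial_deriv i \<phi> x)"
    "integrable (lebesgue_on \<Omega>) (\<lambda>x. g x $ i * \<phi> x)" "integrable (lebesgue_on \<Omega>) (\<lambda>x. h x $ i * \<phi> x)"
    by (intro int has_weak_gradientD(1)[OF u] has_weak_gradientD(3)[OF u]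
        has_weak_gradientD(1)[OF v] has_weak_gradientD(3)[OF v]; assumption)+
  have e: "(\<integral>x. u x * partial_deriv i \<phi> x \<partial>lebesgue_on \<Omega>) = - (\<integral>x. g x $ i * \<phi> x \<partial>lebesgue_on \<Omega>)"
    "(\<integral>x. v x * partial_deriv i \<phi> x \<partial>lebesgue_on \<Omega>) = - (\<integral>x. h x $ i * \<phi> x \<partial>lebesgue_on \<Omega>)"
    using has_weak_gradient_by_parts[OF u \<phi>, of i] has_weak_gradient_by_parts[OF v \<phi>, of i] .
  have "(\<integral>x. (u x + c * v x) * partial_deriv i \<phi> x \<partial>lebesgue_on \<Omega>) =
      (\<integral>x. u x * partial_deriv i \<phi> x + c * (v x * partial_deriv i \<phi> x) \<partial>lebesgue_on \<Omega>)"
    by (simp add: algebra_simps)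
  also have "\<dots> = - (\<integral>x. g x $ i * \<phi> x + c * (h x $ i * \<phi> x) \<partial>lebesgue_on \<Omega>)"
    using i e by simp
  also have "(\<integral>x. g x $ i * \<phi> x + c * (h x $ i * \<phi> x) \<partial>lebesgue_on \<Omega>) = (\<integral>x. (g x + c *\<^sub>R h x) $ i * \<phi> x \<partial>lebesgue_on \<Omega>)"
    by (simp add: algebra_simps)
  finally show "(\<integral>x. (u x + c * v x) * partial_deriv i \<phi> x \<partial>lebesgue_on \<Omega>) = - (\<integral>x. (g x + c *\<^sub>R h x) $ i * \<phi> x \<partial>lebesgue_on \<Omega>)" .
qed

lemma integrable_zero_ext_subset:
  fixes f :: "real ^ 'n \<Rightarrow> 'b::{banach, second_countable_topology}"
  assumes "integrable lebesgue f" "S \<in> sets lebesgue"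
  shows "integrable lebesgue (zero_ext S f)"
  using integrable_mult_indicator[OF assms(2,1)] by (simp add: zero_ext_def[abs_def])

lemma weak_grad_imp_has_weak_gradient:
  assumes \<Omega>: "open \<Omega>" and vg: "weak_grad v g"
  shows "has_weak_gradient \<Omega> v g"
  unfolding has_weak_gradient_def
proof (intro conjI allI impI ballI)
  fix K :: "(real ^ 'a) set" assume K: "compact K \<and> K \<subseteq> \<Omega>"
  then show "integrable (lebesgue_on K) v" "integrable (lebesgue_on K) g"
    using weak_gradD(1,2)[OF vg] by (simp_all add: integrable_zero_ext compact_sets_lebesgue integrable_zero_ext_subset)
next
  fix \<phi> :: "real ^ 'a \<Rightarrow> real" and i assume \<phi>: "\<phi> \<in> Cc_infty \<Omega>"
  have \<phi>0: "zero_ext \<Omega> (\<lambda>x. f x * \<phi> x) = (\<lambda>x. f x * \<phi> x)" if "\<phi> \<in> Cc_infty \<Omega>" for f \<phi> :: "real ^ 'a \<Rightarrow> real"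
    using that by (auto simp: Cc_infty_iff zero_ext_def fun_eq_iff indicator_def)
  show "(\<integral>x. v x * partial_deriv i \<phi> x \<partial>lebesgue_on \<Omega>) = - (\<integral>x. g x $ i * \<phi> x \<partial>lebesgue_on \<Omega>)"
    unfolding integral_zero_ext[OF open_sets_lebesgue[OF \<Omega>]] \<phi>0[OF \<phi>] \<phi>0[OF Cc_infty_partial_deriv[OF \<phi>]]
    by (rule weak_gradD(4)[OF vg Cc_infty_test[OF \<phi>]])
qed

lemma has_weak_gradient_weak_gradient:
  "has_weak_gradient \<Omega> u g \<Longrightarrow> has_weak_gradient \<Omega> u (weak_gradient \<Omega> u)"
  unfolding weak_gradient_def by (rule someI[of "has_weak_gradient \<Omega> u"])

lemma weak_gradient_AE:
  "open \<Omega> \<Longrightarrow> has_weak_gradient \<Omega> u g \<Longrightarrow> AE x in lebesgue. x \<in> \<Omega> \<longrightarrow> weak_gradient \<Omega> u x = g x"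
  using weak_gradient_unique has_weak_gradient_weak_gradient by blast

lemma W11D:
  assumes \<Omega>: "open \<Omega>" and u: "u \<in> W11 \<Omega>"
  shows "integrable (lebesgue_on \<Omega>) u" "has_weak_gradient \<Omega> u (weak_gradient \<Omega> u)"
    "integrable (lebesgue_on \<Omega>) (weak_gradient \<Omega> u)"
proof -
  obtain g where g: "has_weak_gradient \<Omega> u g" "integrable (lebesgue_on \<Omega>) g" and "integrable (lebesgue_on \<Omega>) u"
    using u by (auto simp: W11_def)
  then show "integrable (lebesgue_on \<Omega>) u" "has_weak_gradient \<Omega> u (weak_gradient \<Omega> u)"
    using has_weak_gradient_weak_gradient by auto
  note S = open_sets_lebesgue[OF \<Omega>]
  have ae: "AE x in lebesgue. zero_ext \<Omega> g x = zero_ext \<Omega> (weak_gradient \<Omega> u) x"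
    using weak_gradient_AE[OF \<Omega> g(1)] by eventually_elim (auto simp: zero_ext_def indicator_def)
  have i: "integrable lebesgue (zero_ext \<Omega> g)" using g(2) S by (simp add: integrable_zero_ext)
  show "integrable (lebesgue_on \<Omega>) (weak_gradient \<Omega> u)"
    unfolding integrable_zero_ext[OF S]
    by (rule integrable_cong_AE_imp[OF i measurable_lebesgue_AE[OF _ ae] ae]) (use i in auto)
qed

lemma W11_weak_grad:
  assumes \<Omega>: "open \<Omega>" and vg: "weak_grad v g"
  shows "v \<in> W11 \<Omega>"
  using weak_grad_imp_has_weak_gradient[OF \<Omega> vg] weak_gradD(1,2)[OF vg]
  by (auto simp: W11_def integrable_zero_ext open_sets_lebesgue[OF \<Omega>] integrable_zero_ext_subset)

text \<open>
  The extension by zero of a test function in \<open>\<Omega>\<close> is a test function, and its weak identity on the whole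
  space is stable under convergence of function and gradient in \<open>L\<^sup>1\<close>.
\<close>

lemma W11_0_weak_grad:
  assumes \<Omega>: "open \<Omega>" and u: "u \<in> W11_0 \<Omega>"
  shows "weak_grad (zero_ext \<Omega> u) (zero_ext \<Omega> (weak_gradient \<Omega> u))"
proof -
  note S = open_sets_lebesgue[OF \<Omega>]
  let ?g = "weak_gradient \<Omega> u"
  obtain \<phi> where \<phi>: "\<And>k. \<phi> k \<in> Cc_infty \<Omega>" "(\<lambda>k. W11_norm \<Omega> (\<lambda>x. u x - \<phi> k x)) \<longlonglongrightarrow> 0" and "u \<in> W11 \<Omega>"
    using u by (auto simp: W11_0_def)
  note u = W11D[OF \<Omega> \<open>u \<in> W11 \<Omega>\<close>]
  have iu: "integrable lebesgue (zero_ext \<Omega> u)" and ig: "integrable lebesgue (zero_ext \<Omega> ?g)"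
    using u S by (simp_all add: integrable_zero_ext)
  have t: "test (\<phi> k)" for k using \<phi>(1) Cc_infty_test by blast
  note \<phi>g = weak_grad_test[OF t]
  have \<phi>0: "x \<notin> \<Omega> \<Longrightarrow> \<phi> k x = 0 \<and> grad (\<phi> k) x = 0" for x k
    using \<phi>(1)[of k] Cc_infty_partial_deriv[OF \<phi>(1)[of k]]
    by (auto simp: grad_def vec_eq_iff Cc_infty_iff)
  define e where "e k = (\<integral>x. \<bar>zero_ext \<Omega> u x - \<phi> k x\<bar> \<partial>lebesgue) + (\<integral>x. norm (zero_ext \<Omega> ?g x - grad (\<phi> k) x) \<partial>lebesgue)" for k
  have "W11_norm \<Omega> (\<lambda>x. u x - \<phi> k x) = e k" for k
  proof -
    have "has_weak_gradient \<Omega> (\<lambda>x. u x + (-1) * \<phi> k x) (\<lambda>x. ?g x + (-1) *\<^sub>R grad (\<phi> k) x)"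
      by (intro has_weak_gradient_add \<Omega> u weak_grad_imp_has_weak_gradient \<phi>g)
    then have ae: "AE x in lebesgue. x \<in> \<Omega> \<longrightarrow> weak_gradient \<Omega> (\<lambda>x. u x - \<phi> k x) x = ?g x - grad (\<phi> k) x"
      using weak_gradient_AE[OF \<Omega>] by fastforce
    have ae': "AE x in lebesgue. norm (zero_ext \<Omega> ?g x - grad (\<phi> k) x) = zero_ext \<Omega> (\<lambda>x. norm (weak_gradient \<Omega> (\<lambda>x. u x - \<phi> k x) x)) x"
      using ae
    proof eventually_elim
      fix x assume "x \<in> \<Omega> \<longrightarrow> weak_gradient \<Omega> (\<lambda>x. u x - \<phi> k x) x = ?g x - grad (\<phi> k) x"
      then show "norm (zero_ext \<Omega> ?g x - grad (\<phi> k) x) = zero_ext \<Omega> (\<lambda>x. norm (weak_gradient \<Omega> (\<lambda>x. u x - \<phi> k x) x)) x"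
        using \<phi>0[of x k] by (cases "x \<in> \<Omega>") (simp_all add: zero_ext_simps)
    qed
    have m: "(\<lambda>x. norm (zero_ext \<Omega> ?g x - grad (\<phi> k) x)) \<in> borel_measurable lebesgue"
      using ig weak_gradD(2)[OF \<phi>g, of k] by auto
    have "(\<integral>x. norm (weak_gradient \<Omega> (\<lambda>x. u x - \<phi> k x) x) \<partial>lebesgue_on \<Omega>) = (\<integral>x. norm (zero_ext \<Omega> ?g x - grad (\<phi> k) x) \<partial>lebesgue)"
      unfolding integral_zero_ext[OF S] 
      by (rule integral_cong_AE[symmetric, OF m measurable_lebesgue_AE[OF m ae'] ae'])
    moreover have "zero_ext \<Omega> (\<lambda>x. \<bar>u x - \<phi> k x\<bar>) = (\<lambda>x. \<bar>zero_ext \<Omega> u x - \<phi> k x\<bar>)"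
    proof
      show "zero_ext \<Omega> (\<lambda>x. \<bar>u x - \<phi> k x\<bar>) x = \<bar>zero_ext \<Omega> u x - \<phi> k x\<bar>" for x
        using \<phi>0[of x k] by (cases "x \<in> \<Omega>") (simp_all add: zero_ext_simps)
    qed
    ultimately show ?thesis by (simp add: W11_norm_def e_def integral_zero_ext[OF S])
  qed
  then have e0: "e \<longlonglongrightarrow> 0" using \<phi>(2) by simp
  have "(\<integral>x. zero_ext \<Omega> u x * partial_deriv i \<psi> x \<partial>lebesgue) = - (\<integral>x. zero_ext \<Omega> ?g x $ i * \<psi> x \<partial>lebesgue)" if \<psi>: "test \<psi>" for \<psi> i
  proof -
    obtain B where B: "\<And>x. \<bar>\<psi> x\<bar> \<le> B" using test_bounded[OF \<psi>] by blast
    obtain B' where B': "\<And>x. \<bar>partial_deriv i \<psi> x\<bar> \<le> B'" using test_bounded[OF Cc_infty_partial_deriv[OF \<psi>]] by blast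
    have B0: "0 \<le> B" "0 \<le> B'" using B[of 0] B'[of 0] by linarith+
    have i\<phi>: "integrable lebesgue (\<phi> k)" "integrable lebesgue (grad (\<phi> k))" for k
      using weak_gradD(1,2)[OF \<phi>g] by auto
    have e1: "(\<integral>x. \<bar>zero_ext \<Omega> u x - \<phi> k x\<bar> \<partial>lebesgue) \<le> e k" "(\<integral>x. norm (zero_ext \<Omega> ?g x - grad (\<phi> k) x) \<partial>lebesgue) \<le> e k" for k
      by (simp_all add: e_def)
    have bnd: "(\<integral>x. \<bar>f x * b x - h x * b x\<bar> \<partial>lebesgue) \<le> C * (\<integral>x. \<bar>h x - f x\<bar> \<partial>lebesgue)"
      if "integrable lebesgue f" "integrable lebesgue h" "\<And>x. \<bar>b x\<bar> \<le> C" for f h b :: "real ^ 'a \<Rightarrow> real" and C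
    proof -
      have "(\<integral>x. \<bar>f x * b x - h x * b x\<bar> \<partial>lebesgue) \<le> (\<integral>x. C * \<bar>h x - f x\<bar> \<partial>lebesgue)"
      proof (rule integral_mono')
        fix x
        have "\<bar>f x * b x - h x * b x\<bar> = \<bar>b x\<bar> * \<bar>h x - f x\<bar>" by (simp add: left_diff_distrib[symmetric] abs_mult abs_minus_commute)
        then show "\<bar>f x * b x - h x * b x\<bar> \<le> C * \<bar>h x - f x\<bar>" using that(3)[of x] by (simp add: mult_right_mono)
        show "0 \<le> C * \<bar>h x - f x\<bar>" using that(3)[of x] by simp
      qed (use that in auto)
      then show ?thesis by simp
    qed
    have 1: "(\<lambda>k. \<integral>x. \<phi> k x * partial_deriv i \<psi> x \<partial>lebesgue) \<longlonglongrightarrow> (\<integral>x. zero_ext \<Omega> u x * partial_deriv i \<psi> x \<partial>lebesgue)"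
    proof (rule tendsto_integral_L1)
      show "(\<lambda>k. B' * e k) \<longlonglongrightarrow> 0" by (rule tendsto_mult_right_zero[OF e0])
      show "(\<integral>x. \<bar>\<phi> k x * partial_deriv i \<psi> x - zero_ext \<Omega> u x * partial_deriv i \<psi> x\<bar> \<partial>lebesgue) \<le> B' * e k" for k
        by (rule order_trans[OF bnd[OF i\<phi>(1) iu B'] mult_left_mono[OF e1(1) B0(2)]])
    qed (intro integrable_mult_test i\<phi> iu Cc_infty_partial_deriv \<psi>)+
    have 2: "(\<lambda>k. \<integral>x. grad (\<phi> k) x $ i * \<psi> x \<partial>lebesgue) \<longlonglongrightarrow> (\<integral>x. zero_ext \<Omega> ?g x $ i * \<psi> x \<partial>lebesgue)"
    proof (rule tendsto_integral_L1)
      show "(\<lambda>k. B * e k) \<longlonglongrightarrow> 0" by (rule tendsto_mult_right_zero[OF e0])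
      show "(\<integral>x. \<bar>grad (\<phi> k) x $ i * \<psi> x - zero_ext \<Omega> ?g x $ i * \<psi> x\<bar> \<partial>lebesgue) \<le> B * e k" for k
      proof (rule order_trans[OF bnd[OF integrable_component[OF i\<phi>(2)] integrable_component[OF ig] B] mult_left_mono[OF _ B0(1)]])
        have "(\<integral>x. \<bar>zero_ext \<Omega> ?g x $ i - grad (\<phi> k) x $ i\<bar> \<partial>lebesgue) \<le> (\<integral>x. norm (zero_ext \<Omega> ?g x - grad (\<phi> k) x) \<partial>lebesgue)"
        proof (rule integral_mono')
          show "\<bar>zero_ext \<Omega> ?g x $ i - grad (\<phi> k) x $ i\<bar> \<le> norm (zero_ext \<Omega> ?g x - grad (\<phi> k) x)" for x
            using component_le_norm_cart[of "zero_ext \<Omega> ?g x - grad (\<phi> k) x" i] by simp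
        qed (use ig i\<phi> in auto)
        then show "(\<integral>x. \<bar>zero_ext \<Omega> ?g x $ i - grad (\<phi> k) x $ i\<bar> \<partial>lebesgue) \<le> e k" using e1(2)[of k] by linarith
      qed
    qed (intro integrable_mult_test integrable_component i\<phi> ig \<psi>)+
    have "(\<integral>x. \<phi> k x * partial_deriv i \<psi> x \<partial>lebesgue) = - (\<integral>x. grad (\<phi> k) x $ i * \<psi> x \<partial>lebesgue)" for k
      by (rule weak_gradD(4)[OF \<phi>g \<psi>])
    with 1 have "(\<lambda>k. - (\<integral>x. grad (\<phi> k) x $ i * \<psi> x \<partial>lebesgue)) \<longlonglongrightarrow> (\<integral>x. zero_ext \<Omega> u x * partial_deriv i \<psi> x \<partial>lebesgue)" by simp
    from LIMSEQ_unique[OF this tendsto_minus[OF 2]] show ?thesis .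
  qed
  then show ?thesis using iu ig by (simp add: weak_grad_def)
qed

lemma Cc_infty_W11_0:
  assumes \<Omega>: "open \<Omega>" and \<phi>: "\<phi> \<in> Cc_infty \<Omega>"
  shows "\<phi> \<in> W11_0 \<Omega>"
proof -
  have w: "weak_grad \<phi> (grad \<phi>)" by (rule weak_grad_test[OF Cc_infty_test[OF \<phi>]])
  have "has_weak_gradient \<Omega> (\<lambda>x. 0) (\<lambda>x. 0)" by (simp add: has_weak_gradient_def)
  then have ae: "AE x in lebesgue_on \<Omega>. weak_gradient \<Omega> (\<lambda>x. 0) x = 0"
    using weak_gradient_AE[OF \<Omega>] by (simp add: AE_lebesgue_on[OF open_sets_lebesgue[OF \<Omega>]])
  have "(\<integral>x. norm (weak_gradient \<Omega> (\<lambda>x. 0) x) \<partial>lebesgue_on \<Omega>) = 0"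
    by (rule integral_eq_zero_AE) (use ae in simp)
  then have "W11_norm \<Omega> (\<lambda>x. \<phi> x - \<phi> x) = 0" by (simp add: W11_norm_def)
  then show ?thesis
    using W11_weak_grad[OF \<Omega> w] \<phi> by (auto simp: W11_0_def intro!: exI[of _ "\<lambda>_. \<phi>"])
qed

section \<open>Geometry of Lipschitz domains\<close>

text \<open>
  In the direction \<open>e\<close> of the graph, a ball of radius \<open>s\<close> around \<open>e / 2\<close> generates a cone that is
  steeper than the Lipschitz function: translating along this cone strictly increases the height
  above the graph. It therefore leads from the closure into \<open>\<Omega>\<close>, and backwards from \<open>x0\<close> out of \<open>\<Omega>\<close>.
\<close>

lemma lipschitz_domain_chart:
  fixes \<Omega> :: "(real ^ 'n) set"
  assumes \<Omega>: "bounded_lipschitz_domain \<Omega>" and x0: "x0 \<in> frontier \<Omega>"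
  obtains e s r where "norm e = 1" "0 < s" "s \<le> 1 / 4" "0 < r"
    "\<And>y z \<delta>. y \<in> closure \<Omega> \<Longrightarrow> norm (y - x0) < r \<Longrightarrow> norm (z - (1 / 2) *\<^sub>R e) \<le> s \<Longrightarrow> 0 < \<delta> \<Longrightarrow> \<delta> < r \<Longrightarrow> y + \<delta> *\<^sub>R z \<in> \<Omega>"
    "\<And>z \<delta>. norm (z - (1 / 2) *\<^sub>R e) \<le> s \<Longrightarrow> 0 < \<delta> \<Longrightarrow> \<delta> < r \<Longrightarrow> x0 - \<delta> *\<^sub>R z \<notin> \<Omega>"
proof -
  have "open \<Omega>" using \<Omega> by (simp add: bounded_lipschitz_domain_def)
  obtain R e C and h :: "real ^ 'n \<Rightarrow> real" where R: "0 < R" and e: "norm e = 1"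
    and h: "C-lipschitz_on {y. y \<bullet> e = 0} h"
    and chart: "\<Omega> \<inter> ball x0 R = {x \<in> ball x0 R. h (x - (x \<bullet> e) *\<^sub>R e) < x \<bullet> e}"
    using \<Omega> x0 unfolding bounded_lipschitz_domain_def by blast
  define P where "P x = x - (x \<bullet> e) *\<^sub>R e" for x :: "real ^ 'n"
  have ee: "e \<bullet> e = 1" using e by (simp add: dot_square_norm)
  have P0: "P x \<bullet> e = 0" for x by (simp add: P_def inner_diff_left ee)
  have Pe: "P (c *\<^sub>R e) = 0" for c by (simp add: P_def ee)
  have Plin: "P (x + y) = P x + P y" "P (c *\<^sub>R x) = c *\<^sub>R P x" "P (x - y) = P x - P y" for x y c
    by (simp_all add: P_def inner_add_left inner_diff_left algebra_simps)
  have Ple: "norm (P x) \<le> norm x" for x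
  proof -
    have "(norm (P x))\<^sup>2 = (norm x)\<^sup>2 - (x \<bullet> e)\<^sup>2"
      unfolding power2_norm_eq_inner by (simp add: P_def inner_diff_left inner_diff_right ee inner_commute power2_eq_square)
    then have "(norm (P x))\<^sup>2 \<le> (norm x)\<^sup>2" by simp
    then show ?thesis by (simp add: power2_le_iff_abs_le)
  qed
  have C: "0 \<le> C" using h by (rule lipschitz_on_nonneg)
  have hlip: "\<bar>h (P x) - h (P y)\<bar> \<le> C * norm (P (x - y))" for x y
    using lipschitz_onD[OF h, of "P x" "P y"] P0 by (simp add: dist_norm Plin)
  \<comment> \<open>chosen so that \<open>C * s < 1 / 2 - s\<close>: for \<open>z\<close> within \<open>s\<close> of \<open>e / 2\<close>, the height \<open>z \<bullet> e\<close> exceeds \<open>C\<close> times the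
    tangential part of \<open>z\<close>\<close>
  define s where "s = 1 / (4 * (C + 1))"
  have "0 < C + 1" using C by simp
  moreover have "q * (1 / (4 * q)) = 1 / 4" if "0 < q" for q :: real using that by simp
  ultimately have "(C + 1) * s = 1 / 4" unfolding s_def by blast
  then have s3: "C * s + s = 1 / 4" by (simp add: distrib_right)
  have s1: "0 < s" using C by (simp add: s_def)
  have "0 \<le> C * s" using C s1 by simp
  with s3 have "s \<le> 1 / 4" by linarith
  note s = s1 this s3
  have zb: "norm (P z) \<le> s" "1 / 2 - s \<le> z \<bullet> e" "norm z \<le> 3 / 4" if "norm (z - (1 / 2) *\<^sub>R e) \<le> s" for z
  proof -
    have "P z = P (z - (1 / 2) *\<^sub>R e)" by (simp only: Plin(3) Pe diff_zero)
    then show "norm (P z) \<le> s" using Ple[of "z - (1 / 2) *\<^sub>R e"] that by simp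
    have "\<bar>(z - (1 / 2) *\<^sub>R e) \<bullet> e\<bar> \<le> s"
      using Cauchy_Schwarz_ineq2[of "z - (1 / 2) *\<^sub>R e" e] e that by simp
    then show "1 / 2 - s \<le> z \<bullet> e" by (simp add: inner_diff_left ee)
    have "norm z \<le> norm (z - (1 / 2) *\<^sub>R e) + norm ((1 / 2) *\<^sub>R e)"
      using norm_triangle_ineq[of "z - (1 / 2) *\<^sub>R e" "(1 / 2) *\<^sub>R e"] by simp
    then show "norm z \<le> 3 / 4" using that s(2) e by simp
  qed
  have hcont: "continuous_on UNIV (\<lambda>x. h (P x))"
  proof (rule continuous_on_compose2[OF lipschitz_on_continuous_on[OF h]])
    show "continuous_on UNIV P" unfolding P_def[abs_def] by (intro continuous_intros)
  qed (use P0 in auto)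
  show ?thesis
  proof (rule that[OF e s(1,2), of "R / 2"])
    show "0 < R / 2" using R by simp
    fix z :: "real ^ 'n" and \<delta> assume z: "norm (z - (1 / 2) *\<^sub>R e) \<le> s" and \<delta>: "0 < \<delta>" "\<delta> < R / 2"
    note zb = zb[OF z]
    have dz: "norm (\<delta> *\<^sub>R z) < R / 2"
    proof -
      have "norm (\<delta> *\<^sub>R z) = \<delta> * norm z" using \<delta> by simp
      also have "\<dots> \<le> \<delta> * (3 / 4)" using zb(3) \<delta> by (intro mult_left_mono) auto
      finally show ?thesis using \<delta> by linarith
    qed
    have key: "C * norm (P (\<delta> *\<^sub>R z)) < (\<delta> *\<^sub>R z) \<bullet> e"
    proof -
      have "C * norm (P z) \<le> C * s" using zb(1) C by (intro mult_left_mono)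
      also have "\<dots> < 1 / 2 - s" using s(3) by simp
      also have "\<dots> \<le> z \<bullet> e" by (rule zb(2))
      finally have "\<delta> * (C * norm (P z)) < \<delta> * (z \<bullet> e)" using \<delta>(1) by (intro mult_strict_left_mono)
      then show ?thesis using \<delta>(1) by (simp add: Plin algebra_simps)
    qed
    show "x0 - \<delta> *\<^sub>R z \<notin> \<Omega>"
    proof
      assume "x0 - \<delta> *\<^sub>R z \<in> \<Omega>"
      moreover have "x0 - \<delta> *\<^sub>R z \<in> ball x0 R" using dz R by (simp add: dist_norm)
      ultimately have "x0 - \<delta> *\<^sub>R z \<in> {x \<in> ball x0 R. h (x - (x \<bullet> e) *\<^sub>R e) < x \<bullet> e}" using chart by blast
      then have 1: "h (P (x0 - \<delta> *\<^sub>R z)) < (x0 - \<delta> *\<^sub>R z) \<bullet> e" unfolding P_def by blast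
      have "x0 \<notin> \<Omega>" using x0 \<open>open \<Omega>\<close> by (simp add: frontier_def interior_open)
      have 2: "x0 \<bullet> e \<le> h (P x0)"
      proof (rule ccontr)
        assume "\<not> x0 \<bullet> e \<le> h (P x0)"
        then have "x0 \<in> {x \<in> ball x0 R. h (x - (x \<bullet> e) *\<^sub>R e) < x \<bullet> e}" using R by (simp add: P_def)
        then show False using chart \<open>x0 \<notin> \<Omega>\<close> by blast
      qed
      have "h (P x0) \<le> h (P (x0 - \<delta> *\<^sub>R z)) + C * norm (P (\<delta> *\<^sub>R z))"
        using hlip[of x0 "x0 - \<delta> *\<^sub>R z"] by simp
      then show False using 1 2 key by (simp add: inner_diff_left)
    qed
    fix y assume y: "y \<in> closure \<Omega>" "norm (y - x0) < R / 2"
    have hy: "h (P y) \<le> y \<bullet> e"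
    proof (rule ccontr)
      assume "\<not> h (P y) \<le> y \<bullet> e"
      then have "y \<in> {x. x \<bullet> e < h (P x)} \<inter> ball x0 R" using y(2) R by (auto simp: dist_norm norm_minus_commute)
      moreover have "open ({x. x \<bullet> e < h (P x)} \<inter> ball x0 R)"
        by (intro open_Int open_ball open_Collect_less continuous_intros hcont)
      ultimately obtain x where "x \<in> \<Omega>" "x \<in> ball x0 R" "x \<bullet> e < h (P x)"
        using y(1) open_Int_closure_eq_empty[of "{x. x \<bullet> e < h (P x)} \<inter> ball x0 R" \<Omega>] by blast
      then have "x \<in> {x \<in> ball x0 R. h (x - (x \<bullet> e) *\<^sub>R e) < x \<bullet> e}" using chart by blast
      then show False using \<open>x \<bullet> e < h (P x)\<close> by (simp add: P_def)
    qed
    have "h (P (y + \<delta> *\<^sub>R z)) \<le> h (P y) + C * norm (P (\<delta> *\<^sub>R z))"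
      using hlip[of "y + \<delta> *\<^sub>R z" y] by simp
    also have "\<dots> < (y + \<delta> *\<^sub>R z) \<bullet> e" using hy key by (simp add: inner_add_left)
    finally have "h (P (y + \<delta> *\<^sub>R z)) < (y + \<delta> *\<^sub>R z) \<bullet> e" .
    moreover have "y + \<delta> *\<^sub>R z \<in> ball x0 R"
      using y(2) dz norm_triangle_ineq[of "y - x0" "\<delta> *\<^sub>R z"] by (simp add: dist_norm norm_minus_commute algebra_simps)
    ultimately have "y + \<delta> *\<^sub>R z \<in> {x \<in> ball x0 R. h (x - (x \<bullet> e) *\<^sub>R e) < x \<bullet> e}" by (simp add: P_def)
    then show "y + \<delta> *\<^sub>R z \<in> \<Omega>" using chart by blast
  qed
qed

text \<open>
  At an interior point any mollifier will do; at a boundary point its support is placed in the ball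
  that generates the inward cone of the chart.
\<close>

lemma inward_mollifier:
  fixes \<Omega> :: "(real ^ 'n) set"
  assumes \<Omega>: "bounded_lipschitz_domain \<Omega>" and x0: "x0 \<in> closure \<Omega>"
  obtains \<rho> r K where "mollifier \<rho>" "0 < r" "compact K" "\<And>z. \<rho> z \<noteq> 0 \<Longrightarrow> z \<in> K"
    "\<And>y z \<delta>. y \<in> closure \<Omega> \<Longrightarrow> y \<in> cball x0 r \<Longrightarrow> z \<in> K \<Longrightarrow> 0 < \<delta> \<Longrightarrow> \<delta> < r \<Longrightarrow> y + \<delta> *\<^sub>R z \<in> \<Omega>"
proof (cases "x0 \<in> \<Omega>")
  case True
  have "open \<Omega>" using \<Omega> by (simp add: bounded_lipschitz_domain_def)
  then obtain R where R: "0 < R" "ball x0 R \<subseteq> \<Omega>" using True open_contains_ball by blast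
  obtain \<rho> :: "real ^ 'n \<Rightarrow> real" where \<rho>: "mollifier \<rho>" using ex_mollifier by blast
  show ?thesis
  proof (rule that[OF \<rho>, of "R / 2" "cball 0 1"])
    fix y z :: "real ^ 'n" and \<delta> assume *: "y \<in> cball x0 (R / 2)" "z \<in> cball 0 1" "0 < \<delta>" "\<delta> < R / 2"
    have "\<delta> * norm z \<le> \<delta> * 1" using * by (intro mult_left_mono) auto
    moreover have "norm (\<delta> *\<^sub>R z) = \<delta> * norm z" using * by simp
    ultimately have "norm (\<delta> *\<^sub>R z) < R / 2" using *(4) by linarith
    then have "y + \<delta> *\<^sub>R z \<in> ball x0 R"
      using *(1) norm_triangle_ineq[of "y - x0" "\<delta> *\<^sub>R z"] by (simp add: dist_norm norm_minus_commute algebra_simps)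
    then show "y + \<delta> *\<^sub>R z \<in> \<Omega>" using R by auto
  qed (use R \<rho> in \<open>auto simp: mollifier_def\<close>)
next
  case False
  then have "x0 \<in> frontier \<Omega>" using x0 \<Omega> by (simp add: frontier_def interior_open bounded_lipschitz_domain_def)
  then obtain e s r where *: "norm e = 1" "0 < s" "s \<le> 1 / 4" "0 < r"
    and in\<Omega>: "\<And>y z \<delta>. y \<in> closure \<Omega> \<Longrightarrow> norm (y - x0) < r \<Longrightarrow> norm (z - (1 / 2) *\<^sub>R e) \<le> s \<Longrightarrow> 0 < \<delta> \<Longrightarrow> \<delta> < r \<Longrightarrow> y + \<delta> *\<^sub>R z \<in> \<Omega>"
    using lipschitz_domain_chart[OF \<Omega>] by metis
  have "cball ((1 / 2) *\<^sub>R e) s \<subseteq> cball 0 1"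
  proof
    fix z assume "z \<in> cball ((1 / 2) *\<^sub>R e) s"
    then have "norm (z - (1 / 2) *\<^sub>R e) \<le> s" by (simp add: dist_norm norm_minus_commute)
    then show "z \<in> cball 0 1"
      using * norm_triangle_ineq[of "z - (1 / 2) *\<^sub>R e" "(1 / 2) *\<^sub>R e"] by simp
  qed
  then obtain \<rho> where \<rho>: "mollifier \<rho>" "\<And>z. \<rho> z \<noteq> 0 \<Longrightarrow> z \<in> cball ((1 / 2) *\<^sub>R e) s"
    using mollifier_exists[OF *(2)] by blast
  show ?thesis
  proof (rule that[OF \<rho>(1), of "r / 2" "cball ((1 / 2) *\<^sub>R e) s"])
    fix y z \<delta> assume "y \<in> closure \<Omega>" "y \<in> cball x0 (r / 2)" "z \<in> cball ((1 / 2) *\<^sub>R e) s" "0 < \<delta>" "\<delta> < r / 2"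
    then show "y + \<delta> *\<^sub>R z \<in> \<Omega>"
      using *(4) by (intro in\<Omega>) (auto simp: dist_norm norm_minus_commute)
  qed (use * \<rho> in auto)
qed

section \<open>Hoelder functions with zero boundary values vanish on the boundary\<close>

lemma has_derivative_max_0_sq: "((\<lambda>s. (max 0 s)\<^sup>2) has_real_derivative 2 * max 0 s) (at s)"
proof (cases s "0::real" rule: linorder_cases)
  case less
  then have "((\<lambda>_. 0) has_real_derivative 2 * max 0 s) (at s)" by simp
  then show ?thesis
    by (rule has_field_derivative_transform_within_open[of _ _ _ "{..<0}"]) (use less in auto)
next
  case greater
  have "((\<lambda>s. s\<^sup>2) has_real_derivative 2 * max 0 s) (at s)" using greater by (auto intro!: derivative_eq_intros)
  then show ?thesis
    by (rule has_field_derivative_transform_within_open[of _ _ _ "{0<..}"]) (use greater in auto)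
next
  case equal
  have "((\<lambda>h::real. (max 0 h)\<^sup>2 / h) \<longlongrightarrow> 0) (at 0)"
  proof (rule Lim_null_comparison)
    show "((\<lambda>h::real. norm h) \<longlongrightarrow> 0) (at 0)" by (intro tendsto_norm_zero tendsto_ident_at)
    show "\<forall>\<^sub>F h::real in at 0. norm ((max 0 h)\<^sup>2 / h) \<le> norm h"
      by (intro always_eventually allI) (auto simp: max_def power2_eq_square)
  qed
  then show ?thesis using equal by (simp add: DERIV_def)
qed

text \<open>
  The function \<open>c ^ 4 - (max 0 (c\<^sup>2 - s\<^sup>2))\<^sup>2\<close>: squaring the truncated parabola makes it \<open>C\<^sup>1\<close>.
\<close>

lemma smooth_step:
  assumes c: "0 < (c::real)"
  obtains H H' :: "real \<Rightarrow> real" and C k where "\<And>s. (H has_real_derivative H' s) (at s)" "continuous_on UNIV H'"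
    "\<And>s. \<bar>H' s\<bar> \<le> C" "H 0 = 0" "H' 0 = 0" "0 < k" "\<And>s. c \<le> \<bar>s\<bar> \<Longrightarrow> H s = k" "\<And>s. c \<le> \<bar>s\<bar> \<Longrightarrow> H' s = 0"
proof (rule that)
  let ?H = "\<lambda>s. c ^ 4 - (max 0 (c\<^sup>2 - s\<^sup>2))\<^sup>2" and ?H' = "\<lambda>s. 4 * s * max 0 (c\<^sup>2 - s\<^sup>2)"
  have z: "max 0 (c\<^sup>2 - s\<^sup>2) = 0" if "c \<le> \<bar>s\<bar>" for s
    using that c power_mono[of c "\<bar>s\<bar>" 2] by simp
  show "(?H has_real_derivative ?H' s) (at s)" for s
  proof -
    have "((\<lambda>s. c\<^sup>2 - s\<^sup>2) has_real_derivative - 2 * s) (at s)" by (auto intro!: derivative_eq_intros)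
    from DERIV_chain2[OF has_derivative_max_0_sq this]
    have "((\<lambda>s. (max 0 (c\<^sup>2 - s\<^sup>2))\<^sup>2) has_real_derivative 2 * max 0 (c\<^sup>2 - s\<^sup>2) * (- 2 * s)) (at s)" .
    from DERIV_diff[OF DERIV_const this] show ?thesis by (simp add: mult_ac)
  qed
  show "continuous_on UNIV ?H'" by (intro continuous_intros)
  show "\<bar>?H' s\<bar> \<le> 4 * c * c\<^sup>2" for s
  proof (cases "c \<le> \<bar>s\<bar>")
    case True then show ?thesis using z[OF True] c by simp
  next
    case False
    have "\<bar>?H' s\<bar> = 4 * \<bar>s\<bar> * max 0 (c\<^sup>2 - s\<^sup>2)" by (simp add: abs_mult)
    also have "\<dots> \<le> 4 * c * c\<^sup>2" using False c by (intro mult_mono) auto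
    finally show ?thesis .
  qed
  show "0 < c ^ 4" using c by simp
  show "?H 0 = 0" "?H' 0 = 0" by (simp_all add: max_def)
  show "?H s = c ^ 4" if "c \<le> \<bar>s\<bar>" for s using z[OF that] by simp
  show "?H' s = 0" if "c \<le> \<bar>s\<bar>" for s using z[OF that] by simp
qed

lemma holder_spaceE:
  assumes "v \<in> holder_space \<Omega> \<gamma>"
  obtains B where "0 \<le> B" "\<And>x y. x \<in> \<Omega> \<Longrightarrow> y \<in> \<Omega> \<Longrightarrow> \<bar>v x - v y\<bar> \<le> B * dist x y powr \<gamma>"
proof -
  obtain B where B: "\<And>x y. x \<in> \<Omega> \<Longrightarrow> y \<in> \<Omega> \<Longrightarrow> x \<noteq> y \<Longrightarrow> \<bar>v x - v y\<bar> / dist x y powr \<gamma> \<le> B"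
    using assms unfolding holder_space_def bdd_above_def by blast
  have "\<bar>v x - v y\<bar> \<le> max 0 B * dist x y powr \<gamma>" if "x \<in> \<Omega>" "y \<in> \<Omega>" for x y
  proof (cases "x = y")
    case False
    then have "\<bar>v x - v y\<bar> \<le> B * dist x y powr \<gamma>" using B[OF that False] by (simp add: divide_le_eq)
    also have "\<dots> \<le> max 0 B * dist x y powr \<gamma>" by (intro mult_right_mono) auto
    finally show ?thesis .
  qed auto
  then show ?thesis using that[of "max 0 B"] by auto
qed

text \<open>
  If \<open>v\<close> did not tend to 0 at \<open>x0\<close>, then \<open>\<bar>v\<bar> \<ge> c > 0\<close> on \<open>\<Omega>\<close> near \<open>x0\<close>. Composing with a step function
  gives a function which, near \<open>x0\<close>, is a positive multiple of the indicator of \<open>\<Omega>\<close> and has zero weak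
  gradient. Its mollifications are then constant near \<open>x0\<close>, but they vanish at points well outside \<open>\<Omega>\<close>
  and are positive at points well inside, and both kinds exist by the two cones of the chart.
\<close>

lemma holder_boundary_value:
  fixes \<Omega> :: "(real ^ 'n) set"
  assumes \<Omega>: "bounded_lipschitz_domain \<Omega>" and \<gamma>: "0 < \<gamma>"
    and v: "\<And>x y. x \<in> \<Omega> \<Longrightarrow> y \<in> \<Omega> \<Longrightarrow> \<bar>v x - v y\<bar> \<le> B * dist x y powr \<gamma>" and B: "0 \<le> B"
    and g: "weak_grad (zero_ext \<Omega> v) g"
    and x: "x \<in> \<Omega>" and x0: "x0 \<in> frontier \<Omega>"
  shows "\<bar>v x\<bar> \<le> B * dist x x0 powr \<gamma>"
proof (rule ccontr)
  assume "\<not> \<bar>v x\<bar> \<le> B * dist x x0 powr \<gamma>"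
  define c where "c = (\<bar>v x\<bar> - B * dist x x0 powr \<gamma>) / 2"
  have c: "0 < c" using \<open>\<not> _\<close> by (simp add: c_def)
  have "open \<Omega>" using \<Omega> by (simp add: bounded_lipschitz_domain_def)
  have "((\<lambda>y. B * dist x y powr \<gamma>) \<longlongrightarrow> B * dist x x0 powr \<gamma>) (at x0)"
    using \<gamma> by (intro tendsto_mult tendsto_const tendsto_powr' tendsto_dist tendsto_ident_at) auto
  then have "\<forall>\<^sub>F y in at x0. B * dist x y powr \<gamma> < B * dist x x0 powr \<gamma> + c"
    using c by (intro order_tendstoD(2)) auto
  then obtain r1 where r1: "0 < r1" "\<And>y. y \<noteq> x0 \<Longrightarrow> dist y x0 < r1 \<Longrightarrow> B * dist x y powr \<gamma> < B * dist x x0 powr \<gamma> + c"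
    by (auto simp: eventually_at)
  have x0n: "x0 \<notin> \<Omega>" using x0 \<open>open \<Omega>\<close> by (simp add: frontier_def interior_open)
  have vc: "c \<le> \<bar>v y\<bar>" if "y \<in> \<Omega>" "y \<in> ball x0 r1" for y
  proof -
    have "B * dist x y powr \<gamma> < B * dist x x0 powr \<gamma> + c"
      using that x0n by (intro r1(2)) (auto simp: dist_commute)
    then show ?thesis using v[OF x that(1)] by (simp add: c_def field_simps)
  qed
  obtain H H' :: "real \<Rightarrow> real" and C k where H: "\<And>s. (H has_real_derivative H' s) (at s)" "continuous_on UNIV H'"
    "\<And>s. \<bar>H' s\<bar> \<le> C" "H 0 = 0" and H'0: "H' 0 = 0" and k: "0 < k"
    and Hc: "\<And>s. c \<le> \<bar>s\<bar> \<Longrightarrow> H s = k" "\<And>s. c \<le> \<bar>s\<bar> \<Longrightarrow> H' s = 0"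
    using smooth_step[OF c] by metis
  define w where "w y = H (zero_ext \<Omega> v y)" for y
  define G where "G y = H' (zero_ext \<Omega> v y) *\<^sub>R g y" for y
  have wG: "weak_grad w G" unfolding w_def[abs_def] G_def[abs_def] by (rule weak_grad_chain[OF g H])
  have w_in: "y \<in> \<Omega> \<Longrightarrow> y \<in> ball x0 r1 \<Longrightarrow> w y = k" for y
    using vc by (simp add: w_def zero_ext_simps Hc)
  have w_out: "y \<notin> \<Omega> \<Longrightarrow> w y = 0" for y using H(4) by (simp add: w_def zero_ext_simps)
  have G0: "y \<in> ball x0 r1 \<Longrightarrow> G y = 0" for y
    using vc[of y] H'0 Hc(2) by (cases "y \<in> \<Omega>") (auto simp: G_def zero_ext_simps)
  obtain e s r where e: "norm e = 1" and s: "0 < s" "s \<le> 1 / 4" and r: "0 < r"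
    and into: "\<And>y z \<delta>. y \<in> closure \<Omega> \<Longrightarrow> norm (y - x0) < r \<Longrightarrow> norm (z - (1 / 2) *\<^sub>R e) \<le> s \<Longrightarrow> 0 < \<delta> \<Longrightarrow> \<delta> < r \<Longrightarrow> y + \<delta> *\<^sub>R z \<in> \<Omega>"
    and outof: "\<And>z \<delta>. norm (z - (1 / 2) *\<^sub>R e) \<le> s \<Longrightarrow> 0 < \<delta> \<Longrightarrow> \<delta> < r \<Longrightarrow> x0 - \<delta> *\<^sub>R z \<notin> \<Omega>"
    using lipschitz_domain_chart[OF \<Omega> x0] by metis
  define \<tau> where "\<tau> = min r r1 / 2"
  have \<tau>: "0 < \<tau>" "\<tau> < r" "\<tau> \<le> r1 / 2" using r r1 by (auto simp: \<tau>_def)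
  \<comment> \<open>with this radius the balls around \<open>x0 \<plusminus> \<tau> * e / 2\<close> are the images of the ball generating the cone\<close>
  define \<delta> where "\<delta> = \<tau> * s"
  have \<delta>: "0 < \<delta>" "\<delta> \<le> \<tau> / 4" using \<tau> s by (auto simp: \<delta>_def)
  obtain \<rho> :: "real ^ 'n \<Rightarrow> real" where \<rho>: "mollifier \<rho>" using ex_mollifier by blast
  let ?k = "rescale \<rho> \<delta>"
  note m = mollifier_rescale[OF \<rho> \<delta>(1)]
  have x0c: "x0 \<in> closure \<Omega>" using x0 by (simp add: frontier_def)
  have k0: "?k z = 0" if "\<delta> < norm z" for z using m(4)[of z] that by linarith
  \<comment> \<open>the kernel has radius less than \<open>r1 / 2\<close>, so on this ball it only sees points at which \<open>G\<close> vanishes\<close>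
  have "\<exists>c. \<forall>x\<in>ball x0 (r1 / 2). conv ?k w x = c"
  proof (rule has_derivative_zero_constant[OF convex_ball])
    fix x assume x: "x \<in> ball x0 (r1 / 2)"
    have "partial_deriv i (conv ?k w) x = 0" for i
    proof -
      have "conv ?k (\<lambda>y. G y $ i) x = 0"
      proof (rule conv_eq_0)
        fix y assume "G y $ i \<noteq> 0"
        then have "y \<notin> ball x0 r1" using G0[of y] by auto
        then have "r1 / 2 < norm (x - y)" using x dist_triangle[of x0 y x] by (auto simp: dist_norm)
        then show "?k (x - y) = 0" using \<delta> \<tau> by (intro k0) simp
      qed
      then show ?thesis using weak_grad_conv[OF wG m(1)] by simp
    qed
    then have "(conv ?k w has_derivative (\<lambda>h. 0)) (at x)"
      using has_derivative_partial_deriv[OF conv_differentiable[OF m(1) weak_gradD(1)[OF wG]], of x] by simp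
    then show "(conv ?k w has_derivative (\<lambda>h. 0)) (at x within ball x0 (r1 / 2))"
      by (rule has_derivative_at_withinI)
  qed
  then obtain a where a: "\<And>x. x \<in> ball x0 (r1 / 2) \<Longrightarrow> conv ?k w x = a" by blast
  let ?p = "x0 + \<tau> *\<^sub>R ((1 / 2) *\<^sub>R e)" and ?q = "x0 - \<tau> *\<^sub>R ((1 / 2) *\<^sub>R e)"
  have pq: "?p \<in> ball x0 (r1 / 2)" "?q \<in> ball x0 (r1 / 2)" using \<tau> e by (auto simp: dist_norm)
  have scaled: "norm ((1 / 2) *\<^sub>R e + (1 / \<tau>) *\<^sub>R b - (1 / 2) *\<^sub>R e) \<le> s" if "norm b \<le> \<delta>" for b
    using that \<tau>(1) by (simp add: \<delta>_def divide_le_eq mult.commute)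
  have near_p: "y \<in> \<Omega>" "y \<in> ball x0 r1" if "norm (?p - y) \<le> \<delta>" for y
  proof -
    have n: "norm (y - ?p) \<le> \<delta>" using that by (simp add: norm_minus_commute)
    have "x0 + \<tau> *\<^sub>R ((1 / 2) *\<^sub>R e + (1 / \<tau>) *\<^sub>R (y - ?p)) \<in> \<Omega>"
      using scaled[OF n] \<tau> r by (intro into x0c) auto
    moreover have "x0 + \<tau> *\<^sub>R ((1 / 2) *\<^sub>R e + (1 / \<tau>) *\<^sub>R (y - ?p)) = y"
      using \<tau>(1) by (simp add: algebra_simps)
    ultimately show "y \<in> \<Omega>" by simp
    have "dist x0 y \<le> dist x0 ?p + dist ?p y" by (rule dist_triangle)
    also have "\<dots> < r1" using \<tau> \<delta> that e by (simp add: dist_norm)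
    finally show "y \<in> ball x0 r1" by simp
  qed
  have near_q: "y \<notin> \<Omega>" if "norm (?q - y) \<le> \<delta>" for y
  proof -
    have "x0 - \<tau> *\<^sub>R ((1 / 2) *\<^sub>R e + (1 / \<tau>) *\<^sub>R (?q - y)) \<notin> \<Omega>"
      using scaled[OF that] \<tau> by (intro outof) auto
    moreover have "x0 - \<tau> *\<^sub>R ((1 / 2) *\<^sub>R e + (1 / \<tau>) *\<^sub>R (?q - y)) = y"
      using \<tau>(1) by (simp add: algebra_simps)
    ultimately show "y \<notin> \<Omega>" by simp
  qed
  have "conv ?k w ?q = 0"
  proof (rule conv_eq_0)
    fix y assume "w y \<noteq> 0"
    then have "\<not> norm (?q - y) \<le> \<delta>" using near_q[of y] w_out[of y] by auto
    then show "?k (?q - y) = 0" by (intro k0) simp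
  qed
  moreover have "conv ?k w ?p = k"
  proof -
    have "?k (?p - y) * w y = ?k (?p - y) * k" for y
      using near_p[of y] w_in[of y] k0[of "?p - y"] by (cases "norm (?p - y) \<le> \<delta>") auto
    then have "conv ?k w ?p = (\<integral>y. ?k (?p - y) * k \<partial>lebesgue)" by (simp only: conv_def real_scaleR_def)
    also have "\<dots> = k"
      using integral_lebesgue_reflect[OF test_integrable[OF m(1)], of ?p] m(3) by simp
    finally show ?thesis .
  qed
  ultimately show False using a[OF pq(1)] a[OF pq(2)] k by simp
qed

text \<open>
  A segment from a point of \<open>\<Omega>\<close> to a point outside meets the boundary, where \<open>v\<close> has the value 0.
\<close>

lemma holder_zero_ext:
  fixes \<Omega> :: "(real ^ 'n) set"
  assumes \<Omega>: "bounded_lipschitz_domain \<Omega>" and \<gamma>: "0 < \<gamma>"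
    and v: "v \<in> holder_space \<Omega> \<gamma>" and g: "weak_grad (zero_ext \<Omega> v) g"
  obtains B where "0 \<le> B" "\<And>x y. \<bar>zero_ext \<Omega> v x - zero_ext \<Omega> v y\<bar> \<le> B * dist x y powr \<gamma>"
proof -
  obtain B where B: "0 \<le> B" "\<And>x y. x \<in> \<Omega> \<Longrightarrow> y \<in> \<Omega> \<Longrightarrow> \<bar>v x - v y\<bar> \<le> B * dist x y powr \<gamma>"
    using holder_spaceE[OF v] by blast
  have io: "\<bar>v x\<bar> \<le> B * dist x y powr \<gamma>" if "x \<in> \<Omega>" "y \<notin> \<Omega>" for x y
  proof -
    have "closed_segment x y \<inter> frontier \<Omega> \<noteq> {}"
      using that by (intro connected_Int_frontier) auto
    then obtain x0 where x0: "x0 \<in> closed_segment x y" "x0 \<in> frontier \<Omega>" by blast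
    have "\<bar>v x\<bar> \<le> B * dist x x0 powr \<gamma>"
      by (rule holder_boundary_value[OF \<Omega> \<gamma> B(2) B(1) g that(1) x0(2)])
    also have "\<dots> \<le> B * dist x y powr \<gamma>"
      using B(1) \<gamma> dist_in_closed_segment[OF x0(1)] by (intro mult_left_mono powr_mono2) (auto simp: dist_commute)
    finally show ?thesis .
  qed
  have "\<bar>zero_ext \<Omega> v x - zero_ext \<Omega> v y\<bar> \<le> B * dist x y powr \<gamma>" for x y
    using B io[of x y] io[of y x] by (cases "x \<in> \<Omega>"; cases "y \<in> \<Omega>") (auto simp: zero_ext_simps dist_commute)
  then show ?thesis using that B(1) by blast
qed

section \<open>Partitions of unity\<close>

text \<open>
  Finitely many bumps are divided by their sum. To keep the denominator positive off \<open>S\<close>, it is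
  increased by \<open>flat_exp 0 (c - b)\<close>, where \<open>b\<close> is the sum of the bumps and \<open>c > 0\<close> its minimum on \<open>S\<close>; this
  term vanishes wherever \<open>b \<ge> c\<close>, in particular on \<open>S\<close>.
\<close>

lemma partition_of_unity:
  fixes S :: "(real ^ 'n) set"
  assumes S: "compact S" "S \<noteq> {}" and r: "\<And>x. x \<in> S \<Longrightarrow> 0 < r x"
  obtains I \<zeta> where "finite I" "I \<subseteq> S" "\<And>i. i \<in> I \<Longrightarrow> test (\<zeta> i)" "\<And>i x. i \<in> I \<Longrightarrow> \<bar>\<zeta> i x\<bar> \<le> 1"
    "\<And>i x. i \<in> I \<Longrightarrow> x \<notin> cball i (r i) \<Longrightarrow> \<zeta> i x = 0" "\<And>x. x \<in> S \<Longrightarrow> (\<Sum>i\<in>I. \<zeta> i x) = 1"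
proof -
  have "S \<subseteq> (\<Union>x\<in>S. ball x (r x))" using r by auto
  from compactE_image[OF S(1) _ this] obtain I where I: "I \<subseteq> S" "finite I" "S \<subseteq> (\<Union>x\<in>I. ball x (r x))" by auto
  let ?b = "\<lambda>x. \<Sum>i\<in>I. bump i (r i) x"
  have b0: "0 \<le> ?b x" for x by (intro sum_nonneg bump_nonneg)
  have sb: "smooth ?b" by (intro smooth_sum smooth_bump)
  obtain x1 where x1: "x1 \<in> S" "\<And>x. x \<in> S \<Longrightarrow> ?b x1 \<le> ?b x"
    using continuous_attains_inf[OF S smooth_continuous[OF sb]] by blast
  define c where "c = ?b x1"
  have c: "0 < c"
  proof -
    obtain i where i: "i \<in> I" "x1 \<in> ball i (r i)" using I x1 by blast
    have "0 < bump i (r i) x1" using i by (intro bump_pos) (simp add: dist_norm norm_minus_commute)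
    also have "\<dots> \<le> c" unfolding c_def by (rule member_le_sum[OF i(1) bump_nonneg I(2)])
    finally show ?thesis .
  qed
  define D where "D x = ?b x + flat_exp 0 (c - ?b x)" for x
  have sD: "smooth D" unfolding D_def by (intro smooth_add sb smooth_flat_exp smooth_diff smooth_const)
  have D: "0 < D x" "?b x \<le> D x" for x
    using b0[of x] c flat_exp_nonneg[of 0 "c - ?b x"] flat_exp_pos[of "c - ?b x" 0]
    by (cases "?b x = 0"; force simp: D_def intro: add_pos_nonneg)+
  have DS: "D x = ?b x" if "x \<in> S" for x using x1(2)[OF that] by (simp add: D_def c_def flat_exp_eq_0)
  show ?thesis
  proof (rule that[OF I(2,1)])
    fix i assume i: "i \<in> I"
    have ri: "0 < r i" using i I r by auto
    show "test (\<lambda>x. inverse (D x) * bump i (r i) x)"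
      using D(1) ri by (intro test_mult smooth_inverse sD test_bump) (auto simp: less_imp_neq[THEN not_sym])
    show "\<bar>inverse (D x) * bump i (r i) x\<bar> \<le> 1" for x
    proof -
      have "bump i (r i) x \<le> D x" using member_le_sum[OF i bump_nonneg I(2)] D(2)[of x] by (rule order_trans)
      then show ?thesis using D(1)[of x] bump_nonneg[of i "r i" x] by (simp add: abs_mult field_simps)
    qed
    show "inverse (D x) * bump i (r i) x = 0" if "x \<notin> cball i (r i)" for x
      using bump_eq_0[of "r i" x i] that ri by (simp add: dist_norm norm_minus_commute)
  next
    fix x assume "x \<in> S"
    then have "(\<Sum>i\<in>I. inverse (D x) * bump i (r i) x) = inverse (D x) * D x"
      by (simp add: DS sum_distrib_left)
    then show "(\<Sum>i\<in>I. inverse (D x) * bump i (r i) x) = 1" using D(1)[of x] by simp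
  qed
qed

section \<open>A dominated convergence theorem with moving bounds\<close>

text \<open>
  The truncations \<open>min (f n) (H + F)\<close> converge by dominated convergence, and what is cut off is at most
  \<open>\<bar>h n - H\<bar>\<close>, which tends to zero in \<open>L\<^sup>1\<close>.
\<close>

lemma integral_tendsto_moving_bound:
  fixes f h :: "nat \<Rightarrow> 'a \<Rightarrow> real"
  assumes [measurable]: "\<And>n. f n \<in> borel_measurable M" "F \<in> borel_measurable M"
    and lim: "AE x in M. (\<lambda>n. f n x) \<longlonglongrightarrow> F x"
    and bound: "\<And>n. AE x in M. 0 \<le> f n x \<and> f n x \<le> h n x"
    and h: "\<And>n. integrable M (h n)" "integrable M H" "(\<lambda>n. \<integral>x. \<bar>h n x - H x\<bar> \<partial>M) \<longlonglongrightarrow> 0"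
    and F: "integrable M F" and H: "AE x in M. 0 \<le> H x"
  shows "(\<lambda>n. \<integral>x. f n x \<partial>M) \<longlonglongrightarrow> (\<integral>x. F x \<partial>M)"
proof -
  have F0: "AE x in M. 0 \<le> F x"
  proof -
    have "AE x in M. \<forall>n. 0 \<le> f n x \<and> f n x \<le> h n x" using bound by (simp add: AE_all_countable)
    then show ?thesis using lim
    proof eventually_elim
      fix x assume "\<forall>n. 0 \<le> f n x \<and> f n x \<le> h n x" "(\<lambda>n. f n x) \<longlonglongrightarrow> F x"
      then show "0 \<le> F x" by (intro LIMSEQ_le_const) auto
    qed
  qed
  let ?m = "\<lambda>n x. min (f n x) (H x + F x)"
  have [measurable]: "H \<in> borel_measurable M" "\<And>n. h n \<in> borel_measurable M" using h by auto
  have fi: "integrable M (f n)" for n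
  proof (rule Bochner_Integration.integrable_bound[OF h(1)[of n]])
    show "AE x in M. norm (f n x) \<le> norm (h n x)" using bound[of n] by eventually_elim auto
  qed simp
  have mi: "integrable M (?m n)" for n
    using fi h F by (intro Bochner_Integration.integrable_min) auto
  have 1: "(\<lambda>n. \<integral>x. ?m n x \<partial>M) \<longlonglongrightarrow> (\<integral>x. F x \<partial>M)"
  proof (rule integral_dominated_convergence[where w="\<lambda>x. H x + F x"])
    show "AE x in M. (\<lambda>n. ?m n x) \<longlonglongrightarrow> F x"
      using lim H
    proof eventually_elim
      fix x assume "(\<lambda>n. f n x) \<longlonglongrightarrow> F x" "0 \<le> H x"
      from tendsto_min[OF this(1) tendsto_const[of "H x + F x"]] this(2)
      show "(\<lambda>n. ?m n x) \<longlonglongrightarrow> F x" by simp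
    qed
    show "AE x in M. norm (?m n x) \<le> H x + F x" for n
      using bound[of n] H F0 by eventually_elim auto
  qed (use h F in auto)
  have 2: "(\<lambda>n. (\<integral>x. f n x \<partial>M) - (\<integral>x. ?m n x \<partial>M)) \<longlonglongrightarrow> 0"
  proof (rule Lim_null_comparison[OF _ h(3)])
    have "norm ((\<integral>x. f n x \<partial>M) - (\<integral>x. ?m n x \<partial>M)) \<le> (\<integral>x. \<bar>h n x - H x\<bar> \<partial>M)" for n
    proof -
      have "(\<integral>x. f n x \<partial>M) - (\<integral>x. ?m n x \<partial>M) = (\<integral>x. f n x - ?m n x \<partial>M)" using fi mi by simp
      also have "norm \<dots> \<le> (\<integral>x. norm (f n x - ?m n x) \<partial>M)" by (rule integral_norm_bound)
      also have "\<dots> \<le> (\<integral>x. \<bar>h n x - H x\<bar> \<partial>M)"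
      proof (rule integral_mono_AE)
        show "AE x in M. norm (f n x - ?m n x) \<le> \<bar>h n x - H x\<bar>"
          using bound[of n] H F0 by eventually_elim auto
      qed (use fi mi h in auto)
      finally show ?thesis .
    qed
    then show "\<forall>\<^sub>F n in sequentially. norm ((\<integral>x. f n x \<partial>M) - (\<integral>x. ?m n x \<partial>M)) \<le> (\<integral>x. \<bar>h n x - H x\<bar> \<partial>M)"
      by simp
  qed
  from tendsto_add[OF 2 1] show ?thesis by simp
qed

text \<open>
  Approximating \<open>u\<close> by simple functions reduces this to countably many fixed second arguments.
\<close>

lemma caratheodory_measurable:
  fixes G :: "'a \<Rightarrow> 'b::{metric_space, second_countable_topology} \<Rightarrow> real"
  assumes meas: "\<And>b. (\<lambda>x. G x b) \<in> borel_measurable N"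
    and cont: "\<And>x. x \<in> space N \<Longrightarrow> continuous_on UNIV (G x)"
    and u: "u \<in> borel_measurable N"
  shows "(\<lambda>x. G x (u x)) \<in> borel_measurable N"
proof -
  obtain s where s: "\<And>i. simple_function N (s i)" "\<And>x. x \<in> space N \<Longrightarrow> (\<lambda>i. s i x) \<longlonglongrightarrow> u x"
    using borel_measurable_implies_sequence_metric[OF u, of undefined] by blast
  show ?thesis
  proof (rule borel_measurable_LIMSEQ_metric)
    show "(\<lambda>x. G x (s i x)) \<in> borel_measurable N" for i
    proof (rule measurable_compose_countable'[OF meas])
      show "s i \<in> N \<rightarrow>\<^sub>M count_space (s i ` space N)"
        using s(1)[of i] by (simp add: measurable_count_space_eq2 simple_function_def)
      show "countable (s i ` space N)" using s(1)[of i] by (auto simp: simple_function_def countable_finite)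
    qed
    show "(\<lambda>i. G x (s i x)) \<longlonglongrightarrow> G x (u x)" if "x \<in> space N" for x
      using continuous_on_tendsto_compose[OF cont[OF that] s(2)[OF that]] by simp
  qed
qed

section \<open>Averaging estimate\<close>

text \<open>
  Doubling \<open>N\<close>-functions that decompose into profiles \<open>t \<mapsto> M x (t *\<^sub>R e j)\<close> of one variable. With one index
  and \<open>P\<close> the identity these are the functions of \<open>norm \<xi>\<close>; with the coordinate projections these are the
  sums of functions of \<open>\<bar>\<xi> $ j\<bar>\<close>. Linearity of the \<open>P j\<close> makes the decomposition compatible with convolution.
\<close>

locale musielak =
  fixes \<Omega> :: "(real ^ 'n) set" and M :: "real ^ 'n \<Rightarrow> real ^ 'n \<Rightarrow> real"
    and J :: "'j set" and e :: "'j \<Rightarrow> real ^ 'n" and P :: "'j \<Rightarrow> real ^ 'n \<Rightarrow> real ^ 'n" and A :: real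
  assumes domain: "bounded_lipschitz_domain \<Omega>"
    and N_function: "weak_N_function \<Omega> M"
    and doubling: "0 \<le> A" "\<And>x \<xi>. x \<in> \<Omega> \<Longrightarrow> M x (2 *\<^sub>R \<xi>) \<le> A * (M x \<xi> + 1)"
    and finite_J: "finite J"
    and P: "\<And>j. j \<in> J \<Longrightarrow> bounded_linear (P j)" "\<And>j \<xi>. j \<in> J \<Longrightarrow> norm (P j \<xi>) \<le> norm \<xi>"
    and e: "\<And>j. j \<in> J \<Longrightarrow> norm (e j) = 1"
    and split: "\<And>x \<xi>. x \<in> \<Omega> \<Longrightarrow> M x \<xi> = (\<Sum>j\<in>J. M x (norm (P j \<xi>) *\<^sub>R e j))"
begin

definition balanced :: "real \<Rightarrow> bool" where
  "balanced \<theta> \<longleftrightarrow> (\<forall>K\<ge>1. \<exists>C\<ge>0. \<exists>\<delta>0>0. \<forall>\<delta> x y j t. 0 < \<delta> \<longrightarrow> \<delta> < \<delta>0 \<longrightarrow> x \<in> \<Omega> \<longrightarrow> y \<in> \<Omega> \<longrightarrow> dist x y \<le> \<delta> \<longrightarrow>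
     j \<in> J \<longrightarrow> 1 \<le> t \<longrightarrow> t \<le> K * \<delta> powr (\<theta> - 1) \<longrightarrow> M x (t *\<^sub>R e j) \<le> C * (M y (t *\<^sub>R e j) + 1))"

text \<open>
  The pointwise properties that an \<open>N\<close>-function has at almost every \<open>x\<close>.
\<close>

definition good :: "real ^ 'n \<Rightarrow> bool" where
  "good x \<longleftrightarrow> M x 0 = 0 \<and> convex_on UNIV (M x) \<and> (\<forall>\<xi>. M x \<xi> = M x (- \<xi>))"

lemma open_domain: "open \<Omega>" and bounded_domain: "bounded \<Omega>" and nonempty: "\<Omega> \<noteq> {}"
  using domain by (auto simp: bounded_lipschitz_domain_def)

lemma sets_domain: "\<Omega> \<in> sets lebesgue"
  by (rule open_sets_lebesgue[OF open_domain])

lemma lmeasurable_domain: "\<Omega> \<in> lmeasurable"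
  using bounded_domain open_domain by (simp add: lmeasurable_open)

lemma finite_measure_domain: "emeasure (lebesgue_on \<Omega>) (space (lebesgue_on \<Omega>)) < \<infinity>"
  using fmeasurableD2[OF lmeasurable_domain] sets_domain
  by (simp add: emeasure_restrict_space space_restrict_space less_top del: emeasure_completion)

lemma integrable_const_domain: "integrable (lebesgue_on \<Omega>) (\<lambda>x. c::real)"
  using finite_measure_domain by (intro finite_measure.integrable_const finite_measureI) auto

lemma M_nonneg: "x \<in> \<Omega> \<Longrightarrow> 0 \<le> M x \<xi>"
  using N_function unfolding weak_N_function_def by blast

lemma AE_good: "AE x in lebesgue_on \<Omega>. good x"
proof -
  have "AE x in lebesgue_on \<Omega>. M x 0 = 0 \<and> convex_on UNIV (M x)" "AE x in lebesgue_on \<Omega>. \<forall>\<xi>. M x \<xi> = M x (- \<xi>)"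
    using N_function unfolding weak_N_function_def by blast+
  then show ?thesis by eventually_elim (simp add: good_def)
qed

lemma M_measurable:
  assumes u: "u \<in> borel_measurable (lebesgue_on \<Omega>)"
  shows "(\<lambda>x. M x (u x)) \<in> borel_measurable (lebesgue_on \<Omega>)"
proof (rule caratheodory_measurable[OF _ _ u])
  show "(\<lambda>x. M x \<xi>) \<in> borel_measurable (lebesgue_on \<Omega>)" for \<xi>
    using N_function unfolding weak_N_function_def by blast
  show "continuous_on UNIV (M x)" if "x \<in> space (lebesgue_on \<Omega>)" for x
    using N_function that unfolding weak_N_function_def by (simp add: space_restrict_space)
qed

lemma M_bounded:
  obtains b where "0 \<le> b" "AE x in lebesgue_on \<Omega>. \<forall>\<xi>. norm \<xi> \<le> R \<longrightarrow> M x \<xi> \<le> b"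
proof -
  obtain m2 :: "real \<Rightarrow> real" where m2: "convex_on {0..} m2" "\<And>s. 0 \<le> s \<Longrightarrow> 0 \<le> m2 s"
    and le: "AE x in lebesgue_on \<Omega>. \<forall>\<xi>. M x \<xi> \<le> m2 (norm \<xi>)"
  proof -
    obtain m1 m2 :: "real \<Rightarrow> real" where "convex_on {0..} m2" "\<forall>s\<ge>0. 0 \<le> m2 s"
      and le: "AE x in lebesgue_on \<Omega>. \<forall>\<xi>. m1 (norm \<xi>) \<le> M x \<xi> \<and> M x \<xi> \<le> m2 (norm \<xi>)"
      using N_function unfolding weak_N_function_def by blast
    moreover have "AE x in lebesgue_on \<Omega>. \<forall>\<xi>. M x \<xi> \<le> m2 (norm \<xi>)"
      using le by eventually_elim auto
    ultimately show ?thesis using that by blast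
  qed
  let ?b = "m2 0 + m2 (max 0 R)"
  have m2b: "m2 s \<le> ?b" if "0 \<le> s" "s \<le> R" for s
  proof (cases "R = 0")
    case True
    then show ?thesis using that m2(2)[of 0] by simp
  next
    case False
    have "m2 ((1 - s / R) *\<^sub>R 0 + (s / R) *\<^sub>R R) \<le> (1 - s / R) * m2 0 + (s / R) * m2 R"
      using that False by (intro convex_onD[OF m2(1)]) (auto simp: divide_le_eq)
    also have "\<dots> \<le> 1 * m2 0 + 1 * m2 R"
      using that False m2(2)[of 0] m2(2)[of R] by (intro add_mono mult_right_mono) (auto simp: divide_le_eq)
    finally show ?thesis using that False by (simp add: max_def)
  qed
  show ?thesis
  proof (rule that)
    show "0 \<le> ?b" using m2(2)[of 0] m2(2)[of "max 0 R"] by simp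
    show "AE x in lebesgue_on \<Omega>. \<forall>\<xi>. norm \<xi> \<le> R \<longrightarrow> M x \<xi> \<le> ?b"
      using le by eventually_elim (meson m2b norm_ge_zero order_trans)
  qed
qed

lemma good_scale:
  assumes "good x" "x \<in> \<Omega>" "0 \<le> c" "c \<le> 1"
  shows "M x (c *\<^sub>R \<xi>) \<le> c * M x \<xi>"
proof -
  have "M x ((1 - c) *\<^sub>R 0 + c *\<^sub>R \<xi>) \<le> (1 - c) * M x 0 + c * M x \<xi>"
    using assms by (intro convex_onD[of UNIV "M x"]) (auto simp: good_def)
  then show ?thesis using assms by (simp add: good_def)
qed

lemma good_shrink:
  assumes "good x" "x \<in> \<Omega>" "\<bar>c\<bar> \<le> 1"
  shows "M x (c *\<^sub>R \<xi>) \<le> M x \<xi>"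
proof -
  have "M x (c *\<^sub>R \<xi>) = M x (\<bar>c\<bar> *\<^sub>R \<xi>)"
    using assms(1) by (cases "0 \<le> c") (auto simp: good_def)
  also have "\<dots> \<le> \<bar>c\<bar> * M x \<xi>" using assms by (intro good_scale) auto
  also have "\<dots> \<le> 1 * M x \<xi>" using assms M_nonneg by (intro mult_right_mono) auto
  finally show ?thesis by simp
qed

lemma good_ray:
  assumes "good x" "x \<in> \<Omega>" "0 \<le> t" "t \<le> s" "0 < s"
  shows "M x (t *\<^sub>R \<xi>) * s \<le> M x (s *\<^sub>R \<xi>) * t"
proof -
  have "M x ((t / s) *\<^sub>R (s *\<^sub>R \<xi>)) \<le> (t / s) * M x (s *\<^sub>R \<xi>)"
    using assms by (intro good_scale) (auto simp: divide_le_eq)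
  then show ?thesis using assms by (simp add: field_simps)
qed

lemma good_add:
  assumes "good x" "x \<in> \<Omega>"
  shows "M x (\<xi> + \<eta>) \<le> A * (M x \<xi> + M x \<eta> + 1)"
proof -
  have "M x ((1 - 1 / 2) *\<^sub>R (2 *\<^sub>R \<xi>) + (1 / 2) *\<^sub>R (2 *\<^sub>R \<eta>)) \<le> (1 - 1 / 2) * M x (2 *\<^sub>R \<xi>) + (1 / 2) * M x (2 *\<^sub>R \<eta>)"
    using assms by (intro convex_onD[of UNIV "M x"]) (auto simp: good_def)
  also have "\<dots> \<le> (1 - 1 / 2) * (A * (M x \<xi> + 1)) + (1 / 2) * (A * (M x \<eta> + 1))"
    using doubling(2)[OF assms(2)] by (intro add_mono mult_left_mono) auto
  also have "\<dots> = A * ((M x \<xi> + M x \<eta>) / 2 + 1)" by (simp add: field_simps)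
  also have "\<dots> \<le> A * (M x \<xi> + M x \<eta> + 1)"
    using doubling(1) M_nonneg[OF assms(2)] by (intro mult_left_mono) auto
  finally show ?thesis by simp
qed

lemma good_sum:
  assumes "finite I"
  obtains C where "0 \<le> C" "\<And>x \<eta>. good x \<Longrightarrow> x \<in> \<Omega> \<Longrightarrow> M x (\<Sum>i\<in>I. \<eta> i) \<le> C * ((\<Sum>i\<in>I. M x (\<eta> i)) + 1)"
proof -
  have "\<exists>C\<ge>0. \<forall>x \<eta>. good x \<longrightarrow> x \<in> \<Omega> \<longrightarrow> M x (\<Sum>i\<in>I. \<eta> i) \<le> C * ((\<Sum>i\<in>I. M x (\<eta> i)) + 1)"
    using assms
  proof (induction I rule: finite_induct)
    case empty
    then show ?case by (intro exI[of _ 0]) (auto simp: good_def)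
  next
    case (insert i I)
    then obtain C where C: "0 \<le> C" "\<And>x \<eta>. good x \<Longrightarrow> x \<in> \<Omega> \<Longrightarrow> M x (\<Sum>i\<in>I. \<eta> i) \<le> C * ((\<Sum>i\<in>I. M x (\<eta> i)) + 1)" by blast
    have "M x (\<Sum>i\<in>insert i I. \<eta> i) \<le> (A * (C + 1)) * ((\<Sum>i\<in>insert i I. M x (\<eta> i)) + 1)" if x: "good x" "x \<in> \<Omega>" for x \<eta>
    proof -
      let ?S = "\<Sum>i\<in>I. M x (\<eta> i)"
      have S0: "0 \<le> ?S" "0 \<le> M x (\<eta> i)" using M_nonneg[OF x(2)] by (auto intro: sum_nonneg)
      have "M x (\<Sum>i\<in>insert i I. \<eta> i) \<le> A * (M x (\<eta> i) + M x (\<Sum>i\<in>I. \<eta> i) + 1)"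
        using insert.hyps good_add[OF x, of "\<eta> i" "\<Sum>i\<in>I. \<eta> i"] by simp
      also have "\<dots> \<le> A * (M x (\<eta> i) + C * (?S + 1) + 1)"
        using C(2)[OF x, of \<eta>] doubling(1) by (intro mult_left_mono) auto
      also have "\<dots> \<le> A * ((C + 1) * (M x (\<eta> i) + ?S + 1))"
        using S0 C(1) doubling(1) by (intro mult_left_mono) (auto simp: algebra_simps)
      finally show ?thesis using insert.hyps by (simp add: mult.assoc)
    qed
    then show ?case using C(1) doubling(1) by (intro exI[of _ "A * (C + 1)"]) auto
  qed
  then show ?thesis using that by blast
qed

lemma component_le:
  assumes "x \<in> \<Omega>" "j \<in> J"
  shows "M x (norm (P j \<xi>) *\<^sub>R e j) \<le> M x \<xi>"
  unfolding split[OF assms(1), of \<xi>]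
  by (rule member_le_sum[OF assms(2) _ finite_J]) (use M_nonneg[OF assms(1)] in auto)

lemma norm_conv_le:
  fixes g :: "real ^ 'n \<Rightarrow> 'b::{banach, second_countable_topology}"
  assumes "\<And>z. 0 \<le> k z"
  shows "norm (conv k g x) \<le> conv k (\<lambda>y. norm (g y)) x"
  unfolding conv_def using integral_norm_bound[of lebesgue "\<lambda>y. k (x - y) *\<^sub>R g y"] assms by simp

text \<open>
  Let \<open>N y = norm (P j (g y))\<close>, so that \<open>s \<le> conv k N x\<close>, and write \<open>f x t = M x (t *\<^sub>R e j)\<close>. It is enough to
  show \<open>f x s / s * N y \<le> f x s / 2 + A * (C + 1) * h y\<close> for \<open>y\<close> near \<open>x\<close>: averaging over \<open>y\<close> with the
  kernel \<open>k\<close> gives \<open>f x s\<close> on the left, and the term \<open>f x s / 2\<close> is absorbed. If \<open>N y < s / 2\<close>, the bound is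
  trivial. Otherwise balance at \<open>s / 2\<close> and doubling replace \<open>f x s\<close> by \<open>f y (s / 2)\<close>, and convexity of
  \<open>f y\<close>, by which \<open>f y t / t\<close> increases with \<open>t\<close>, replaces \<open>f y (s / 2) * N y\<close> by \<open>f y (N y) * s / 2\<close>.
\<close>

lemma averaging_component:
  assumes bal: "\<And>x y t. x \<in> \<Omega> \<Longrightarrow> y \<in> \<Omega> \<Longrightarrow> dist x y \<le> \<delta> \<Longrightarrow> 1 \<le> t \<Longrightarrow> t \<le> T \<Longrightarrow> M x (t *\<^sub>R e j) \<le> C * (M y (t *\<^sub>R e j) + 1)"
    and C: "0 \<le> C" and j: "j \<in> J"
    and k: "test k" "\<And>z. 0 \<le> k z" "(\<integral>z. k z \<partial>lebesgue) = 1" "\<And>z. k z \<noteq> 0 \<Longrightarrow> norm z \<le> \<delta>"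
    and g: "integrable lebesgue g" "\<And>y. y \<notin> \<Omega> \<Longrightarrow> g y = 0"
    and h: "integrable lebesgue h" "\<And>y. y \<in> \<Omega> \<Longrightarrow> h y = M y (g y) + norm (g y)" "\<And>y. 0 \<le> h y"
    and x: "good x" "x \<in> \<Omega>" and s: "s = norm (P j (conv k g x))" "2 \<le> s" "s \<le> T"
  shows "M x (s *\<^sub>R e j) \<le> 2 * (A * (C + 1)) * conv k h x"
proof -
  let ?f = "\<lambda>y t. M y (t *\<^sub>R e j)" and ?N = "\<lambda>y. norm (P j (g y))" and ?A = "A * (C + 1)"
  have A: "0 \<le> ?A" using C doubling(1) by simp
  have fx0: "0 \<le> ?f x s" using M_nonneg[OF x(2)] .
  have s0: "0 < s" using s(2) by linarith
  have RHS: "(\<lambda>y. k (x - y) * (?f x s / 2 + ?A * h y)) = (\<lambda>y. ?f x s / 2 * k (x - y) + ?A * (k (x - y) *\<^sub>R h y))"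
    by (rule ext) (simp add: algebra_simps)
  \<comment> \<open>\<open>2 \<le> s\<close> ensures \<open>1 \<le> s / 2\<close>, the lower end of the range of balance\<close>
  have half: "?f x s \<le> ?A * (?f y (s / 2) + 1)" if y: "y \<in> \<Omega>" "dist x y \<le> \<delta>" for y
  proof -
    have "?f x s \<le> A * (?f x (s / 2) + 1)" using doubling(2)[OF x(2), of "(s / 2) *\<^sub>R e j"] by simp
    also have "\<dots> \<le> A * (C * (?f y (s / 2) + 1) + 1)"
      using bal[OF x(2) y, of "s / 2"] s doubling(1) by (intro mult_left_mono) auto
    also have "\<dots> \<le> A * ((C + 1) * (?f y (s / 2) + 1))"
      using M_nonneg[OF y(1)] doubling(1) C by (intro mult_left_mono) (auto simp: algebra_simps)
    finally show ?thesis by (simp add: mult.assoc)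
  qed
  have pw: "k (x - y) * (?f x s / s * ?N y) \<le> k (x - y) * (?f x s / 2 + ?A * h y)" if y: "y \<in> \<Omega> \<longrightarrow> good y" for y
  proof (cases "k (x - y) = 0 \<or> y \<notin> \<Omega> \<or> ?N y < s / 2")
    case True
    have imp: "?f x s / s * ?N y \<le> ?f x s / 2 + ?A * h y" if "k (x - y) \<noteq> 0"
    proof (cases "y \<in> \<Omega>")
      case False
      then have "?N y = 0" using g(2)[OF False] P(1)[OF j] by (simp add: linear_0 bounded_linear.linear)
      then show ?thesis using fx0 A h(3)[of y] by simp
    next
      case True
      with that \<open>k (x - y) = 0 \<or> y \<notin> \<Omega> \<or> ?N y < s / 2\<close> have "?N y \<le> s / 2" by simp
      then have "?f x s / s * ?N y \<le> ?f x s / s * (s / 2)" using fx0 s by (intro mult_left_mono) auto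
      also have "\<dots> = ?f x s / 2" using s0 by simp
      also have "\<dots> \<le> ?f x s / 2 + ?A * h y" using A h(3)[of y] by simp
      finally show ?thesis .
    qed
    show ?thesis
    proof (cases "k (x - y) = 0")
      case False
      show ?thesis by (rule mult_left_mono[OF imp[OF False] k(2)])
    qed simp
  next
    case False
    then have y': "y \<in> \<Omega>" "good y" "s / 2 \<le> ?N y" "dist x y \<le> \<delta>"
      using y k(4)[of "x - y"] by (auto simp: dist_norm)
    have N0: "0 < ?N y" using y'(3) s by linarith
    have "?f y (s / 2) * ?N y \<le> ?f y (?N y) * (s / 2)"
      using y' s N0 by (intro good_ray) auto
    also have "\<dots> \<le> M y (g y) * (s / 2)"
      using component_le[OF y'(1) j] s by (intro mult_right_mono) auto
    also have "\<dots> \<le> M y (g y) * s" using M_nonneg[OF y'(1)] s by (intro mult_left_mono) auto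
    finally have 1: "?f y (s / 2) * ?N y \<le> M y (g y) * s" .
    have 2: "?N y \<le> norm (g y) * s"
      using P(2)[OF j, of "g y"] s mult_left_mono[of 1 s "norm (g y)"] by simp
    have "?f x s * ?N y \<le> ?A * (?f y (s / 2) + 1) * ?N y"
      using half[OF y'(1,4)] N0 by (intro mult_right_mono) auto
    also have "\<dots> = ?A * (?f y (s / 2) * ?N y + ?N y)" by (simp add: algebra_simps)
    also have "\<dots> \<le> ?A * (M y (g y) * s + norm (g y) * s)"
      using 1 2 A by (intro mult_left_mono add_mono) auto
    also have "\<dots> = (?A * h y) * s" by (simp add: h(2)[OF y'(1)] algebra_simps)
    finally have "?f x s / s * ?N y \<le> ?A * h y" using s0 by (simp add: divide_le_eq)
    then have "?f x s / s * ?N y \<le> ?f x s / 2 + ?A * h y" using fx0 by linarith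
    then show ?thesis by (rule mult_left_mono[OF _ k(2)])
  qed
  have gN: "integrable lebesgue ?N"
    by (intro integrable_norm integrable_bounded_linear[OF P(1)[OF j]] g)
  have ik: "integrable lebesgue (\<lambda>y. k (x - y))" by (rule integrable_lebesgue_reflect[OF test_integrable[OF k(1)]])
  have Ik: "(\<integral>y. k (x - y) \<partial>lebesgue) = 1" using integral_lebesgue_reflect[OF test_integrable[OF k(1)], of x] k(3) by simp
  note ih = conv_integrable[OF k(1) h(1), of x] and iN = conv_integrable[OF k(1) gN, of x]
  have "P j (conv k g x) = conv k (\<lambda>y. P j (g y)) x"
    unfolding conv_def using integral_bounded_linear[OF P(1)[OF j] conv_integrable[OF k(1) g(1), of x]]
    by (simp add: linear_scale[OF bounded_linear.linear[OF P(1)[OF j]]])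
  then have sN: "s \<le> conv k ?N x" unfolding s(1) using norm_conv_le[of k] k(2) by simp
  have "?f x s = ?f x s / s * s" using s0 by simp
  also have "\<dots> \<le> ?f x s / s * conv k ?N x" using sN fx0 s by (intro mult_left_mono) auto
  also have "\<dots> = (\<integral>y. k (x - y) * (?f x s / s * ?N y) \<partial>lebesgue)"
    unfolding conv_def by (subst integral_mult_right_zero[symmetric]) (simp add: mult_ac)
  also have "\<dots> \<le> (\<integral>y. k (x - y) * (?f x s / 2 + ?A * h y) \<partial>lebesgue)"
  proof (rule integral_mono_AE)
    show "integrable lebesgue (\<lambda>y. k (x - y) * (?f x s / s * ?N y))"
      using integrable_mult_right[OF iN, of "?f x s / s"] by (simp add: mult_ac)
    show "integrable lebesgue (\<lambda>y. k (x - y) * (?f x s / 2 + ?A * h y))"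
      unfolding RHS by (intro Bochner_Integration.integrable_add integrable_mult_right ih ik)
    have "AE y in lebesgue. y \<in> \<Omega> \<longrightarrow> good y" using AE_good by (simp add: AE_lebesgue_on[OF sets_domain])
    then show "AE y in lebesgue. k (x - y) * (?f x s / s * ?N y) \<le> k (x - y) * (?f x s / 2 + ?A * h y)"
      by eventually_elim (rule pw)
  qed
  also have "\<dots> = (\<integral>y. ?f x s / 2 * k (x - y) + ?A * (k (x - y) *\<^sub>R h y) \<partial>lebesgue)"
    unfolding RHS ..
  also have "\<dots> = ?f x s / 2 + ?A * conv k h x"
    using ih ik Ik by (simp add: conv_def)
  finally show ?thesis by simp
qed

text \<open>
  The components of size at most 2 lie below the range in which balance is used; there \<open>M\<close> is bounded.
\<close>

lemma averaging:
  assumes bal: "balanced \<theta>" and K: "1 \<le> K"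
  obtains C \<delta>0 where "0 \<le> C" "0 < \<delta>0"
    "\<And>\<delta> k g h. 0 < \<delta> \<Longrightarrow> \<delta> < \<delta>0 \<Longrightarrow> test k \<Longrightarrow> (\<And>z. 0 \<le> k z) \<Longrightarrow> (\<integral>z. k z \<partial>lebesgue) = 1 \<Longrightarrow>
      (\<And>z. k z \<noteq> 0 \<Longrightarrow> norm z \<le> \<delta>) \<Longrightarrow> integrable lebesgue g \<Longrightarrow> (\<And>y. y \<notin> \<Omega> \<Longrightarrow> g y = 0) \<Longrightarrow>
      integrable lebesgue h \<Longrightarrow> (\<And>y. y \<in> \<Omega> \<Longrightarrow> h y = M y (g y) + norm (g y)) \<Longrightarrow> (\<And>y. 0 \<le> h y) \<Longrightarrow>
      AE x in lebesgue_on \<Omega>. norm (conv k g x) \<le> K * \<delta> powr (\<theta> - 1) \<longrightarrow> M x (conv k g x) \<le> C * (conv k h x + 1)"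
proof -
  obtain B \<delta>0 where B: "0 \<le> B" "0 < \<delta>0"
    and bal': "\<And>\<delta> x y j t. 0 < \<delta> \<Longrightarrow> \<delta> < \<delta>0 \<Longrightarrow> x \<in> \<Omega> \<Longrightarrow> y \<in> \<Omega> \<Longrightarrow> dist x y \<le> \<delta> \<Longrightarrow> j \<in> J \<Longrightarrow> 1 \<le> t \<Longrightarrow> t \<le> K * \<delta> powr (\<theta> - 1) \<Longrightarrow>
      M x (t *\<^sub>R e j) \<le> B * (M y (t *\<^sub>R e j) + 1)"
    using bal K unfolding balanced_def by metis
  obtain b where b: "0 \<le> b" "AE x in lebesgue_on \<Omega>. \<forall>\<xi>. norm \<xi> \<le> 2 \<longrightarrow> M x \<xi> \<le> b" by (rule M_bounded)
  define C where "C = real (card J) * (b + 2 * (A * (B + 1)))"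
  have A: "0 \<le> A * (B + 1)" using B doubling(1) by simp
  show ?thesis
  proof (rule that[of C \<delta>0])
    show "0 \<le> C" using b A by (simp add: C_def)
    fix \<delta> :: real and k :: "real ^ 'n \<Rightarrow> real" and g :: "real ^ 'n \<Rightarrow> real ^ 'n" and h :: "real ^ 'n \<Rightarrow> real"
    assume \<delta>: "0 < \<delta>" "\<delta> < \<delta>0"
      and k: "test k" "\<And>z. 0 \<le> k z" "(\<integral>z. k z \<partial>lebesgue) = 1" "\<And>z. k z \<noteq> 0 \<Longrightarrow> norm z \<le> \<delta>"
      and g: "integrable lebesgue g" "\<And>y. y \<notin> \<Omega> \<Longrightarrow> g y = 0"
      and h: "integrable lebesgue h" "\<And>y. y \<in> \<Omega> \<Longrightarrow> h y = M y (g y) + norm (g y)" "\<And>y. 0 \<le> h y"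
    have "AE x in lebesgue_on \<Omega>. x \<in> \<Omega>" using AE_space[of "lebesgue_on \<Omega>"] by (simp add: space_restrict_space)
    then show "AE x in lebesgue_on \<Omega>. norm (conv k g x) \<le> K * \<delta> powr (\<theta> - 1) \<longrightarrow> M x (conv k g x) \<le> C * (conv k h x + 1)"
      using AE_good b(2)
    proof eventually_elim
      fix x assume x: "x \<in> \<Omega>" "good x" and bx: "\<forall>\<xi>. norm \<xi> \<le> 2 \<longrightarrow> M x \<xi> \<le> b"
      have hc: "0 \<le> conv k h x" unfolding conv_def using k(2) h(3) by (intro Bochner_Integration.integral_nonneg) auto
      show "norm (conv k g x) \<le> K * \<delta> powr (\<theta> - 1) \<longrightarrow> M x (conv k g x) \<le> C * (conv k h x + 1)"
      proof
        assume n: "norm (conv k g x) \<le> K * \<delta> powr (\<theta> - 1)"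
        have "M x (norm (P j (conv k g x)) *\<^sub>R e j) \<le> (b + 2 * (A * (B + 1))) * (conv k h x + 1)" if j: "j \<in> J" for j
        proof (cases "norm (P j (conv k g x)) \<le> 2")
          case True
          then have "M x (norm (P j (conv k g x)) *\<^sub>R e j) \<le> b" using bx e[OF j] by simp
          also have "b \<le> (b + 2 * (A * (B + 1))) * (conv k h x + 1)"
            using b(1) A hc mult_mono[of b "b + 2 * (A * (B + 1))" 1 "conv k h x + 1"] by simp
          finally show ?thesis .
        next
          case False
          have "M x (norm (P j (conv k g x)) *\<^sub>R e j) \<le> 2 * (A * (B + 1)) * conv k h x"
          proof (rule averaging_component[OF _ B(1) j k g h x(2,1) refl])
            show "norm (P j (conv k g x)) \<le> K * \<delta> powr (\<theta> - 1)" using P(2)[OF j] n by (rule order_trans)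
            show "2 \<le> norm (P j (conv k g x))" using False by simp
          qed (use bal' \<delta> j in auto)
          also have "\<dots> \<le> (b + 2 * (A * (B + 1))) * (conv k h x + 1)"
            using b(1) A hc by (intro mult_mono) auto
          finally show ?thesis .
        qed
        then have "(\<Sum>j\<in>J. M x (norm (P j (conv k g x)) *\<^sub>R e j)) \<le> (\<Sum>j\<in>J. (b + 2 * (A * (B + 1))) * (conv k h x + 1))"
          by (rule sum_mono)
        then show "M x (conv k g x) \<le> C * (conv k h x + 1)"
          unfolding split[OF x(1), of "conv k g x"] by (simp add: C_def mult.assoc)
      qed
    qed
  qed (rule B(2))
qed

end

section \<open>Modular approximation by test functions\<close>

lemma integral_partial_deriv_test:
  assumes "test k"
  shows "(\<integral>x. partial_deriv i k x \<partial>lebesgue) = 0"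
proof -
  note t = Cc_infty_partial_deriv[OF assms, of i]
  obtain B where B: "\<And>x. \<bar>partial_deriv i k x\<bar> \<le> B" using test_bounded[OF t] by blast
  obtain K where K: "compact K" "\<And>x. x \<notin> K \<Longrightarrow> k x = 0" and s: "smooth k" using assms by (auto simp: Cc_infty_iff)
  show ?thesis
    by (rule integral_partial_deriv_eq_0[OF smooth_differentiable[OF s] B _ K test_integrable[OF assms]])
      (use test_integrable[OF t] in auto)
qed

lemma conv_component:
  assumes "test k" "integrable lebesgue (g :: real ^ 'n \<Rightarrow> real ^ 'n)"
  shows "conv k g x $ l = conv k (\<lambda>y. g y $ l) x"
  using integral_bounded_linear[OF bounded_linear_vec_nth[of l] conv_integrable[OF assms, of x]]
  by (simp add: conv_def)

text \<open>
  The gradient of \<open>w\<close> falls on the kernel, whose derivative has integral 0; so \<open>w\<close> may be replaced by its increment \<open>w y - w x\<close> over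
  distances at most \<open>\<delta>\<close>. The \<open>L\<^sup>1\<close> norm of that derivative is of order \<open>1 / \<delta>\<close>.
\<close>

lemma conv_gradient_bound:
  fixes g :: "real ^ 'n \<Rightarrow> real ^ 'n"
  assumes \<rho>: "mollifier \<rho>" and \<delta>: "0 < \<delta>" and wg: "weak_grad w g"
    and osc: "\<And>y. dist x y \<le> \<delta> \<Longrightarrow> \<bar>w y - w x\<bar> \<le> B"
  shows "norm (conv (rescale \<rho> \<delta>) g x) \<le> (\<Sum>l\<in>UNIV. \<integral>z. \<bar>partial_deriv l \<rho> z\<bar> \<partial>lebesgue) * (B / \<delta>)"
proof -
  let ?k = "rescale \<rho> \<delta>"
  note m = mollifier_rescale[OF \<rho> \<delta>]
  have t\<rho>: "test \<rho>" using \<rho> by (auto simp: mollifier_def)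
  have "\<bar>conv ?k g x $ l\<bar> \<le> (\<integral>z. \<bar>partial_deriv l \<rho> z\<bar> \<partial>lebesgue) * (B / \<delta>)" for l
  proof -
    let ?p = "partial_deriv l ?k"
    have tp: "test ?p" by (rule Cc_infty_partial_deriv[OF m(1)])
    have ip: "integrable lebesgue (\<lambda>y. ?p (x - y))" by (rule integrable_lebesgue_reflect[OF test_integrable[OF tp]])
    have p0: "(\<integral>y. ?p (x - y) \<partial>lebesgue) = 0"
      using integral_lebesgue_reflect[OF test_integrable[OF tp], of x] integral_partial_deriv_test[OF m(1)] by simp
    have pk: "?p z = 0" if "\<delta> < norm z" for z
    proof (rule partial_deriv_eq_0_outside[of "cball 0 \<delta>"])
      show "?k y = 0" if "y \<notin> cball 0 \<delta>" for y using m(4)[of y] that by auto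
    qed (use that in auto)
    note ipw = conv_integrable[OF tp weak_gradD(1)[OF wg], of x, unfolded real_scaleR_def]
    have "conv ?k g x $ l = conv ?p w x"
      unfolding conv_component[OF m(1) weak_gradD(2)[OF wg]] weak_grad_conv[OF wg m(1), symmetric]
      by (rule partial_deriv_conv[OF m(1) weak_gradD(1)[OF wg]])
    also have "\<dots> = (\<integral>y. ?p (x - y) * w y - w x * ?p (x - y) \<partial>lebesgue)"
      using ipw ip p0 by (simp add: conv_def)
    also have "\<bar>\<dots>\<bar> \<le> (\<integral>y. \<bar>?p (x - y)\<bar> * B \<partial>lebesgue)"
    proof (rule order_trans[OF integral_abs_bound integral_mono'])
      show "integrable lebesgue (\<lambda>y. \<bar>?p (x - y)\<bar> * B)" using ip by auto
      fix y
      have "\<bar>?p (x - y)\<bar> * \<bar>w y - w x\<bar> \<le> \<bar>?p (x - y)\<bar> * B"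
      proof (cases "dist x y \<le> \<delta>")
        case True
        then show ?thesis by (intro mult_left_mono osc) auto
      next
        case False
        then show ?thesis using pk[of "x - y"] by (simp add: dist_norm)
      qed
      moreover have "\<bar>?p (x - y) * w y - w x * ?p (x - y)\<bar> = \<bar>?p (x - y)\<bar> * \<bar>w y - w x\<bar>"
        by (simp add: abs_mult[symmetric] algebra_simps)
      ultimately show "\<bar>?p (x - y) * w y - w x * ?p (x - y)\<bar> \<le> \<bar>?p (x - y)\<bar> * B" by simp
      show "0 \<le> \<bar>?p (x - y)\<bar> * B" using osc[of x] \<delta> by simp
    qed
    also have "\<dots> = (\<integral>z. \<bar>?p z\<bar> \<partial>lebesgue) * B"
      using integral_lebesgue_reflect[OF integrable_abs[OF test_integrable[OF tp]], of x] by simp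
    also have "(\<integral>z. \<bar>?p z\<bar> \<partial>lebesgue) = (\<integral>z. (1 / \<delta>) * rescale (\<lambda>z. \<bar>partial_deriv l \<rho> z\<bar>) \<delta> z \<partial>lebesgue)"
      using \<delta> by (intro Bochner_Integration.integral_cong) (auto simp: partial_deriv_rescale[OF t\<rho> \<delta>] rescale_def abs_mult)
    also have "\<dots> = (1 / \<delta>) * (\<integral>z. \<bar>partial_deriv l \<rho> z\<bar> \<partial>lebesgue)"
      using integral_rescale[OF integrable_abs[OF test_integrable[OF Cc_infty_partial_deriv[OF t\<rho>]]] \<delta>, of l] by simp
    finally show ?thesis by (simp add: mult_ac)
  qed
  then have "(\<Sum>l\<in>UNIV. \<bar>conv ?k g x $ l\<bar>) \<le> (\<Sum>l\<in>UNIV. (\<integral>z. \<bar>partial_deriv l \<rho> z\<bar> \<partial>lebesgue) * (B / \<delta>))"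
    by (rule sum_mono)
  then show ?thesis unfolding sum_distrib_right by (rule order_trans[OF norm_le_l1_cart])
qed

lemma integral_lebesgue_on_le:
  fixes f :: "real ^ 'n \<Rightarrow> real"
  assumes "S \<in> sets lebesgue" "integrable lebesgue f" "\<And>x. 0 \<le> f x"
  shows "integral\<^sup>L (lebesgue_on S) f \<le> integral\<^sup>L lebesgue f"
  unfolding integral_zero_ext[OF assms(1)]
  by (rule integral_mono[OF integrable_zero_ext_subset[OF assms(2,1)] assms(2)])
    (use assms(3) in \<open>auto simp: zero_ext_def indicator_def\<close>)

lemma integrable_lebesgue_on:
  fixes f :: "real ^ 'n \<Rightarrow> 'b::{banach, second_countable_topology}"
  assumes "S \<in> sets lebesgue" "integrable lebesgue f"
  shows "integrable (lebesgue_on S) f"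
  using integrable_zero_ext_subset[OF assms(2,1)] integrable_zero_ext[OF assms(1)] by blast

lemma conv_support:
  assumes \<rho>: "\<And>z. \<rho> z \<noteq> 0 \<Longrightarrow> z \<in> K" and \<delta>: "0 < \<delta>" and w: "\<And>y. w y \<noteq> 0 \<Longrightarrow> y \<in> S"
    and x: "conv (rescale \<rho> \<delta>) w x \<noteq> 0"
  shows "x \<in> {y + \<delta> *\<^sub>R z | y z. y \<in> S \<and> z \<in> K}"
proof -
  obtain y where y: "w y \<noteq> 0" "rescale \<rho> \<delta> (x - y) \<noteq> 0" using x conv_eq_0[of w "rescale \<rho> \<delta>" x] by blast
  then have "(1 / \<delta>) *\<^sub>R (x - y) \<in> K" using \<rho> by (auto simp: rescale_def)
  moreover have "x = y + \<delta> *\<^sub>R ((1 / \<delta>) *\<^sub>R (x - y))" using \<delta> by simp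
  ultimately show ?thesis using w[OF y(1)] by blast
qed

context musielak
begin

text \<open>
  Each piece \<open>\<zeta> i * v\<close> of a partition of unity is mollified with the inward kernel that belongs to its
  ball, which gives it compact support in \<open>\<Omega>\<close>. The gradient of a piece is \<open>\<zeta> i * g + v * grad (\<zeta> i)\<close>: the
  second term is bounded, so the modular of the piece is still integrable, and the oscillation
  of the piece at scale \<open>\<delta>\<close> is of order \<open>\<delta> powr \<theta>\<close> like that of \<open>v\<close>. The averaging estimate thus
  bounds the modular of every mollified piece, hence that of their sum.
\<close>

lemma approximation:
  assumes bal: "balanced \<theta>" and \<theta>: "0 \<le> \<theta>" "\<theta> < 1"
    and vg: "weak_grad v g"
    and out: "\<And>x. x \<notin> \<Omega> \<Longrightarrow> v x = 0" "\<And>x. x \<notin> \<Omega> \<Longrightarrow> g x = 0"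
    and vB: "\<And>x. \<bar>v x\<bar> \<le> B"
    and osc: "\<And>x y \<delta>. 0 < \<delta> \<Longrightarrow> dist x y \<le> \<delta> \<Longrightarrow> \<bar>v x - v y\<bar> \<le> B * \<delta> powr \<theta>"
    and Mg: "integrable (lebesgue_on \<Omega>) (\<lambda>x. M x (g x))"
  obtains \<phi> hn h where "\<And>n. \<phi> n \<in> Cc_infty \<Omega>"
    "AE x in lebesgue. (\<lambda>n. \<phi> n x) \<longlonglongrightarrow> v x" "AE x in lebesgue. (\<lambda>n. grad (\<phi> n) x) \<longlonglongrightarrow> g x"
    "\<And>n. AE x in lebesgue_on \<Omega>. M x (grad (\<phi> n) x) \<le> hn n x"
    "\<And>n::nat. integrable (lebesgue_on \<Omega>) (hn n)" "integrable (lebesgue_on \<Omega>) h" "\<And>x. 0 \<le> h x"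
    "(\<lambda>n. \<integral>x. \<bar>hn n x - h x\<bar> \<partial>lebesgue_on \<Omega>) \<longlonglongrightarrow> 0"
proof -
  let ?S = "closure \<Omega>"
  have S: "compact ?S" "?S \<noteq> {}" using bounded_domain nonempty by (auto simp: compact_closure)
  have B0: "0 \<le> B" using vB[of 0] by linarith
  define inward where "inward x \<rho> r K \<longleftrightarrow> mollifier \<rho> \<and> 0 < r \<and> compact K \<and> (\<forall>z. \<rho> z \<noteq> 0 \<longrightarrow> z \<in> K) \<and>
    (\<forall>y z \<delta>. y \<in> ?S \<longrightarrow> y \<in> cball x r \<longrightarrow> z \<in> K \<longrightarrow> 0 < \<delta> \<longrightarrow> \<delta> < r \<longrightarrow> y + \<delta> *\<^sub>R z \<in> \<Omega>)" for x \<rho> r K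
  have "\<exists>\<rho> r K. inward x \<rho> r K" if "x \<in> ?S" for x
    using inward_mollifier[OF domain that] unfolding inward_def by metis
  then obtain \<rho> r K where inward: "\<And>x. x \<in> ?S \<Longrightarrow> inward x (\<rho> x) (r x) (K x)"
    by metis
  have \<rho>: "\<And>x. x \<in> ?S \<Longrightarrow> mollifier (\<rho> x)" and r: "\<And>x. x \<in> ?S \<Longrightarrow> 0 < r x"
    and K: "\<And>x. x \<in> ?S \<Longrightarrow> compact (K x)" "\<And>x z. x \<in> ?S \<Longrightarrow> \<rho> x z \<noteq> 0 \<Longrightarrow> z \<in> K x"
    and into: "\<And>x y z \<delta>. x \<in> ?S \<Longrightarrow> y \<in> ?S \<Longrightarrow> y \<in> cball x (r x) \<Longrightarrow> z \<in> K x \<Longrightarrow> 0 < \<delta> \<Longrightarrow> \<delta> < r x \<Longrightarrow> y + \<delta> *\<^sub>R z \<in> \<Omega>"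
    using inward unfolding inward_def by blast+
  obtain I \<zeta> where I: "finite I" "I \<subseteq> ?S" and \<zeta>: "\<And>i. i \<in> I \<Longrightarrow> test (\<zeta> i)" "\<And>i x. i \<in> I \<Longrightarrow> \<bar>\<zeta> i x\<bar> \<le> 1"
    "\<And>i x. i \<in> I \<Longrightarrow> x \<notin> cball i (r i) \<Longrightarrow> \<zeta> i x = 0" "\<And>x. x \<in> ?S \<Longrightarrow> (\<Sum>i\<in>I. \<zeta> i x) = 1"
    by (rule partition_of_unity[OF S, of r]) (use r in auto)
  have IS: "i \<in> I \<Longrightarrow> i \<in> ?S" for i using I by auto
  define vi where "vi i x = \<zeta> i x * v x" for i x
  define gi where "gi i x = \<zeta> i x *\<^sub>R g x + v x *\<^sub>R grad (\<zeta> i) x" for i x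
  have wi: "weak_grad (vi i) (gi i)" if "i \<in> I" for i
    unfolding vi_def[abs_def] gi_def[abs_def] by (rule weak_grad_mult[OF vg \<zeta>(1)[OF that]])
  have ivi: "integrable lebesgue (vi i)" and igi: "integrable lebesgue (gi i)" and igil: "integrable lebesgue (\<lambda>x. gi i x $ l)"
    if "i \<in> I" for i l using weak_gradD[OF wi[OF that]] by auto
  have gi_out: "gi i x = 0" if "x \<notin> \<Omega>" for i x using out[OF that] by (simp add: gi_def)
  have vi_sum: "(\<Sum>i\<in>I. vi i x) = v x" for x
  proof (cases "x \<in> \<Omega>")
    case True
    then have "(\<Sum>i\<in>I. \<zeta> i x) = 1" using closure_subset by (intro \<zeta>(4)) auto
    then show ?thesis by (simp add: vi_def sum_distrib_right[symmetric])
  qed (simp add: vi_def out)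
  \<comment> \<open>the gradients of the \<open>\<zeta> i\<close> add up to zero where their sum is constant\<close>
  have gi_sum: "(\<Sum>i\<in>I. gi i x) = g x" for x
  proof (cases "x \<in> \<Omega>")
    case True
    have s1: "(\<Sum>i\<in>I. \<zeta> i y) = 1" if "y \<in> \<Omega>" for y using closure_subset that by (intro \<zeta>(4)) auto
    have "(\<Sum>i\<in>I. partial_deriv l (\<zeta> i) x) = 0" for l
    proof -
      have "((\<lambda>y. \<Sum>i\<in>I. \<zeta> i y) has_derivative (\<lambda>h. \<Sum>i\<in>I. \<Sum>l\<in>UNIV. h $ l * partial_deriv l (\<zeta> i) x)) (at x)"
        using \<zeta>(1) by (intro has_derivative_sum has_derivative_partial_deriv smooth_differentiable) (auto simp: Cc_infty_iff)
      moreover have "((\<lambda>y. \<Sum>i\<in>I. \<zeta> i y) has_derivative (\<lambda>h. 0)) (at x)"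
      proof -
        have "((\<lambda>y. 1::real) has_derivative (\<lambda>h. 0)) (at x)" by simp
        then show ?thesis
          by (rule has_derivative_transform_within_open[OF _ open_domain True]) (simp add: s1)
      qed
      ultimately have "(\<lambda>h. \<Sum>i\<in>I. \<Sum>l\<in>UNIV. h $ l * partial_deriv l (\<zeta> i) x) = (\<lambda>h. 0)"
        by (rule has_derivative_unique)
      from fun_cong[OF this, of "axis l 1"] show ?thesis
        by (simp add: axis_def if_distrib if_distribR cong: if_cong)
    qed
    then have "(\<Sum>i\<in>I. grad (\<zeta> i) x) = 0" by (simp add: vec_eq_iff grad_def)
    then show ?thesis using s1[OF True]
      by (simp add: gi_def sum.distrib scaleR_sum_left[symmetric] scaleR_sum_right[symmetric])
  qed (simp add: gi_out out)
  define h\<^sub>i where "h\<^sub>i i = zero_ext \<Omega> (\<lambda>y. M y (gi i y) + norm (gi i y))" for i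
  have hi_in: "h\<^sub>i i y = M y (gi i y) + norm (gi i y)" if "y \<in> \<Omega>" for i y
    using that by (simp add: h\<^sub>i_def zero_ext_simps)
  have hi0: "0 \<le> h\<^sub>i i y" for i y
    using M_nonneg[of y "gi i y"] by (cases "y \<in> \<Omega>") (auto simp: h\<^sub>i_def zero_ext_simps)
  have ihi: "integrable lebesgue (h\<^sub>i i)" if i: "i \<in> I" for i
  proof -
    obtain G where G: "\<And>x. norm (grad (\<zeta> i) x) \<le> G"
    proof -
      have "\<exists>b. \<forall>x. \<bar>partial_deriv l (\<zeta> i) x\<bar> \<le> b" for l
        using test_bounded[OF Cc_infty_partial_deriv[OF \<zeta>(1)[OF i], of l]] by metis
      then obtain b where b: "\<And>l x. \<bar>partial_deriv l (\<zeta> i) x\<bar> \<le> b l" by metis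
      have "norm (grad (\<zeta> i) x) \<le> (\<Sum>l\<in>UNIV. b l)" for x
        by (rule order_trans[OF norm_le_l1_cart sum_mono]) (simp add: grad_def b)
      then show ?thesis using that by blast
    qed
    obtain b where b: "0 \<le> b" "AE x in lebesgue_on \<Omega>. \<forall>\<xi>. norm \<xi> \<le> B * G \<longrightarrow> M x \<xi> \<le> b" by (rule M_bounded)
    note gm = integrable_lebesgue_on[OF sets_domain igi[OF i]]
    have "integrable (lebesgue_on \<Omega>) (\<lambda>y. M y (gi i y))"
    proof (rule Bochner_Integration.integrable_bound)
      show "integrable (lebesgue_on \<Omega>) (\<lambda>x. A * (M x (g x) + b + 1))"
        by (intro integrable_mult_right Bochner_Integration.integrable_add Mg integrable_const_domain)
      show "(\<lambda>y. M y (gi i y)) \<in> borel_measurable (lebesgue_on \<Omega>)"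
        using gm by (intro M_measurable) auto
      have "AE x in lebesgue_on \<Omega>. x \<in> \<Omega>" using AE_space[of "lebesgue_on \<Omega>"] by (simp add: space_restrict_space)
      then show "AE x in lebesgue_on \<Omega>. norm (M x (gi i x)) \<le> norm (A * (M x (g x) + b + 1))"
        using AE_good b(2)
      proof eventually_elim
        fix x assume x: "x \<in> \<Omega>" "good x" and bx: "\<forall>\<xi>. norm \<xi> \<le> B * G \<longrightarrow> M x \<xi> \<le> b"
        have "M x (gi i x) \<le> A * (M x (\<zeta> i x *\<^sub>R g x) + M x (v x *\<^sub>R grad (\<zeta> i) x) + 1)"
          unfolding gi_def by (rule good_add[OF x(2,1)])
        also have "\<dots> \<le> A * (M x (g x) + b + 1)"
        proof (intro mult_left_mono add_mono order_refl doubling(1))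
          show "M x (\<zeta> i x *\<^sub>R g x) \<le> M x (g x)" by (rule good_shrink[OF x(2,1) \<zeta>(2)[OF i]])
          have "norm (v x *\<^sub>R grad (\<zeta> i) x) \<le> B * G" using vB[of x] G[of x] B0 by (auto intro!: mult_mono)
          then show "M x (v x *\<^sub>R grad (\<zeta> i) x) \<le> b" using bx by blast
        qed
        finally show "norm (M x (gi i x)) \<le> norm (A * (M x (g x) + b + 1))" using M_nonneg[OF x(1)] by simp
      qed
    qed
    then have "integrable (lebesgue_on \<Omega>) (\<lambda>y. M y (gi i y) + norm (gi i y))" using gm by auto
    then show ?thesis unfolding h\<^sub>i_def using integrable_zero_ext[OF sets_domain] by blast
  qed
  have "\<exists>L>0. \<forall>x y. \<bar>\<zeta> i x - \<zeta> i y\<bar> \<le> L * norm (x - y)" if "i \<in> I" for i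
    using test_lipschitz[OF \<zeta>(1)[OF that]] by metis
  then obtain L where L: "\<And>i. i \<in> I \<Longrightarrow> 0 < L i" "\<And>i x y. i \<in> I \<Longrightarrow> \<bar>\<zeta> i x - \<zeta> i y\<bar> \<le> L i * norm (x - y)" by metis
  have osci: "\<bar>vi i y - vi i x\<bar> \<le> B * (1 + L i) * \<delta> powr \<theta>" if i: "i \<in> I" and \<delta>: "0 < \<delta>" "\<delta> \<le> 1" "dist x y \<le> \<delta>" for i x y \<delta>
  proof -
    have "\<bar>vi i y - vi i x\<bar> = \<bar>\<zeta> i y * (v y - v x) + (\<zeta> i y - \<zeta> i x) * v x\<bar>" by (simp add: vi_def algebra_simps)
    also have "\<dots> \<le> \<bar>\<zeta> i y\<bar> * \<bar>v y - v x\<bar> + \<bar>\<zeta> i y - \<zeta> i x\<bar> * \<bar>v x\<bar>"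
      using abs_triangle_ineq by (simp add: abs_mult[symmetric])
    also have "\<dots> \<le> 1 * (B * \<delta> powr \<theta>) + (L i * \<delta>) * B"
    proof (intro add_mono mult_mono)
      show "\<bar>v y - v x\<bar> \<le> B * \<delta> powr \<theta>" using osc[OF \<delta>(1), of y x] \<delta>(3) by (simp add: dist_commute)
      have "\<bar>\<zeta> i y - \<zeta> i x\<bar> \<le> L i * norm (y - x)" by (rule L(2)[OF i])
      also have "\<dots> \<le> L i * \<delta>" using L(1)[OF i] \<delta>(3) by (intro mult_left_mono) (auto simp: dist_norm norm_minus_commute)
      finally show "\<bar>\<zeta> i y - \<zeta> i x\<bar> \<le> L i * \<delta>" .
    qed (use \<zeta>(2)[OF i] vB L(1)[OF i] \<delta> in auto)
    also have "\<delta> \<le> \<delta> powr \<theta>" using \<delta> \<theta> powr_mono'[of \<theta> 1 \<delta>] by simp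
    then have "1 * (B * \<delta> powr \<theta>) + (L i * \<delta>) * B \<le> 1 * (B * \<delta> powr \<theta>) + (L i * \<delta> powr \<theta>) * B"
      using L(1)[OF i] B0 by (intro add_left_mono mult_right_mono mult_left_mono) auto
    finally show ?thesis by (simp add: algebra_simps)
  qed
  define c where "c i = (\<Sum>l\<in>UNIV. \<integral>z. \<bar>partial_deriv l (\<rho> i) z\<bar> \<partial>lebesgue)" for i
  have c0: "0 \<le> c i" for i unfolding c_def by (intro sum_nonneg Bochner_Integration.integral_nonneg) auto
  have cBL: "0 \<le> c i * (B * (1 + L i))" if "i \<in> I" for i
    by (intro mult_nonneg_nonneg c0 B0) (use L(1)[OF that] in simp)
  define Q where "Q = 1 + (\<Sum>i\<in>I. c i * (B * (1 + L i)))"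
  have Qi: "c i * (B * (1 + L i)) \<le> Q" if "i \<in> I" for i
  proof -
    have "c i * (B * (1 + L i)) \<le> (\<Sum>i\<in>I. c i * (B * (1 + L i)))"
      by (rule member_le_sum[OF that _ I(1)]) (use cBL in auto)
    then show ?thesis by (simp add: Q_def)
  qed
  have Q1: "1 \<le> Q" unfolding Q_def using sum_nonneg[of I "\<lambda>i. c i * (B * (1 + L i))"] cBL by simp
  have gbound: "norm (conv (rescale (\<rho> i) \<delta>) (gi i) x) \<le> Q * \<delta> powr (\<theta> - 1)" if i: "i \<in> I" and \<delta>: "0 < \<delta>" "\<delta> \<le> 1" for i \<delta> x
  proof -
    have "norm (conv (rescale (\<rho> i) \<delta>) (gi i) x) \<le> c i * ((B * (1 + L i) * \<delta> powr \<theta>) / \<delta>)"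
      unfolding c_def using osci[OF i \<delta>] by (intro conv_gradient_bound[OF \<rho>[OF IS[OF i]] \<delta>(1) wi[OF i]]) auto
    also have "\<dots> = c i * (B * (1 + L i)) * \<delta> powr (\<theta> - 1)" using \<delta> by (simp add: powr_diff)
    also have "\<dots> \<le> Q * \<delta> powr (\<theta> - 1)" by (intro mult_right_mono Qi[OF i]) auto
    finally show ?thesis .
  qed
  obtain C \<delta>0 where C: "0 \<le> C" "0 < \<delta>0"
    and avg: "\<And>\<delta> k g h. 0 < \<delta> \<Longrightarrow> \<delta> < \<delta>0 \<Longrightarrow> test k \<Longrightarrow> (\<And>z. 0 \<le> k z) \<Longrightarrow> (\<integral>z. k z \<partial>lebesgue) = 1 \<Longrightarrow>
      (\<And>z. k z \<noteq> 0 \<Longrightarrow> norm z \<le> \<delta>) \<Longrightarrow> integrable lebesgue g \<Longrightarrow> (\<And>y. y \<notin> \<Omega> \<Longrightarrow> g y = 0) \<Longrightarrow>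
      integrable lebesgue h \<Longrightarrow> (\<And>y. y \<in> \<Omega> \<Longrightarrow> h y = M y (g y) + norm (g y)) \<Longrightarrow> (\<And>y. 0 \<le> h y) \<Longrightarrow>
      AE x in lebesgue_on \<Omega>. norm (conv k g x) \<le> Q * \<delta> powr (\<theta> - 1) \<longrightarrow> M x (conv k g x) \<le> C * (conv k h x + 1)"
    by (rule averaging[OF bal Q1]) blast
  obtain A' where A': "0 \<le> A'" "\<And>x \<eta>. good x \<Longrightarrow> x \<in> \<Omega> \<Longrightarrow> M x (\<Sum>i\<in>I. \<eta> i) \<le> A' * ((\<Sum>i\<in>I. M x (\<eta> i)) + 1)"
    by (rule good_sum[OF I(1)]) blast
  \<comment> \<open>below the scale \<open>D\<close> the averaging estimate holds and all the kernels push into \<open>\<Omega>\<close>\<close>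
  define D where "D = Min (insert \<delta>0 (insert 1 (r ` I)))"
  have D: "0 < D" "D \<le> \<delta>0" "D \<le> 1" "\<And>i. i \<in> I \<Longrightarrow> D \<le> r i"
  proof -
    have fin: "finite (insert \<delta>0 (insert 1 (r ` I)))" using I(1) by simp
    show "0 < D" unfolding D_def using fin C(2) r IS by (subst Min_gr_iff) auto
    show "D \<le> \<delta>0" "D \<le> 1" unfolding D_def by (rule Min_le[OF fin]; simp)+
    show "D \<le> r i" if "i \<in> I" for i unfolding D_def by (rule Min_le[OF fin]) (use that in simp)
  qed
  define d where "d n = D / 2 * (1 / real (Suc n))" for n
  have d: "0 < d n" for n using D by (simp add: d_def)
  have dD: "d n < D" for n
  proof -
    have "d n \<le> D / 2 * 1" unfolding d_def using D by (intro mult_left_mono) auto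
    then show ?thesis using D by simp
  qed
  have d0: "d \<longlonglongrightarrow> 0" using tendsto_mult_right_zero[OF LIMSEQ_inverse_real_of_nat, of "D / 2"]
    by (simp add: d_def[abs_def] inverse_eq_divide)
  define k where "k i n = rescale (\<rho> i) (d n)" for i n
  have k: "test (k i n)" "\<And>z. 0 \<le> k i n z" "(\<integral>z. k i n z \<partial>lebesgue) = 1" "\<And>z. k i n z \<noteq> 0 \<Longrightarrow> norm z \<le> d n"
    if "i \<in> I" for i n
    unfolding k_def using mollifier_rescale[OF \<rho>[OF IS[OF that]] d] by auto
  have kL1: "(\<lambda>n. \<integral>x. \<bar>conv (k i n) w x - w x\<bar> \<partial>lebesgue) \<longlonglongrightarrow> 0" and kint: "integrable lebesgue (conv (k i n) w)"
    if "i \<in> I" "integrable lebesgue w" for i n and w :: "real ^ 'n \<Rightarrow> real"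
    unfolding k_def using conv_tendsto_L1[OF \<rho>[OF IS[OF that(1)]] that(2) d d0] integrable_conv_mollifier[OF \<rho>[OF IS[OF that(1)]] that(2) d]
    by auto
  define \<Phi> where "\<Phi> n x = (\<Sum>i\<in>I. conv (k i n) (vi i) x)" for n x
  have \<Phi>: "\<Phi> n \<in> Cc_infty \<Omega>" for n
    unfolding \<Phi>_def[abs_def]
  proof (rule test_sum)
    fix i assume i: "i \<in> I"
    let ?T = "{y + d n *\<^sub>R z | y z. y \<in> ?S \<inter> cball i (r i) \<and> z \<in> K i}"
    have T: "compact ?T"
    proof -
      have "compact {y + z | y z. y \<in> ?S \<inter> cball i (r i) \<and> z \<in> (\<lambda>z. d n *\<^sub>R z) ` K i}"
        using S K(1)[OF IS[OF i]] by (intro compact_sums compact_Int compact_cball compact_scaling)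
      moreover have "{y + z | y z. y \<in> ?S \<inter> cball i (r i) \<and> z \<in> (\<lambda>z. d n *\<^sub>R z) ` K i} = ?T" by blast
      ultimately show ?thesis by simp
    qed
    have vi_supp: "y \<in> ?S \<inter> cball i (r i)" if "vi i y \<noteq> 0" for y
      using that out(1)[of y] \<zeta>(3)[OF i, of y] closure_subset[of \<Omega>] by (auto simp: vi_def)
    have "conv (k i n) (vi i) x = 0" if "x \<notin> ?T" for x
      using conv_support[OF K(2)[OF IS[OF i]] d[of n] vi_supp, where x=x] that unfolding k_def by blast
    moreover have "?T \<subseteq> \<Omega>" using into[OF IS[OF i] _ _ _ d] dD D(4)[OF i] by (fastforce intro: less_le_trans)
    ultimately show "conv (k i n) (vi i) \<in> Cc_infty \<Omega>"
      unfolding Cc_infty_iff using smooth_conv[OF k(1)[OF i] ivi[OF i]] T by blast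
  qed
  have grad\<Phi>: "grad (\<Phi> n) x = (\<Sum>i\<in>I. conv (k i n) (gi i) x)" for n x
  proof -
    have "(\<Phi> n has_derivative (\<lambda>h. \<Sum>i\<in>I. \<Sum>l\<in>UNIV. h $ l * partial_deriv l (conv (k i n) (vi i)) x)) (at x)"
      unfolding \<Phi>_def[abs_def]
      using conv_differentiable[OF k(1) ivi] by (intro has_derivative_sum has_derivative_partial_deriv) auto
    from partial_deriv_eqI[OF this]
    have "partial_deriv l (\<Phi> n) x = (\<Sum>i\<in>I. partial_deriv l (conv (k i n) (vi i)) x)" for l
      by (simp add: axis_def if_distrib if_distribR cong: if_cong)
    also have "\<dots> l = (\<Sum>i\<in>I. conv (k i n) (gi i) x $ l)" for l
      by (intro sum.cong refl) (simp add: weak_grad_conv[OF wi k(1)] conv_component[OF k(1) igi])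
    finally show ?thesis by (simp add: vec_eq_iff grad_def)
  qed
  \<comment> \<open>the total error; a subsequence on which it tends to zero almost everywhere serves all pieces and all
    partial derivatives\<close>
  define u where "u n x = (\<Sum>i\<in>I. \<bar>conv (k i n) (vi i) x - vi i x\<bar> + (\<Sum>l\<in>UNIV. \<bar>conv (k i n) (\<lambda>y. gi i y $ l) x - gi i x $ l\<bar>))" for n x
  have iu: "integrable lebesgue (u n)" for n
    unfolding u_def[abs_def]
    by (intro Bochner_Integration.integrable_sum Bochner_Integration.integrable_add integrable_abs
        Bochner_Integration.integrable_diff kint ivi igil)
  have u0: "0 \<le> u n x" for n x unfolding u_def by (intro sum_nonneg add_nonneg_nonneg) auto
  have "(\<lambda>n. \<integral>x. u n x \<partial>lebesgue) \<longlonglongrightarrow> (\<Sum>i\<in>I. 0 + (\<Sum>l\<in>(UNIV::'n set). 0))"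
  proof -
    have "(\<integral>x. u n x \<partial>lebesgue) = (\<Sum>i\<in>I. (\<integral>x. \<bar>conv (k i n) (vi i) x - vi i x\<bar> \<partial>lebesgue) +
        (\<Sum>l\<in>UNIV. \<integral>x. \<bar>conv (k i n) (\<lambda>y. gi i y $ l) x - gi i x $ l\<bar> \<partial>lebesgue))" for n
      unfolding u_def using kint ivi igil
      by (subst Bochner_Integration.integral_sum) (auto intro!: sum.cong simp: Bochner_Integration.integral_add Bochner_Integration.integral_sum)
    then show ?thesis using kL1 ivi igil by (simp only:) (intro tendsto_sum tendsto_add; blast)
  qed
  then have "(\<lambda>n. \<integral>x. norm (u n x) \<partial>lebesgue) \<longlonglongrightarrow> 0" using u0 by simp
  from tendsto_L1_AE_subseq[OF iu this] obtain s :: "nat \<Rightarrow> nat" where s: "strict_mono s" "AE x in lebesgue. (\<lambda>n. u (s n) x) \<longlonglongrightarrow> 0" by blast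
  have term_le: "\<bar>conv (k i n) (vi i) x - vi i x\<bar> \<le> u n x" "\<bar>conv (k i n) (\<lambda>y. gi i y $ l) x - gi i x $ l\<bar> \<le> u n x" if i: "i \<in> I" for i n x l
  proof -
    let ?a = "\<lambda>i. \<bar>conv (k i n) (vi i) x - vi i x\<bar> + (\<Sum>l\<in>UNIV. \<bar>conv (k i n) (\<lambda>y. gi i y $ l) x - gi i x $ l\<bar>)"
    have "?a i \<le> u n x" unfolding u_def by (rule member_le_sum[OF i _ I(1)]) (auto intro!: add_nonneg_nonneg sum_nonneg)
    moreover have "\<bar>conv (k i n) (\<lambda>y. gi i y $ l) x - gi i x $ l\<bar> \<le> (\<Sum>l\<in>UNIV. \<bar>conv (k i n) (\<lambda>y. gi i y $ l) x - gi i x $ l\<bar>)"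
      by (rule member_le_sum) auto
    moreover have "0 \<le> (\<Sum>l\<in>UNIV. \<bar>conv (k i n) (\<lambda>y. gi i y $ l) x - gi i x $ l\<bar>)" by (intro sum_nonneg) auto
    ultimately show "\<bar>conv (k i n) (vi i) x - vi i x\<bar> \<le> u n x" "\<bar>conv (k i n) (\<lambda>y. gi i y $ l) x - gi i x $ l\<bar> \<le> u n x"
      by linarith+
  qed
  have to: "(\<lambda>n. a n) \<longlonglongrightarrow> a0" if "\<And>n. \<bar>a n - a0\<bar> \<le> u (s n) x" "(\<lambda>n. u (s n) x) \<longlonglongrightarrow> 0" for a a0 x
    using Lim_null_comparison[OF _ that(2), of "\<lambda>n. a n - a0"] that(1) by (simp add: LIM_zero_iff)
  define H where "H n x = A' * ((\<Sum>i\<in>I. C * (conv (k i n) (h\<^sub>i i) x + 1)) + 1)" for n x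
  define H\<^sub>0 where "H\<^sub>0 x = A' * ((\<Sum>i\<in>I. C * (h\<^sub>i i x + 1)) + 1)" for x
  have iH: "integrable (lebesgue_on \<Omega>) (H n)" for n
    unfolding H_def[abs_def]
    by (intro integrable_mult_right Bochner_Integration.integrable_add Bochner_Integration.integrable_sum
        integrable_const_domain integrable_lebesgue_on[OF sets_domain] kint ihi)
  have iH0: "integrable (lebesgue_on \<Omega>) H\<^sub>0"
    unfolding H\<^sub>0_def[abs_def]
    by (intro integrable_mult_right Bochner_Integration.integrable_add Bochner_Integration.integrable_sum
        integrable_const_domain integrable_lebesgue_on[OF sets_domain] ihi)
  have HL1: "(\<lambda>n. \<integral>x. \<bar>H n x - H\<^sub>0 x\<bar> \<partial>lebesgue_on \<Omega>) \<longlonglongrightarrow> 0"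
  proof (rule tendsto_sandwich[OF _ _ tendsto_const])
    show "\<forall>\<^sub>F n in sequentially. 0 \<le> (\<integral>x. \<bar>H n x - H\<^sub>0 x\<bar> \<partial>lebesgue_on \<Omega>)" by simp
    have "(\<integral>x. \<bar>H n x - H\<^sub>0 x\<bar> \<partial>lebesgue_on \<Omega>) \<le> A' * C * (\<Sum>i\<in>I. \<integral>x. \<bar>conv (k i n) (h\<^sub>i i) x - h\<^sub>i i x\<bar> \<partial>lebesgue)" for n
    proof -
      let ?E = "\<lambda>x. A' * C * (\<Sum>i\<in>I. \<bar>conv (k i n) (h\<^sub>i i) x - h\<^sub>i i x\<bar>)"
      have iE: "integrable lebesgue ?E"
        by (intro integrable_mult_right Bochner_Integration.integrable_sum integrable_abs Bochner_Integration.integrable_diff kint ihi)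
      have E0: "0 \<le> ?E x" for x using A'(1) C(1) by (intro mult_nonneg_nonneg sum_nonneg) auto
      have "(\<integral>x. \<bar>H n x - H\<^sub>0 x\<bar> \<partial>lebesgue_on \<Omega>) \<le> (\<integral>x. ?E x \<partial>lebesgue_on \<Omega>)"
      proof (rule integral_mono'[OF integrable_lebesgue_on[OF sets_domain iE] _ E0])
        fix x
        have "H n x - H\<^sub>0 x = A' * C * (\<Sum>i\<in>I. conv (k i n) (h\<^sub>i i) x - h\<^sub>i i x)"
          by (simp add: H_def H\<^sub>0_def sum_subtractf sum.distrib sum_distrib_left algebra_simps)
        then have "\<bar>H n x - H\<^sub>0 x\<bar> = A' * C * \<bar>\<Sum>i\<in>I. conv (k i n) (h\<^sub>i i) x - h\<^sub>i i x\<bar>"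
          using A'(1) C(1) by (simp add: abs_mult)
        also have "\<dots> \<le> ?E x" using A'(1) C(1) by (intro mult_left_mono sum_abs) auto
        finally show "\<bar>H n x - H\<^sub>0 x\<bar> \<le> ?E x" .
      qed
      also have "\<dots> \<le> (\<integral>x. ?E x \<partial>lebesgue)" by (rule integral_lebesgue_on_le[OF sets_domain iE E0])
      also have "\<dots> = A' * C * (\<Sum>i\<in>I. \<integral>x. \<bar>conv (k i n) (h\<^sub>i i) x - h\<^sub>i i x\<bar> \<partial>lebesgue)"
        using kint ihi by (simp add: Bochner_Integration.integral_sum)
      finally show ?thesis .
    qed
    then show "\<forall>\<^sub>F n in sequentially. (\<integral>x. \<bar>H n x - H\<^sub>0 x\<bar> \<partial>lebesgue_on \<Omega>) \<le> A' * C * (\<Sum>i\<in>I. \<integral>x. \<bar>conv (k i n) (h\<^sub>i i) x - h\<^sub>i i x\<bar> \<partial>lebesgue)" by simp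
    have "(\<lambda>n. A' * C * (\<Sum>i\<in>I. \<integral>x. \<bar>conv (k i n) (h\<^sub>i i) x - h\<^sub>i i x\<bar> \<partial>lebesgue)) \<longlonglongrightarrow> A' * C * (\<Sum>i\<in>I. 0)"
      using kL1 ihi by (intro tendsto_mult tendsto_const tendsto_sum) blast
    then show "(\<lambda>n. A' * C * (\<Sum>i\<in>I. \<integral>x. \<bar>conv (k i n) (h\<^sub>i i) x - h\<^sub>i i x\<bar> \<partial>lebesgue)) \<longlonglongrightarrow> 0" by simp
  qed
  show ?thesis
  proof (rule that[of "\<lambda>n. \<Phi> (s n)" "\<lambda>n. H (s n)" H\<^sub>0])
    show "\<Phi> (s n) \<in> Cc_infty \<Omega>" for n by (rule \<Phi>)
    show "AE x in lebesgue. (\<lambda>n. \<Phi> (s n) x) \<longlonglongrightarrow> v x"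
      using s(2)
    proof eventually_elim
      fix x assume ux: "(\<lambda>n. u (s n) x) \<longlonglongrightarrow> 0"
      have "(\<lambda>n. \<Sum>i\<in>I. conv (k i (s n)) (vi i) x) \<longlonglongrightarrow> (\<Sum>i\<in>I. vi i x)"
        by (intro tendsto_sum to[OF _ ux] term_le(1))
      then show "(\<lambda>n. \<Phi> (s n) x) \<longlonglongrightarrow> v x" by (simp add: \<Phi>_def vi_sum)
    qed
    show "AE x in lebesgue. (\<lambda>n. grad (\<Phi> (s n)) x) \<longlonglongrightarrow> g x"
      using s(2)
    proof eventually_elim
      fix x assume ux: "(\<lambda>n. u (s n) x) \<longlonglongrightarrow> 0"
      have "(\<lambda>n. grad (\<Phi> (s n)) x $ l) \<longlonglongrightarrow> g x $ l" for l
      proof -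
        have "(\<lambda>n. \<Sum>i\<in>I. conv (k i (s n)) (\<lambda>y. gi i y $ l) x) \<longlonglongrightarrow> (\<Sum>i\<in>I. gi i x $ l)"
          by (intro tendsto_sum to[OF _ ux] term_le(2))
        moreover have "grad (\<Phi> (s n)) x $ l = (\<Sum>i\<in>I. conv (k i (s n)) (\<lambda>y. gi i y $ l) x)" for n
          unfolding grad\<Phi> by (auto intro!: sum.cong simp: conv_component[OF k(1) igi])
        moreover have "(\<Sum>i\<in>I. gi i x $ l) = g x $ l" using gi_sum[of x] by (metis sum_component)
        ultimately show ?thesis by simp
      qed
      then show "(\<lambda>n. grad (\<Phi> (s n)) x) \<longlonglongrightarrow> g x" by (rule vec_tendstoI)
    qed
    show "AE x in lebesgue_on \<Omega>. M x (grad (\<Phi> (s n)) x) \<le> H (s n) x" for n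
    proof -
      let ?n = "s n"
      have "AE x in lebesgue_on \<Omega>. norm (conv (k i ?n) (gi i) x) \<le> Q * d ?n powr (\<theta> - 1) \<longrightarrow>
          M x (conv (k i ?n) (gi i) x) \<le> C * (conv (k i ?n) (h\<^sub>i i) x + 1)" if i: "i \<in> I" for i
        by (rule avg[OF d _ k[OF i] igi[OF i] gi_out ihi[OF i] hi_in hi0]) (use dD[of ?n] D(2) in auto)
      then have "AE x in lebesgue_on \<Omega>. \<forall>i\<in>I. norm (conv (k i ?n) (gi i) x) \<le> Q * d ?n powr (\<theta> - 1) \<longrightarrow>
          M x (conv (k i ?n) (gi i) x) \<le> C * (conv (k i ?n) (h\<^sub>i i) x + 1)"
        by (intro eventually_ball_finite[OF I(1)] ballI)
      moreover have "AE x in lebesgue_on \<Omega>. x \<in> \<Omega>" using AE_space[of "lebesgue_on \<Omega>"] by (simp add: space_restrict_space)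
      ultimately show ?thesis using AE_good
      proof eventually_elim
        fix x assume *: "\<forall>i\<in>I. norm (conv (k i ?n) (gi i) x) \<le> Q * d ?n powr (\<theta> - 1) \<longrightarrow>
          M x (conv (k i ?n) (gi i) x) \<le> C * (conv (k i ?n) (h\<^sub>i i) x + 1)" and x: "x \<in> \<Omega>" "good x"
        have "M x (conv (k i ?n) (gi i) x) \<le> C * (conv (k i ?n) (h\<^sub>i i) x + 1)" if i: "i \<in> I" for i
          using * i gbound[OF i d, of ?n x] dD[of ?n] D(3) unfolding k_def by simp
        then have "M x (grad (\<Phi> ?n) x) \<le> A' * ((\<Sum>i\<in>I. C * (conv (k i ?n) (h\<^sub>i i) x + 1)) + 1)"
          unfolding grad\<Phi>
          by (intro order_trans[OF A'(2)[OF x(2,1)]] mult_left_mono add_right_mono sum_mono A'(1))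
        then show "M x (grad (\<Phi> ?n) x) \<le> H ?n x" by (simp add: H_def)
      qed
    qed
    show "integrable (lebesgue_on \<Omega>) (H (s n))" for n by (rule iH)
    show "integrable (lebesgue_on \<Omega>) H\<^sub>0" by (rule iH0)
    show "0 \<le> H\<^sub>0 x" for x unfolding H\<^sub>0_def using A'(1) C(1) hi0
      by (intro mult_nonneg_nonneg add_nonneg_nonneg sum_nonneg) auto
    show "(\<lambda>n. \<integral>x. \<bar>H (s n) x - H\<^sub>0 x\<bar> \<partial>lebesgue_on \<Omega>) \<longlonglongrightarrow> 0"
      using LIMSEQ_subseq_LIMSEQ[OF HL1 s(1)] by (simp add: o_def)
  qed
qed

end

section \<open>Absence of the Lavrentiev phenomenon from balance\<close>

context musielak
begin

lemma AE_domain: "AE x in lebesgue_on \<Omega>. x \<in> \<Omega>"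
  using AE_space[of "lebesgue_on \<Omega>"] by (simp add: space_restrict_space)

lemma scale_bound: "\<exists>C\<ge>0. \<forall>x \<xi>. good x \<longrightarrow> x \<in> \<Omega> \<longrightarrow> M x (c *\<^sub>R \<xi>) \<le> C * (M x \<xi> + 1)"
proof -
  have pow: "\<exists>C\<ge>0. \<forall>x \<xi>. x \<in> \<Omega> \<longrightarrow> M x (2 ^ n *\<^sub>R \<xi>) \<le> C * (M x \<xi> + 1)" for n
  proof (induction n)
    case 0
    then show ?case by (intro exI[of _ 1]) auto
  next
    case (Suc n)
    then obtain C where C: "0 \<le> C" "\<And>x \<xi>. x \<in> \<Omega> \<Longrightarrow> M x (2 ^ n *\<^sub>R \<xi>) \<le> C * (M x \<xi> + 1)" by blast
    have "M x (2 ^ Suc n *\<^sub>R \<xi>) \<le> (A * (C + 1)) * (M x \<xi> + 1)" if x: "x \<in> \<Omega>" for x \<xi>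
    proof -
      have "M x (2 ^ Suc n *\<^sub>R \<xi>) \<le> A * (M x (2 ^ n *\<^sub>R \<xi>) + 1)"
        using doubling(2)[OF x, of "2 ^ n *\<^sub>R \<xi>"] by simp
      also have "\<dots> \<le> A * (C * (M x \<xi> + 1) + 1)" using C(2)[OF x, of \<xi>] doubling(1) by (intro mult_left_mono) auto
      also have "\<dots> \<le> A * ((C + 1) * (M x \<xi> + 1))"
        using M_nonneg[OF x, of \<xi>] doubling(1) by (intro mult_left_mono) (auto simp: algebra_simps)
      finally show ?thesis by (simp add: mult.assoc)
    qed
    then show ?case using C(1) doubling(1) by (intro exI[of _ "A * (C + 1)"]) auto
  qed
  obtain n where n: "\<bar>c\<bar> < 2 ^ n" using real_arch_pow[of 2 "\<bar>c\<bar>"] by auto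
  obtain C where C: "0 \<le> C" "\<And>x \<xi>. x \<in> \<Omega> \<Longrightarrow> M x (2 ^ n *\<^sub>R \<xi>) \<le> C * (M x \<xi> + 1)" using pow by blast
  have "M x (c *\<^sub>R \<xi>) \<le> C * (M x \<xi> + 1)" if x: "good x" "x \<in> \<Omega>" for x \<xi>
  proof -
    have "M x ((c / 2 ^ n) *\<^sub>R (2 ^ n *\<^sub>R \<xi>)) \<le> M x (2 ^ n *\<^sub>R \<xi>)"
      using n by (intro good_shrink[OF x]) (simp add: divide_le_eq)
    also have "\<dots> \<le> C * (M x \<xi> + 1)" by (rule C(2)[OF x(2)])
    finally show ?thesis by simp
  qed
  then show ?thesis using C(1) by blast
qed

lemma modular_finite_iff:
  assumes "\<xi> \<in> borel_measurable (lebesgue_on \<Omega>)"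
  shows "(\<integral>\<^sup>+x. ennreal (M x (\<xi> x)) \<partial>lebesgue_on \<Omega>) < \<infinity> \<longleftrightarrow> integrable (lebesgue_on \<Omega>) (\<lambda>x. M x (\<xi> x))"
proof -
  have "(\<integral>\<^sup>+x. ennreal (norm (M x (\<xi> x))) \<partial>lebesgue_on \<Omega>) = (\<integral>\<^sup>+x. ennreal (M x (\<xi> x)) \<partial>lebesgue_on \<Omega>)"
    by (rule nn_integral_cong) (simp add: space_restrict_space M_nonneg)
  then show ?thesis using M_measurable[OF assms] by (simp add: integrable_iff_bounded)
qed

lemma integrable_M_bound:
  assumes "\<xi> \<in> borel_measurable (lebesgue_on \<Omega>)" "integrable (lebesgue_on \<Omega>) b"
    and "AE x in lebesgue_on \<Omega>. M x (\<xi> x) \<le> b x"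
  shows "integrable (lebesgue_on \<Omega>) (\<lambda>x. M x (\<xi> x))"
proof (rule Bochner_Integration.integrable_bound[OF assms(2) M_measurable[OF assms(1)]])
  show "AE x in lebesgue_on \<Omega>. norm (M x (\<xi> x)) \<le> norm (b x)"
    using assms(3) AE_domain
  proof eventually_elim
    fix x assume "M x (\<xi> x) \<le> b x" "x \<in> \<Omega>"
    then show "norm (M x (\<xi> x)) \<le> norm (b x)" using M_nonneg[of x "\<xi> x"] by simp
  qed
qed

lemma integrable_M_add:
  assumes "\<xi> \<in> borel_measurable (lebesgue_on \<Omega>)" "\<eta> \<in> borel_measurable (lebesgue_on \<Omega>)"
    and "integrable (lebesgue_on \<Omega>) (\<lambda>x. M x (\<xi> x))" "integrable (lebesgue_on \<Omega>) (\<lambda>x. M x (\<eta> x))"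
  shows "integrable (lebesgue_on \<Omega>) (\<lambda>x. M x (\<xi> x + \<eta> x))"
proof (rule integrable_M_bound)
  show "(\<lambda>x. \<xi> x + \<eta> x) \<in> borel_measurable (lebesgue_on \<Omega>)" using assms(1,2) by simp
  show "integrable (lebesgue_on \<Omega>) (\<lambda>x. A * (M x (\<xi> x) + M x (\<eta> x) + 1))"
    by (intro integrable_mult_right Bochner_Integration.integrable_add assms integrable_const_domain)
  show "AE x in lebesgue_on \<Omega>. M x (\<xi> x + \<eta> x) \<le> A * (M x (\<xi> x) + M x (\<eta> x) + 1)"
    using AE_good AE_domain by eventually_elim (rule good_add)
qed

lemma integrable_M_scale:
  assumes "\<xi> \<in> borel_measurable (lebesgue_on \<Omega>)" "integrable (lebesgue_on \<Omega>) (\<lambda>x. M x (\<xi> x))"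
  shows "integrable (lebesgue_on \<Omega>) (\<lambda>x. M x (c *\<^sub>R \<xi> x))"
proof -
  obtain C where C: "\<And>x \<xi>. good x \<Longrightarrow> x \<in> \<Omega> \<Longrightarrow> M x (c *\<^sub>R \<xi>) \<le> C * (M x \<xi> + 1)" using scale_bound[of c] by blast
  show ?thesis
  proof (rule integrable_M_bound)
    show "(\<lambda>x. c *\<^sub>R \<xi> x) \<in> borel_measurable (lebesgue_on \<Omega>)" using assms(1) by simp
    show "integrable (lebesgue_on \<Omega>) (\<lambda>x. C * (M x (\<xi> x) + 1))"
      by (intro integrable_mult_right Bochner_Integration.integrable_add assms integrable_const_domain)
    show "AE x in lebesgue_on \<Omega>. M x (c *\<^sub>R \<xi> x) \<le> C * (M x (\<xi> x) + 1)"
      using AE_good AE_domain by eventually_elim (rule C)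
  qed
qed

text \<open>
  By doubling, the functions of finite modular already form a linear space.
\<close>

lemma L_space_eq:
  "L_space \<Omega> M = {\<xi> \<in> borel_measurable (lebesgue_on \<Omega>). integrable (lebesgue_on \<Omega>) (\<lambda>x. M x (\<xi> x))}" (is "_ = ?K")
proof -
  have K: "{\<xi> \<in> borel_measurable (lebesgue_on \<Omega>). (\<integral>\<^sup>+ x. ennreal (M x (\<xi> x)) \<partial>lebesgue_on \<Omega>) < \<infinity>} = ?K"
    using modular_finite_iff by blast
  have "integrable (lebesgue_on \<Omega>) (\<lambda>x. M x 0)"
  proof (rule integrable_M_bound[OF _ integrable_const_domain[of 0]])
    show "AE x in lebesgue_on \<Omega>. M x 0 \<le> 0" using AE_good by eventually_elim (simp add: good_def)
  qed simp
  then have "linear_function_space ?K"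
    unfolding linear_function_space_def by (auto intro: integrable_M_add integrable_M_scale)
  then show ?thesis unfolding L_space_def K by blast
qed

lemma V1LD:
  assumes "u \<in> V1L \<Omega> M"
  shows "u \<in> W11 \<Omega>" "integrable (lebesgue_on \<Omega>) (\<lambda>x. M x (weak_gradient \<Omega> u x))"
  using assms by (auto simp: V1L_def L_space_eq)

lemma V1_0D:
  assumes "u \<in> V1_0 \<Omega> M"
  shows "u \<in> W11_0 \<Omega>" "u \<in> W11 \<Omega>" "integrable (lebesgue_on \<Omega>) (\<lambda>x. M x (weak_gradient \<Omega> u x))"
  using assms by (auto simp: V1_0_def W11_0_def L_space_eq)

lemma Cc_infty_V1_0: "Cc_infty \<Omega> \<subseteq> V1_0 \<Omega> M"
proof
  fix \<phi> assume \<phi>: "\<phi> \<in> Cc_infty \<Omega>"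
  note t = Cc_infty_test[OF \<phi>]
  have w: "weak_grad \<phi> (grad \<phi>)" by (rule weak_grad_test[OF t])
  have \<phi>W: "\<phi> \<in> W11_0 \<Omega>" by (rule Cc_infty_W11_0[OF open_domain \<phi>])
  then have "\<phi> \<in> W11 \<Omega>" by (simp add: W11_0_def)
  from W11D(3)[OF open_domain this] have m: "weak_gradient \<Omega> \<phi> \<in> borel_measurable (lebesgue_on \<Omega>)" by auto
  have "\<exists>b. \<forall>x. \<bar>partial_deriv l \<phi> x\<bar> \<le> b" for l
    using test_bounded[OF Cc_infty_partial_deriv[OF t, of l]] by metis
  then obtain b where b: "\<And>l x. \<bar>partial_deriv l \<phi> x\<bar> \<le> b l" by metis
  have G: "norm (grad \<phi> x) \<le> (\<Sum>l\<in>UNIV. b l)" for x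
    by (rule order_trans[OF norm_le_l1_cart sum_mono]) (simp add: grad_def b)
  obtain c where c: "AE x in lebesgue_on \<Omega>. \<forall>\<xi>. norm \<xi> \<le> (\<Sum>l\<in>UNIV. b l) \<longrightarrow> M x \<xi> \<le> c" by (rule M_bounded)
  have "AE x in lebesgue_on \<Omega>. weak_gradient \<Omega> \<phi> x = grad \<phi> x"
    using weak_gradient_AE[OF open_domain weak_grad_imp_has_weak_gradient[OF open_domain w]] by (simp add: AE_lebesgue_on[OF sets_domain])
  with c have "AE x in lebesgue_on \<Omega>. M x (weak_gradient \<Omega> \<phi> x) \<le> c"
    by eventually_elim (simp add: G)
  then have "integrable (lebesgue_on \<Omega>) (\<lambda>x. M x (weak_gradient \<Omega> \<phi> x))"
    by (rule integrable_M_bound[OF m integrable_const_domain])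
  then show "\<phi> \<in> V1_0 \<Omega> M" using \<phi>W m by (simp add: V1_0_def L_space_eq)
qed

lemma Cc_infty_holder:
  assumes "\<gamma> < 1"
  shows "Cc_infty \<Omega> \<subseteq> holder_space \<Omega> \<gamma>"
proof
  fix \<phi> assume \<phi>: "\<phi> \<in> Cc_infty \<Omega>"
  obtain L where L: "0 < L" "\<And>x y. \<bar>\<phi> x - \<phi> y\<bar> \<le> L * norm (x - y)"
    using test_lipschitz[OF Cc_infty_test[OF \<phi>]] by blast
  have "\<bar>\<phi> x - \<phi> y\<bar> / dist x y powr \<gamma> \<le> L * diameter \<Omega> powr (1 - \<gamma>)" if "x \<in> \<Omega>" "y \<in> \<Omega>" "x \<noteq> y" for x y
  proof -
    have "\<bar>\<phi> x - \<phi> y\<bar> / dist x y powr \<gamma> \<le> L * dist x y / dist x y powr \<gamma>"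
      using L(2)[of x y] by (intro divide_right_mono) (auto simp: dist_norm)
    also have "\<dots> = L * dist x y powr (1 - \<gamma>)" using that by (simp add: powr_diff)
    also have "\<dots> \<le> L * diameter \<Omega> powr (1 - \<gamma>)"
      using L(1) assms diameter_bounded_bound[OF bounded_domain that(1,2)] by (intro mult_left_mono powr_mono2) auto
    finally show ?thesis .
  qed
  then show "\<phi> \<in> holder_space \<Omega> \<gamma>" unfolding holder_space_def bdd_above_def by blast
qed

end

locale musielak_functional = musielak \<Omega> M J e P A
  for \<Omega> :: "(real ^ 'n) set" and M J e P A +
  fixes F :: "real ^ 'n \<Rightarrow> real \<Rightarrow> real ^ 'n \<Rightarrow> real" and \<nu> \<beta> L :: real
  assumes F_caratheodory: "caratheodory_integrand \<Omega> F"
    and constants: "0 < \<nu>" "1 < L"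
    and F_growth: "\<And>x z \<xi>. x \<in> \<Omega> \<Longrightarrow> \<nu> * M x (\<beta> *\<^sub>R \<xi>) \<le> F x z \<xi> \<and> F x z \<xi> \<le> L * (M x \<xi> + 1)"
begin

lemma F_nonneg: "x \<in> \<Omega> \<Longrightarrow> 0 \<le> F x z \<xi>"
  using F_growth[of x \<xi> z] M_nonneg[of x "\<beta> *\<^sub>R \<xi>"] constants(1) by (meson mult_nonneg_nonneg less_imp_le order_trans)

lemma F_measurable:
  assumes u: "u \<in> borel_measurable (lebesgue_on \<Omega>)" and \<xi>: "\<xi> \<in> borel_measurable (lebesgue_on \<Omega>)"
  shows "(\<lambda>x. F x (u x) (\<xi> x)) \<in> borel_measurable (lebesgue_on \<Omega>)"
proof -
  have "(\<lambda>x. (\<lambda>(z, \<xi>). F x z \<xi>) (u x, \<xi> x)) \<in> borel_measurable (lebesgue_on \<Omega>)"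
  proof (rule caratheodory_measurable[where G="\<lambda>x. \<lambda>(z, \<xi>). F x z \<xi>" and u="\<lambda>x. (u x, \<xi> x)"])
    show "(\<lambda>x. (\<lambda>(z, \<xi>). F x z \<xi>) b) \<in> borel_measurable (lebesgue_on \<Omega>)" for b
      using F_caratheodory by (cases b) (simp add: caratheodory_integrand_def)
    show "continuous_on UNIV (\<lambda>(z, \<xi>). F x z \<xi>)" if "x \<in> space (lebesgue_on \<Omega>)" for x
      using F_caratheodory that by (simp add: caratheodory_integrand_def space_restrict_space)
    show "(\<lambda>x. (u x, \<xi> x)) \<in> borel_measurable (lebesgue_on \<Omega>)" using u \<xi> by simp
  qed
  then show ?thesis by simp
qed

lemma F_integrable:
  assumes "u \<in> borel_measurable (lebesgue_on \<Omega>)" "\<xi> \<in> borel_measurable (lebesgue_on \<Omega>)"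
    and "integrable (lebesgue_on \<Omega>) (\<lambda>x. M x (\<xi> x))"
  shows "integrable (lebesgue_on \<Omega>) (\<lambda>x. F x (u x) (\<xi> x))"
proof (rule Bochner_Integration.integrable_bound[OF _ F_measurable[OF assms(1,2)]])
  show "integrable (lebesgue_on \<Omega>) (\<lambda>x. L * (M x (\<xi> x) + 1))"
    by (intro integrable_mult_right Bochner_Integration.integrable_add assms integrable_const_domain)
  show "AE x in lebesgue_on \<Omega>. norm (F x (u x) (\<xi> x)) \<le> norm (L * (M x (\<xi> x) + 1))"
    using AE_domain
  proof eventually_elim
    fix x assume "x \<in> \<Omega>"
    then show "norm (F x (u x) (\<xi> x)) \<le> norm (L * (M x (\<xi> x) + 1))"
      using F_nonneg[of x "u x" "\<xi> x"] F_growth[of x "\<xi> x" "u x"] by auto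
  qed
qed

lemma functional_eq:
  assumes "has_weak_gradient \<Omega> u0 G0" "has_weak_gradient \<Omega> w h"
  shows "functional \<Omega> F (\<lambda>x. u0 x + w x) = (\<integral>\<^sup>+x. ennreal (F x (u0 x + w x) (G0 x + h x)) \<partial>lebesgue_on \<Omega>)"
proof -
  have "has_weak_gradient \<Omega> (\<lambda>x. u0 x + 1 * w x) (\<lambda>x. G0 x + 1 *\<^sub>R h x)"
    by (rule has_weak_gradient_add[OF open_domain assms])
  then have "AE x in lebesgue_on \<Omega>. weak_gradient \<Omega> (\<lambda>x. u0 x + w x) x = G0 x + h x"
    using weak_gradient_AE[OF open_domain] by (simp add: AE_lebesgue_on[OF sets_domain])
  then show ?thesis unfolding functional_def by (intro nn_integral_cong_AE) (auto elim: eventually_mono)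
qed

lemma nn_integral_F:
  assumes "u \<in> borel_measurable (lebesgue_on \<Omega>)" "\<xi> \<in> borel_measurable (lebesgue_on \<Omega>)"
    and "integrable (lebesgue_on \<Omega>) (\<lambda>x. M x (\<xi> x))"
  shows "(\<integral>\<^sup>+x. ennreal (F x (u x) (\<xi> x)) \<partial>lebesgue_on \<Omega>) = ennreal (\<integral>x. F x (u x) (\<xi> x) \<partial>lebesgue_on \<Omega>)"
  by (rule nn_integral_eq_integral[OF F_integrable[OF assms]])
    (auto intro!: eventually_mono[OF AE_domain] F_nonneg)

text \<open>
  By growth and doubling the integrands are bounded by \<open>L * (A * (M x (\<nabla>u0 x) + hn n x + 1) + 1)\<close>, which
  converges in \<open>L\<^sup>1\<close> together with \<open>hn n\<close>.
\<close>

lemma functional_tendsto: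
  fixes w :: "nat \<Rightarrow> real ^ 'n \<Rightarrow> real"
  assumes u0: "u0 \<in> V1L \<Omega> M"
    and wn: "\<And>n. has_weak_gradient \<Omega> (w n) (gn n)" "\<And>n. w n \<in> borel_measurable (lebesgue_on \<Omega>)" "\<And>n. gn n \<in> borel_measurable (lebesgue_on \<Omega>)"
    and v: "has_weak_gradient \<Omega> v g" "v \<in> borel_measurable (lebesgue_on \<Omega>)" "g \<in> borel_measurable (lebesgue_on \<Omega>)"
    and Mg: "integrable (lebesgue_on \<Omega>) (\<lambda>x. M x (g x))"
    and lim: "AE x in lebesgue_on \<Omega>. (\<lambda>n. w n x) \<longlonglongrightarrow> v x" "AE x in lebesgue_on \<Omega>. (\<lambda>n. gn n x) \<longlonglongrightarrow> g x"
    and bound: "\<And>n. AE x in lebesgue_on \<Omega>. M x (gn n x) \<le> hn n x"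
    and h: "\<And>n. integrable (lebesgue_on \<Omega>) (hn n)" "integrable (lebesgue_on \<Omega>) h" "\<And>x. x \<in> \<Omega> \<Longrightarrow> 0 \<le> h x"
    and hL1: "(\<lambda>n. \<integral>x. \<bar>hn n x - h x\<bar> \<partial>lebesgue_on \<Omega>) \<longlonglongrightarrow> 0"
  shows "(\<lambda>n. functional \<Omega> F (\<lambda>x. u0 x + w n x)) \<longlonglongrightarrow> functional \<Omega> F (\<lambda>x. u0 x + v x)"
proof -
  let ?G = "weak_gradient \<Omega> u0"
  note u0 = V1LD[OF u0]
  note u0W = W11D[OF open_domain u0(1)]
  have [measurable]: "u0 \<in> borel_measurable (lebesgue_on \<Omega>)" "?G \<in> borel_measurable (lebesgue_on \<Omega>)"
    using u0W by auto
  note [measurable] = wn(2,3) v(2,3)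
  have Mgn: "integrable (lebesgue_on \<Omega>) (\<lambda>x. M x (gn n x))" for n
    by (rule integrable_M_bound[OF wn(3) h(1) bound])
  have M1: "integrable (lebesgue_on \<Omega>) (\<lambda>x. M x (?G x + gn n x))" for n
    by (rule integrable_M_add[OF _ wn(3) u0(2) Mgn]) simp
  have M2: "integrable (lebesgue_on \<Omega>) (\<lambda>x. M x (?G x + g x))"
    by (rule integrable_M_add[OF _ v(3) u0(2) Mg]) simp
  define f where "f n x = F x (u0 x + w n x) (?G x + gn n x)" for n x
  define f0 where "f0 x = F x (u0 x + v x) (?G x + g x)" for x
  let ?H = "\<lambda>hh x. L * (A * (M x (?G x) + hh x + 1) + 1)"
  have H: "integrable (lebesgue_on \<Omega>) (?H hh)" if "integrable (lebesgue_on \<Omega>) hh" for hh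
    by (intro integrable_mult_right Bochner_Integration.integrable_add that u0 integrable_const_domain)
  have "(\<lambda>n. \<integral>x. f n x \<partial>lebesgue_on \<Omega>) \<longlonglongrightarrow> (\<integral>x. f0 x \<partial>lebesgue_on \<Omega>)"
  proof (rule integral_tendsto_moving_bound[where h="\<lambda>n. ?H (hn n)" and H="?H h"])
    show "f n \<in> borel_measurable (lebesgue_on \<Omega>)" for n unfolding f_def by (rule F_measurable) simp_all
    show "f0 \<in> borel_measurable (lebesgue_on \<Omega>)" unfolding f0_def by (rule F_measurable) simp_all
    show "integrable (lebesgue_on \<Omega>) f0" unfolding f0_def by (rule F_integrable[OF _ _ M2]) simp_all
    show "integrable (lebesgue_on \<Omega>) (?H (hn n))" for n by (rule H[OF h(1)])
    show "integrable (lebesgue_on \<Omega>) (?H h)" by (rule H[OF h(2)])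
    show "AE x in lebesgue_on \<Omega>. (\<lambda>n. f n x) \<longlonglongrightarrow> f0 x"
      using lim AE_domain
    proof eventually_elim
      fix x assume l: "(\<lambda>n. w n x) \<longlonglongrightarrow> v x" "(\<lambda>n. gn n x) \<longlonglongrightarrow> g x" and x: "x \<in> \<Omega>"
      have c: "continuous_on UNIV (\<lambda>(z, \<xi>). F x z \<xi>)"
        using F_caratheodory x by (simp add: caratheodory_integrand_def)
      have "(\<lambda>n. (u0 x + w n x, ?G x + gn n x)) \<longlonglongrightarrow> (u0 x + v x, ?G x + g x)"
        by (intro tendsto_Pair tendsto_add tendsto_const l)
      from continuous_on_tendsto_compose[OF c this] show "(\<lambda>n. f n x) \<longlonglongrightarrow> f0 x"
        by (simp add: f_def f0_def)
    qed
    show "AE x in lebesgue_on \<Omega>. 0 \<le> f n x \<and> f n x \<le> ?H (hn n) x" for n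
      using bound[of n] AE_domain AE_good
    proof eventually_elim
      fix x assume b: "M x (gn n x) \<le> hn n x" and x: "x \<in> \<Omega>" "good x"
      have "f n x \<le> L * (M x (?G x + gn n x) + 1)" using F_growth[OF x(1)] by (simp add: f_def)
      also have "\<dots> \<le> L * (A * (M x (?G x) + M x (gn n x) + 1) + 1)"
        using good_add[OF x(2,1)] constants(2) by (intro mult_left_mono add_right_mono) auto
      also have "\<dots> \<le> ?H (hn n) x"
        using b constants(2) doubling(1) by (intro mult_left_mono add_right_mono add_left_mono) auto
      finally show "0 \<le> f n x \<and> f n x \<le> ?H (hn n) x" using F_nonneg[OF x(1)] by (simp add: f_def)
    qed
    show "AE x in lebesgue_on \<Omega>. 0 \<le> ?H h x"
      using AE_domain
    proof eventually_elim
      fix x assume x: "x \<in> \<Omega>"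
      show "0 \<le> ?H h x" using M_nonneg[OF x] h(3)[OF x] constants(2) doubling(1)
        by (intro mult_nonneg_nonneg add_nonneg_nonneg) auto
    qed
    have "\<bar>?H (hn n) x - ?H h x\<bar> = (L * A) * \<bar>hn n x - h x\<bar>" for n x
    proof -
      have "?H (hn n) x - ?H h x = (L * A) * (hn n x - h x)" by (simp add: algebra_simps)
      then show ?thesis using constants(2) doubling(1) by (simp add: abs_mult)
    qed
    then show "(\<lambda>n. \<integral>x. \<bar>?H (hn n) x - ?H h x\<bar> \<partial>lebesgue_on \<Omega>) \<longlonglongrightarrow> 0"
      using tendsto_mult_right_zero[OF hL1, of "L * A"] by simp
  qed
  then have "(\<lambda>n. ennreal (\<integral>x. f n x \<partial>lebesgue_on \<Omega>)) \<longlonglongrightarrow> ennreal (\<integral>x. f0 x \<partial>lebesgue_on \<Omega>)"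
    by (rule tendsto_ennrealI)
  moreover have "functional \<Omega> F (\<lambda>x. u0 x + w n x) = ennreal (\<integral>x. f n x \<partial>lebesgue_on \<Omega>)" for n
    unfolding functional_eq[OF u0W(2) wn(1)] f_def by (rule nn_integral_F[OF _ _ M1]) simp_all
  moreover have "functional \<Omega> F (\<lambda>x. u0 x + v x) = ennreal (\<integral>x. f0 x \<partial>lebesgue_on \<Omega>)"
    unfolding functional_eq[OF u0W(2) v(1)] f0_def by (rule nn_integral_F[OF _ _ M2]) simp_all
  ultimately show ?thesis by simp
qed

lemma functional_cong_domain:
  assumes "u0 \<in> W11 \<Omega>" "v \<in> W11_0 \<Omega>"
  shows "functional \<Omega> F (\<lambda>x. u0 x + zero_ext \<Omega> v x) = functional \<Omega> F (\<lambda>x. u0 x + v x)"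
proof -
  have v: "v \<in> W11 \<Omega>" using assms(2) by (simp add: W11_0_def)
  note wg = weak_grad_imp_has_weak_gradient[OF open_domain W11_0_weak_grad[OF open_domain assms(2)]]
  show ?thesis
    unfolding functional_eq[OF W11D(2)[OF open_domain assms(1)] wg]
      functional_eq[OF W11D(2)[OF open_domain assms(1)] W11D(2)[OF open_domain v]]
    by (rule nn_integral_cong) (simp add: space_restrict_space zero_ext_simps)
qed

lemma INF_le_functional:
  assumes bal: "balanced \<theta>" and \<theta>: "0 \<le> \<theta>" "\<theta> < 1"
    and u0: "u0 \<in> V1L \<Omega> M"
    and vg: "weak_grad v g"
    and out: "\<And>x. x \<notin> \<Omega> \<Longrightarrow> v x = 0" "\<And>x. x \<notin> \<Omega> \<Longrightarrow> g x = 0"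
    and vB: "\<And>x. \<bar>v x\<bar> \<le> B"
    and osc: "\<And>x y \<delta>. 0 < \<delta> \<Longrightarrow> dist x y \<le> \<delta> \<Longrightarrow> \<bar>v x - v y\<bar> \<le> B * \<delta> powr \<theta>"
    and Mg: "integrable (lebesgue_on \<Omega>) (\<lambda>x. M x (g x))"
  shows "(INF u\<in>translate_space u0 (Cc_infty \<Omega>). functional \<Omega> F u) \<le> functional \<Omega> F (\<lambda>x. u0 x + v x)"
proof -
  obtain \<phi> hn h where \<phi>: "\<And>n. \<phi> n \<in> Cc_infty \<Omega>"
    and lim: "AE x in lebesgue. (\<lambda>n. \<phi> n x) \<longlonglongrightarrow> v x" "AE x in lebesgue. (\<lambda>n. grad (\<phi> n) x) \<longlonglongrightarrow> g x"
    and bound: "\<And>n. AE x in lebesgue_on \<Omega>. M x (grad (\<phi> n) x) \<le> hn n x"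
    and h: "\<And>n::nat. integrable (lebesgue_on \<Omega>) (hn n)" "integrable (lebesgue_on \<Omega>) h" "\<And>x. 0 \<le> h x"
    and hL1: "(\<lambda>n. \<integral>x. \<bar>hn n x - h x\<bar> \<partial>lebesgue_on \<Omega>) \<longlonglongrightarrow> 0"
    by (rule approximation[OF bal \<theta> vg out vB osc Mg]) blast+
  have w: "weak_grad (\<phi> n) (grad (\<phi> n))" for n by (rule weak_grad_test[OF Cc_infty_test[OF \<phi>]])
  note on = integrable_lebesgue_on[OF sets_domain]
  have "(\<lambda>n. functional \<Omega> F (\<lambda>x. u0 x + \<phi> n x)) \<longlonglongrightarrow> functional \<Omega> F (\<lambda>x. u0 x + v x)"
  proof (rule functional_tendsto[OF u0 weak_grad_imp_has_weak_gradient[OF open_domain w] _ _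
        weak_grad_imp_has_weak_gradient[OF open_domain vg] _ _ Mg _ _ bound h(1,2,3) hL1])
    show "\<phi> n \<in> borel_measurable (lebesgue_on \<Omega>)" "grad (\<phi> n) \<in> borel_measurable (lebesgue_on \<Omega>)" for n
      using on[OF weak_gradD(1)[OF w[of n]]] on[OF weak_gradD(2)[OF w[of n]]] by auto
    show "v \<in> borel_measurable (lebesgue_on \<Omega>)" "g \<in> borel_measurable (lebesgue_on \<Omega>)"
      using on[OF weak_gradD(1)[OF vg]] on[OF weak_gradD(2)[OF vg]] by auto
    show "AE x in lebesgue_on \<Omega>. (\<lambda>n. \<phi> n x) \<longlonglongrightarrow> v x" "AE x in lebesgue_on \<Omega>. (\<lambda>n. grad (\<phi> n) x) \<longlonglongrightarrow> g x"
      using lim by (auto simp: AE_lebesgue_on[OF sets_domain])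
  qed
  moreover have "(INF u\<in>translate_space u0 (Cc_infty \<Omega>). functional \<Omega> F u) \<le> functional \<Omega> F (\<lambda>x. u0 x + \<phi> n x)" for n
    using \<phi>[of n] by (intro INF_lower) (auto simp: translate_space_def)
  ultimately show ?thesis by (intro LIMSEQ_le_const) auto
qed

lemma no_lavrentievI:
  assumes X: "Cc_infty \<Omega> \<subseteq> X"
    and le: "\<And>u0 v. u0 \<in> D \<Longrightarrow> v \<in> X \<Longrightarrow>
      (INF u\<in>translate_space u0 (Cc_infty \<Omega>). functional \<Omega> F u) \<le> functional \<Omega> F (\<lambda>x. u0 x + v x)"
  shows "no_lavrentiev \<Omega> F D X"
  unfolding no_lavrentiev_def
proof (intro ballI antisym)
  fix u0 assume u0: "u0 \<in> D"
  show "(INF u\<in>translate_space u0 X. functional \<Omega> F u) \<le> (INF u\<in>translate_space u0 (Cc_infty \<Omega>). functional \<Omega> F u)"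
    using X by (intro INF_superset_mono) (auto simp: translate_space_def)
  show "(INF u\<in>translate_space u0 (Cc_infty \<Omega>). functional \<Omega> F u) \<le> (INF u\<in>translate_space u0 X. functional \<Omega> F u)"
    using le[OF u0] by (intro INF_greatest) (auto simp: translate_space_def)
qed

lemma arctan_rescaled_tendsto: "(\<lambda>n. real (Suc n) * arctan (s / real (Suc n))) \<longlonglongrightarrow> s"
proof -
  have "((\<lambda>t. arctan (s * t)) has_real_derivative s) (at 0)"
    by (auto intro!: derivative_eq_intros)
  then have "((\<lambda>h. arctan (s * h) / h) \<longlongrightarrow> s) (at 0)" by (simp add: DERIV_def)
  moreover have "filterlim (\<lambda>n. inverse (real (Suc n))) (at 0) sequentially"
    unfolding filterlim_at using LIMSEQ_inverse_real_of_nat by auto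
  ultimately have "(\<lambda>n. arctan (s * inverse (real (Suc n))) / inverse (real (Suc n))) \<longlonglongrightarrow> s"
    by (rule filterlim_compose)
  then show ?thesis by (simp add: divide_inverse mult.commute)
qed

text \<open>
  Functions bounded by \<open>B\<close> oscillate by at most \<open>2 * B\<close> at every scale, so the approximation applies with \<open>\<theta> = 0\<close>.
  The general case follows with the truncations \<open>m * arctan (v / m)\<close>; they are \<open>C\<^sup>1\<close> functions of \<open>v\<close> with derivative
  in \<open>[0, 1]\<close>, so \<open>M x\<close> of their gradients is at most \<open>M x\<close> of the gradient of \<open>v\<close>.
\<close>

theorem no_lavrentiev_V_balanced:
  assumes bal: "balanced 0"
  shows "no_lavrentiev_V \<Omega> M F"
  unfolding no_lavrentiev_V_def
proof (rule no_lavrentievI[OF Cc_infty_V1_0])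
  fix u0 v assume u0: "u0 \<in> V1L \<Omega> M" and v: "v \<in> V1_0 \<Omega> M"
  note v = V1_0D[OF v]
  let ?v = "zero_ext \<Omega> v" and ?g = "zero_ext \<Omega> (weak_gradient \<Omega> v)"
  have vg: "weak_grad ?v ?g" by (rule W11_0_weak_grad[OF open_domain v(1)])
  note on = integrable_lebesgue_on[OF sets_domain]
  define m where "m n = real (Suc n)" for n
  have m: "0 < m n" for n by (simp add: m_def)
  define H where "H n s = m n * arctan (s / m n)" for n s
  define H' where "H' n s = 1 / (1 + (s / m n)\<^sup>2)" for n s
  have pos: "0 < 1 + (s / m n)\<^sup>2" for s n by (rule add_pos_nonneg) auto
  have H': "\<bar>H' n s\<bar> \<le> 1" for n s using pos[of s n] by (simp add: H'_def)
  have der: "(H n has_real_derivative H' n s) (at s)" for n s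
  proof -
    have "((\<lambda>s. s / m n) has_real_derivative 1 / m n) (at s)"
      by (rule DERIV_cdivide[OF DERIV_ident])
    from DERIV_cmult[OF DERIV_chain2[OF DERIV_arctan this], of "m n"]
    show ?thesis using m[of n] by (simp add: H_def[abs_def] H'_def inverse_eq_divide)
  qed
  have cont: "continuous_on UNIV (H' n)" for n
    unfolding H'_def[abs_def] using m[of n] pos by (intro continuous_intros) (auto simp: less_imp_neq[THEN not_sym])
  have wn: "weak_grad (\<lambda>x. H n (?v x)) (\<lambda>x. H' n (?v x) *\<^sub>R ?g x)" for n
    by (rule weak_grad_chain[OF vg der cont H']) (simp add: H_def)
  have Mg: "integrable (lebesgue_on \<Omega>) (\<lambda>x. M x (?g x))"
    using v(3) by (rule iffD1[OF Bochner_Integration.integrable_cong, rotated -1]) (auto simp: space_restrict_space zero_ext_simps)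
  have Mb: "AE x in lebesgue_on \<Omega>. M x (H' n (?v x) *\<^sub>R ?g x) \<le> M x (?g x)" for n
    using AE_good AE_domain by eventually_elim (rule good_shrink[OF _ _ H'])
  have meas: "?v \<in> borel_measurable (lebesgue_on \<Omega>)" "?g \<in> borel_measurable (lebesgue_on \<Omega>)"
    "(\<lambda>x. H n (?v x)) \<in> borel_measurable (lebesgue_on \<Omega>)" "(\<lambda>x. H' n (?v x) *\<^sub>R ?g x) \<in> borel_measurable (lebesgue_on \<Omega>)" for n
    using on[OF weak_gradD(1)[OF vg]] on[OF weak_gradD(2)[OF vg]] on[OF weak_gradD(1)[OF wn[of n]]] on[OF weak_gradD(2)[OF wn[of n]]]
    by auto
  have step: "(INF u\<in>translate_space u0 (Cc_infty \<Omega>). functional \<Omega> F u) \<le> functional \<Omega> F (\<lambda>x. u0 x + H n (?v x))" for n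
  proof (rule INF_le_functional[OF bal _ _ u0 wn])
    have b: "\<bar>H n s\<bar> \<le> m n * (pi / 2)" for s
      using m[of n] arctan_lbound[of "s / m n"] arctan_ubound[of "s / m n"]
      by (auto simp: H_def abs_mult abs_le_iff)
    show "\<bar>H n (?v x)\<bar> \<le> m n * pi" for x
      using b[of "?v x"] m[of n] pi_gt_zero mult_left_mono[of "pi / 2" pi "m n"] by auto
    show "\<bar>H n (?v x) - H n (?v y)\<bar> \<le> m n * pi * \<delta> powr 0" if "0 < \<delta>" for x y \<delta>
      using b[of "?v x"] b[of "?v y"] that by simp
    show "integrable (lebesgue_on \<Omega>) (\<lambda>x. M x (H' n (?v x) *\<^sub>R ?g x))"
      by (rule integrable_M_bound[OF meas(4) Mg Mb])
  qed (auto simp: zero_ext_simps H_def)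
  have "(\<lambda>n. functional \<Omega> F (\<lambda>x. u0 x + H n (?v x))) \<longlonglongrightarrow> functional \<Omega> F (\<lambda>x. u0 x + ?v x)"
  proof (rule functional_tendsto[OF u0 weak_grad_imp_has_weak_gradient[OF open_domain wn] meas(3,4)
        weak_grad_imp_has_weak_gradient[OF open_domain vg] meas(1,2) Mg _ _ Mb Mg Mg])
    show "AE x in lebesgue_on \<Omega>. (\<lambda>n. H n (?v x)) \<longlonglongrightarrow> ?v x"
      using arctan_rescaled_tendsto by (simp add: H_def m_def)
    have "(\<lambda>n. H' n s) \<longlonglongrightarrow> 1" for s
    proof -
      have "(\<lambda>n. 1 / (1 + (s * inverse (real (Suc n)))\<^sup>2)) \<longlonglongrightarrow> 1 / (1 + (s * 0)\<^sup>2)"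
        by (intro tendsto_intros LIMSEQ_inverse_real_of_nat) auto
      then show ?thesis by (simp add: H'_def m_def divide_inverse)
    qed
    then have "(\<lambda>n. H' n (?v x) *\<^sub>R ?g x) \<longlonglongrightarrow> 1 *\<^sub>R ?g x" for x by (intro tendsto_scaleR tendsto_const)
    then show "AE x in lebesgue_on \<Omega>. (\<lambda>n. H' n (?v x) *\<^sub>R ?g x) \<longlonglongrightarrow> ?g x" by simp
  qed (auto simp: M_nonneg)
  from LIMSEQ_le_const[OF this] step
  have "(INF u\<in>translate_space u0 (Cc_infty \<Omega>). functional \<Omega> F u) \<le> functional \<Omega> F (\<lambda>x. u0 x + ?v x)" by auto
  then show "(INF u\<in>translate_space u0 (Cc_infty \<Omega>). functional \<Omega> F u) \<le> functional \<Omega> F (\<lambda>x. u0 x + v x)"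
    using functional_cong_domain[OF V1LD(1)[OF u0] v(1)] by simp
qed

theorem no_lavrentiev_V_holder_balanced:
  assumes bal: "balanced \<gamma>" and \<gamma>: "0 < \<gamma>" "\<gamma> < 1"
  shows "no_lavrentiev_V_holder \<Omega> M F \<gamma>"
  unfolding no_lavrentiev_V_holder_def
proof (rule no_lavrentievI)
  show "Cc_infty \<Omega> \<subseteq> V1_0 \<Omega> M \<inter> holder_space \<Omega> \<gamma>" using Cc_infty_V1_0 Cc_infty_holder[OF \<gamma>(2)] by blast
  fix u0 v assume "u0 \<in> V1L \<Omega> M \<inter> holder_space \<Omega> \<gamma>" and "v \<in> V1_0 \<Omega> M \<inter> holder_space \<Omega> \<gamma>"
  then have u0: "u0 \<in> V1L \<Omega> M" and v: "v \<in> V1_0 \<Omega> M" and vh: "v \<in> holder_space \<Omega> \<gamma>" by auto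
  note v = V1_0D[OF v]
  let ?v = "zero_ext \<Omega> v" and ?g = "zero_ext \<Omega> (weak_gradient \<Omega> v)"
  have vg: "weak_grad ?v ?g" by (rule W11_0_weak_grad[OF open_domain v(1)])
  obtain B where B: "0 \<le> B" "\<And>x y. \<bar>?v x - ?v y\<bar> \<le> B * dist x y powr \<gamma>"
    using holder_zero_ext[OF domain \<gamma>(1) vh vg] by blast
  obtain R where R: "0 < R" "\<Omega> \<subseteq> ball 0 R" using bounded_domain bounded_subset_ballD by blast
  \<comment> \<open>the extension vanishes at \<open>y0\<close>, so its Hoelder continuity bounds it on \<open>\<Omega>\<close>\<close>
  obtain y0 :: "real ^ 'n" where y0: "norm y0 = R" using vector_choose_size[of R] R(1) by auto
  then have y0n: "y0 \<notin> \<Omega>" using R(2) by auto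
  let ?B = "B + B * (2 * R) powr \<gamma>"
  have vB: "\<bar>?v x\<bar> \<le> ?B" for x
  proof (cases "x \<in> \<Omega>")
    case True
    have "dist x y0 \<le> 2 * R" using True R y0 norm_triangle_ineq4[of x y0] by (auto simp: dist_norm subset_iff)
    then have "B * dist x y0 powr \<gamma> \<le> B * (2 * R) powr \<gamma>" using B(1) \<gamma> by (intro mult_left_mono powr_mono2) auto
    then show ?thesis using B(2)[of x y0] B(1) y0n by (simp add: zero_ext_simps)
  qed (use B in \<open>simp add: zero_ext_simps\<close>)
  have "(INF u\<in>translate_space u0 (Cc_infty \<Omega>). functional \<Omega> F u) \<le> functional \<Omega> F (\<lambda>x. u0 x + ?v x)"
  proof (rule INF_le_functional[OF bal _ \<gamma>(2) u0 vg _ _ vB])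
    show "\<bar>?v x - ?v y\<bar> \<le> ?B * \<delta> powr \<gamma>" if "0 < \<delta>" "dist x y \<le> \<delta>" for x y \<delta>
    proof -
      have "\<bar>?v x - ?v y\<bar> \<le> B * dist x y powr \<gamma>" by (rule B(2))
      also have "\<dots> \<le> ?B * \<delta> powr \<gamma>" using B(1) that \<gamma> by (intro mult_mono powr_mono2) auto
      finally show ?thesis .
    qed
    show "integrable (lebesgue_on \<Omega>) (\<lambda>x. M x (?g x))"
      using v(3) by (rule iffD1[OF Bochner_Integration.integrable_cong, rotated -1]) (auto simp: space_restrict_space zero_ext_simps)
  qed (use \<gamma> in \<open>auto simp: zero_ext_simps\<close>)
  then show "(INF u\<in>translate_space u0 (Cc_infty \<Omega>). functional \<Omega> F u) \<le> functional \<Omega> F (\<lambda>x. u0 x + v x)"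
    using functional_cong_domain[OF V1LD(1)[OF u0] v(1)] by simp
qed

end

section \<open>Calculus of balanced profiles\<close>

text \<open>
  Doubling and balance of \<open>h\<close> measured against another profile \<open>f\<close>. A profile that is a sum of
  phases is compared with itself phase by phase, and a phase such as \<open>a x * t powr q\<close> is balanced only
  relative to a sum that contains the base phase: where \<open>a y = 0\<close> only \<open>t powr p\<close> can bound it.
\<close>

definition rel_doubling :: "(real ^ 'n) set \<Rightarrow> (real ^ 'n \<Rightarrow> real \<Rightarrow> real) \<Rightarrow> (real ^ 'n \<Rightarrow> real \<Rightarrow> real) \<Rightarrow> bool" where
  "rel_doubling \<Omega> h f \<longleftrightarrow> (\<exists>A\<ge>0. \<forall>x\<in>\<Omega>. \<forall>t\<ge>0. h x (2 * t) \<le> A * (f x t + 1))"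

definition rel_balanced_at :: "(real ^ 'n) set \<Rightarrow> real \<Rightarrow> real \<Rightarrow> (real ^ 'n \<Rightarrow> real \<Rightarrow> real) \<Rightarrow> (real ^ 'n \<Rightarrow> real \<Rightarrow> real) \<Rightarrow> bool" where
  "rel_balanced_at \<Omega> \<theta> K h f \<longleftrightarrow> (\<exists>C\<ge>0. \<exists>\<delta>0>0. \<forall>\<delta> x y t. 0 < \<delta> \<longrightarrow> \<delta> < \<delta>0 \<longrightarrow> x \<in> \<Omega> \<longrightarrow> y \<in> \<Omega> \<longrightarrow>
     dist x y \<le> \<delta> \<longrightarrow> 1 \<le> t \<longrightarrow> t \<le> K * \<delta> powr (\<theta> - 1) \<longrightarrow> h x t \<le> C * (f y t + 1))"

definition rel_balanced :: "(real ^ 'n) set \<Rightarrow> real \<Rightarrow> (real ^ 'n \<Rightarrow> real \<Rightarrow> real) \<Rightarrow> (real ^ 'n \<Rightarrow> real \<Rightarrow> real) \<Rightarrow> bool" where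
  "rel_balanced \<Omega> \<theta> h f \<longleftrightarrow> (\<forall>K\<ge>1. rel_balanced_at \<Omega> \<theta> K h f)"

lemma rel_doublingI:
  "0 \<le> A \<Longrightarrow> (\<And>x t. x \<in> \<Omega> \<Longrightarrow> 0 \<le> t \<Longrightarrow> h x (2 * t) \<le> A * (f x t + 1)) \<Longrightarrow> rel_doubling \<Omega> h f"
  unfolding rel_doubling_def by blast

lemma rel_balancedI: "(\<And>K. 1 \<le> K \<Longrightarrow> rel_balanced_at \<Omega> \<theta> K h f) \<Longrightarrow> rel_balanced \<Omega> \<theta> h f"
  unfolding rel_balanced_def by blast

lemma rel_balanced_atI:
  assumes "0 \<le> C" "0 < \<delta>0" "\<And>\<delta> x y t. 0 < \<delta> \<Longrightarrow> \<delta> < \<delta>0 \<Longrightarrow> x \<in> \<Omega> \<Longrightarrow> y \<in> \<Omega> \<Longrightarrow>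
     dist x y \<le> \<delta> \<Longrightarrow> 1 \<le> t \<Longrightarrow> t \<le> K * \<delta> powr (\<theta> - 1) \<Longrightarrow> h x t \<le> C * (f y t + 1)"
  shows "rel_balanced_at \<Omega> \<theta> K h f"
  using assms unfolding rel_balanced_at_def by blast

lemma rel_balancedE:
  assumes "rel_balanced \<Omega> \<theta> h f" "1 \<le> K"
  obtains C \<delta>0 where "0 \<le> C" "0 < \<delta>0" "\<And>\<delta> x y t. 0 < \<delta> \<Longrightarrow> \<delta> < \<delta>0 \<Longrightarrow> x \<in> \<Omega> \<Longrightarrow> y \<in> \<Omega> \<Longrightarrow>
     dist x y \<le> \<delta> \<Longrightarrow> 1 \<le> t \<Longrightarrow> t \<le> K * \<delta> powr (\<theta> - 1) \<Longrightarrow> h x t \<le> C * (f y t + 1)"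
  using assms unfolding rel_balanced_def rel_balanced_at_def by metis

lemma rel_doubling_add:
  assumes "rel_doubling \<Omega> h1 f" "rel_doubling \<Omega> h2 f"
  shows "rel_doubling \<Omega> (\<lambda>x t. h1 x t + h2 x t) f"
proof -
  obtain A B where "0 \<le> A" "0 \<le> B" "\<forall>x\<in>\<Omega>. \<forall>t\<ge>0. h1 x (2 * t) \<le> A * (f x t + 1)" "\<forall>x\<in>\<Omega>. \<forall>t\<ge>0. h2 x (2 * t) \<le> B * (f x t + 1)"
    using assms unfolding rel_doubling_def by blast
  then show ?thesis by (intro rel_doublingI[of "A + B"]) (auto simp: distrib_right intro!: add_mono)
qed

lemma rel_doubling_sum:
  assumes "finite I" "\<And>i. i \<in> I \<Longrightarrow> rel_doubling \<Omega> (h i) f"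
  shows "rel_doubling \<Omega> (\<lambda>x t. \<Sum>i\<in>I. h i x t) f"
  using assms
proof (induction I rule: finite_induct)
  case empty
  then show ?case by (intro rel_doublingI[of 0]) auto
next
  case (insert i I)
  then show ?case using rel_doubling_add[of \<Omega> "h i" f "\<lambda>x t. \<Sum>i\<in>I. h i x t"] by simp
qed

lemma rel_doubling_mono:
  assumes "rel_doubling \<Omega> h f" "\<And>x t. x \<in> \<Omega> \<Longrightarrow> 0 \<le> t \<Longrightarrow> f x t \<le> f' x t"
  shows "rel_doubling \<Omega> h f'"
proof -
  obtain A where A: "0 \<le> A" "\<forall>x\<in>\<Omega>. \<forall>t\<ge>0. h x (2 * t) \<le> A * (f x t + 1)"
    using assms unfolding rel_doubling_def by blast
  have "A * (f x t + 1) \<le> A * (f' x t + 1)" if "x \<in> \<Omega>" "0 \<le> t" for x t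
    using assms(2)[OF that] A(1) by (intro mult_left_mono) auto
  with A show ?thesis by (intro rel_doublingI[of A]) (meson order_trans)+
qed

lemma rel_balanced_add:
  assumes 1: "rel_balanced \<Omega> \<theta> h1 f" and 2: "rel_balanced \<Omega> \<theta> h2 f"
  shows "rel_balanced \<Omega> \<theta> (\<lambda>x t. h1 x t + h2 x t) f"
proof (rule rel_balancedI)
  fix K :: real assume K: "1 \<le> K"
  obtain C a where C: "0 \<le> C" "0 < a" "\<And>\<delta> x y t. 0 < \<delta> \<Longrightarrow> \<delta> < a \<Longrightarrow> x \<in> \<Omega> \<Longrightarrow> y \<in> \<Omega> \<Longrightarrow>
     dist x y \<le> \<delta> \<Longrightarrow> 1 \<le> t \<Longrightarrow> t \<le> K * \<delta> powr (\<theta> - 1) \<Longrightarrow> h1 x t \<le> C * (f y t + 1)"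
    by (rule rel_balancedE[OF 1 K]) blast
  obtain D b where D: "0 \<le> D" "0 < b" "\<And>\<delta> x y t. 0 < \<delta> \<Longrightarrow> \<delta> < b \<Longrightarrow> x \<in> \<Omega> \<Longrightarrow> y \<in> \<Omega> \<Longrightarrow>
     dist x y \<le> \<delta> \<Longrightarrow> 1 \<le> t \<Longrightarrow> t \<le> K * \<delta> powr (\<theta> - 1) \<Longrightarrow> h2 x t \<le> D * (f y t + 1)"
    by (rule rel_balancedE[OF 2 K]) blast
  show "rel_balanced_at \<Omega> \<theta> K (\<lambda>x t. h1 x t + h2 x t) f"
  proof (rule rel_balanced_atI[of "C + D" "min a b"])
    fix \<delta> x y t assume "0 < \<delta>" "\<delta> < min a b" "x \<in> \<Omega>" "y \<in> \<Omega>" "dist x y \<le> \<delta>" "1 \<le> t" "t \<le> K * \<delta> powr (\<theta> - 1)"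
    then have "h1 x t \<le> C * (f y t + 1)" "h2 x t \<le> D * (f y t + 1)" by (auto intro: C(3) D(3))
    then show "h1 x t + h2 x t \<le> (C + D) * (f y t + 1)" by (simp add: distrib_right)
  qed (use C D in auto)
qed

lemma rel_balanced_sum:
  assumes "finite I" "\<And>i. i \<in> I \<Longrightarrow> rel_balanced \<Omega> \<theta> (h i) f"
  shows "rel_balanced \<Omega> \<theta> (\<lambda>x t. \<Sum>i\<in>I. h i x t) f"
  using assms
proof (induction I rule: finite_induct)
  case empty
  show ?case by (rule rel_balancedI, rule rel_balanced_atI[of 0 1]) auto
next
  case (insert i I)
  then show ?case using rel_balanced_add[of \<Omega> \<theta> "h i" f "\<lambda>x t. \<Sum>i\<in>I. h i x t"] by simp
qed

lemma rel_balanced_mono: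
  assumes 1: "rel_balanced \<Omega> \<theta> h f" and le: "\<And>x t. x \<in> \<Omega> \<Longrightarrow> 1 \<le> t \<Longrightarrow> f x t \<le> f' x t"
  shows "rel_balanced \<Omega> \<theta> h f'"
proof (rule rel_balancedI)
  fix K :: real assume K: "1 \<le> K"
  obtain C a where C: "0 \<le> C" "0 < a" "\<And>\<delta> x y t. 0 < \<delta> \<Longrightarrow> \<delta> < a \<Longrightarrow> x \<in> \<Omega> \<Longrightarrow> y \<in> \<Omega> \<Longrightarrow>
     dist x y \<le> \<delta> \<Longrightarrow> 1 \<le> t \<Longrightarrow> t \<le> K * \<delta> powr (\<theta> - 1) \<Longrightarrow> h x t \<le> C * (f y t + 1)"
    by (rule rel_balancedE[OF 1 K]) blast
  show "rel_balanced_at \<Omega> \<theta> K h f'"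
  proof (rule rel_balanced_atI[of C a])
    fix \<delta> x y t assume *: "0 < \<delta>" "\<delta> < a" "x \<in> \<Omega>" "y \<in> \<Omega>" "dist x y \<le> \<delta>" "1 \<le> t" "t \<le> K * \<delta> powr (\<theta> - 1)"
    have "h x t \<le> C * (f y t + 1)" by (rule C(3)[OF *])
    also have "\<dots> \<le> C * (f' y t + 1)" using le[OF *(4,6)] C(1) by (intro mult_left_mono) auto
    finally show "h x t \<le> C * (f' y t + 1)" .
  qed (use C in auto)
qed

lemma
  fixes \<phi> :: "real ^ 'n \<Rightarrow> real \<Rightarrow> real" and h :: "'i \<Rightarrow> real ^ 'n \<Rightarrow> real \<Rightarrow> real"
  assumes I: "finite I"
    and pos: "\<And>x t. x \<in> \<Omega> \<Longrightarrow> 0 \<le> t \<Longrightarrow> 0 \<le> \<phi> x t" "\<And>i x t. i \<in> I \<Longrightarrow> x \<in> \<Omega> \<Longrightarrow> 0 \<le> t \<Longrightarrow> 0 \<le> h i x t"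
  shows rel_doubling_phases: "rel_doubling \<Omega> \<phi> \<phi> \<Longrightarrow> (\<And>i. i \<in> I \<Longrightarrow> rel_doubling \<Omega> (h i) (\<lambda>x t. \<phi> x t + h i x t)) \<Longrightarrow>
      rel_doubling \<Omega> (\<lambda>x t. \<phi> x t + (\<Sum>i\<in>I. h i x t)) (\<lambda>x t. \<phi> x t + (\<Sum>i\<in>I. h i x t))"
    and rel_balanced_phases: "rel_balanced \<Omega> \<theta> \<phi> \<phi> \<Longrightarrow> (\<And>i. i \<in> I \<Longrightarrow> rel_balanced \<Omega> \<theta> (h i) (\<lambda>x t. \<phi> x t + h i x t)) \<Longrightarrow>
      rel_balanced \<Omega> \<theta> (\<lambda>x t. \<phi> x t + (\<Sum>i\<in>I. h i x t)) (\<lambda>x t. \<phi> x t + (\<Sum>i\<in>I. h i x t))"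
proof -
  have le: "\<phi> x t \<le> \<phi> x t + (\<Sum>i\<in>I. h i x t)" "i \<in> I \<Longrightarrow> \<phi> x t + h i x t \<le> \<phi> x t + (\<Sum>i\<in>I. h i x t)" if "x \<in> \<Omega>" "0 \<le> t" for x t i
    using pos that member_le_sum[of i I "\<lambda>i. h i x t"] I by (auto intro!: sum_nonneg)
  show "rel_doubling \<Omega> \<phi> \<phi> \<Longrightarrow> (\<And>i. i \<in> I \<Longrightarrow> rel_doubling \<Omega> (h i) (\<lambda>x t. \<phi> x t + h i x t)) \<Longrightarrow>
      rel_doubling \<Omega> (\<lambda>x t. \<phi> x t + (\<Sum>i\<in>I. h i x t)) (\<lambda>x t. \<phi> x t + (\<Sum>i\<in>I. h i x t))"
  proof (intro rel_doubling_add rel_doubling_sum I)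
    assume 1: "rel_doubling \<Omega> \<phi> \<phi>" and 2: "\<And>i. i \<in> I \<Longrightarrow> rel_doubling \<Omega> (h i) (\<lambda>x t. \<phi> x t + h i x t)"
    show "rel_doubling \<Omega> \<phi> (\<lambda>x t. \<phi> x t + (\<Sum>i\<in>I. h i x t))" by (rule rel_doubling_mono[OF 1 le(1)])
    show "rel_doubling \<Omega> (h i) (\<lambda>x t. \<phi> x t + (\<Sum>i\<in>I. h i x t))" if "i \<in> I" for i
      by (rule rel_doubling_mono[OF 2[OF that] le(2)[OF _ _ that]])
  qed
  show "rel_balanced \<Omega> \<theta> \<phi> \<phi> \<Longrightarrow> (\<And>i. i \<in> I \<Longrightarrow> rel_balanced \<Omega> \<theta> (h i) (\<lambda>x t. \<phi> x t + h i x t)) \<Longrightarrow>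
      rel_balanced \<Omega> \<theta> (\<lambda>x t. \<phi> x t + (\<Sum>i\<in>I. h i x t)) (\<lambda>x t. \<phi> x t + (\<Sum>i\<in>I. h i x t))"
  proof (intro rel_balanced_add rel_balanced_sum I)
    assume 1: "rel_balanced \<Omega> \<theta> \<phi> \<phi>" and 2: "\<And>i. i \<in> I \<Longrightarrow> rel_balanced \<Omega> \<theta> (h i) (\<lambda>x t. \<phi> x t + h i x t)"
    show "rel_balanced \<Omega> \<theta> \<phi> (\<lambda>x t. \<phi> x t + (\<Sum>i\<in>I. h i x t))" by (rule rel_balanced_mono[OF 1 le(1)]) auto
    show "rel_balanced \<Omega> \<theta> (h i) (\<lambda>x t. \<phi> x t + (\<Sum>i\<in>I. h i x t))" if "i \<in> I" for i
      by (rule rel_balanced_mono[OF 2[OF that] le(2)[OF _ _ that]]) auto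
  qed
qed

lemma
  fixes \<phi> h :: "real ^ 'n \<Rightarrow> real \<Rightarrow> real"
  assumes pos: "\<And>x t. x \<in> \<Omega> \<Longrightarrow> 0 \<le> t \<Longrightarrow> 0 \<le> \<phi> x t" "\<And>x t. x \<in> \<Omega> \<Longrightarrow> 0 \<le> t \<Longrightarrow> 0 \<le> h x t"
  shows rel_doubling_phase: "rel_doubling \<Omega> \<phi> \<phi> \<Longrightarrow> rel_doubling \<Omega> h (\<lambda>x t. \<phi> x t + h x t) \<Longrightarrow>
      rel_doubling \<Omega> (\<lambda>x t. \<phi> x t + h x t) (\<lambda>x t. \<phi> x t + h x t)"
    and rel_balanced_phase: "rel_balanced \<Omega> \<theta> \<phi> \<phi> \<Longrightarrow> rel_balanced \<Omega> \<theta> h (\<lambda>x t. \<phi> x t + h x t) \<Longrightarrow>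
      rel_balanced \<Omega> \<theta> (\<lambda>x t. \<phi> x t + h x t) (\<lambda>x t. \<phi> x t + h x t)"
  using rel_doubling_phases[of "{()}" \<Omega> \<phi> "\<lambda>_. h"] rel_balanced_phases[of "{()}" \<Omega> \<phi> "\<lambda>_. h" \<theta>] pos by simp_all

lemma rel_balanced_const: "rel_balanced \<Omega> \<theta> (\<lambda>x. \<phi>) (\<lambda>x. \<phi>)"
  if "\<And>t. 1 \<le> t \<Longrightarrow> 0 \<le> \<phi> t"
  by (rule rel_balancedI, rule rel_balanced_atI[of 1 1]) auto

subsection \<open>Logarithmic Hoelder continuity\<close>

lemma log_holder_const: "(\<lambda>x. c) \<in> log_holder \<Omega>"
proof -
  have "0 \<le> 1 / ln (1 / d)" if "0 < d" "d < 1" for d :: real using that by simp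
  then show ?thesis unfolding log_holder_def by (auto intro!: exI[of _ "1::real"])
qed

text \<open>
  Log-Hoelder continuous functions are uniformly continuous, hence bounded on bounded sets.
\<close>

lemma log_holder_bounded:
  fixes \<Omega> :: "(real ^ 'n) set"
  assumes \<Omega>: "bounded \<Omega>" and p: "p \<in> log_holder \<Omega>"
  obtains N where "0 \<le> N" "\<And>x. x \<in> \<Omega> \<Longrightarrow> \<bar>p x\<bar> \<le> N"
proof -
  obtain c d where c: "0 < c" "0 < d" and p: "\<And>x y. x \<in> \<Omega> \<Longrightarrow> y \<in> \<Omega> \<Longrightarrow> x \<noteq> y \<Longrightarrow> dist x y < d \<Longrightarrow> \<bar>p x - p y\<bar> \<le> c / ln (1 / dist x y)"
    using p unfolding log_holder_def by blast
  have "uniformly_continuous_on \<Omega> p"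
    unfolding uniformly_continuous_on_def
  proof (intro allI impI)
    fix e :: real assume e: "0 < e"
    show "\<exists>d>0. \<forall>x\<in>\<Omega>. \<forall>x'\<in>\<Omega>. dist x' x < d \<longrightarrow> dist (p x') (p x) < e"
    proof (intro exI[of _ "min d (exp (- (c / e)))"] conjI ballI impI)
      fix x y assume xy: "x \<in> \<Omega>" "y \<in> \<Omega>" "dist y x < min d (exp (- (c / e)))"
      show "dist (p y) (p x) < e"
      proof (cases "x = y")
        case False
        then have pos: "0 < dist y x" by auto
        have "ln (dist y x) < - (c / e)" using xy(3) pos ln_less_cancel_iff[of "dist y x" "exp (- (c / e))"] by simp
        then have l: "c / e < ln (1 / dist y x)" using pos by (simp add: ln_div)
        have "0 < c / e" using c e by simp
        then have lp: "0 < ln (1 / dist y x)" using l by linarith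
        have "c < ln (1 / dist y x) * e" using l e by (simp only: pos_divide_less_eq)
        then have "c / ln (1 / dist y x) < e" using lp by (simp only: pos_divide_less_eq mult.commute)
        then show ?thesis using p[of y x] xy False by (auto simp: dist_real_def)
      qed (use e in simp)
    qed (use c in auto)
  qed
  then have "bounded (p ` \<Omega>)" using \<Omega> by (rule bounded_uniformly_continuous_image)
  then obtain N where "0 < N" "\<forall>y\<in>p ` \<Omega>. norm y \<le> N" unfolding bounded_pos by blast
  then show ?thesis using that[of N] by auto
qed

text \<open>
  For \<open>t \<le> K / \<delta>\<close> the logarithm of \<open>t\<close> is at most a multiple of \<open>ln (1 / \<delta>)\<close>, the reciprocal of the modulus
  of continuity; and \<open>\<delta> powr (\<theta> - 1) \<le> 1 / \<delta>\<close>.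
\<close>

lemma log_holder_ln:
  assumes p: "p \<in> log_holder \<Omega>" and K: "1 \<le> K" and \<theta>: "0 \<le> \<theta>"
  obtains C \<delta>0 where "0 \<le> C" "0 < \<delta>0" "\<delta>0 \<le> 1" "\<And>\<delta> x y t. 0 < \<delta> \<Longrightarrow> \<delta> < \<delta>0 \<Longrightarrow> x \<in> \<Omega> \<Longrightarrow> y \<in> \<Omega> \<Longrightarrow>
    dist x y \<le> \<delta> \<Longrightarrow> 1 \<le> t \<Longrightarrow> t \<le> K * \<delta> powr (\<theta> - 1) \<Longrightarrow> \<bar>p x - p y\<bar> * ln (exp 1 + t) \<le> C"
proof -
  obtain c d where c: "0 < c" "0 < d" and p: "\<And>x y. x \<in> \<Omega> \<Longrightarrow> y \<in> \<Omega> \<Longrightarrow> x \<noteq> y \<Longrightarrow> dist x y < d \<Longrightarrow> \<bar>p x - p y\<bar> \<le> c / ln (1 / dist x y)"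
    using p unfolding log_holder_def by blast
  have eK: "1 \<le> exp 1 + K" using K exp_gt_zero[of "1::real"] by linarith
  let ?C = "c * (ln (exp 1 + K) + 1)"
  \<comment> \<open>\<open>\<delta> < exp (- 1)\<close> makes \<open>ln (1 / \<delta>) \<ge> 1\<close>, so that it absorbs the constant \<open>ln (exp 1 + K)\<close>\<close>
  show ?thesis
  proof (rule that[of ?C "min d (exp (- 1))"])
    show "0 \<le> ?C" using c eK by simp
    show "min d (exp (- 1)) \<le> 1" by (simp add: min_le_iff_disj)
    fix \<delta> t :: real and x y assume *: "0 < \<delta>" "\<delta> < min d (exp (- 1))" "x \<in> \<Omega>" "y \<in> \<Omega>" "dist x y \<le> \<delta>" "1 \<le> t" "t \<le> K * \<delta> powr (\<theta> - 1)"
    have "ln \<delta> < - 1" using *(1,2) ln_less_cancel_iff[of \<delta> "exp (- 1)"] by simp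
    then have l1: "1 \<le> ln (1 / \<delta>)" using *(1) by (simp add: ln_div)
    have "exp (- 1 :: real) < 1" by simp
    then have \<delta>1: "\<delta> < 1" using *(2) by linarith
    have "t \<le> K * \<delta> powr (- 1)"
      using *(7) by (rule order_trans) (use K \<theta> \<delta>1 *(1) in \<open>intro mult_left_mono powr_mono'; simp\<close>)
    then have "t \<le> K / \<delta>" using *(1) by (simp add: powr_minus divide_inverse)
    moreover have "exp 1 \<le> exp 1 / \<delta>" using *(1) \<delta>1 by (simp add: le_divide_eq mult_left_le)
    ultimately have "exp 1 + t \<le> (exp 1 + K) * (1 / \<delta>)" by (simp add: add_divide_distrib)
    moreover have "0 < exp 1 + t" using *(6) exp_gt_zero[of "1::real"] by linarith
    ultimately have "ln (exp 1 + t) \<le> ln ((exp 1 + K) * (1 / \<delta>))" by (rule ln_mono)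
    also have "\<dots> = ln (exp 1 + K) + ln (1 / \<delta>)" using *(1) eK by (intro ln_mult_pos) auto
    also have "\<dots> \<le> (ln (exp 1 + K) + 1) * ln (1 / \<delta>)"
      using l1 eK mult_left_mono[of 1 "ln (1 / \<delta>)" "ln (exp 1 + K)"] by (simp add: distrib_right)
    finally have L: "ln (exp 1 + t) \<le> (ln (exp 1 + K) + 1) * ln (1 / \<delta>)" .
    show "\<bar>p x - p y\<bar> * ln (exp 1 + t) \<le> ?C"
    proof (cases "x = y")
      case True
      then show ?thesis using \<open>0 \<le> ?C\<close> by simp
    next
      case False
      then have pos: "0 < dist x y" by simp
      have "\<bar>p x - p y\<bar> \<le> c / ln (1 / dist x y)" using *(2,5) by (intro p *(3,4) False) auto
      also have "ln (1 / \<delta>) \<le> ln (1 / dist x y)" using pos *(1,5) by (simp add: ln_div)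
      then have "c / ln (1 / dist x y) \<le> c / ln (1 / \<delta>)" using c l1 by (intro divide_left_mono) auto
      finally have "\<bar>p x - p y\<bar> \<le> c / ln (1 / \<delta>)" .
      moreover have "0 \<le> ln (exp 1 + t)" using *(6) exp_gt_zero[of "1::real"] by (intro ln_ge_zero) linarith
      ultimately have "\<bar>p x - p y\<bar> * ln (exp 1 + t) \<le> c / ln (1 / \<delta>) * ((ln (exp 1 + K) + 1) * ln (1 / \<delta>))"
        using L c l1 by (intro mult_mono) auto
      also have "\<dots> = ?C" using l1 by simp
      finally show ?thesis .
    qed
  qed (use c in auto)
qed

lemma log_holder_powr:
  assumes p: "p \<in> log_holder \<Omega>" and K: "1 \<le> K" and \<theta>: "0 \<le> \<theta>"
  obtains C \<delta>0 where "1 \<le> C" "0 < \<delta>0" "\<delta>0 \<le> 1" "\<And>\<delta> x y t. 0 < \<delta> \<Longrightarrow> \<delta> < \<delta>0 \<Longrightarrow> x \<in> \<Omega> \<Longrightarrow> y \<in> \<Omega> \<Longrightarrow>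
    dist x y \<le> \<delta> \<Longrightarrow> 1 \<le> t \<Longrightarrow> t \<le> K * \<delta> powr (\<theta> - 1) \<Longrightarrow> t powr p x \<le> C * t powr p y"
proof -
  obtain C \<delta>0 where C: "0 \<le> C" "0 < \<delta>0" "\<delta>0 \<le> 1" "\<And>\<delta> x y t. 0 < \<delta> \<Longrightarrow> \<delta> < \<delta>0 \<Longrightarrow> x \<in> \<Omega> \<Longrightarrow> y \<in> \<Omega> \<Longrightarrow>
    dist x y \<le> \<delta> \<Longrightarrow> 1 \<le> t \<Longrightarrow> t \<le> K * \<delta> powr (\<theta> - 1) \<Longrightarrow> \<bar>p x - p y\<bar> * ln (exp 1 + t) \<le> C"
    by (rule log_holder_ln[OF p K \<theta>]) blast
  show ?thesis
  proof (rule that[of "exp C" \<delta>0])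
    show "1 \<le> exp C" using C(1) by simp
    fix \<delta> t :: real and x y assume *: "0 < \<delta>" "\<delta> < \<delta>0" "x \<in> \<Omega>" "y \<in> \<Omega>" "dist x y \<le> \<delta>" "1 \<le> t" "t \<le> K * \<delta> powr (\<theta> - 1)"
    have "(p x - p y) * ln t \<le> \<bar>p x - p y\<bar> * ln (exp 1 + t)"
      using *(6) exp_gt_zero[of "1::real"] by (intro mult_mono) (auto simp: add_pos_pos)
    also have "\<dots> \<le> C" by (rule C(4)[OF *])
    finally have "t powr (p x - p y) \<le> exp C" using *(6) by (simp add: powr_def)
    then have "t powr (p x - p y) * t powr p y \<le> exp C * t powr p y" by (intro mult_right_mono) auto
    then show "t powr p x \<le> exp C * t powr p y" by (simp add: powr_add[symmetric])
  qed (use C in auto)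
qed

subsection \<open>Power phases\<close>

lemma powr_doubling:
  assumes "bounded \<Omega>" "p \<in> log_holder \<Omega>" "\<And>x. x \<in> \<Omega> \<Longrightarrow> 0 \<le> a x" "\<And>x t. x \<in> \<Omega> \<Longrightarrow> 0 \<le> t \<Longrightarrow> a x * t powr p x \<le> f x t"
  shows "rel_doubling \<Omega> (\<lambda>x t. a x * t powr p x) f"
proof -
  obtain N where N: "0 \<le> N" "\<And>x. x \<in> \<Omega> \<Longrightarrow> \<bar>p x\<bar> \<le> N" using log_holder_bounded[OF assms(1,2)] by blast
  show ?thesis
  proof (rule rel_doublingI[of "2 powr N"])
    fix x and t :: real assume *: "x \<in> \<Omega>" "0 \<le> t"
    have "a x * (2 * t) powr p x = 2 powr p x * (a x * t powr p x)" using *(2) by (simp add: powr_mult)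
    also have "\<dots> \<le> 2 powr N * (f x t + 1)"
      using N(2)[OF *(1)] assms(3)[OF *(1)] assms(4)[OF *] by (intro mult_mono powr_mono) auto
    finally show "a x * (2 * t) powr p x \<le> 2 powr N * (f x t + 1)" .
  qed simp
qed

lemma powr_doubling':
  assumes "bounded \<Omega>" "p \<in> log_holder \<Omega>"
  shows "rel_doubling \<Omega> (\<lambda>x t. t powr p x) (\<lambda>x t. t powr p x)"
  using powr_doubling[of \<Omega> p "\<lambda>_. 1" "\<lambda>x t. t powr p x"] assms by simp

lemma powr_balanced:
  assumes p: "p \<in> log_holder \<Omega>" and \<theta>: "0 \<le> \<theta>"
  shows "rel_balanced \<Omega> \<theta> (\<lambda>x t. t powr p x) (\<lambda>x t. t powr p x)"
proof (rule rel_balancedI)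
  fix K :: real assume K: "1 \<le> K"
  obtain C \<delta>0 where C: "1 \<le> C" "0 < \<delta>0" "\<And>\<delta> x y t. 0 < \<delta> \<Longrightarrow> \<delta> < \<delta>0 \<Longrightarrow> x \<in> \<Omega> \<Longrightarrow> y \<in> \<Omega> \<Longrightarrow>
    dist x y \<le> \<delta> \<Longrightarrow> 1 \<le> t \<Longrightarrow> t \<le> K * \<delta> powr (\<theta> - 1) \<Longrightarrow> t powr p x \<le> C * t powr p y"
    by (rule log_holder_powr[OF p K \<theta>]) blast
  show "rel_balanced_at \<Omega> \<theta> K (\<lambda>x t. t powr p x) (\<lambda>x t. t powr p x)"
  proof (rule rel_balanced_atI[of C \<delta>0])
    fix \<delta> x y t assume *: "0 < \<delta>" "\<delta> < \<delta>0" "x \<in> \<Omega>" "y \<in> \<Omega>" "dist x y \<le> \<delta>" "1 \<le> t" "t \<le> K * \<delta> powr (\<theta> - 1)"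
    show "t powr p x \<le> C * (t powr p y + 1)" using C(3)[OF *] C(1) by (simp add: distrib_left)
  qed (use C in auto)
qed

text \<open>
  Moving the exponent from \<open>q x\<close> to \<open>q y\<close> costs a constant by log-Hoelder continuity. Moving the weight
  costs \<open>\<delta> powr \<alpha> * t powr q y\<close>, and this is at most a multiple of \<open>t powr p y\<close>, because
  \<open>t powr (q y - p y) \<le> (K * \<delta> powr (\<theta> - 1)) powr (q y - p y)\<close> is of order at most \<open>\<delta> powr (- \<alpha>)\<close>.
\<close>

lemma double_phase_balanced:
  assumes a: "a \<in> holder_space \<Omega> \<alpha>" "\<And>x. x \<in> \<Omega> \<Longrightarrow> 0 \<le> a x" and \<alpha>: "0 < \<alpha>"
    and q: "q \<in> log_holder \<Omega>" and pq: "\<And>x. x \<in> \<Omega> \<Longrightarrow> p x \<le> q x" "\<And>x. x \<in> \<Omega> \<Longrightarrow> (1 - \<theta>) * (q x - p x) \<le> \<alpha>"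
    and \<theta>: "0 \<le> \<theta>" "\<theta> < 1"
  shows "rel_balanced \<Omega> \<theta> (\<lambda>x t. a x * t powr q x) (\<lambda>x t. t powr p x + a x * t powr q x)"
proof (rule rel_balancedI)
  fix K :: real assume K: "1 \<le> K"
  obtain B where B: "0 \<le> B" "\<And>x y. x \<in> \<Omega> \<Longrightarrow> y \<in> \<Omega> \<Longrightarrow> \<bar>a x - a y\<bar> \<le> B * dist x y powr \<alpha>"
    using holder_spaceE[OF a(1)] by blast
  obtain C \<delta>0 where C: "1 \<le> C" "0 < \<delta>0" "\<delta>0 \<le> 1" "\<And>\<delta> x y t. 0 < \<delta> \<Longrightarrow> \<delta> < \<delta>0 \<Longrightarrow> x \<in> \<Omega> \<Longrightarrow> y \<in> \<Omega> \<Longrightarrow>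
    dist x y \<le> \<delta> \<Longrightarrow> 1 \<le> t \<Longrightarrow> t \<le> K * \<delta> powr (\<theta> - 1) \<Longrightarrow> t powr q x \<le> C * t powr q y"
    by (rule log_holder_powr[OF q K \<theta>(1)]) blast
  define N where "N = \<alpha> / (1 - \<theta>)"
  let ?C = "C * (1 + B * K powr N)"
  show "rel_balanced_at \<Omega> \<theta> K (\<lambda>x t. a x * t powr q x) (\<lambda>x t. t powr p x + a x * t powr q x)"
  proof (rule rel_balanced_atI[of ?C \<delta>0])
    fix \<delta> x y t assume *: "0 < \<delta>" "\<delta> < \<delta>0" "x \<in> \<Omega>" "y \<in> \<Omega>" "dist x y \<le> \<delta>" "1 \<le> t" "t \<le> K * \<delta> powr (\<theta> - 1)"
    have \<delta>1: "\<delta> < 1" using * C(3) by linarith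
    let ?r = "q y - p y"
    have r: "0 \<le> ?r" "?r \<le> N" using pq[OF *(4)] \<theta>(2) by (auto simp: N_def field_simps)
    have "t powr ?r \<le> (K * \<delta> powr (\<theta> - 1)) powr ?r" using *(6,7) r by (intro powr_mono2) auto
    also have "\<dots> = K powr ?r * \<delta> powr ((\<theta> - 1) * ?r)" using K by (simp add: powr_mult powr_powr)
    also have "\<dots> \<le> K powr N * \<delta> powr (- \<alpha>)"
    proof (rule mult_mono)
      show "K powr ?r \<le> K powr N" using r K by (intro powr_mono) auto
      have "- \<alpha> \<le> (\<theta> - 1) * ?r" using pq(2)[OF *(4)] by (simp add: algebra_simps)
      then show "\<delta> powr ((\<theta> - 1) * ?r) \<le> \<delta> powr (- \<alpha>)" using *(1) \<delta>1 by (intro powr_mono') auto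
    qed auto
    finally have tr: "t powr ?r \<le> K powr N * \<delta> powr (- \<alpha>)" .
    have "\<delta> powr \<alpha> * t powr q y = t powr p y * (\<delta> powr \<alpha> * t powr ?r)" by (simp add: powr_add[symmetric] mult.left_commute)
    also have "\<dots> \<le> t powr p y * (\<delta> powr \<alpha> * (K powr N * \<delta> powr (- \<alpha>)))" using tr by (intro mult_left_mono) auto
    also have "\<dots> = K powr N * t powr p y" using *(1) by (simp add: powr_minus)
    finally have osc: "\<delta> powr \<alpha> * t powr q y \<le> K powr N * t powr p y" .
    have "a x \<le> a y + B * dist x y powr \<alpha>" using B(2)[OF *(3,4)] by linarith
    also have "\<dots> \<le> a y + B * \<delta> powr \<alpha>" using *(5) \<alpha> B(1) by (intro add_left_mono mult_left_mono powr_mono2) auto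
    finally have axy: "a x \<le> a y + B * \<delta> powr \<alpha>" .
    have "a x * t powr q x \<le> a x * (C * t powr q y)" using C(4)[OF *] a(2)[OF *(3)] by (intro mult_left_mono) auto
    also have "\<dots> \<le> (a y + B * \<delta> powr \<alpha>) * (C * t powr q y)" using axy C(1) by (intro mult_right_mono) auto
    also have "\<dots> = C * (a y * t powr q y + B * (\<delta> powr \<alpha> * t powr q y))" by (simp add: algebra_simps)
    also have "\<dots> \<le> C * (a y * t powr q y + B * (K powr N * t powr p y))"
      using osc B(1) C(1) by (intro mult_left_mono add_left_mono) auto
    also have "\<dots> \<le> C * ((1 + B * K powr N) * (t powr p y + a y * t powr q y + 1))"
    proof (intro mult_left_mono)
      have "0 \<le> B * K powr N" "0 \<le> a y * t powr q y" using B(1) a(2)[OF *(4)] by auto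
      then show "a y * t powr q y + B * (K powr N * t powr p y) \<le> (1 + B * K powr N) * (t powr p y + a y * t powr q y + 1)"
        using mult_nonneg_nonneg[of "B * K powr N" "a y * t powr q y"] powr_ge_zero[of t "p y"]
        by (simp add: algebra_simps)
    qed (use C(1) in simp)
    finally show "a x * t powr q x \<le> ?C * (t powr p y + a y * t powr q y + 1)" by (simp add: mult.assoc)
  next
    show "0 \<le> ?C" using C(1) B(1) by (intro mult_nonneg_nonneg add_nonneg_nonneg) auto
  qed (use C in auto)
qed

subsection \<open>Logarithmic phases\<close>

lemma exp_1_add_pos: "0 \<le> t \<Longrightarrow> 0 < exp 1 + (t :: real)"
  using exp_gt_zero[of "1::real"] by linarith

lemma ln_exp_add_ge_1:
  fixes t :: real
  assumes "0 \<le> t"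
  shows "1 \<le> ln (exp 1 + t)"
proof -
  have "ln (exp 1) \<le> ln (exp 1 + t)" using assms by (intro ln_mono) auto
  then show ?thesis by simp
qed

lemma ln_exp_add_double:
  fixes t :: real
  assumes t: "0 \<le> t"
  shows "ln (exp 1 + 2 * t) \<le> 2 * ln (exp 1 + t)"
proof -
  have "ln (exp 1 + 2 * t) \<le> ln (2 * (exp 1 + t))"
    using t exp_1_add_pos[of "2 * t"] by (intro ln_mono) auto
  also have "\<dots> = ln 2 + ln (exp 1 + t)" using exp_1_add_pos[OF t] by (intro ln_mult_pos) auto
  also have "ln 2 \<le> (1::real)" using ln_le_minus_one[of "2::real"] by simp
  finally show ?thesis using ln_exp_add_ge_1[OF t] by linarith
qed

lemma log_phase_doubling:
  assumes a: "\<And>x. x \<in> \<Omega> \<Longrightarrow> 0 \<le> a x"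
  shows "rel_doubling \<Omega> (\<lambda>x t. a x * (t powr p * ln (exp 1 + t))) (\<lambda>x t. t powr p + a x * (t powr p * ln (exp 1 + t)))"
proof (rule rel_doublingI[of "2 powr p * 2"])
  fix x and t :: real assume *: "x \<in> \<Omega>" "0 \<le> t"
  have "a x * ((2 * t) powr p * ln (exp 1 + 2 * t)) \<le> a x * ((2 * t) powr p * (2 * ln (exp 1 + t)))"
    using a[OF *(1)] ln_exp_add_double[OF *(2)] by (intro mult_left_mono) auto
  also have "\<dots> = 2 powr p * 2 * (a x * (t powr p * ln (exp 1 + t)))" using *(2) by (simp add: powr_mult)
  also have "\<dots> \<le> 2 powr p * 2 * (t powr p + a x * (t powr p * ln (exp 1 + t)) + 1)"
    by (intro mult_left_mono) auto
  finally show "a x * ((2 * t) powr p * ln (exp 1 + 2 * t)) \<le> 2 powr p * 2 * (t powr p + a x * (t powr p * ln (exp 1 + t)) + 1)" .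
qed simp

text \<open>
  The oscillation of the weight times the logarithm is bounded, so it is paid for by \<open>t powr p\<close>.
\<close>

lemma log_phase_balanced:
  assumes a: "a \<in> log_holder \<Omega>" "\<And>x. x \<in> \<Omega> \<Longrightarrow> 0 \<le> a x" and \<theta>: "0 \<le> \<theta>"
  shows "rel_balanced \<Omega> \<theta> (\<lambda>x t. a x * (t powr p * ln (exp 1 + t))) (\<lambda>x t. t powr p + a x * (t powr p * ln (exp 1 + t)))"
proof (rule rel_balancedI)
  fix K :: real assume K: "1 \<le> K"
  obtain C \<delta>0 where C: "0 \<le> C" "0 < \<delta>0" "\<And>\<delta> x y t. 0 < \<delta> \<Longrightarrow> \<delta> < \<delta>0 \<Longrightarrow> x \<in> \<Omega> \<Longrightarrow> y \<in> \<Omega> \<Longrightarrow>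
    dist x y \<le> \<delta> \<Longrightarrow> 1 \<le> t \<Longrightarrow> t \<le> K * \<delta> powr (\<theta> - 1) \<Longrightarrow> \<bar>a x - a y\<bar> * ln (exp 1 + t) \<le> C"
    by (rule log_holder_ln[OF a(1) K \<theta>]) blast
  show "rel_balanced_at \<Omega> \<theta> K (\<lambda>x t. a x * (t powr p * ln (exp 1 + t))) (\<lambda>x t. t powr p + a x * (t powr p * ln (exp 1 + t)))"
  proof (rule rel_balanced_atI[of "C + 1" \<delta>0])
    fix \<delta> x y t assume *: "0 < \<delta>" "\<delta> < \<delta>0" "x \<in> \<Omega>" "y \<in> \<Omega>" "dist x y \<le> \<delta>" "1 \<le> t" "t \<le> K * \<delta> powr (\<theta> - 1)"
    let ?l = "ln (exp 1 + t)"
    have l: "0 \<le> ?l" using ln_exp_add_ge_1[of t] *(6) by linarith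
    have "a x * ?l \<le> (a y + \<bar>a x - a y\<bar>) * ?l" using l by (intro mult_right_mono) auto
    also have "\<dots> \<le> a y * ?l + C" using C(3)[OF *] by (simp add: distrib_right)
    finally have "t powr p * (a x * ?l) \<le> t powr p * (a y * ?l + C)" by (intro mult_left_mono) auto
    also have "\<dots> = C * t powr p + a y * (t powr p * ?l)" by (simp add: algebra_simps)
    also have "\<dots> \<le> (C + 1) * (t powr p + a y * (t powr p * ?l) + 1)"
    proof -
      have "0 \<le> a y * (t powr p * ?l)" using a(2)[OF *(4)] l by auto
      then show ?thesis using C(1) mult_nonneg_nonneg[of C "a y * (t powr p * ?l)"] powr_ge_zero[of t p]
        by (simp add: algebra_simps)
    qed
    finally show "a x * (t powr p * ?l) \<le> (C + 1) * (t powr p + a y * (t powr p * ?l) + 1)" by (simp add: mult.left_commute)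
  qed (use C in auto)
qed

subsection \<open>Orlicz phases\<close>

lemma Young_ray:
  assumes \<phi>: "Young_function \<phi>" and "0 \<le> s" "s \<le> t"
  shows "0 \<le> \<phi> s" "\<phi> s \<le> \<phi> t"
proof -
  show 0: "0 \<le> \<phi> s" using assms by (cases "s = 0") (auto simp: Young_function_def less_imp_le)
  show "\<phi> s \<le> \<phi> t"
  proof (cases "t = 0")
    case False
    then have t: "0 < t" using assms by simp
    have "\<phi> ((1 - s / t) *\<^sub>R 0 + (s / t) *\<^sub>R t) \<le> (1 - s / t) * \<phi> 0 + (s / t) * \<phi> t"
      using \<phi> assms t by (intro convex_onD[of "{0..}" \<phi>]) (auto simp: Young_function_def divide_le_eq)
    then have "\<phi> s \<le> (s / t) * \<phi> t" using t \<phi> by (simp add: Young_function_def)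
    also have "\<dots> \<le> 1 * \<phi> t" using assms t \<phi> by (intro mult_right_mono) (auto simp: Young_function_def divide_le_eq less_imp_le)
    finally show ?thesis by simp
  qed (use assms in simp)
qed

lemma Young_doubling:
  assumes \<phi>: "Young_function \<phi>" "Delta2 \<phi>"
  obtains c b where "0 \<le> c" "0 \<le> b" "\<And>t. 0 \<le> t \<Longrightarrow> \<phi> (2 * t) \<le> c * \<phi> t + b"
proof -
  obtain c C h where c: "0 < c" "0 < C" "0 < h" "\<And>t. C < t \<Longrightarrow> \<phi> (2 * t) \<le> c * \<phi> t + h"
    using \<phi>(2) unfolding Delta2_def by blast
  have C2: "0 \<le> \<phi> (2 * C)" using c by (intro Young_ray(1)[OF \<phi>(1)]) auto
  have "\<phi> (2 * t) \<le> c * \<phi> t + (h + \<phi> (2 * C))" if t: "0 \<le> t" for t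
  proof (cases "C < t")
    case True
    then show ?thesis using c(4)[OF True] C2 by simp
  next
    case False
    have "\<phi> (2 * t) \<le> \<phi> (2 * C)" using t False by (intro Young_ray(2)[OF \<phi>(1)]) auto
    moreover have "0 \<le> c * \<phi> t" using c Young_ray(1)[OF \<phi>(1) t order_refl] by simp
    ultimately show ?thesis using c by simp
  qed
  then show ?thesis using that[of c "h + \<phi> (2 * C)"] c C2 by auto
qed

text \<open>
  Iterated doubling gives \<open>\<phi> t \<le> C * \<phi> (t / K) + d\<close>, and for \<open>t \<ge> 1\<close> the constant \<open>d\<close> is absorbed since
  \<open>\<phi> (t / K) \<ge> \<phi> (1 / K) > 0\<close>.
\<close>

lemma Young_scale:
  assumes \<phi>: "Young_function \<phi>" "Delta2 \<phi>" and K: "1 \<le> K"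
  obtains D where "0 \<le> D" "\<And>t. 1 \<le> t \<Longrightarrow> \<phi> t \<le> D * \<phi> (t / K)"
proof -
  obtain c b where c: "0 \<le> c" "0 \<le> b" "\<And>t. 0 \<le> t \<Longrightarrow> \<phi> (2 * t) \<le> c * \<phi> t + b"
    using Young_doubling[OF \<phi>] by blast
  have pow: "\<exists>C\<ge>0. \<exists>d\<ge>0. \<forall>t\<ge>0. \<phi> (2 ^ n * t) \<le> C * \<phi> t + d" for n
  proof (induction n)
    case 0
    then show ?case by (intro exI[of _ "1::real"] conjI exI[of _ "0::real"]) auto
  next
    case (Suc n)
    then obtain C d where C: "0 \<le> C" "0 \<le> d" "\<And>t. 0 \<le> t \<Longrightarrow> \<phi> (2 ^ n * t) \<le> C * \<phi> t + d" by blast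
    have "\<phi> (2 ^ Suc n * t) \<le> (c * C) * \<phi> t + (c * d + b)" if t: "0 \<le> t" for t
    proof -
      have "\<phi> (2 ^ Suc n * t) \<le> c * \<phi> (2 ^ n * t) + b" using c(3)[of "2 ^ n * t"] t by (simp add: mult.assoc)
      also have "\<dots> \<le> c * (C * \<phi> t + d) + b" using C(3)[OF t] c(1) by (intro add_right_mono mult_left_mono) auto
      finally show ?thesis by (simp add: algebra_simps)
    qed
    moreover have "0 \<le> c * C" "0 \<le> c * d + b" using c C by auto
    ultimately show ?case by blast
  qed
  obtain n where n: "K < 2 ^ n" using real_arch_pow[of 2 K] by auto
  obtain C d where C: "0 \<le> C" "0 \<le> d" "\<And>t. 0 \<le> t \<Longrightarrow> \<phi> (2 ^ n * t) \<le> C * \<phi> t + d" using pow by blast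
  have pos: "0 < \<phi> (1 / K)" using \<phi>(1) K by (simp add: Young_function_def)
  have "\<phi> t \<le> (C + d / \<phi> (1 / K)) * \<phi> (t / K)" if t: "1 \<le> t" for t
  proof -
    have "t \<le> 2 ^ n * (t / K)" using n t K by (simp add: le_divide_eq mult_mono mult.commute[of t])
    then have "\<phi> t \<le> \<phi> (2 ^ n * (t / K))" using t by (intro Young_ray(2)[OF \<phi>(1)]) auto
    also have "\<dots> \<le> C * \<phi> (t / K) + d" using t K by (intro C(3)) auto
    also have "d = d / \<phi> (1 / K) * \<phi> (1 / K)" using pos by simp
    also have "\<dots> \<le> d / \<phi> (1 / K) * \<phi> (t / K)"
      using t K C(2) pos by (intro mult_left_mono Young_ray(2)[OF \<phi>(1)]) (auto simp: divide_right_mono)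
    finally show ?thesis by (simp add: algebra_simps)
  qed
  then show ?thesis using that[of "C + d / \<phi> (1 / K)"] C pos by auto
qed

lemma orlicz_phase_doubling:
  assumes \<psi>: "Young_function \<psi>" "Delta2 \<psi>" and a: "\<And>x. x \<in> \<Omega> \<Longrightarrow> 0 \<le> a x" "\<And>x. x \<in> \<Omega> \<Longrightarrow> a x \<le> N"
    and le: "\<And>x t. x \<in> \<Omega> \<Longrightarrow> 0 \<le> t \<Longrightarrow> a x * \<psi> t \<le> f x t"
  shows "rel_doubling \<Omega> (\<lambda>x t. a x * \<psi> t) f"
proof -
  obtain c b where c: "0 \<le> c" "0 \<le> b" "\<And>t. 0 \<le> t \<Longrightarrow> \<psi> (2 * t) \<le> c * \<psi> t + b"
    using Young_doubling[OF \<psi>] by blast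
  show ?thesis
  proof (rule rel_doublingI[of "c + max 0 N * b"])
    show "0 \<le> c + max 0 N * b" using c by simp
    fix x and t :: real assume x: "x \<in> \<Omega>" "0 \<le> t"
    have f0: "0 \<le> f x t" using le[OF x] a(1)[OF x(1)] Young_ray(1)[OF \<psi>(1) x(2) order_refl] by (meson mult_nonneg_nonneg order_trans)
    have "a x * \<psi> (2 * t) \<le> a x * (c * \<psi> t + b)" using c(3)[OF x(2)] a(1)[OF x(1)] by (intro mult_left_mono)
    also have "\<dots> = c * (a x * \<psi> t) + a x * b" by (simp add: algebra_simps)
    also have "\<dots> \<le> c * f x t + max 0 N * b"
      using le[OF x] c a[OF x(1)] by (intro add_mono mult_left_mono mult_right_mono) auto
    also have "\<dots> \<le> c * (f x t + 1) + max 0 N * b * (f x t + 1)"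
      using c f0 mult_left_mono[of 1 "f x t + 1" "max 0 N * b"] by (intro add_mono mult_left_mono) auto
    finally show "a x * \<psi> (2 * t) \<le> (c + max 0 N * b) * (f x t + 1)" by (simp add: distrib_right)
  qed
qed

lemma modulus_bounded:
  assumes \<Omega>: "bounded \<Omega>" and a: "modulus_of_continuity \<Omega> a \<omega>"
  obtains N where "\<And>x. x \<in> \<Omega> \<Longrightarrow> a x \<le> N"
proof (cases "\<Omega> = {}")
  case False
  then obtain y where y: "y \<in> \<Omega>" by blast
  have "a x \<le> a y + \<omega> (diameter \<Omega>)" if x: "x \<in> \<Omega>" for x
  proof -
    have "\<bar>a x - a y\<bar> \<le> \<omega> (dist x y)" using a x y by (simp add: modulus_of_continuity_def)
    also have "\<dots> \<le> \<omega> (diameter \<Omega>)"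
      using a diameter_bounded_bound[OF \<Omega> x y] diameter_ge_0[OF \<Omega>] by (intro mono_onD[of "{0..}" \<omega>]) (auto simp: modulus_of_continuity_def)
    finally show ?thesis by linarith
  qed
  then show ?thesis using that by blast
qed auto

lemma weight_phase_balanced:
  fixes \<phi> \<psi> :: "real \<Rightarrow> real"
  assumes \<phi>: "\<And>t. 1 \<le> t \<Longrightarrow> 0 \<le> \<phi> t" and \<psi>: "\<And>t. 1 \<le> t \<Longrightarrow> 0 \<le> \<psi> t" and a: "\<And>x. x \<in> \<Omega> \<Longrightarrow> 0 \<le> a x"
    and osc: "\<And>K. 1 \<le> K \<Longrightarrow> \<exists>D\<ge>0. \<forall>\<delta> x y t. 0 < \<delta> \<longrightarrow> x \<in> \<Omega> \<longrightarrow> y \<in> \<Omega> \<longrightarrow> dist x y \<le> \<delta> \<longrightarrow> 1 \<le> t \<longrightarrow>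
      t \<le> K * \<delta> powr (\<theta> - 1) \<longrightarrow> \<bar>a x - a y\<bar> * \<psi> t \<le> D * \<phi> t"
  shows "rel_balanced \<Omega> \<theta> (\<lambda>x t. a x * \<psi> t) (\<lambda>x t. \<phi> t + a x * \<psi> t)"
proof (rule rel_balancedI)
  fix K :: real assume K: "1 \<le> K"
  obtain D where D: "0 \<le> D" "\<And>\<delta> x y t. 0 < \<delta> \<Longrightarrow> x \<in> \<Omega> \<Longrightarrow> y \<in> \<Omega> \<Longrightarrow> dist x y \<le> \<delta> \<Longrightarrow> 1 \<le> t \<Longrightarrow>
      t \<le> K * \<delta> powr (\<theta> - 1) \<Longrightarrow> \<bar>a x - a y\<bar> * \<psi> t \<le> D * \<phi> t"
    using osc[OF K] by blast
  show "rel_balanced_at \<Omega> \<theta> K (\<lambda>x t. a x * \<psi> t) (\<lambda>x t. \<phi> t + a x * \<psi> t)"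
  proof (rule rel_balanced_atI[of "D + 1" 1])
    fix \<delta> x y t assume *: "0 < \<delta>" "\<delta> < 1" "x \<in> \<Omega>" "y \<in> \<Omega>" "dist x y \<le> \<delta>" "1 \<le> t" "t \<le> K * \<delta> powr (\<theta> - 1)"
    have "a x * \<psi> t \<le> (a y + \<bar>a x - a y\<bar>) * \<psi> t" using \<psi>[OF *(6)] by (intro mult_right_mono) auto
    also have "\<dots> \<le> a y * \<psi> t + D * \<phi> t" using D(2)[OF *(1,3-7)] by (simp add: distrib_right)
    also have "\<dots> \<le> (D + 1) * (\<phi> t + a y * \<psi> t + 1)"
    proof -
      have "0 \<le> a y * \<psi> t" using a[OF *(4)] \<psi>[OF *(6)] by simp
      then show ?thesis using D(1) \<phi>[OF *(6)] mult_nonneg_nonneg[of D "a y * \<psi> t"] by (simp add: algebra_simps)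
    qed
    finally show "a x * \<psi> t \<le> (D + 1) * (\<phi> t + a y * \<psi> t + 1)" .
  qed (use D in auto)
qed

text \<open>
  The bound on \<open>\<omega>\<close> controls the weight only at the scale tied to \<open>t\<close>. A point \<open>t\<close> of the admissible range
  determines a scale \<open>\<tau>\<close> by \<open>\<tau> powr (\<theta> - 1) = t / K\<close>, which is at least \<open>\<delta>\<close>, and \<open>\<omega>\<close> is monotone; so the
  oscillation of \<open>a\<close> is at most \<open>\<phi> (t / K) / \<psi> (t / K)\<close>, and doubling of \<open>\<psi>\<close> removes the factor \<open>K\<close>.
\<close>

lemma orlicz_phase_balanced:
  assumes \<phi>: "Young_function \<phi>" and \<psi>: "Young_function \<psi>" "Delta2 \<psi>" and a: "\<And>x. x \<in> \<Omega> \<Longrightarrow> 0 \<le> a x"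
    and \<omega>: "modulus_of_continuity \<Omega> a \<omega>" "\<And>t. 0 < t \<Longrightarrow> \<omega> t \<le> \<phi> (t powr (\<theta> - 1)) / \<psi> (t powr (\<theta> - 1))"
    and \<theta>: "\<theta> < 1"
  shows "rel_balanced \<Omega> \<theta> (\<lambda>x t. a x * \<psi> t) (\<lambda>x t. \<phi> t + a x * \<psi> t)"
proof (rule weight_phase_balanced[OF _ _ a])
  show "0 \<le> \<phi> t" "0 \<le> \<psi> t" if "1 \<le> t" for t using Young_ray(1)[OF \<phi>, of t t] Young_ray(1)[OF \<psi>(1), of t t] that by auto
  fix K :: real assume K: "1 \<le> K"
  obtain D where D: "0 \<le> D" "\<And>t. 1 \<le> t \<Longrightarrow> \<psi> t \<le> D * \<psi> (t / K)" using Young_scale[OF \<psi> K] by blast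
  show "\<exists>D\<ge>0. \<forall>\<delta> x y t. 0 < \<delta> \<longrightarrow> x \<in> \<Omega> \<longrightarrow> y \<in> \<Omega> \<longrightarrow> dist x y \<le> \<delta> \<longrightarrow> 1 \<le> t \<longrightarrow>
      t \<le> K * \<delta> powr (\<theta> - 1) \<longrightarrow> \<bar>a x - a y\<bar> * \<psi> t \<le> D * \<phi> t"
  proof (intro exI[of _ D] conjI allI impI)
    fix \<delta> x y t assume *: "0 < \<delta>" "x \<in> \<Omega>" "y \<in> \<Omega>" "dist x y \<le> \<delta>" "1 \<le> t" "t \<le> K * \<delta> powr (\<theta> - 1)"
    define \<tau> where "\<tau> = (K / t) powr (1 / (1 - \<theta>))"
    have Kt: "0 < K / t" using K *(5) by simp
    have \<tau>: "0 < \<tau>" using K *(5) by (simp add: \<tau>_def)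
    have "(1 / (1 - \<theta>)) * (\<theta> - 1) = - 1" using \<theta> by (simp add: field_simps)
    then have \<tau>K: "\<tau> powr (\<theta> - 1) = t / K" using K *(5) by (simp add: \<tau>_def powr_powr powr_minus)
    have "\<delta> \<le> \<tau>"
    proof -
      have "\<delta> powr (1 - \<theta>) \<le> K / t"
      proof -
        have "t * \<delta> powr (1 - \<theta>) \<le> K * \<delta> powr (\<theta> - 1) * \<delta> powr (1 - \<theta>)" using *(6) by (intro mult_right_mono) auto
        also have "\<dots> = K" using *(1) by (simp add: mult.assoc powr_add[symmetric])
        finally show ?thesis using *(5) by (simp add: le_divide_eq mult.commute)
      qed
      then have "(\<delta> powr (1 - \<theta>)) powr (1 / (1 - \<theta>)) \<le> \<tau>" unfolding \<tau>_def using \<theta> by (intro powr_mono2) auto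
      then show ?thesis using *(1) \<theta> by (simp add: powr_powr)
    qed
    have \<psi>K: "0 < \<psi> (t / K)" using \<psi>(1) *(5) K by (simp add: Young_function_def)
    have \<phi>K: "0 \<le> \<phi> (t / K)" "\<phi> (t / K) \<le> \<phi> t"
      using *(5) K mult_left_mono[of 1 K t] by (auto intro!: Young_ray[OF \<phi>] simp: divide_le_eq)
    have "\<bar>a x - a y\<bar> \<le> \<omega> (dist x y)" using \<omega>(1) *(2,3) by (simp add: modulus_of_continuity_def)
    also have "\<dots> \<le> \<omega> \<tau>"
      using \<omega>(1) *(4) \<tau> \<open>\<delta> \<le> \<tau>\<close> by (intro mono_onD[of "{0..}" \<omega>]) (auto simp: modulus_of_continuity_def)
    also have "\<dots> \<le> \<phi> (t / K) / \<psi> (t / K)" using \<omega>(2)[OF \<tau>] \<tau>K by simp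
    finally have "\<bar>a x - a y\<bar> * \<psi> t \<le> \<phi> (t / K) / \<psi> (t / K) * (D * \<psi> (t / K))"
      using D(2)[OF *(5)] \<phi>K \<psi>K Young_ray(1)[OF \<psi>(1), of t t] *(5) by (intro mult_mono) auto
    also have "\<dots> = D * \<phi> (t / K)" using \<psi>K by simp
    also have "\<dots> \<le> D * \<phi> t" using D(1) \<phi>K by (intro mult_left_mono)
    finally show "\<bar>a x - a y\<bar> * \<psi> t \<le> D * \<phi> t" .
  qed (use D in auto)
qed

subsection \<open>Zygmund phases\<close>

lemma log_weight_phase_doubling:
  assumes \<sigma>: "0 \<le> \<sigma>" and a: "\<And>x. x \<in> \<Omega> \<Longrightarrow> 0 \<le> a x"
    and le: "\<And>x t. x \<in> \<Omega> \<Longrightarrow> 0 \<le> t \<Longrightarrow> a x * (t powr p * ln (exp 1 + t) powr \<sigma>) \<le> f x t"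
  shows "rel_doubling \<Omega> (\<lambda>x t. a x * (t powr p * ln (exp 1 + t) powr \<sigma>)) f"
proof (rule rel_doublingI[of "2 powr p * 2 powr \<sigma>"])
  fix x and t :: real assume x: "x \<in> \<Omega>" "0 \<le> t"
  have "ln (exp 1 + 2 * t) powr \<sigma> \<le> (2 * ln (exp 1 + t)) powr \<sigma>"
    using ln_exp_add_double[OF x(2)] ln_exp_add_ge_1[of "2 * t"] x(2) \<sigma> by (intro powr_mono2) auto
  also have "\<dots> = 2 powr \<sigma> * ln (exp 1 + t) powr \<sigma>" using ln_exp_add_ge_1[OF x(2)] by (simp add: powr_mult)
  finally have "a x * ((2 * t) powr p * ln (exp 1 + 2 * t) powr \<sigma>) \<le> a x * ((2 * t) powr p * (2 powr \<sigma> * ln (exp 1 + t) powr \<sigma>))"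
    using a[OF x(1)] by (intro mult_left_mono) auto
  also have "\<dots> = 2 powr p * 2 powr \<sigma> * (a x * (t powr p * ln (exp 1 + t) powr \<sigma>))" using x(2) by (simp add: powr_mult)
  also have "\<dots> \<le> 2 powr p * 2 powr \<sigma> * (f x t + 1)" using le[OF x] by (intro mult_left_mono) auto
  finally show "a x * ((2 * t) powr p * ln (exp 1 + 2 * t) powr \<sigma>) \<le> 2 powr p * 2 powr \<sigma> * (f x t + 1)" .
qed simp

lemma log_base_doubling:
  assumes \<tau>: "0 \<le> \<tau>"
  shows "rel_doubling \<Omega> (\<lambda>x t. t powr p * ln (exp 1 + t) powr (- \<tau>)) (\<lambda>x t. t powr p * ln (exp 1 + t) powr (- \<tau>))"
proof (rule rel_doublingI[of "2 powr p"])
  fix x and t :: real assume t: "0 \<le> t"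
  have "ln (exp 1 + t) \<le> ln (exp 1 + 2 * t)" using t exp_1_add_pos[OF t] by (intro ln_mono) auto
  then have "ln (exp 1 + 2 * t) powr (- \<tau>) \<le> ln (exp 1 + t) powr (- \<tau>)"
    using ln_exp_add_ge_1[OF t] \<tau> by (intro powr_mono2') auto
  then have "(2 * t) powr p * ln (exp 1 + 2 * t) powr (- \<tau>) \<le> (2 * t) powr p * ln (exp 1 + t) powr (- \<tau>)"
    by (intro mult_left_mono) auto
  also have "\<dots> = 2 powr p * (t powr p * ln (exp 1 + t) powr (- \<tau>))" using t by (simp add: powr_mult)
  also have "\<dots> \<le> 2 powr p * (t powr p * ln (exp 1 + t) powr (- \<tau>) + 1)" by (intro mult_left_mono) auto
  finally show "(2 * t) powr p * ln (exp 1 + 2 * t) powr (- \<tau>) \<le> 2 powr p * (t powr p * ln (exp 1 + t) powr (- \<tau>) + 1)" .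
qed simp

text \<open>
  The quotient of the two phases is \<open>ln (exp 1 + t) powr (\<sigma> + \<tau>)\<close>, and for \<open>t \<le> K / \<delta>\<close> this logarithm is at most
  \<open>1 + ln K\<close> times the logarithm at \<open>1 / \<delta>\<close> that appears in the modulus of continuity.
\<close>

lemma log_weight_phase_balanced:
  assumes \<sigma>\<tau>: "0 \<le> \<sigma> + \<tau>" and a: "\<And>x. x \<in> \<Omega> \<Longrightarrow> 0 \<le> a x"
    and \<omega>: "modulus_of_continuity \<Omega> a \<omega>" "\<And>t. 0 < t \<Longrightarrow> \<omega> t \<le> ln (exp 1 + 1 / t) powr (- (\<sigma> + \<tau>))"
  shows "rel_balanced \<Omega> 0 (\<lambda>x t. a x * (t powr p * ln (exp 1 + t) powr \<sigma>))
     (\<lambda>x t. t powr p * ln (exp 1 + t) powr (- \<tau>) + a x * (t powr p * ln (exp 1 + t) powr \<sigma>))"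
proof (rule weight_phase_balanced[OF _ _ a])
  fix K :: real assume K: "1 \<le> K"
  let ?D = "(1 + ln K) powr (\<sigma> + \<tau>)"
  show "\<exists>D\<ge>0. \<forall>\<delta> x y t. 0 < \<delta> \<longrightarrow> x \<in> \<Omega> \<longrightarrow> y \<in> \<Omega> \<longrightarrow> dist x y \<le> \<delta> \<longrightarrow> 1 \<le> t \<longrightarrow>
      t \<le> K * \<delta> powr (0 - 1) \<longrightarrow> \<bar>a x - a y\<bar> * (t powr p * ln (exp 1 + t) powr \<sigma>) \<le> D * (t powr p * ln (exp 1 + t) powr (- \<tau>))"
  proof (intro exI[of _ ?D] conjI allI impI)
    fix \<delta> x y t assume *: "0 < \<delta>" "x \<in> \<Omega>" "y \<in> \<Omega>" "dist x y \<le> \<delta>" "1 \<le> t" "t \<le> K * \<delta> powr (0 - 1)"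
    let ?l = "ln (exp 1 + t)" and ?m = "ln (exp 1 + 1 / \<delta>)"
    have l1: "1 \<le> ?l" using *(5) by (intro ln_exp_add_ge_1) auto
    have m1: "1 \<le> ?m" using *(1) by (intro ln_exp_add_ge_1) auto
    have "t \<le> K * (1 / \<delta>)" using *(1,6) by (simp add: powr_minus divide_inverse)
    moreover have "exp 1 \<le> K * exp (1::real)" using K by simp
    ultimately have "exp 1 + t \<le> K * exp 1 + K * (1 / \<delta>)" by (rule add_mono[rotated])
    then have "exp 1 + t \<le> K * (exp 1 + 1 / \<delta>)" by (simp only: distrib_left)
    then have "?l \<le> ln (K * (exp 1 + 1 / \<delta>))" using *(5) exp_1_add_pos[of t] by (intro ln_mono) auto
    also have "\<dots> = ln K + ?m" using K *(1) by (intro ln_mult_pos) (auto intro!: add_pos_pos)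
    also have "\<dots> \<le> (1 + ln K) * ?m" using m1 K mult_left_mono[of 1 ?m "ln K"] by (simp add: distrib_right)
    finally have lm: "?l \<le> (1 + ln K) * ?m" .
    have "\<bar>a x - a y\<bar> \<le> \<omega> (dist x y)" using \<omega>(1) *(2,3) by (simp add: modulus_of_continuity_def)
    also have "\<dots> \<le> \<omega> \<delta>" using \<omega>(1) *(1,4) by (intro mono_onD[of "{0..}" \<omega>]) (auto simp: modulus_of_continuity_def)
    also have "\<dots> \<le> ?m powr (- (\<sigma> + \<tau>))" by (rule \<omega>(2)[OF *(1)])
    finally have "\<bar>a x - a y\<bar> * ?l powr (\<sigma> + \<tau>) \<le> ?m powr (- (\<sigma> + \<tau>)) * ((1 + ln K) * ?m) powr (\<sigma> + \<tau>)"
      using lm l1 \<sigma>\<tau> by (intro mult_mono powr_mono2) auto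
    also have "\<dots> = ?D * (?m powr (- (\<sigma> + \<tau>)) * ?m powr (\<sigma> + \<tau>))" using m1 K by (simp add: powr_mult mult_ac)
    also have "?m powr (- (\<sigma> + \<tau>)) * ?m powr (\<sigma> + \<tau>) = 1" using m1 by (simp only: powr_add[symmetric]) simp
    finally have "\<bar>a x - a y\<bar> * ?l powr (\<sigma> + \<tau>) \<le> ?D" by simp
    then have "(t powr p * ?l powr (- \<tau>)) * (\<bar>a x - a y\<bar> * ?l powr (\<sigma> + \<tau>)) \<le> (t powr p * ?l powr (- \<tau>)) * ?D"
      by (intro mult_left_mono) auto
    moreover have "?l powr (- \<tau>) * ?l powr (\<sigma> + \<tau>) = ?l powr \<sigma>" using l1 by (simp add: powr_add[symmetric])
    ultimately show "\<bar>a x - a y\<bar> * (t powr p * ?l powr \<sigma>) \<le> ?D * (t powr p * ?l powr (- \<tau>))"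
      by (simp add: mult_ac)
  qed auto
qed auto

section \<open>Isotropic and orthotropic integrands\<close>

lemma Lp_varI:
  assumes "f \<in> borel_measurable (lebesgue_on \<Omega>)" "0 < k"
    and "(\<integral>\<^sup>+ x. ennreal ((\<bar>f x\<bar> / k) powr p x) \<partial>lebesgue_on \<Omega>) < \<infinity>"
  shows "f \<in> Lp_var \<Omega> p"
  using assms unfolding Lp_var_def by blast

locale lavrentiev_setting =
  fixes \<Omega> :: "(real ^ 'n) set" and F :: "real ^ 'n \<Rightarrow> real \<Rightarrow> real ^ 'n \<Rightarrow> real"
    and M :: "real ^ 'n \<Rightarrow> real ^ 'n \<Rightarrow> real" and \<gamma> \<nu> \<beta> L :: real
  assumes domain: "bounded_lipschitz_domain \<Omega>"
    and \<gamma>: "0 < \<gamma>" "\<gamma> < 1"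
    and F: "caratheodory_integrand \<Omega> F"
    and N_function: "weak_N_function \<Omega> M"
    and constants: "0 < \<nu>" "1 < L"
    and growth: "\<forall>x\<in>\<Omega>. \<forall>z \<xi>. \<nu> * M x (\<beta> *\<^sub>R \<xi>) \<le> F x z \<xi> \<and> F x z \<xi> \<le> L * (M x \<xi> + 1)"
begin

lemma bounded_domain: "bounded \<Omega>"
  using domain by (simp add: bounded_lipschitz_domain_def)

lemma isotropic_locale:
  fixes f :: "real ^ 'n \<Rightarrow> real \<Rightarrow> real" and i :: 'n
  assumes M: "\<forall>x\<in>\<Omega>. \<forall>\<xi>. M x \<xi> = f x (norm \<xi>)" and dbl: "rel_doubling \<Omega> f f"
  obtains A where "musielak_functional \<Omega> M {()} (\<lambda>_. axis i 1) (\<lambda>_ \<xi>. \<xi>) A F \<nu> \<beta> L"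
proof -
  obtain A where A: "0 \<le> A" "\<And>x t. x \<in> \<Omega> \<Longrightarrow> 0 \<le> t \<Longrightarrow> f x (2 * t) \<le> A * (f x t + 1)"
    using dbl unfolding rel_doubling_def by blast
  have "musielak_functional \<Omega> M {()} (\<lambda>_. axis i 1) (\<lambda>_ \<xi>. \<xi>) A F \<nu> \<beta> L"
  proof (intro musielak_functional.intro musielak.intro musielak_functional_axioms.intro)
    show "M x (2 *\<^sub>R \<xi>) \<le> A * (M x \<xi> + 1)" if "x \<in> \<Omega>" for x \<xi>
      using A(2)[OF that, of "norm \<xi>"] M that by simp
    show "M x \<xi> = (\<Sum>j\<in>{()}. M x (norm \<xi> *\<^sub>R axis i 1))" if "x \<in> \<Omega>" for x \<xi>
      using M that by simp
    show "\<nu> * M x (\<beta> *\<^sub>R \<xi>) \<le> F x z \<xi> \<and> F x z \<xi> \<le> L * (M x \<xi> + 1)" if "x \<in> \<Omega>" for x z \<xi>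
      using growth that by blast
    show "bounded_linear (\<lambda>\<xi> :: real ^ 'n. \<xi>)" by (rule bounded_linear_ident)
  qed (use domain N_function A(1) F constants in auto)
  then show ?thesis by (rule that)
qed

lemma isotropic:
  assumes M: "\<forall>x\<in>\<Omega>. \<forall>\<xi>. M x \<xi> = f x (norm \<xi>)" and dbl: "rel_doubling \<Omega> f f"
  shows "rel_balanced \<Omega> 0 f f \<Longrightarrow> no_lavrentiev_V \<Omega> M F"
    and "rel_balanced \<Omega> \<gamma> f f \<Longrightarrow> no_lavrentiev_V_holder \<Omega> M F \<gamma>"
proof -
  \<comment> \<open>every unit vector can serve as direction, so the index of the axis is irrelevant\<close>
  obtain A where A: "musielak_functional \<Omega> M {()} (\<lambda>_. axis undefined 1) (\<lambda>_ \<xi>. \<xi>) A F \<nu> \<beta> L"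
    by (rule isotropic_locale[OF M dbl])
  interpret musielak_functional \<Omega> M "{()}" "\<lambda>_. axis undefined 1" "\<lambda>_ \<xi>. \<xi>" A F \<nu> \<beta> L by (rule A)
  have bal: "balanced \<theta>" if rel: "rel_balanced \<Omega> \<theta> f f" for \<theta>
    unfolding balanced_def
  proof (intro allI impI)
    fix K :: real assume K: "1 \<le> K"
    obtain C \<delta>0 where C: "0 \<le> C" "0 < \<delta>0" "\<And>\<delta> x y t. 0 < \<delta> \<Longrightarrow> \<delta> < \<delta>0 \<Longrightarrow> x \<in> \<Omega> \<Longrightarrow> y \<in> \<Omega> \<Longrightarrow>
       dist x y \<le> \<delta> \<Longrightarrow> 1 \<le> t \<Longrightarrow> t \<le> K * \<delta> powr (\<theta> - 1) \<Longrightarrow> f x t \<le> C * (f y t + 1)"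
      by (rule rel_balancedE[OF rel K]) blast
    have "M x (t *\<^sub>R axis undefined 1) = f x t" if "x \<in> \<Omega>" "1 \<le> t" for x t using M that by simp
    then show "\<exists>C\<ge>0. \<exists>\<delta>0>0. \<forall>\<delta> x y j t. 0 < \<delta> \<longrightarrow> \<delta> < \<delta>0 \<longrightarrow> x \<in> \<Omega> \<longrightarrow> y \<in> \<Omega> \<longrightarrow> dist x y \<le> \<delta> \<longrightarrow>
       j \<in> {()} \<longrightarrow> 1 \<le> t \<longrightarrow> t \<le> K * \<delta> powr (\<theta> - 1) \<longrightarrow> M x (t *\<^sub>R axis undefined 1) \<le> C * (M y (t *\<^sub>R axis undefined 1) + 1)"
      using C by (metis (no_types, lifting))
  qed
  show "rel_balanced \<Omega> 0 f f \<Longrightarrow> no_lavrentiev_V \<Omega> M F" by (rule no_lavrentiev_V_balanced[OF bal])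
  show "rel_balanced \<Omega> \<gamma> f f \<Longrightarrow> no_lavrentiev_V_holder \<Omega> M F \<gamma>" by (rule no_lavrentiev_V_holder_balanced[OF bal \<gamma>])
qed

lemma orthotropic_axis:
  fixes f :: "'n \<Rightarrow> real ^ 'n \<Rightarrow> real \<Rightarrow> real"
  assumes M: "\<forall>x\<in>\<Omega>. \<forall>\<xi>. M x \<xi> = (\<Sum>i\<in>UNIV. f i x \<bar>\<xi> $ i\<bar>)" and f0: "\<And>i x. x \<in> \<Omega> \<Longrightarrow> f i x 0 = 0"
    and x: "x \<in> \<Omega>"
  shows "M x (t *\<^sub>R axis j 1) = f j x \<bar>t\<bar>"
proof -
  have "M x (t *\<^sub>R axis j 1) = (\<Sum>i\<in>UNIV. if i = j then f i x \<bar>t\<bar> else 0)"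
    unfolding M[rule_format, OF x] by (rule sum.cong) (auto simp: axis_def f0[OF x])
  then show ?thesis by simp
qed

lemma orthotropic_locale:
  fixes f :: "'n \<Rightarrow> real ^ 'n \<Rightarrow> real \<Rightarrow> real"
  assumes M: "\<forall>x\<in>\<Omega>. \<forall>\<xi>. M x \<xi> = (\<Sum>i\<in>UNIV. f i x \<bar>\<xi> $ i\<bar>)" and f0: "\<And>i x. x \<in> \<Omega> \<Longrightarrow> f i x 0 = 0"
    and dbl: "\<And>i. rel_doubling \<Omega> (f i) (f i)"
    and nonneg: "\<And>i x t. x \<in> \<Omega> \<Longrightarrow> 0 \<le> t \<Longrightarrow> 0 \<le> f i x t"
  obtains A where "musielak_functional \<Omega> M UNIV (\<lambda>j. axis j 1) (\<lambda>j \<xi>. (\<xi> $ j) *\<^sub>R axis j 1) A F \<nu> \<beta> L"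
proof -
  have "\<exists>A\<ge>0. \<forall>x\<in>\<Omega>. \<forall>t\<ge>0. f i x (2 * t) \<le> A * (f i x t + 1)" for i
    using dbl unfolding rel_doubling_def by blast
  then obtain A where A: "\<And>i. 0 \<le> A i" "\<And>i x t. x \<in> \<Omega> \<Longrightarrow> 0 \<le> t \<Longrightarrow> f i x (2 * t) \<le> A i * (f i x t + 1)" by metis
  have "musielak_functional \<Omega> M UNIV (\<lambda>j. axis j 1) (\<lambda>j \<xi>. (\<xi> $ j) *\<^sub>R axis j 1) (\<Sum>i\<in>UNIV. A i) F \<nu> \<beta> L"
  proof (intro musielak_functional.intro musielak.intro musielak_functional_axioms.intro)
    show "0 \<le> (\<Sum>i\<in>UNIV. A i)" using A(1) by (intro sum_nonneg) auto
    show "M x (2 *\<^sub>R \<xi>) \<le> (\<Sum>i\<in>UNIV. A i) * (M x \<xi> + 1)" if x: "x \<in> \<Omega>" for x \<xi>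
    proof -
      have "M x (2 *\<^sub>R \<xi>) = (\<Sum>i\<in>UNIV. f i x (2 * \<bar>\<xi> $ i\<bar>))" using M x by (simp add: abs_mult)
      also have "\<dots> \<le> (\<Sum>i\<in>UNIV. A i * (M x \<xi> + 1))"
      proof (rule sum_mono)
        fix i
        have "f i x \<bar>\<xi> $ i\<bar> \<le> M x \<xi>"
          unfolding M[rule_format, OF x] by (rule member_le_sum) (use nonneg[OF x] in auto)
        then have "A i * (f i x \<bar>\<xi> $ i\<bar> + 1) \<le> A i * (M x \<xi> + 1)" using A(1) by (intro mult_left_mono) auto
        with A(2)[OF x, of "\<bar>\<xi> $ i\<bar>" i] show "f i x (2 * \<bar>\<xi> $ i\<bar>) \<le> A i * (M x \<xi> + 1)" by simp
      qed
      finally show ?thesis by (simp add: sum_distrib_right)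
    qed
    show "bounded_linear (\<lambda>\<xi> :: real ^ 'n. (\<xi> $ j) *\<^sub>R (axis j 1 :: real ^ 'n))" for j :: 'n
      by (intro bounded_linear_scaleR_const bounded_linear_vec_nth)
    show "norm ((\<xi> $ j) *\<^sub>R (axis j 1 :: real ^ 'n)) \<le> norm \<xi>" for \<xi> :: "real ^ 'n" and j :: 'n
      using component_le_norm_cart[of \<xi> j] by simp
    show "M x \<xi> = (\<Sum>j\<in>UNIV. M x (norm ((\<xi> $ j) *\<^sub>R (axis j 1 :: real ^ 'n)) *\<^sub>R axis j 1))" if x: "x \<in> \<Omega>" for x \<xi>
    proof -
      have "M x (norm ((\<xi> $ j) *\<^sub>R (axis j 1 :: real ^ 'n)) *\<^sub>R axis j 1) = f j x \<bar>\<xi> $ j\<bar>" for j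
        using orthotropic_axis[OF M f0 x, of "\<bar>\<xi> $ j\<bar>" j] by simp
      then show ?thesis unfolding M[rule_format, OF x, of \<xi>] by simp
    qed
    show "\<nu> * M x (\<beta> *\<^sub>R \<xi>) \<le> F x z \<xi> \<and> F x z \<xi> \<le> L * (M x \<xi> + 1)" if "x \<in> \<Omega>" for x z \<xi>
      using growth that by blast
  qed (use domain N_function F constants in auto)
  then show ?thesis by (rule that)
qed

lemma orthotropic:
  fixes f :: "'n \<Rightarrow> real ^ 'n \<Rightarrow> real \<Rightarrow> real"
  assumes M: "\<forall>x\<in>\<Omega>. \<forall>\<xi>. M x \<xi> = (\<Sum>i\<in>UNIV. f i x \<bar>\<xi> $ i\<bar>)" and f0: "\<And>i x. x \<in> \<Omega> \<Longrightarrow> f i x 0 = 0"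
    and dbl: "\<And>i. rel_doubling \<Omega> (f i) (f i)"
    and nonneg: "\<And>i x t. x \<in> \<Omega> \<Longrightarrow> 0 \<le> t \<Longrightarrow> 0 \<le> f i x t"
  shows "(\<And>i. rel_balanced \<Omega> 0 (f i) (f i)) \<Longrightarrow> no_lavrentiev_V \<Omega> M F"
    and "(\<And>i. rel_balanced \<Omega> \<gamma> (f i) (f i)) \<Longrightarrow> no_lavrentiev_V_holder \<Omega> M F \<gamma>"
proof -
  obtain A where A: "musielak_functional \<Omega> M UNIV (\<lambda>j. axis j 1) (\<lambda>j \<xi>. (\<xi> $ j) *\<^sub>R axis j 1) A F \<nu> \<beta> L"
    by (rule orthotropic_locale[OF M f0 dbl nonneg])
  interpret musielak_functional \<Omega> M UNIV "\<lambda>j. axis j 1" "\<lambda>j \<xi>. (\<xi> $ j) *\<^sub>R axis j 1" A F \<nu> \<beta> L by (rule A)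
  have bal: "balanced \<theta>" if rel: "\<And>i. rel_balanced \<Omega> \<theta> (f i) (f i)" for \<theta>
    unfolding balanced_def
  proof (intro allI impI)
    fix K :: real assume K: "1 \<le> K"
    have "\<exists>C \<delta>0. 0 \<le> C \<and> 0 < \<delta>0 \<and> (\<forall>\<delta> x y t. 0 < \<delta> \<longrightarrow> \<delta> < \<delta>0 \<longrightarrow> x \<in> \<Omega> \<longrightarrow> y \<in> \<Omega> \<longrightarrow>
       dist x y \<le> \<delta> \<longrightarrow> 1 \<le> t \<longrightarrow> t \<le> K * \<delta> powr (\<theta> - 1) \<longrightarrow> f i x t \<le> C * (f i y t + 1))" for i
      by (rule rel_balancedE[OF rel[of i] K]) blast
    then obtain C \<delta>0 where C: "\<And>i. 0 \<le> C i" "\<And>i. 0 < \<delta>0 i" "\<And>i \<delta> x y t. 0 < \<delta> \<Longrightarrow> \<delta> < \<delta>0 i \<Longrightarrow> x \<in> \<Omega> \<Longrightarrow> y \<in> \<Omega> \<Longrightarrow>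
       dist x y \<le> \<delta> \<Longrightarrow> 1 \<le> t \<Longrightarrow> t \<le> K * \<delta> powr (\<theta> - 1) \<Longrightarrow> f i x t \<le> C i * (f i y t + 1)"
      by metis
    define D where "D = (\<Sum>i\<in>UNIV. C i)"
    define d where "d = Min (range \<delta>0)"
    have D: "0 \<le> D" "C i \<le> D" for i
      unfolding D_def using C(1) by (auto intro!: sum_nonneg member_le_sum)
    have d: "0 < d" "d \<le> \<delta>0 i" for i
      unfolding d_def using C(2) by (auto simp: Min_gr_iff)
    have "M x (t *\<^sub>R axis j 1) \<le> D * (M y (t *\<^sub>R axis j 1) + 1)"
      if *: "0 < \<delta>" "\<delta> < d" "x \<in> \<Omega>" "y \<in> \<Omega>" "dist x y \<le> \<delta>" "1 \<le> t" "t \<le> K * \<delta> powr (\<theta> - 1)" for \<delta> x y j t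
    proof -
      have "f j x t \<le> C j * (f j y t + 1)" using * d(2)[of j] by (intro C(3)) auto
      also have "\<dots> \<le> D * (f j y t + 1)" using D nonneg[OF *(4), of t j] *(6) by (intro mult_right_mono) auto
      finally show ?thesis using *(3,4,6) by (simp add: orthotropic_axis[OF M f0])
    qed
    then show "\<exists>C\<ge>0. \<exists>\<delta>0>0. \<forall>\<delta> x y j t. 0 < \<delta> \<longrightarrow> \<delta> < \<delta>0 \<longrightarrow> x \<in> \<Omega> \<longrightarrow> y \<in> \<Omega> \<longrightarrow> dist x y \<le> \<delta> \<longrightarrow>
       j \<in> UNIV \<longrightarrow> 1 \<le> t \<longrightarrow> t \<le> K * \<delta> powr (\<theta> - 1) \<longrightarrow> M x (t *\<^sub>R axis j 1) \<le> C * (M y (t *\<^sub>R axis j 1) + 1)"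
      using D(1) d(1) by blast
  qed
  show "(\<And>i. rel_balanced \<Omega> 0 (f i) (f i)) \<Longrightarrow> no_lavrentiev_V \<Omega> M F" by (rule no_lavrentiev_V_balanced[OF bal])
  show "(\<And>i. rel_balanced \<Omega> \<gamma> (f i) (f i)) \<Longrightarrow> no_lavrentiev_V_holder \<Omega> M F \<gamma>" by (rule no_lavrentiev_V_holder_balanced[OF bal \<gamma>])
qed

text \<open>
  The Luxemburg description asks for a finite modular after division by some \<open>k\<close>; the exponent is bounded,
  so the modular is doubling and its finiteness does not depend on \<open>k\<close>.
\<close>

lemma V1_0_variable_exponent:
  assumes M: "\<forall>x\<in>\<Omega>. \<forall>\<xi>. M x \<xi> = norm \<xi> powr p x" and p: "p \<in> log_holder \<Omega>"
  shows "V1_0 \<Omega> M = W1p_var_0 \<Omega> p"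
proof -
  obtain A where A: "musielak_functional \<Omega> M {()} (\<lambda>_. axis undefined 1) (\<lambda>_ \<xi>. \<xi>) A F \<nu> \<beta> L"
    using isotropic_locale[of "\<lambda>x t. t powr p x", OF M powr_doubling'[OF bounded_domain p]] by blast
  interpret musielak_functional \<Omega> M "{()}" "\<lambda>_. axis undefined 1" "\<lambda>_ \<xi>. \<xi>" A F \<nu> \<beta> L by (rule A)
  have "weak_gradient \<Omega> u \<in> L_space \<Omega> M \<longleftrightarrow> (\<lambda>x. norm (weak_gradient \<Omega> u x)) \<in> Lp_var \<Omega> p" if u: "u \<in> W11_0 \<Omega>" for u
  proof -
    let ?g = "weak_gradient \<Omega> u"
    have "u \<in> W11 \<Omega>" using u by (simp add: W11_0_def)
    from W11D(3)[OF open_domain this] have g: "?g \<in> borel_measurable (lebesgue_on \<Omega>)" by auto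
    have eq: "(\<integral>\<^sup>+x. ennreal ((\<bar>norm (?g x)\<bar> / k) powr p x) \<partial>lebesgue_on \<Omega>) < \<infinity> \<longleftrightarrow>
        integrable (lebesgue_on \<Omega>) (\<lambda>x. M x ((1 / k) *\<^sub>R ?g x))" if "0 < k" for k
    proof -
      have "(\<integral>\<^sup>+x. ennreal ((\<bar>norm (?g x)\<bar> / k) powr p x) \<partial>lebesgue_on \<Omega>) = (\<integral>\<^sup>+x. ennreal (M x ((1 / k) *\<^sub>R ?g x)) \<partial>lebesgue_on \<Omega>)"
        by (rule nn_integral_cong) (use M that in \<open>simp add: space_restrict_space\<close>)
      moreover have "(\<lambda>x. (1 / k) *\<^sub>R ?g x) \<in> borel_measurable (lebesgue_on \<Omega>)" using g by simp
      ultimately show ?thesis using modular_finite_iff by simp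
    qed
    show ?thesis
    proof
      assume "?g \<in> L_space \<Omega> M"
      then have "integrable (lebesgue_on \<Omega>) (\<lambda>x. M x ((1 / 1) *\<^sub>R ?g x))" by (simp add: L_space_eq)
      then have "(\<integral>\<^sup>+x. ennreal ((\<bar>norm (?g x)\<bar> / 1) powr p x) \<partial>lebesgue_on \<Omega>) < \<infinity>" using eq[of 1] by simp
      then show "(\<lambda>x. norm (?g x)) \<in> Lp_var \<Omega> p" 
        using g by (intro Lp_varI[of _ _ 1]) auto
    next
      assume "(\<lambda>x. norm (?g x)) \<in> Lp_var \<Omega> p"
      then obtain k where k: "0 < k" "integrable (lebesgue_on \<Omega>) (\<lambda>x. M x ((1 / k) *\<^sub>R ?g x))"
        unfolding Lp_var_def using eq by blast
      have "(\<lambda>x. (1 / k) *\<^sub>R ?g x) \<in> borel_measurable (lebesgue_on \<Omega>)" using g by simp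
      from integrable_M_scale[OF this k(2), of k] show "?g \<in> L_space \<Omega> M" using k(1) g by (simp add: L_space_eq)
    qed
  qed
  then show ?thesis unfolding V1_0_def W1p_var_0_def by blast
qed

lemma V1_0_orthotropic_variable_exponent:
  fixes p :: "'n \<Rightarrow> real ^ 'n \<Rightarrow> real"
  assumes M: "\<forall>x\<in>\<Omega>. \<forall>\<xi>. M x \<xi> = (\<Sum>i\<in>UNIV. \<bar>\<xi> $ i\<bar> powr p i x)" and p: "\<And>i. p i \<in> log_holder \<Omega>"
  shows "V1_0 \<Omega> M = W1p_aniso_0 \<Omega> p"
proof -
  have f0: "(0::real) powr p i x = 0" for i x by simp
  obtain A where A: "musielak_functional \<Omega> M UNIV (\<lambda>j. axis j 1) (\<lambda>j \<xi>. (\<xi> $ j) *\<^sub>R axis j 1) A F \<nu> \<beta> L"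
    using orthotropic_locale[of "\<lambda>i x t. t powr p i x", OF M f0 powr_doubling'[OF bounded_domain p]] by auto
  interpret musielak_functional \<Omega> M UNIV "\<lambda>j. axis j 1" "\<lambda>j \<xi>. (\<xi> $ j) *\<^sub>R axis j 1" A F \<nu> \<beta> L by (rule A)
  have axis: "M x (t *\<^sub>R axis j 1) = \<bar>t\<bar> powr p j x" if "x \<in> \<Omega>" for x t j
    by (rule orthotropic_axis[of "\<lambda>i x t. t powr p i x", OF M f0 that])
  have "weak_gradient \<Omega> u \<in> L_space \<Omega> M \<longleftrightarrow> (\<forall>i. (\<lambda>x. weak_gradient \<Omega> u x $ i) \<in> Lp_var \<Omega> (p i))" if u: "u \<in> W11_0 \<Omega>" for u
  proof -
    let ?g = "weak_gradient \<Omega> u"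
    have "u \<in> W11 \<Omega>" using u by (simp add: W11_0_def)
    note gi = W11D(3)[OF open_domain this]
    have g: "?g \<in> borel_measurable (lebesgue_on \<Omega>)" using gi by auto
    have gc: "(\<lambda>x. ?g x $ i) \<in> borel_measurable (lebesgue_on \<Omega>)" for i using integrable_component[OF gi] by auto
    have gm: "(\<lambda>x. (?g x $ i / k) *\<^sub>R (axis i 1 :: real ^ 'n)) \<in> borel_measurable (lebesgue_on \<Omega>)" for i k
      using gc[of i] by (intro borel_measurable_scaleR borel_measurable_divide) auto
    have eq: "(\<integral>\<^sup>+x. ennreal ((\<bar>?g x $ i\<bar> / k) powr p i x) \<partial>lebesgue_on \<Omega>) < \<infinity> \<longleftrightarrow>
        integrable (lebesgue_on \<Omega>) (\<lambda>x. M x ((?g x $ i / k) *\<^sub>R axis i 1))" if "0 < k" for k i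
    proof -
      have "(\<integral>\<^sup>+x. ennreal ((\<bar>?g x $ i\<bar> / k) powr p i x) \<partial>lebesgue_on \<Omega>) = (\<integral>\<^sup>+x. ennreal (M x ((?g x $ i / k) *\<^sub>R axis i 1)) \<partial>lebesgue_on \<Omega>)"
        by (rule nn_integral_cong) (use that in \<open>simp add: space_restrict_space axis abs_divide del: scaleR_eq_0_iff\<close>)
      then show ?thesis using modular_finite_iff[OF gm[of i k]] by simp
    qed
    have split': "M x (?g x) = (\<Sum>i\<in>UNIV. M x ((?g x $ i) *\<^sub>R axis i 1))" if "x \<in> \<Omega>" for x
      unfolding axis[OF that] using M that by simp
    show ?thesis
    proof (intro iffI allI)
      fix i assume "?g \<in> L_space \<Omega> M"
      then have I: "integrable (lebesgue_on \<Omega>) (\<lambda>x. M x (?g x))" by (simp add: L_space_eq)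
      have "integrable (lebesgue_on \<Omega>) (\<lambda>x. M x ((?g x $ i / 1) *\<^sub>R axis i 1))"
      proof (rule integrable_M_bound[OF gm I])
        show "AE x in lebesgue_on \<Omega>. M x ((?g x $ i / 1) *\<^sub>R axis i 1) \<le> M x (?g x)"
          using AE_domain
        proof eventually_elim
          fix x assume x: "x \<in> \<Omega>"
          show "M x ((?g x $ i / 1) *\<^sub>R axis i 1) \<le> M x (?g x)"
            unfolding split'[OF x] by (simp, rule member_le_sum) (use M_nonneg[OF x] in auto)
        qed
      qed
      then have "(\<integral>\<^sup>+x. ennreal ((\<bar>?g x $ i\<bar> / 1) powr p i x) \<partial>lebesgue_on \<Omega>) < \<infinity>" using eq[of 1 i] by simp
      then show "(\<lambda>x. ?g x $ i) \<in> Lp_var \<Omega> (p i)" 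
        using gc by (intro Lp_varI[of _ _ 1]) auto
    next
      assume *: "\<forall>i. (\<lambda>x. ?g x $ i) \<in> Lp_var \<Omega> (p i)"
      have "integrable (lebesgue_on \<Omega>) (\<lambda>x. M x ((?g x $ i) *\<^sub>R axis i 1))" for i
      proof -
        obtain k where k: "0 < k" "integrable (lebesgue_on \<Omega>) (\<lambda>x. M x ((?g x $ i / k) *\<^sub>R axis i 1))"
          using * eq unfolding Lp_var_def by blast
        from integrable_M_scale[OF gm k(2), of k] show ?thesis using k(1) by simp
      qed
      then have "integrable (lebesgue_on \<Omega>) (\<lambda>x. \<Sum>i\<in>UNIV. M x ((?g x $ i) *\<^sub>R axis i 1))"
        by (intro Bochner_Integration.integrable_sum)
      then have "integrable (lebesgue_on \<Omega>) (\<lambda>x. M x (?g x))"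
        by (rule iffD2[OF Bochner_Integration.integrable_cong, rotated -1]) (auto simp: space_restrict_space split')
      then show "?g \<in> L_space \<Omega> M" using g by (simp add: L_space_eq)
    qed
  qed
  then show ?thesis unfolding V1_0_def W1p_aniso_0_def by blast
qed

end

section \<open>The model integrands\<close>

lemma SUP_ereal_le_iff: "(SUP x\<in>S. ereal (h x)) \<le> ereal c \<longleftrightarrow> (\<forall>x\<in>S. h x \<le> c)"
  by (simp add: SUP_le_iff)

context lavrentiev_setting
begin

lemma exponent_gap: "d \<le> \<alpha> / (1 - \<gamma>) \<Longrightarrow> (1 - \<gamma>) * d \<le> \<alpha>"
  using \<gamma> by (simp add: le_divide_eq mult.commute)

lemma variable_exponent:
  assumes M: "\<forall>x\<in>\<Omega>. \<forall>\<xi>. M x \<xi> = norm \<xi> powr p x" and p: "p \<in> log_holder \<Omega>"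
  shows "V1_0 \<Omega> M = W1p_var_0 \<Omega> p"
    "no_lavrentiev \<Omega> F (V1L \<Omega> M) (W1p_var_0 \<Omega> p)"
    "no_lavrentiev \<Omega> F (V1L \<Omega> M \<inter> holder_space \<Omega> \<gamma>) (W1p_var_0 \<Omega> p \<inter> holder_space \<Omega> \<gamma>)"
proof -
  note iso = isotropic[of "\<lambda>x t. t powr p x", OF M powr_doubling'[OF bounded_domain p] powr_balanced[OF p]]
  show V: "V1_0 \<Omega> M = W1p_var_0 \<Omega> p" by (rule V1_0_variable_exponent[OF M p])
  show "no_lavrentiev \<Omega> F (V1L \<Omega> M) (W1p_var_0 \<Omega> p)"
    "no_lavrentiev \<Omega> F (V1L \<Omega> M \<inter> holder_space \<Omega> \<gamma>) (W1p_var_0 \<Omega> p \<inter> holder_space \<Omega> \<gamma>)"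
    using iso \<gamma> by (simp_all add: V no_lavrentiev_V_def no_lavrentiev_V_holder_def)
qed

lemma mild_double_phase:
  assumes M: "\<forall>x\<in>\<Omega>. \<forall>\<xi>. M x \<xi> = norm \<xi> powr p + a x * (norm \<xi> powr p * ln (exp 1 + norm \<xi>))"
    and a: "\<forall>x\<in>\<Omega>. 0 \<le> a x" "a \<in> log_holder \<Omega>"
  shows "no_lavrentiev_V \<Omega> M F" "no_lavrentiev_V_holder \<Omega> M F \<gamma>"
proof -
  let ?\<phi> = "\<lambda>(x :: real ^ 'n) t. t powr p" and ?h = "\<lambda>x t. a x * (t powr p * ln (exp 1 + t))"
  have a0: "\<And>x. x \<in> \<Omega> \<Longrightarrow> 0 \<le> a x" using a by blast
  have pos: "0 \<le> ?h x t" if "x \<in> \<Omega>" "0 \<le> t" for x t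
    using a0[OF that(1)] ln_exp_add_ge_1[OF that(2)] by simp
  have dbl: "rel_doubling \<Omega> (\<lambda>x t. ?\<phi> x t + ?h x t) (\<lambda>x t. ?\<phi> x t + ?h x t)"
    by (rule rel_doubling_phase[OF _ pos powr_doubling'[OF bounded_domain log_holder_const] log_phase_doubling[OF a0]]) auto
  have bal: "rel_balanced \<Omega> \<theta> (\<lambda>x t. ?\<phi> x t + ?h x t) (\<lambda>x t. ?\<phi> x t + ?h x t)" if "0 \<le> \<theta>" for \<theta>
    by (rule rel_balanced_phase[OF _ pos powr_balanced[OF log_holder_const that] log_phase_balanced[OF a(2) a0 that]]) auto
  show "no_lavrentiev_V \<Omega> M F" "no_lavrentiev_V_holder \<Omega> M F \<gamma>"
    using isotropic[of "\<lambda>x t. ?\<phi> x t + ?h x t", OF M dbl] bal \<gamma> by simp_all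
qed

lemma
  fixes p q a :: "real ^ 'n \<Rightarrow> real"
  assumes \<alpha>: "0 < \<alpha>" and a: "\<forall>x\<in>\<Omega>. 0 \<le> a x" "a \<in> holder_space \<Omega> \<alpha>"
    and pq: "\<forall>x\<in>\<Omega>. p x \<le> q x" "p \<in> log_holder \<Omega>" "q \<in> log_holder \<Omega>"
  shows variable_double_phase_doubling:
      "rel_doubling \<Omega> (\<lambda>x t. t powr p x + a x * t powr q x) (\<lambda>x t. t powr p x + a x * t powr q x)"
    and variable_double_phase_balanced: "\<forall>x\<in>\<Omega>. q x - p x \<le> \<alpha> \<Longrightarrow>
      rel_balanced \<Omega> 0 (\<lambda>x t. t powr p x + a x * t powr q x) (\<lambda>x t. t powr p x + a x * t powr q x)"
    and variable_double_phase_balanced_holder: "\<forall>x\<in>\<Omega>. q x - p x \<le> \<alpha> / (1 - \<gamma>) \<Longrightarrow>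
      rel_balanced \<Omega> \<gamma> (\<lambda>x t. t powr p x + a x * t powr q x) (\<lambda>x t. t powr p x + a x * t powr q x)"
proof -
  have a0: "\<And>x. x \<in> \<Omega> \<Longrightarrow> 0 \<le> a x" using a by blast
  have pos: "0 \<le> a x * t powr q x" if "x \<in> \<Omega>" "0 \<le> t" for x t using a0[OF that(1)] by simp
  show "rel_doubling \<Omega> (\<lambda>x t. t powr p x + a x * t powr q x) (\<lambda>x t. t powr p x + a x * t powr q x)"
    by (rule rel_doubling_phase[OF _ pos powr_doubling'[OF bounded_domain pq(2)] powr_doubling[OF bounded_domain pq(3) a0]]) auto
  have bal: "rel_balanced \<Omega> \<theta> (\<lambda>x t. t powr p x + a x * t powr q x) (\<lambda>x t. t powr p x + a x * t powr q x)"
    if "0 \<le> \<theta>" "\<theta> < 1" "\<And>x. x \<in> \<Omega> \<Longrightarrow> (1 - \<theta>) * (q x - p x) \<le> \<alpha>" for \<theta>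
    by (rule rel_balanced_phase[OF _ pos powr_balanced[OF pq(2) that(1)]
          double_phase_balanced[OF a(2) a0 \<alpha> pq(3) _ that(3,1,2)]]) (use pq(1) in auto)
  show "\<forall>x\<in>\<Omega>. q x - p x \<le> \<alpha> \<Longrightarrow>
      rel_balanced \<Omega> 0 (\<lambda>x t. t powr p x + a x * t powr q x) (\<lambda>x t. t powr p x + a x * t powr q x)"
    by (rule bal) auto
  show "\<forall>x\<in>\<Omega>. q x - p x \<le> \<alpha> / (1 - \<gamma>) \<Longrightarrow>
      rel_balanced \<Omega> \<gamma> (\<lambda>x t. t powr p x + a x * t powr q x) (\<lambda>x t. t powr p x + a x * t powr q x)"
    using \<gamma> exponent_gap by (intro bal) auto
qed

lemma variable_double_phase:
  fixes p q a :: "real ^ 'n \<Rightarrow> real"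
  assumes M: "\<forall>x\<in>\<Omega>. \<forall>\<xi>. M x \<xi> = norm \<xi> powr p x + a x * norm \<xi> powr q x"
    and \<alpha>: "0 < \<alpha>" and a: "\<forall>x\<in>\<Omega>. 0 \<le> a x" "a \<in> holder_space \<Omega> \<alpha>"
    and pq: "\<forall>x\<in>\<Omega>. p x \<le> q x" "p \<in> log_holder \<Omega>" "q \<in> log_holder \<Omega>"
  shows "\<forall>x\<in>\<Omega>. q x - p x \<le> \<alpha> \<Longrightarrow> no_lavrentiev_V \<Omega> M F"
    and "\<forall>x\<in>\<Omega>. q x - p x \<le> \<alpha> / (1 - \<gamma>) \<Longrightarrow> no_lavrentiev_V_holder \<Omega> M F \<gamma>"
proof -
  note dp = \<alpha> a pq
  note iso = isotropic[of "\<lambda>x t. t powr p x + a x * t powr q x", OF M variable_double_phase_doubling[OF dp]]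
  show "\<forall>x\<in>\<Omega>. q x - p x \<le> \<alpha> \<Longrightarrow> no_lavrentiev_V \<Omega> M F"
    by (rule iso(1)[OF variable_double_phase_balanced[OF dp]])
  show "\<forall>x\<in>\<Omega>. q x - p x \<le> \<alpha> / (1 - \<gamma>) \<Longrightarrow> no_lavrentiev_V_holder \<Omega> M F \<gamma>"
    by (rule iso(2)[OF variable_double_phase_balanced_holder[OF dp]])
qed

lemma multi_phase:
  fixes q \<alpha> :: "'n \<Rightarrow> real" and a :: "'n \<Rightarrow> real ^ 'n \<Rightarrow> real"
  assumes M: "\<forall>x\<in>\<Omega>. \<forall>\<xi>. M x \<xi> = norm \<xi> powr p + (\<Sum>i\<in>UNIV. a i x * norm \<xi> powr q i)"
    and a: "\<forall>i. 0 < \<alpha> i \<and> (\<forall>x\<in>\<Omega>. 0 \<le> a i x) \<and> a i \<in> holder_space \<Omega> (\<alpha> i) \<and> p \<le> q i"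
  shows "\<forall>i. q i \<le> p + \<alpha> i \<Longrightarrow> no_lavrentiev_V \<Omega> M F"
    and "\<forall>i. q i \<le> p + \<alpha> i / (1 - \<gamma>) \<Longrightarrow> no_lavrentiev_V_holder \<Omega> M F \<gamma>"
proof -
  let ?\<phi> = "\<lambda>(x :: real ^ 'n) t. t powr p" and ?h = "\<lambda>i x t. a i x * t powr q i"
  let ?f = "\<lambda>x t. ?\<phi> x t + (\<Sum>i\<in>UNIV. ?h i x t)"
  have a0: "\<And>i x. x \<in> \<Omega> \<Longrightarrow> 0 \<le> a i x" using a by blast
  have pos: "0 \<le> ?h i x t" if "x \<in> \<Omega>" "0 \<le> t" for i x t using a0[OF that(1)] by simp
  have dbl: "rel_doubling \<Omega> ?f ?f"
    by (rule rel_doubling_phases[OF finite_class.finite_UNIV _ pos powr_doubling'[OF bounded_domain log_holder_const]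
          powr_doubling[OF bounded_domain log_holder_const a0]]) auto
  have bal: "rel_balanced \<Omega> \<theta> ?f ?f" if \<theta>: "0 \<le> \<theta>" "\<theta> < 1" and gap: "\<And>i. (1 - \<theta>) * (q i - p) \<le> \<alpha> i" for \<theta>
  proof (rule rel_balanced_phases[OF finite_class.finite_UNIV _ pos powr_balanced[OF log_holder_const \<theta>(1)]])
    show "rel_balanced \<Omega> \<theta> (?h i) (\<lambda>x t. ?\<phi> x t + ?h i x t)" for i
      using a by (intro double_phase_balanced[OF _ a0 _ log_holder_const _ gap \<theta>]) auto
  qed auto
  show "\<forall>i. q i \<le> p + \<alpha> i \<Longrightarrow> no_lavrentiev_V \<Omega> M F"
    by (rule isotropic(1)[of ?f, OF M dbl bal]) (auto simp: algebra_simps)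
  assume g: "\<forall>i. q i \<le> p + \<alpha> i / (1 - \<gamma>)"
  have "(1 - \<gamma>) * (q i - p) \<le> \<alpha> i" for i using g[rule_format, of i] by (intro exponent_gap) linarith
  then show "no_lavrentiev_V_holder \<Omega> M F \<gamma>"
    using \<gamma> by (intro isotropic(2)[of ?f, OF M dbl bal]) auto
qed

lemma orlicz_double_phase:
  fixes \<phi> \<psi> \<omega> :: "real \<Rightarrow> real" and a :: "real ^ 'n \<Rightarrow> real"
  assumes M: "\<forall>x\<in>\<Omega>. \<forall>\<xi>. M x \<xi> = \<phi> (norm \<xi>) + a x * \<psi> (norm \<xi>)"
    and \<phi>: "Young_function \<phi>" "Delta2 \<phi>" and \<psi>: "Young_function \<psi>" "Delta2 \<psi>"
    and a: "\<forall>x\<in>\<Omega>. 0 \<le> a x" "modulus_of_continuity \<Omega> a \<omega>"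
  shows "\<forall>t>0. \<omega> t \<le> \<phi> (t powr (- 1)) / \<psi> (t powr (- 1)) \<Longrightarrow> no_lavrentiev_V \<Omega> M F"
    and "\<forall>t>0. \<omega> t \<le> \<phi> (t powr (\<gamma> - 1)) / \<psi> (t powr (\<gamma> - 1)) \<Longrightarrow> no_lavrentiev_V_holder \<Omega> M F \<gamma>"
proof -
  let ?f = "\<lambda>x t. \<phi> t + a x * \<psi> t"
  have a0: "\<And>x. x \<in> \<Omega> \<Longrightarrow> 0 \<le> a x" using a by blast
  obtain N where N: "\<And>x. x \<in> \<Omega> \<Longrightarrow> a x \<le> N" using modulus_bounded[OF bounded_domain a(2)] by blast
  have \<phi>0: "0 \<le> \<phi> t" and \<psi>0: "0 \<le> \<psi> t" if "0 \<le> t" for t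
    using Young_ray(1)[OF \<phi>(1), of t t] Young_ray(1)[OF \<psi>(1), of t t] that by auto
  have pos: "0 \<le> a x * \<psi> t" if "x \<in> \<Omega>" "0 \<le> t" for x t using a0[OF that(1)] \<psi>0[OF that(2)] by simp
  have "rel_doubling \<Omega> (\<lambda>x t. 1 * \<phi> t) (\<lambda>x. \<phi>)"
    by (rule orlicz_phase_doubling[OF \<phi>, of \<Omega> "\<lambda>_. 1" 1]) auto
  then have base: "rel_doubling \<Omega> (\<lambda>x. \<phi>) (\<lambda>x. \<phi>)" by simp
  have dbl: "rel_doubling \<Omega> ?f ?f"
    by (rule rel_doubling_phase[of \<Omega> "\<lambda>x. \<phi>", OF \<phi>0 pos base orlicz_phase_doubling[OF \<psi> a0 N]]) (use \<phi>0 in auto)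
  have bal: "rel_balanced \<Omega> \<theta> ?f ?f" if "\<theta> < 1" "\<And>t. 0 < t \<Longrightarrow> \<omega> t \<le> \<phi> (t powr (\<theta> - 1)) / \<psi> (t powr (\<theta> - 1))" for \<theta>
    by (rule rel_balanced_phase[of \<Omega> "\<lambda>x. \<phi>", OF \<phi>0 pos rel_balanced_const[OF \<phi>0]
          orlicz_phase_balanced[OF \<phi>(1) \<psi> a0 a(2) that(2,1)]]) auto
  show "\<forall>t>0. \<omega> t \<le> \<phi> (t powr (- 1)) / \<psi> (t powr (- 1)) \<Longrightarrow> no_lavrentiev_V \<Omega> M F"
    by (rule isotropic(1)[of ?f, OF M dbl bal]) auto
  show "\<forall>t>0. \<omega> t \<le> \<phi> (t powr (\<gamma> - 1)) / \<psi> (t powr (\<gamma> - 1)) \<Longrightarrow> no_lavrentiev_V_holder \<Omega> M F \<gamma>"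
    using \<gamma> by (intro isotropic(2)[of ?f, OF M dbl bal]) auto
qed

lemma zygmund_double_phase:
  fixes \<phi> \<psi> \<omega> :: "real \<Rightarrow> real" and a :: "real ^ 'n \<Rightarrow> real"
  assumes M: "\<forall>x\<in>\<Omega>. \<forall>\<xi>. M x \<xi> = \<phi> (norm \<xi>) + a x * \<psi> (norm \<xi>)"
    and \<phi>: "\<forall>t\<ge>0. \<phi> t = t powr p * ln (exp 1 + t) powr (- \<tau>)"
    and \<psi>: "\<forall>t\<ge>0. \<psi> t = t powr p * ln (exp 1 + t) powr \<sigma>"
    and \<sigma>\<tau>: "0 \<le> \<sigma>" "0 \<le> \<tau>"
    and a: "\<forall>x\<in>\<Omega>. 0 \<le> a x" "modulus_of_continuity \<Omega> a \<omega>"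
    and \<omega>: "\<forall>t>0. \<omega> t \<le> ln (exp 1 + 1 / t) powr (- (\<sigma> + \<tau>))"
  shows "no_lavrentiev_V \<Omega> M F"
proof -
  let ?\<phi> = "\<lambda>(x :: real ^ 'n) t. t powr p * ln (exp 1 + t) powr (- \<tau>)" and ?h = "\<lambda>x t. a x * (t powr p * ln (exp 1 + t) powr \<sigma>)"
  let ?f = "\<lambda>x t. ?\<phi> x t + ?h x t"
  have a0: "\<And>x. x \<in> \<Omega> \<Longrightarrow> 0 \<le> a x" using a by blast
  have pos: "0 \<le> ?h x t" if "x \<in> \<Omega>" "0 \<le> t" for x t using a0[OF that(1)] by simp
  have M': "\<forall>x\<in>\<Omega>. \<forall>\<xi>. M x \<xi> = ?f x (norm \<xi>)" using M \<phi> \<psi> by simp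
  have dbl: "rel_doubling \<Omega> ?f ?f"
    by (rule rel_doubling_phase[OF _ pos log_base_doubling[OF \<sigma>\<tau>(2)] log_weight_phase_doubling[OF \<sigma>\<tau>(1) a0]]) auto
  have bal: "rel_balanced \<Omega> 0 ?f ?f"
    by (rule rel_balanced_phase[OF _ pos rel_balanced_const log_weight_phase_balanced[OF _ a0 a(2)]]) (use \<sigma>\<tau> \<omega> in auto)
  show ?thesis by (rule isotropic(1)[of ?f, OF M' dbl bal])
qed

lemma orthotropic_variable_exponent:
  fixes p :: "'n \<Rightarrow> real ^ 'n \<Rightarrow> real"
  assumes M: "\<forall>x\<in>\<Omega>. \<forall>\<xi>. M x \<xi> = (\<Sum>i\<in>UNIV. \<bar>\<xi> $ i\<bar> powr p i x)" and p: "\<And>i. p i \<in> log_holder \<Omega>"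
  shows "V1_0 \<Omega> M = W1p_aniso_0 \<Omega> p"
    "no_lavrentiev \<Omega> F (V1L \<Omega> M) (W1p_aniso_0 \<Omega> p)"
    "no_lavrentiev \<Omega> F (V1L \<Omega> M \<inter> holder_space \<Omega> \<gamma>) (W1p_aniso_0 \<Omega> p \<inter> holder_space \<Omega> \<gamma>)"
proof -
  have f0: "(0::real) powr p i x = 0" for i x by simp
  note ortho = orthotropic[of "\<lambda>i x t. t powr p i x", OF M f0 powr_doubling'[OF bounded_domain p] powr_ge_zero powr_balanced[OF p]]
  show V: "V1_0 \<Omega> M = W1p_aniso_0 \<Omega> p" by (rule V1_0_orthotropic_variable_exponent[OF M p])
  show "no_lavrentiev \<Omega> F (V1L \<Omega> M) (W1p_aniso_0 \<Omega> p)"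
    "no_lavrentiev \<Omega> F (V1L \<Omega> M \<inter> holder_space \<Omega> \<gamma>) (W1p_aniso_0 \<Omega> p \<inter> holder_space \<Omega> \<gamma>)"
    using ortho \<gamma> by (simp_all add: V no_lavrentiev_V_def no_lavrentiev_V_holder_def)
qed

lemma orthotropic_log_phase:
  fixes p :: "'n \<Rightarrow> real" and a :: "'n \<Rightarrow> real ^ 'n \<Rightarrow> real"
  assumes M: "\<forall>x\<in>\<Omega>. \<forall>\<xi>. M x \<xi> = (\<Sum>i\<in>UNIV. \<bar>\<xi> $ i\<bar> powr p i) +
      (\<Sum>i\<in>UNIV. a i x * (\<bar>\<xi> $ i\<bar> powr p i * ln (exp 1 + \<bar>\<xi> $ i\<bar>)))"
    and a: "\<forall>i. (\<forall>x\<in>\<Omega>. 0 \<le> a i x) \<and> a i \<in> log_holder \<Omega>"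
  shows "no_lavrentiev_V \<Omega> M F" "no_lavrentiev_V_holder \<Omega> M F \<gamma>"
proof -
  let ?\<phi> = "\<lambda>i (x :: real ^ 'n) t. t powr p i" and ?h = "\<lambda>i x t. a i x * (t powr p i * ln (exp 1 + t))"
  let ?f = "\<lambda>i x t. ?\<phi> i x t + ?h i x t"
  have M': "\<forall>x\<in>\<Omega>. \<forall>\<xi>. M x \<xi> = (\<Sum>i\<in>UNIV. ?f i x \<bar>\<xi> $ i\<bar>)" using M by (simp add: sum.distrib)
  have a0: "\<And>i x. x \<in> \<Omega> \<Longrightarrow> 0 \<le> a i x" and al: "\<And>i. a i \<in> log_holder \<Omega>" using a by auto
  have pos: "0 \<le> ?h i x t" if "x \<in> \<Omega>" "0 \<le> t" for i x t
    using a0[OF that(1)] ln_exp_add_ge_1[OF that(2)] by simp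
  have dbl: "rel_doubling \<Omega> (?f i) (?f i)" for i
    by (rule rel_doubling_phase[OF _ pos powr_doubling'[OF bounded_domain log_holder_const] log_phase_doubling[OF a0]]) auto
  have bal: "rel_balanced \<Omega> \<theta> (?f i) (?f i)" if "0 \<le> \<theta>" for i \<theta>
    by (rule rel_balanced_phase[OF _ pos powr_balanced[OF log_holder_const that] log_phase_balanced[OF al a0 that]]) auto
  have "0 \<le> ?f i x t" if "x \<in> \<Omega>" "0 \<le> t" for i x t using pos[OF that, of i] by simp
  note ortho = orthotropic[of ?f, OF M' _ dbl this]
  show "no_lavrentiev_V \<Omega> M F" by (rule ortho(1)[OF _ _ _ bal]) auto
  show "no_lavrentiev_V_holder \<Omega> M F \<gamma>" by (rule ortho(2)[OF _ _ _ bal]) (use \<gamma> in auto)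
qed

lemma orthotropic_double_phase:
  fixes p q :: "'n \<Rightarrow> real ^ 'n \<Rightarrow> real" and \<alpha> :: "'n \<Rightarrow> real" and a :: "'n \<Rightarrow> real ^ 'n \<Rightarrow> real"
  assumes M: "\<forall>x\<in>\<Omega>. \<forall>\<xi>. M x \<xi> = (\<Sum>i\<in>UNIV. \<bar>\<xi> $ i\<bar> powr p i x) + (\<Sum>i\<in>UNIV. a i x * \<bar>\<xi> $ i\<bar> powr q i x)"
    and a: "\<forall>i. 0 < \<alpha> i \<and> (\<forall>x\<in>\<Omega>. 0 \<le> a i x) \<and> a i \<in> holder_space \<Omega> (\<alpha> i) \<and>
      (\<forall>x\<in>\<Omega>. p i x \<le> q i x) \<and> p i \<in> log_holder \<Omega> \<and> q i \<in> log_holder \<Omega>"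
  shows "\<forall>i. \<forall>x\<in>\<Omega>. q i x - p i x \<le> \<alpha> i \<Longrightarrow> no_lavrentiev_V \<Omega> M F"
    and "\<forall>i. \<forall>x\<in>\<Omega>. q i x - p i x \<le> \<alpha> i / (1 - \<gamma>) \<Longrightarrow> no_lavrentiev_V_holder \<Omega> M F \<gamma>"
proof -
  let ?f = "\<lambda>i x t. t powr p i x + a i x * t powr q i x"
  have M': "\<forall>x\<in>\<Omega>. \<forall>\<xi>. M x \<xi> = (\<Sum>i\<in>UNIV. ?f i x \<bar>\<xi> $ i\<bar>)" using M by (simp add: sum.distrib)
  have dp: "0 < \<alpha> i" "\<forall>x\<in>\<Omega>. 0 \<le> a i x" "a i \<in> holder_space \<Omega> (\<alpha> i)" "\<forall>x\<in>\<Omega>. p i x \<le> q i x" "p i \<in> log_holder \<Omega>" "q i \<in> log_holder \<Omega>" for i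
    using a by auto
  have f0: "?f i x 0 = 0" for i x by simp
  have pos: "0 \<le> ?f i x t" if "x \<in> \<Omega>" "0 \<le> t" for i x t using dp(2)[of i] that by simp
  note ortho = orthotropic[of ?f, OF M' f0 variable_double_phase_doubling[OF dp] pos]
  show "\<forall>i. \<forall>x\<in>\<Omega>. q i x - p i x \<le> \<alpha> i \<Longrightarrow> no_lavrentiev_V \<Omega> M F"
    by (rule ortho(1)[OF _ _ variable_double_phase_balanced[OF dp]]) auto
  show "\<forall>i. \<forall>x\<in>\<Omega>. q i x - p i x \<le> \<alpha> i / (1 - \<gamma>) \<Longrightarrow> no_lavrentiev_V_holder \<Omega> M F \<gamma>"
    by (rule ortho(2)[OF _ _ variable_double_phase_balanced_holder[OF dp]]) auto
qed

end

theorem corollary1p2: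
  fixes \<Omega> :: "(real ^ 'n) set"
    and F :: "real ^ 'n \<Rightarrow> real \<Rightarrow> real ^ 'n \<Rightarrow> real"
    and M :: "real ^ 'n \<Rightarrow> real ^ 'n \<Rightarrow> real"
    and \<gamma> \<nu> \<beta> L :: real
  assumes "bounded_lipschitz_domain \<Omega>"
    and "0 < \<gamma>" "\<gamma> < 1"
    and "caratheodory_integrand \<Omega> F"
    and "weak_N_function \<Omega> M"
    and "0 < \<nu>" "\<nu> < 1" "0 < \<beta>" "\<beta> < 1" "1 < L"
    and "\<forall>x\<in>\<Omega>. \<forall>z \<xi>. \<nu> * M x (\<beta> *\<^sub>R \<xi>) \<le> F x z \<xi> \<and> F x z \<xi> \<le> L * (M x \<xi> + 1)"
  shows
    \<comment> \<open>(i)\<close>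
    "(\<forall>p :: real ^ 'n \<Rightarrow> real.
        (\<forall>x\<in>\<Omega>. \<forall>\<xi>. M x \<xi> = norm \<xi> powr p x) \<and>
        p \<in> log_holder \<Omega> \<and> (\<forall>x\<in>\<Omega>. 1 \<le> p x)
        \<longrightarrow> V1_0 \<Omega> M = W1p_var_0 \<Omega> p \<and>
            no_lavrentiev \<Omega> F (V1L \<Omega> M) (W1p_var_0 \<Omega> p) \<and>
            no_lavrentiev \<Omega> F (V1L \<Omega> M \<inter> holder_space \<Omega> \<gamma>) (W1p_var_0 \<Omega> p \<inter> holder_space \<Omega> \<gamma>))
     \<and>
     \<comment> \<open>(ii)\<close>
     (\<forall>(p :: real) (a :: real ^ 'n \<Rightarrow> real).
        (\<forall>x\<in>\<Omega>. \<forall>\<xi>. M x \<xi> = norm \<xi> powr p + a x * (norm \<xi> powr p * ln (exp 1 + norm \<xi>))) \<and>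
        (\<forall>x\<in>\<Omega>. 0 \<le> a x) \<and> a \<in> log_holder \<Omega> \<and> 1 \<le> p
        \<longrightarrow> no_lavrentiev_V \<Omega> M F \<and> no_lavrentiev_V_holder \<Omega> M F \<gamma>)
     \<and>
     \<comment> \<open>(iii)\<close>
     (\<forall>(p :: real) (q :: real) (\<alpha> :: real) (a :: real ^ 'n \<Rightarrow> real).
        (\<forall>x\<in>\<Omega>. \<forall>\<xi>. M x \<xi> = norm \<xi> powr p + a x * norm \<xi> powr q) \<and>
        0 < \<alpha> \<and> \<alpha> \<le> 1 \<and> (\<forall>x\<in>\<Omega>. 0 \<le> a x) \<and> a \<in> holder_space \<Omega> \<alpha> \<and> 1 \<le> p \<and> p \<le> q
        \<longrightarrow> (q \<le> p + \<alpha> \<longrightarrow> no_lavrentiev_V \<Omega> M F) \<and>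
            (q \<le> p + \<alpha> / (1 - \<gamma>) \<longrightarrow> no_lavrentiev_V_holder \<Omega> M F \<gamma>))
     \<and>
     \<comment> \<open>(iv)\<close>
     (\<forall>(p :: real ^ 'n \<Rightarrow> real) (q :: real ^ 'n \<Rightarrow> real) (\<alpha> :: real) (a :: real ^ 'n \<Rightarrow> real).
        (\<forall>x\<in>\<Omega>. \<forall>\<xi>. M x \<xi> = norm \<xi> powr p x + a x * norm \<xi> powr q x) \<and>
        0 < \<alpha> \<and> \<alpha> \<le> 1 \<and> (\<forall>x\<in>\<Omega>. 0 \<le> a x) \<and> a \<in> holder_space \<Omega> \<alpha> \<and>
        (\<forall>x\<in>\<Omega>. 1 \<le> p x \<and> p x \<le> q x) \<and> p \<in> log_holder \<Omega> \<and> q \<in> log_holder \<Omega>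
        \<longrightarrow> ((SUP x\<in>\<Omega>. ereal (q x - p x)) \<le> ereal \<alpha> \<longrightarrow> no_lavrentiev_V \<Omega> M F) \<and>
            ((SUP x\<in>\<Omega>. ereal (q x - p x)) \<le> ereal (\<alpha> / (1 - \<gamma>))
               \<longrightarrow> no_lavrentiev_V_holder \<Omega> M F \<gamma>))
     \<and>
     \<comment> \<open>(v)\<close>
     (\<forall>(p :: real) (q :: 'n \<Rightarrow> real) (\<alpha> :: 'n \<Rightarrow> real) (a :: 'n \<Rightarrow> real ^ 'n \<Rightarrow> real).
        (\<forall>x\<in>\<Omega>. \<forall>\<xi>. M x \<xi> = norm \<xi> powr p + (\<Sum>i\<in>UNIV. a i x * norm \<xi> powr q i)) \<and>
        1 \<le> p \<and>
        (\<forall>i. 0 < \<alpha> i \<and> \<alpha> i \<le> 1 \<and> (\<forall>x\<in>\<Omega>. 0 \<le> a i x) \<and> a i \<in> holder_space \<Omega> (\<alpha> i) \<and> p \<le> q i)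
        \<longrightarrow> ((\<forall>i. q i \<le> p + \<alpha> i) \<longrightarrow> no_lavrentiev_V \<Omega> M F) \<and>
            ((\<forall>i. q i \<le> p + \<alpha> i / (1 - \<gamma>)) \<longrightarrow> no_lavrentiev_V_holder \<Omega> M F \<gamma>))
     \<and>
     \<comment> \<open>(vi)\<close>
     (\<forall>(\<phi> :: real \<Rightarrow> real) (\<psi> :: real \<Rightarrow> real) (a :: real ^ 'n \<Rightarrow> real) (\<omega> :: real \<Rightarrow> real).
        (\<forall>x\<in>\<Omega>. \<forall>\<xi>. M x \<xi> = \<phi> (norm \<xi>) + a x * \<psi> (norm \<xi>)) \<and>
        Young_function \<phi> \<and> Young_function \<psi> \<and> Delta2 \<phi> \<and> Delta2 \<psi> \<and>
        filterlim (\<lambda>t. \<psi> t / \<phi> t) at_top at_top \<and>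
        (\<forall>x\<in>\<Omega>. 0 \<le> a x) \<and> continuous_on \<Omega> a \<and> modulus_of_continuity \<Omega> a \<omega>
        \<longrightarrow> ((\<forall>t>0. \<omega> t \<le> \<phi> (t powr (- 1)) / \<psi> (t powr (- 1))) \<longrightarrow> no_lavrentiev_V \<Omega> M F) \<and>
            ((\<forall>t>0. \<omega> t \<le> \<phi> (t powr (\<gamma> - 1)) / \<psi> (t powr (\<gamma> - 1)))
               \<longrightarrow> no_lavrentiev_V_holder \<Omega> M F \<gamma>))
     \<and>
     \<comment> \<open>(vi), the particular case\<close>
     (\<forall>(\<phi> :: real \<Rightarrow> real) (\<psi> :: real \<Rightarrow> real) (p :: real) (\<sigma> :: real) (\<tau> :: real)
        (a :: real ^ 'n \<Rightarrow> real) (\<omega> :: real \<Rightarrow> real).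
        (\<forall>x\<in>\<Omega>. \<forall>\<xi>. M x \<xi> = \<phi> (norm \<xi>) + a x * \<psi> (norm \<xi>)) \<and>
        (\<forall>t\<ge>0. \<phi> t = t powr p * ln (exp 1 + t) powr (- \<tau>)) \<and>
        (\<forall>t\<ge>0. \<psi> t = t powr p * ln (exp 1 + t) powr \<sigma>) \<and>
        1 < p \<and> 0 \<le> \<sigma> \<and> 0 \<le> \<tau> \<and>
        (\<forall>x\<in>\<Omega>. 0 \<le> a x) \<and> continuous_on \<Omega> a \<and> modulus_of_continuity \<Omega> a \<omega> \<and>
        (\<forall>t>0. \<omega> t \<le> ln (exp 1 + 1 / t) powr (- (\<sigma> + \<tau>)))
        \<longrightarrow> no_lavrentiev_V \<Omega> M F)
     \<and>
     \<comment> \<open>(i')\<close>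
     (\<forall>p :: 'n \<Rightarrow> real ^ 'n \<Rightarrow> real.
        (\<forall>x\<in>\<Omega>. \<forall>\<xi>. M x \<xi> = (\<Sum>i\<in>UNIV. \<bar>\<xi> $ i\<bar> powr p i x)) \<and>
        (\<forall>i. p i \<in> log_holder \<Omega> \<and> (\<forall>x\<in>\<Omega>. 1 \<le> p i x))
        \<longrightarrow> V1_0 \<Omega> M = W1p_aniso_0 \<Omega> p \<and>
            no_lavrentiev \<Omega> F (V1L \<Omega> M) (W1p_aniso_0 \<Omega> p) \<and>
            no_lavrentiev \<Omega> F (V1L \<Omega> M \<inter> holder_space \<Omega> \<gamma>) (W1p_aniso_0 \<Omega> p \<inter> holder_space \<Omega> \<gamma>))
     \<and>
     \<comment> \<open>(ii')\<close>
     (\<forall>(p :: 'n \<Rightarrow> real) (q :: 'n \<Rightarrow> real) (\<alpha> :: 'n \<Rightarrow> real) (a :: 'n \<Rightarrow> real ^ 'n \<Rightarrow> real).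
        (\<forall>x\<in>\<Omega>. \<forall>\<xi>. M x \<xi> = (\<Sum>i\<in>UNIV. \<bar>\<xi> $ i\<bar> powr p i) + (\<Sum>i\<in>UNIV. a i x * \<bar>\<xi> $ i\<bar> powr q i)) \<and>
        (\<forall>i. 0 < \<alpha> i \<and> \<alpha> i \<le> 1 \<and> (\<forall>x\<in>\<Omega>. 0 \<le> a i x) \<and> a i \<in> holder_space \<Omega> (\<alpha> i) \<and>
             1 \<le> p i \<and> p i \<le> q i)
        \<longrightarrow> ((\<forall>i. q i \<le> p i + \<alpha> i) \<longrightarrow> no_lavrentiev_V \<Omega> M F) \<and>
            ((\<forall>i. q i \<le> p i + \<alpha> i / (1 - \<gamma>)) \<longrightarrow> no_lavrentiev_V_holder \<Omega> M F \<gamma>))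
     \<and>
     \<comment> \<open>(iii')\<close>
     (\<forall>(p :: 'n \<Rightarrow> real) (a :: 'n \<Rightarrow> real ^ 'n \<Rightarrow> real).
        (\<forall>x\<in>\<Omega>. \<forall>\<xi>. M x \<xi> = (\<Sum>i\<in>UNIV. \<bar>\<xi> $ i\<bar> powr p i) +
            (\<Sum>i\<in>UNIV. a i x * (\<bar>\<xi> $ i\<bar> powr p i * ln (exp 1 + \<bar>\<xi> $ i\<bar>)))) \<and>
        (\<forall>i. (\<forall>x\<in>\<Omega>. 0 \<le> a i x) \<and> a i \<in> log_holder \<Omega> \<and> 1 \<le> p i)
        \<longrightarrow> no_lavrentiev_V \<Omega> M F \<and> no_lavrentiev_V_holder \<Omega> M F \<gamma>)
     \<and>
     \<comment> \<open>(iv')\<close>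
     (\<forall>(p :: 'n \<Rightarrow> real ^ 'n \<Rightarrow> real) (q :: 'n \<Rightarrow> real ^ 'n \<Rightarrow> real) (\<alpha> :: 'n \<Rightarrow> real)
        (a :: 'n \<Rightarrow> real ^ 'n \<Rightarrow> real).
        (\<forall>x\<in>\<Omega>. \<forall>\<xi>. M x \<xi> = (\<Sum>i\<in>UNIV. \<bar>\<xi> $ i\<bar> powr p i x) +
            (\<Sum>i\<in>UNIV. a i x * \<bar>\<xi> $ i\<bar> powr q i x)) \<and>
        (\<forall>i. 0 < \<alpha> i \<and> \<alpha> i \<le> 1 \<and> (\<forall>x\<in>\<Omega>. 0 \<le> a i x) \<and> a i \<in> holder_space \<Omega> (\<alpha> i) \<and>
             (\<forall>x\<in>\<Omega>. 1 \<le> p i x \<and> p i x \<le> q i x) \<and> p i \<in> log_holder \<Omega> \<and> q i \<in> log_holder \<Omega>)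
        \<longrightarrow> ((\<forall>i. (SUP x\<in>\<Omega>. ereal (q i x - p i x)) \<le> ereal (\<alpha> i)) \<longrightarrow> no_lavrentiev_V \<Omega> M F) \<and>
            ((\<forall>i. (SUP x\<in>\<Omega>. ereal (q i x - p i x)) \<le> ereal (\<alpha> i / (1 - \<gamma>)))
               \<longrightarrow> no_lavrentiev_V_holder \<Omega> M F \<gamma>))"
proof -
  interpret lavrentiev_setting \<Omega> F M \<gamma> \<nu> \<beta> L
    using assms by unfold_locales auto
  have const: "\<forall>x\<in>\<Omega>. b - c \<le> d" if "b \<le> c + d" for b c d :: real using that by auto
  show ?thesis (is "?i \<and> ?ii \<and> ?iii \<and> ?iv \<and> ?v \<and> ?vi \<and> ?vi' \<and> ?i' \<and> ?ii' \<and> ?iii' \<and> ?iv'")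
  proof (intro conjI)
    show ?i using variable_exponent by blast
    show ?ii using mild_double_phase by blast
    show ?iii
    proof (intro allI impI)
      fix p q \<alpha> :: real and a :: "real ^ 'n \<Rightarrow> real"
      assume *: "(\<forall>x\<in>\<Omega>. \<forall>\<xi>. M x \<xi> = norm \<xi> powr p + a x * norm \<xi> powr q) \<and>
        0 < \<alpha> \<and> \<alpha> \<le> 1 \<and> (\<forall>x\<in>\<Omega>. 0 \<le> a x) \<and> a \<in> holder_space \<Omega> \<alpha> \<and> 1 \<le> p \<and> p \<le> q"
      note dp = variable_double_phase[of "\<lambda>_. p" a "\<lambda>_. q" \<alpha>, OF _ _ _ _ _ log_holder_const log_holder_const]
      show "(q \<le> p + \<alpha> \<longrightarrow> no_lavrentiev_V \<Omega> M F) \<and>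
            (q \<le> p + \<alpha> / (1 - \<gamma>) \<longrightarrow> no_lavrentiev_V_holder \<Omega> M F \<gamma>)"
        using dp const[of q p \<alpha>] const[of q p "\<alpha> / (1 - \<gamma>)"] * by blast
    qed
    show ?iv unfolding SUP_ereal_le_iff using variable_double_phase by blast
    show ?v using multi_phase by blast
    show ?vi using orlicz_double_phase by blast
    show ?vi' using zygmund_double_phase by blast
    show ?i' using orthotropic_variable_exponent by blast
    show ?ii'
    proof (intro allI impI)
      fix p q \<alpha> :: "'n \<Rightarrow> real" and a :: "'n \<Rightarrow> real ^ 'n \<Rightarrow> real"
      assume *: "(\<forall>x\<in>\<Omega>. \<forall>\<xi>. M x \<xi> = (\<Sum>i\<in>UNIV. \<bar>\<xi> $ i\<bar> powr p i) + (\<Sum>i\<in>UNIV. a i x * \<bar>\<xi> $ i\<bar> powr q i)) \<and>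
        (\<forall>i. 0 < \<alpha> i \<and> \<alpha> i \<le> 1 \<and> (\<forall>x\<in>\<Omega>. 0 \<le> a i x) \<and> a i \<in> holder_space \<Omega> (\<alpha> i) \<and>
             1 \<le> p i \<and> p i \<le> q i)"
      note dp = orthotropic_double_phase[of "\<lambda>i _. p i" a "\<lambda>i _. q i" \<alpha>]
      show "((\<forall>i. q i \<le> p i + \<alpha> i) \<longrightarrow> no_lavrentiev_V \<Omega> M F) \<and>
            ((\<forall>i. q i \<le> p i + \<alpha> i / (1 - \<gamma>)) \<longrightarrow> no_lavrentiev_V_holder \<Omega> M F \<gamma>)"
        using dp const[of "q _" "p _" "\<alpha> _"] const[of "q _" "p _" "\<alpha> _ / (1 - \<gamma>)"] * log_holder_const by blast
    qed
    show ?iii' using orthotropic_log_phase by blast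
    show ?iv' unfolding SUP_ereal_le_iff
    proof (intro allI impI, goal_cases)
      case (1 p q \<alpha> a)
      then show ?case using orthotropic_double_phase[of p a q \<alpha>] by simp
    qed
  qed
qed

end
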